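(* Let $n\ge2$ and assume: (A1) $H\in C(\mathbb{R}^n\times\mathbb{R}^n)$ and for each $p$ the map $y\mapsto H(y,p)$ is $\mathbb{Z}^n$-periodic; (A2) $\lim_{|p|\to\infty}\inf_{y\in\mathbb{R}^n}H(y,p)=+\infty$; (A3) for each $y$ the map $p\mapsto H(y,p)$ is convex; (A4) $g:\mathbb{R}^n\to\mathbb{R}$ is bounded, uniformly continuous and Lipschitz; (A5) for each $y\in\mathbb{R}^n$, $\min_{p\in\mathbb{R}^n}H(y,p)=H(y,0)=0$. Let $D\Subset\left(-\frac12,\frac12\right)^n$ be an open connected set with $C^1$ boundary containing $0$ such that $\Omega=\mathbb{R}^n\setminus\bigcup_{m\in\mathbb{Z}^n}(m+\overline{D})$ is connected, and let $\Omega_\varepsilon=\varepsilon\Omega$. Let $\emptyset\ne I\subsetneq\mathbb{Z}^n$ and $$W=\mathbb{R}^n\setminus\bigcup_{m\in\mathbb{Z}^n\setminus I}(m+\overline{D}),\qquad W_\varepsilon=\varepsilon W .$$ For $k\in\mathbb{N}$ let $I_k=I\cap[-k,k]^n$, and assume that $\frac{|I_k|}{k}=\omega_0\left(\frac1k\right)$ for all $k\in\mathbb{N}$, where $|I_k|$ is the cardinality of $I_k$ and $\omega_0$ is a modulus of continuity. For $\varepsilon>0$ let $u^\varepsilon$ be the viscosity solution of the state-constraint problem $$u^\varepsilon_t+H\left(\tfrac{x}{\varepsilon},Du^\varepsilon\right)\le 0\ \text{ in }\Omega_\varepsilon\times(0,\infty),\quad u^\varepsilon_t+H\left(\tfrac{x}{\varepsilon},Du^\varepsilon\right)\ge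 0\ \text{ on }\overline{\Omega}_\varepsilon\times(0,\infty),\quad u^\varepsilon(\cdot,0)=g\ \text{ on }\overline{\Omega}_\varepsilon,$$ let $w^\varepsilon$ be the viscosity solution of the same problem with $\Omega_\varepsilon$ replaced by $W_\varepsilon$, and let $u$ be the viscosity solution of $u_t+\overline{H}(Du)=0$ in $\mathbb{R}^n\times(0,\infty)$, $u(\cdot,0)=g$ on $\mathbb{R}^n$, where $\overline{H}=\overline{H}_\Omega$ is the effective Hamiltonian of the state-constraint cell problem on $\overline{\Omega}$. Let $M_0>0$ be the velocity-bound constant defined in the context. Then there exist constants $C,\tilde C>0$ depending only on $n$, $\partial D$, $H$ and $\|Dg\|_{L^\infty(\mathbb{R}^n)}$ such that, for all $\varepsilon\in(0,1)$ and all $(x,t)\in\overline{W}_\varepsilon\times[0,\infty)$ with $M_0t+|x|>0$, $$u(x,t)-C(M_0t+|x|+1)\,\omega_0\!\left(\frac{\varepsilon}{M_0t+|x|}\right)-\tilde C\varepsilon\le w^\varepsilon(x,t)\le u(x,t)+C\varepsilon ,$$ and, if moreover $x\in\overline{\Omega}_\varepsilon$, $$\begin{aligned} &u(x,t)-C(M_0t+|x|+1)\,\omega_0\!\left(\frac{\varepsilon}{M_0t+|x|}\right)-\tilde C\varepsilon\\ \le\ &u^\varepsilon(x,t)-C(M_0t+|x|+1)\,\omega_0\!\left(\frac{\varepsilon}{M_0t+|x|}\right)-C\varepsilon\\ \le\ &w^\varepsilon(x,t)\le u^\varepsilon(x,t)\le u(x,t)+C\varepsilon . \end{aligned}$$ In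 particular, for all $\varepsilon\in(0,1)$ and all $(x,t)\in\overline{W}_\varepsilon\times[0,\infty)$ with $M_0t+|x|>0$, $$|w^\varepsilon(x,t)-u(x,t)|\le C(M_0t+|x|+1)\,\omega_0\!\left(\frac{\varepsilon}{M_0t+|x|}\right)+C\varepsilon .$$
   Context: A modulus of continuity is a nondecreasing continuous function $\omega_0:[0,\infty)\to[0,\infty)$ with $\omega_0(0)=0$. State-constraint viscosity solutions on $\overline U$ ($U=\Omega_\varepsilon$ or $W_\varepsilon$): a continuous function $z$ on $\overline U\times[0,\infty)$ that is a viscosity subsolution in the open set $U\times(0,\infty)$ in the usual sense and a supersolution on $\overline U\times(0,\infty)$: whenever $\varphi$ is $C^1$ and $z-\varphi$ has a local minimum relative to $\overline U\times(0,\infty)$ at $(x_0,t_0)$, one has $\varphi_t(x_0,t_0)+H(x_0/\varepsilon,D\varphi(x_0,t_0))\ge0$. The problems are well posed; $u^\varepsilon,w^\varepsilon$ denote the unique (globally Lipschitz) solutions. Effective Hamiltonian: for $p\in\mathbb{R}^n$, $\overline{H}(p)$ is the unique constant for which $H(y,p+Dv)\le\overline{H}(p)$ in $\Omega$, $H(y,p+Dv)\ge\overline{H}(p)$ on $\overline\Omega$ (state-constraint viscosity sense) has a $\mathbb{Z}^n$-periodic solution $v$. The constant $M_0$: the solutions $u^\varepsilon,w^\varepsilon$ have Lipschitz bounds $C_0$ depending only on $H$ and $\|Dg\|_{L^\infty}$; therefore $H(y,p)$ may be modified for $|p|>2C_0+1$ without changing the solutions, and the paper always assumes it is so modified that $\frac{|p|^2}{2}-K_0\le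 H(y,p)\le\frac{|p|^2}{2}+K_0$ for all $(y,p)$, with $K_0=K_0(H,\|Dg\|_{L^\infty})>0$. Let $L(y,v)=\sup_{p}(p\cdot v-H(y,p))$ be the Legendre transform of this (modified) $H$. Then, for $x\in\overline W_\varepsilon$, $t>0$, $$w^\varepsilon(x,t)=\inf\left\{\varepsilon\int_0^{t/\varepsilon}L(\gamma,\dot\gamma)\,ds+g(\varepsilon\gamma(0)):\ \gamma\in \mathrm{AC}([0,t/\varepsilon];\overline W),\ \gamma(t/\varepsilon)=x/\varepsilon\right\},$$ and similarly for $u^\varepsilon$ with $\overline\Omega$ in place of $\overline W$ (AC denotes absolutely continuous curves). $M_0>0$ denotes a constant depending only on $n,\partial\Omega,H,\|Dg\|_{L^\infty}$ such that every minimizing curve $\gamma$ in these formulas (for any $\varepsilon$, $x$, $t$) satisfies $\|\dot\gamma\|_{L^\infty([0,t/\varepsilon])}\le M_0$. *)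

theory Defs
  imports "HOL-Analysis.Analysis"
begin

section \<open>The perforated domains\<close>

definition int_lattice :: "(real ^ 'n) set" where
  "int_lattice = {m. \<forall>i. m $ i \<in> \<int>}"

text \<open>The set \<open>D\<close> is \<open>C\<^sup>1\<close>: near each boundary point, and after a choice of the axis \<open>e\<close>,
  it is the region strictly above the graph of a \<open>C\<^sup>1\<close> function of the component of \<open>x\<close>
  orthogonal to \<open>e\<close>. Only the values of \<open>h\<close> on the hyperplane orthogonal to \<open>e\<close> matter; a
  \<open>C\<^sup>1\<close> function on that hyperplane extends to the whole space, constant along \<open>e\<close>.\<close>

definition C1_fun :: "('a::euclidean_space \<Rightarrow> real) \<Rightarrow> ('a \<Rightarrow> 'a) \<Rightarrow> bool" where
  "C1_fun f Df \<longleftrightarrow> (\<forall>x. GDERIV f x :> Df x) \<and> continuous_on UNIV Df"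

definition C1_boundary :: "'a::euclidean_space set \<Rightarrow> bool" where
  "C1_boundary D \<longleftrightarrow>
     (\<forall>x0\<in>frontier D. \<exists>r>0. \<exists>e h Dh. norm e = 1 \<and> C1_fun h Dh \<and>
        D \<inter> ball x0 r = {x \<in> ball x0 r. h (x - (x \<bullet> e) *\<^sub>R e) < x \<bullet> e})"

text \<open>\<open>perforated D I\<close> is the whole space with the holes indexed by \<open>\<int>\<^sup>n - I\<close> removed. It is the
  set \<open>W\<close>, and \<open>perforated D {}\<close> is \<open>\<Omega>\<close>.\<close>

definition perforated :: "(real ^ 'n) set \<Rightarrow> (real ^ 'n) set \<Rightarrow> (real ^ 'n) set" where
  "perforated D I = UNIV - (\<Union>m\<in>int_lattice - I. (\<lambda>y. m + y) ` closure D)"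

definition admissible_hole :: "(real ^ 'n) set \<Rightarrow> bool" where
  "admissible_hole D \<longleftrightarrow>
     open D \<and> connected D \<and> 0 \<in> D \<and> C1_boundary D \<and>
     closure D \<subseteq> {x. \<forall>i. - 1/2 < x $ i \<and> x $ i < 1/2} \<and>
     connected (perforated D {})"

definition dilate :: "real \<Rightarrow> (real ^ 'n) set \<Rightarrow> (real ^ 'n) set" where
  "dilate \<epsilon> U = (\<lambda>x. \<epsilon> *\<^sub>R x) ` U"

definition index_box :: "(real ^ 'n) set \<Rightarrow> nat \<Rightarrow> (real ^ 'n) set" where
  "index_box I k = {m \<in> I. \<forall>i. \<bar>m $ i\<bar> \<le> real k}"

definition modulus_of_continuity :: "(real \<Rightarrow> real) \<Rightarrow> bool" where
  "modulus_of_continuity \<omega> \<longleftrightarrow>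
     \<omega> 0 = 0 \<and> (\<forall>r\<ge>0. 0 \<le> \<omega> r) \<and> mono_on {0..} \<omega> \<and> continuous_on {0..} \<omega>"

section \<open>The data\<close>

definition A1 :: "(real ^ 'n \<Rightarrow> real ^ 'n \<Rightarrow> real) \<Rightarrow> bool" where
  "A1 H \<longleftrightarrow> continuous_on UNIV (\<lambda>(y, p). H y p) \<and>
     (\<forall>p y. \<forall>m\<in>int_lattice. H (y + m) p = H y p)"

definition A2 :: "(real ^ 'n \<Rightarrow> real ^ 'n \<Rightarrow> real) \<Rightarrow> bool" where
  "A2 H \<longleftrightarrow> filterlim (\<lambda>p. INF y. H y p) at_top at_infinity"

definition A3 :: "(real ^ 'n \<Rightarrow> real ^ 'n \<Rightarrow> real) \<Rightarrow> bool" where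
  "A3 H \<longleftrightarrow> (\<forall>y. convex_on UNIV (H y))"

definition A4 :: "(real ^ 'n \<Rightarrow> real) \<Rightarrow> bool" where
  "A4 g \<longleftrightarrow> bounded (range g) \<and> uniformly_continuous_on UNIV g \<and> (\<exists>K. K-lipschitz_on UNIV g)"

definition A5 :: "(real ^ 'n \<Rightarrow> real ^ 'n \<Rightarrow> real) \<Rightarrow> bool" where
  "A5 H \<longleftrightarrow> (\<forall>y. H y 0 = 0 \<and> (\<forall>p. H y 0 \<le> H y p))"

text \<open>The \<open>L\<^sup>\<infinity>\<close> norm of the gradient of a Lipschitz function (which is differentiable almost
  everywhere).\<close>

definition grad_Linf_norm :: "(real ^ 'n \<Rightarrow> real) \<Rightarrow> real" where
  "grad_Linf_norm g =
     Inf {B. AE x in lebesgue. \<exists>d. GDERIV g x :> d \<and> norm d \<le> B}"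

section \<open>Viscosity solutions\<close>

text \<open>Sub- and supersolutions on \<open>S\<close> of \<open>F(x, Dz) = 0\<close>; extrema are local relative to \<open>S\<close>, so for
  non-open \<open>S\<close> the second notion is the state-constraint one. For evolution problems the
  variable is the pair \<open>(x, t)\<close> and the gradient is \<open>(D\<phi>, \<phi>\<^sub>t)\<close>.\<close>

definition visc_subsolution ::
  "('a::euclidean_space \<Rightarrow> 'a \<Rightarrow> real) \<Rightarrow> 'a set \<Rightarrow> ('a \<Rightarrow> real) \<Rightarrow> bool" where
  "visc_subsolution F S z \<longleftrightarrow>
     (\<forall>\<phi> D\<phi>. \<forall>x0\<in>S. C1_fun \<phi> D\<phi> \<longrightarrow>
        eventually (\<lambda>x. z x - \<phi> x \<le> z x0 - \<phi> x0) (at x0 within S) \<longrightarrow> F x0 (D\<phi> x0) \<le> 0)"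

definition visc_supersolution ::
  "('a::euclidean_space \<Rightarrow> 'a \<Rightarrow> real) \<Rightarrow> 'a set \<Rightarrow> ('a \<Rightarrow> real) \<Rightarrow> bool" where
  "visc_supersolution F S z \<longleftrightarrow>
     (\<forall>\<phi> D\<phi>. \<forall>x0\<in>S. C1_fun \<phi> D\<phi> \<longrightarrow>
        eventually (\<lambda>x. z x0 - \<phi> x0 \<le> z x - \<phi> x) (at x0 within S) \<longrightarrow> 0 \<le> F x0 (D\<phi> x0))"

text \<open>The (globally Lipschitz) solution \<open>z\<close> of \<open>z\<^sub>t + F(x, Dz) = 0\<close>, \<open>z = g\<close> at time \<open>0\<close>, with state
  constraint in the closure of \<open>U\<close>. The Lipschitz condition singles out the class in which the
  problem is well posed. For \<open>U = UNIV\<close> this is the usual Cauchy problem.\<close>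

definition state_constraint_solution ::
  "(real ^ 'n \<Rightarrow> real ^ 'n \<Rightarrow> real) \<Rightarrow> (real ^ 'n) set \<Rightarrow> (real ^ 'n \<Rightarrow> real)
     \<Rightarrow> ((real ^ 'n) \<times> real \<Rightarrow> real) \<Rightarrow> bool" where
  "state_constraint_solution F U g z \<longleftrightarrow>
     continuous_on (closure U \<times> {0..}) z \<and>
     (\<exists>K. K-lipschitz_on (closure U \<times> {0..}) z) \<and>
     visc_subsolution (\<lambda>(x, t) (p, s). s + F x p) (U \<times> {0<..}) z \<and>
     visc_supersolution (\<lambda>(x, t) (p, s). s + F x p) (closure U \<times> {0<..}) z \<and>
     (\<forall>x\<in>closure U. z (x, 0) = g x)"

definition osc_ham ::
  "real \<Rightarrow> (real ^ 'n \<Rightarrow> real ^ 'n \<Rightarrow> real) \<Rightarrow> real ^ 'n \<Rightarrow> real ^ 'n \<Rightarrow> real" where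
  "osc_ham \<epsilon> H = (\<lambda>x p. H (x /\<^sub>R \<epsilon>) p)"

definition is_corrector ::
  "(real ^ 'n \<Rightarrow> real ^ 'n \<Rightarrow> real) \<Rightarrow> (real ^ 'n) set \<Rightarrow> real ^ 'n \<Rightarrow> real
     \<Rightarrow> (real ^ 'n \<Rightarrow> real) \<Rightarrow> bool" where
  "is_corrector H U p c v \<longleftrightarrow>
     continuous_on (closure U) v \<and>
     (\<forall>y\<in>closure U. \<forall>m\<in>int_lattice. v (y + m) = v y) \<and>
     visc_subsolution (\<lambda>y q. H y (p + q) - c) U v \<and>
     visc_supersolution (\<lambda>y q. H y (p + q) - c) (closure U) v"

definition effective_hamiltonian ::
  "(real ^ 'n \<Rightarrow> real ^ 'n \<Rightarrow> real) \<Rightarrow> (real ^ 'n) set \<Rightarrow> real ^ 'n \<Rightarrow> real" where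
  "effective_hamiltonian H U p = (THE c. \<exists>v. is_corrector H U p c v)"

section \<open>The velocity bound\<close>

text \<open>\<open>C\<^sub>0\<close> bounds the spatial gradient of all the solutions at hand: those for \<open>\<Omega>\<close> (\<open>J = {}\<close>)
  and for every \<open>W\<close>, for all \<open>\<epsilon>\<close> and all initial data with the given gradient norm \<open>G\<close>.
  The bound is expressed as a local Lipschitz constant, since a gradient bound on a non-convex
  domain does not give the same Lipschitz constant for the Euclidean distance.\<close>

definition solution_gradient_bound ::
  "(real ^ 'n \<Rightarrow> real ^ 'n \<Rightarrow> real) \<Rightarrow> (real ^ 'n) set \<Rightarrow> real \<Rightarrow> real \<Rightarrow> bool" where
  "solution_gradient_bound H D G C0 \<longleftrightarrow>
     (\<forall>J \<epsilon> g z. J \<subset> int_lattice \<and> 0 < \<epsilon> \<and> A4 g \<and> grad_Linf_norm g = G \<and>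
        state_constraint_solution (osc_ham \<epsilon> H) (dilate \<epsilon> (perforated D J)) g z \<longrightarrow>
        (\<forall>x \<in> dilate \<epsilon> (perforated D J). \<forall>t>0. \<exists>r>0.
           C0-lipschitz_on (ball x r \<inter> dilate \<epsilon> (perforated D J)) (\<lambda>y. z (y, t))))"

text \<open>\<open>Hm\<close> is \<open>H\<close> modified for \<open>|p| > 2 C\<^sub>0 + 1\<close> so as to be quadratic up to a constant.\<close>

definition quadratic_modification ::
  "(real ^ 'n \<Rightarrow> real ^ 'n \<Rightarrow> real) \<Rightarrow> real \<Rightarrow> real \<Rightarrow> (real ^ 'n \<Rightarrow> real ^ 'n \<Rightarrow> real) \<Rightarrow> bool" where
  "quadratic_modification H C0 K0 Hm \<longleftrightarrow>
     A1 Hm \<and> A3 Hm \<and>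
     (\<forall>y p. norm p \<le> 2 * C0 + 1 \<longrightarrow> Hm y p = H y p) \<and>
     (\<forall>y p. (norm p)\<^sup>2 / 2 - K0 \<le> Hm y p \<and> Hm y p \<le> (norm p)\<^sup>2 / 2 + K0)"

definition legendre ::
  "(real ^ 'n \<Rightarrow> real ^ 'n \<Rightarrow> real) \<Rightarrow> real ^ 'n \<Rightarrow> real ^ 'n \<Rightarrow> real" where
  "legendre H y v = (SUP p. p \<bullet> v - H y p)"

text \<open>Absolute continuity on \<open>[a, b]\<close>; \<open>P\<close> is a finite family of non-overlapping intervals, given by
  their end points.\<close>

definition abs_continuous_curve :: "real \<Rightarrow> real \<Rightarrow> (real \<Rightarrow> real ^ 'n) \<Rightarrow> bool" where
  "abs_continuous_curve a b \<gamma> \<longleftrightarrow>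
     (\<forall>e>0. \<exists>d>0. \<forall>P. finite P \<and> (\<forall>(l, r)\<in>P. a \<le> l \<and> l \<le> r \<and> r \<le> b) \<and>
        pairwise (\<lambda>p q. disjnt {fst p<..<snd p} {fst q<..<snd q}) P \<and>
        (\<Sum>(l, r)\<in>P. r - l) < d \<longrightarrow>
        (\<Sum>(l, r)\<in>P. norm (\<gamma> r - \<gamma> l)) < e)"

definition running_cost ::
  "(real ^ 'n \<Rightarrow> real ^ 'n \<Rightarrow> real) \<Rightarrow> (real \<Rightarrow> real ^ 'n) \<Rightarrow> real \<Rightarrow> real" where
  "running_cost H \<gamma> s = legendre H (\<gamma> s) (vector_derivative \<gamma> (at s))"

definition action ::
  "(real ^ 'n \<Rightarrow> real ^ 'n \<Rightarrow> real) \<Rightarrow> (real ^ 'n \<Rightarrow> real) \<Rightarrow> real \<Rightarrow> real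
     \<Rightarrow> (real \<Rightarrow> real ^ 'n) \<Rightarrow> real" where
  "action H g \<epsilon> t \<gamma> =
     \<epsilon> * set_lebesgue_integral lebesgue {0..t/\<epsilon>} (running_cost H \<gamma>) + g (\<epsilon> *\<^sub>R \<gamma> 0)"

text \<open>The running cost of a quadratically bounded Hamiltonian is bounded below; a curve on which it
  is not integrable has action \<open>+\<infinity>\<close> and is irrelevant for the minimization.\<close>

definition admissible_curve ::
  "(real ^ 'n \<Rightarrow> real ^ 'n \<Rightarrow> real) \<Rightarrow> (real ^ 'n) set \<Rightarrow> real \<Rightarrow> real ^ 'n \<Rightarrow> real
     \<Rightarrow> (real \<Rightarrow> real ^ 'n) \<Rightarrow> bool" where
  "admissible_curve H U \<epsilon> x t \<gamma> \<longleftrightarrow>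
     abs_continuous_curve 0 (t/\<epsilon>) \<gamma> \<and> \<gamma> ` {0..t/\<epsilon>} \<subseteq> closure U \<and> \<gamma> (t/\<epsilon>) = x /\<^sub>R \<epsilon> \<and>
     set_integrable lebesgue {0..t/\<epsilon>} (running_cost H \<gamma>)"

definition minimizing_curve ::
  "(real ^ 'n \<Rightarrow> real ^ 'n \<Rightarrow> real) \<Rightarrow> (real ^ 'n) set \<Rightarrow> (real ^ 'n \<Rightarrow> real) \<Rightarrow> real
     \<Rightarrow> real ^ 'n \<Rightarrow> real \<Rightarrow> (real \<Rightarrow> real ^ 'n) \<Rightarrow> bool" where
  "minimizing_curve H U g \<epsilon> x t \<gamma> \<longleftrightarrow>
     admissible_curve H U \<epsilon> x t \<gamma> \<and>
     (\<forall>\<eta>. admissible_curve H U \<epsilon> x t \<eta> \<longrightarrow> action H g \<epsilon> t \<gamma> \<le> action H g \<epsilon> t \<eta>)"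

text \<open>As above, the bound is for \<open>\<Omega>\<close> (\<open>J = {}\<close>) and uniform over all \<open>W\<close>, \<open>\<epsilon>\<close> and initial data
  with gradient norm \<open>G\<close>. The Hamiltonian meant here is the modified one.\<close>

definition velocity_bound ::
  "(real ^ 'n \<Rightarrow> real ^ 'n \<Rightarrow> real) \<Rightarrow> (real ^ 'n) set \<Rightarrow> real \<Rightarrow> real \<Rightarrow> bool" where
  "velocity_bound Hm D G M0 \<longleftrightarrow>
     (\<forall>J \<epsilon> g x t \<gamma>. J \<subset> int_lattice \<and> 0 < \<epsilon> \<and> A4 g \<and> grad_Linf_norm g = G \<and>
        x \<in> closure (dilate \<epsilon> (perforated D J)) \<and> 0 < t \<and>
        minimizing_curve Hm (perforated D J) g \<epsilon> x t \<gamma> \<longrightarrow>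
        (AE s in lebesgue. s \<in> {0..t/\<epsilon>} \<longrightarrow> norm (vector_derivative \<gamma> (at s)) \<le> M0))"

end

theory Submission
  imports Defs "HOL-Homology.Homology"
begin

text \<open>At unit scale the solutions are represented by the costs of polygonal travels: the subsolution
  property bounds a solution by the cost of every travel, and the supersolution property produces
  almost optimal travels. No Lagrangian action is needed, since the Lagrangian is truncated to momenta
  in a ball and instantaneous jumps are allowed.

  The value functions of the cell problem give correctors, so that travels in \<open>\<Omega>\<close> satisfy a Fenchel
  inequality with the effective Hamiltonian up to a bounded error. This yields one half of the rate
  \<open>O(\<epsilon>)\<close>. For the other half, the cost of a displacement is almost additive under doubling: by the
  Hobby--Rice theorem a travel can be cut into boundedly many pieces forming two groups with the same
  displacement and duration. Hence the cost lies within a constant of a convex, positively homogeneous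
  function, and duality applies.

  Finally, a travel in \<open>W\<close> is turned into one in \<open>\<Omega>\<close> by filling the visited holes one by one, at a
  bounded cost each; only holes within distance \<open>O(|x| + t)\<close> are visited.\<close>

section \<open>The Hobby--Rice theorem\<close>

text \<open>Truncating to momenta of norm at most \<open>R\<close> loses nothing once
  \<open>H\<close> exceeds, beyond that norm, the largest rate at which the solution can decrease in
  time: the subsolution inequality then confines contact momenta to the ball, and on the
  supersolution side longer momenta can be shortened without loss. Jumps, priced at \<open>R\<close>
  per unit length, make finite polygons sufficient, so neither minimizers nor measurable velocities
  occur. The scaling keeps the Lipschitz constant of the data, hence constants found at unit scale
  are uniform in \<epsilon>, and an error C there becomes C \<epsilon>. The delicate inequality is
  the upper bound of the solution in \<Omega> by the effective one: concatenating travels bounds the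
  cost of a double displacement, but the converse needs an optimal travel to be halved with all its
  components, which is what Hobby--Rice provides. The term with \<omega> is a count: the relevant
  box has half-width k of order (M0 t + |x| + 1) / \<epsilon>, and \<epsilon> |I_k| = \<epsilon> k
  \<omega>(1/k).\<close>

definition cutpt :: "(nat => real) => nat => real" where
 "cutpt x i = (\<Sum>j<i. (x j)^2)"

text \<open>A point of the sphere encodes a partition of [0, 1] with signs: the squares of its
  coordinates are the lengths of the intervals, and its coordinates give the signs. The sign
  attached to a zero coordinate is immaterial because its interval is degenerate.\<close>

definition signed_var :: "(real => real) => nat => (nat => real) => real" where
 "signed_var f n x =
   (\<Sum>i\<le>n. (if 0 <= x i then 1 else - 1) * (f (cutpt x (Suc i)) - f (cutpt x i)))"

definition unit_vec :: "nat => (nat => real) => nat => real" where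
 "unit_vec n v = (\<lambda>j. if j <= n then v j / sqrt (\<Sum>k\<le>n. (v k)^2) else 0)"

lemma cutpt_Suc: "cutpt x (Suc i) = cutpt x i + (x i)^2"
 by (simp add: cutpt_def)

lemma cutpt_0 [simp]: "cutpt x 0 = 0"
 by (simp add: cutpt_def)

lemma cutpt_mono: "i <= j ==> cutpt x i <= cutpt x j"
 unfolding cutpt_def by (rule sum_mono2) auto

lemma cutpt_nonneg: "0 <= cutpt x i"
 unfolding cutpt_def by (rule sum_nonneg) auto

lemma topspace_nsphere_iff:
 "x \<in> topspace (nsphere n) \<longleftrightarrow> (\<Sum>i\<le>n. (x i)^2) = 1 \<and> (\<forall>i>n. x i = 0)"
 by (simp add: nsphere)

lemma cutpt_last: "x \<in> topspace (nsphere n) ==> cutpt x (Suc n) = 1"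
 by (simp add: topspace_nsphere_iff cutpt_def lessThan_Suc_atMost)

text \<open>Of \<open>max (x i) 0\<close> and \<open>min (x i) 0\<close> one vanishes, so the
  difference carries the sign by itself. Without the case distinction, continuity across zero
  coordinates and oddness become visible.\<close>

lemma signed_var_eq:
 "signed_var f n x =
   (\<Sum>i\<le>n. f (cutpt x i + (max (x i) 0)^2) - f (cutpt x i + (min (x i) 0)^2))"
 unfolding signed_var_def
 by (rule sum.cong) (auto simp: cutpt_Suc max_def min_def)

lemma signed_var_neg: "signed_var f n (\<lambda>i. - x i) = - signed_var f n x"
proof -
 have c: "cutpt (\<lambda>i. - x i) = cutpt x" by (simp add: cutpt_def fun_eq_iff)
 show ?thesis
  unfolding signed_var_eq c sum_negf[symmetric]
  by (rule sum.cong) (auto simp: max_def min_def)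
qed

lemma signed_var_Suc_zero: "x (Suc n) = 0 ==> signed_var f (Suc n) x = signed_var f n x"
 by (simp add: signed_var_def cutpt_Suc)

lemma signed_var_lincomb:
 "signed_var (\<lambda>s. f s - a * g s) n x = signed_var f n x - a * signed_var g n x"
 unfolding signed_var_def sum_distrib_left sum_subtractf[symmetric]
 by (rule sum.cong) (auto simp: algebra_simps)

lemma continuous_map_real_comp:
 assumes "continuous_map X euclideanreal u" "continuous_on UNIV (f :: real => real)"
 shows "continuous_map X euclideanreal (\<lambda>x. f (u x))"
 using continuous_map_compose[OF assms(1), of euclideanreal f] assms(2) by (simp add: o_def)

lemma continuous_map_signed_var:
 assumes f: "continuous_on UNIV f" and x: "\<And>i. continuous_map X euclideanreal (\<lambda>z. x z i)"
 shows "continuous_map X euclideanreal (\<lambda>z. signed_var f n (x z))"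
proof -
 have c: "continuous_map X euclideanreal (\<lambda>z. cutpt (x z) i)" for i
  unfolding cutpt_def by (intro continuous_intros x) auto
 show ?thesis
  unfolding signed_var_eq
  by (intro continuous_intros continuous_map_real_comp[OF _ f] c x) auto
qed

lemma unit_vec_in_nsphere:
 assumes "\<exists>j\<le>n. v j \<noteq> 0"
 shows "unit_vec n v \<in> topspace (nsphere n)"
proof -
 let ?s = "\<Sum>k\<le>n. (v k)^2"
 have "?s \<noteq> 0" using assms by (subst sum_nonneg_eq_0_iff) auto
 moreover have "0 <= ?s" by (intro sum_nonneg) auto
 ultimately have "0 < ?s" by linarith
 then show ?thesis
  by (simp add: topspace_nsphere_iff unit_vec_def power_divide flip: sum_divide_distrib)
qed

lemma unit_vec_Suc: "v (Suc n) = 0 ==> unit_vec (Suc n) v = unit_vec n v"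
 by (auto simp: unit_vec_def fun_eq_iff le_Suc_eq)

lemma unit_vec_cong: "(\<And>j. j <= n ==> v j = w j) ==> unit_vec n v = unit_vec n w"
 by (simp add: unit_vec_def fun_eq_iff)

lemma continuous_map_unit_vec:
 assumes c: "\<And>j. j <= n ==> continuous_map X euclideanreal (\<lambda>x. v x j)"
  and nz: "\<And>x. x \<in> topspace X ==> \<exists>j\<le>n. v x j \<noteq> 0"
 shows "continuous_map X (nsphere n) (\<lambda>x. unit_vec n (v x))"
proof -
 have "continuous_map X euclideanreal (\<lambda>x. unit_vec n (v x) k)" for k
 proof (cases "k <= n")
  case True
  have "(\<Sum>k\<le>n. (v x k)^2) \<noteq> 0" if "x \<in> topspace X" for x
   using nz[OF that] by (subst sum_nonneg_eq_0_iff) auto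
  then show ?thesis
   using True c by (auto simp: unit_vec_def intro!: continuous_intros)
 qed (simp add: unit_vec_def)
 moreover have "(\<lambda>x. unit_vec n (v x)) \<in> topspace X \<rightarrow> {x. (\<Sum>i\<le>n. (x i)^2) = 1 \<and> (\<forall>i>n. x i = 0)}"
  using unit_vec_in_nsphere[OF nz] by (auto simp: topspace_nsphere_iff)
 ultimately show ?thesis
  unfolding nsphere continuous_map_in_subtopology continuous_map_componentwise_UNIV by auto
qed

lemma degree_homotopic_nonvanishing:
 assumes c: "\<And>j. j <= n ==> continuous_map (prod_topology (top_of_set {0..1}) (nsphere n)) euclideanreal
   (\<lambda>z. H (fst z) (snd z) j)"
  and nz: "\<And>s x. 0 <= s ==> s <= 1 ==> x \<in> topspace (nsphere n) ==> \<exists>j\<le>n. H s x j \<noteq> (0::real)"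
 shows "Brouwer_degree2 n (\<lambda>x. unit_vec n (H (0::real) x)) = Brouwer_degree2 n (\<lambda>x. unit_vec n (H 1 x))"
proof (rule Brouwer_degree2_homotopic)
 have "continuous_map (prod_topology (top_of_set {0..1}) (nsphere n)) (nsphere n)
   (\<lambda>z. unit_vec n (H (fst z) (snd z)))"
  by (rule continuous_map_unit_vec) (use c nz in auto)
 then show "homotopic_with (\<lambda>x. True) (nsphere n) (nsphere n) (\<lambda>x. unit_vec n (H 0 x)) (\<lambda>x. unit_vec n (H 1 x))"
  unfolding homotopic_with_def
  by (intro exI[of _ "\<lambda>z. unit_vec n (H (fst z) (snd z))"]) auto
qed

text \<open>The sphere is a closed subset of a product of intervals [-1, 1], which is compact by
  Tychonoff.\<close>

lemma compact_space_nsphere: "compact_space (nsphere n)"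
proof -
 have 1: "compactin (powertop_real UNIV) (PiE UNIV (\<lambda>i::nat. {-1..1::real}))"
  by (simp add: compactin_PiE)
 have 2: "closedin (powertop_real UNIV) {x. (\<Sum>i\<le>n. x i ^ 2) = 1 \<and> (\<forall>i>n. x i = 0)}"
 proof -
  have "closedin (powertop_real UNIV) {x \<in> topspace (powertop_real UNIV). (\<Sum>i\<le>n. x i ^ 2) \<in> {1::real}}"
   by (rule closedin_continuous_map_preimage) (auto intro!: continuous_intros)
  moreover have "closedin (powertop_real UNIV) {x \<in> topspace (powertop_real UNIV). x i \<in> {0::real}}" for i :: nat
   by (rule closedin_continuous_map_preimage) (auto intro!: continuous_intros)
  then have "closedin (powertop_real UNIV) (\<Inter>i::nat. if i > n then {x. x i = (0::real)} else UNIV)"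
   by (intro closedin_Inter) (auto simp: euclidean_product_topology)
  moreover have "{x. (\<Sum>i\<le>n. x i ^ 2) = 1 \<and> (\<forall>i>n. x i = 0)} =
    {x. (\<Sum>i\<le>n. x i ^ 2) = 1} \<inter> (\<Inter>i::nat. if i > n then {x. x i = (0::real)} else UNIV)"
   by (auto split: if_splits)
  ultimately show ?thesis by auto
 qed
 have 3: "{x. (\<Sum>i\<le>n. x i ^ 2) = 1 \<and> (\<forall>i>n. x i = 0)} \<subseteq> PiE UNIV (\<lambda>i::nat. {-1..1::real})"
 proof
  fix x :: "nat => real"
  assume "x \<in> {x. (\<Sum>i\<le>n. x i ^ 2) = 1 \<and> (\<forall>i>n. x i = 0)}"
  then have x: "(\<Sum>i\<le>n. x i ^ 2) = 1" "\<forall>i>n. x i = 0" by auto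
  have "(x i)^2 <= 1" for i
  proof (cases "i <= n")
   case True
   then show ?thesis using member_le_sum[of i "{..n}" "\<lambda>i. (x i)^2"] x by auto
  qed (use x in auto)
  then have "\<bar>x i\<bar> <= 1" for i by (simp add: abs_square_le_1)
  then show "x \<in> PiE UNIV (\<lambda>i::nat. {-1..1::real})" by (auto simp: abs_le_iff minus_le_iff)
 qed
 have 4: "compactin (powertop_real UNIV) {x. (\<Sum>i\<le>n. x i ^ 2) = 1 \<and> (\<forall>i>n. x i = 0)}"
  using closed_compactin[OF 1 3 2] .
 show ?thesis
  unfolding nsphere using compact_space_subtopology[OF 4] .
qed

lemma nonvanishing_lower_bound:
 fixes F :: "(nat => real) => nat => real"
 assumes c: "\<And>j. j <= n ==> continuous_map (nsphere m) euclideanreal (\<lambda>x. F x j)"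
  and nz: "\<And>x. x \<in> topspace (nsphere m) ==> \<exists>j\<le>n. F x j \<noteq> 0"
 obtains c where "c > 0" "\<And>x. x \<in> topspace (nsphere m) ==> \<exists>j\<le>n. c <= \<bar>F x j\<bar>"
proof -
 let ?g = "\<lambda>x. \<Sum>j\<le>n. \<bar>F x j\<bar>"
 have "continuous_map (nsphere m) euclideanreal ?g"
  by (intro continuous_intros c) auto
 then have "compactin euclideanreal (?g ` topspace (nsphere m))"
  using compact_space_nsphere by (meson compact_space_def image_compactin)
 then have "compact (?g ` topspace (nsphere m))" by simp
 moreover have "?g ` topspace (nsphere m) \<noteq> {}" using in_topspace_nsphere by blast
 ultimately obtain x0 where x0: "x0 \<in> topspace (nsphere m)"
   and le: "\<And>x. x \<in> topspace (nsphere m) ==> ?g x0 <= ?g x"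
  using compact_attains_inf[of "?g ` topspace (nsphere m)"] by blast
 have pos: "?g x0 > 0"
 proof -
  obtain j where j: "j <= n" "F x0 j \<noteq> 0" using nz[OF x0] by blast
  have "\<bar>F x0 j\<bar> <= ?g x0" using j by (intro member_le_sum) auto
  then show ?thesis using j by linarith
 qed
 show thesis
 proof (rule that[of "?g x0 / real (Suc n)"])
  show "0 < ?g x0 / real (Suc n)" using pos by simp
  fix x assume x: "x \<in> topspace (nsphere m)"
  show "\<exists>j\<le>n. ?g x0 / real (Suc n) <= \<bar>F x j\<bar>"
  proof (rule ccontr)
   assume "\<not> ?thesis"
   then have "?g x < (\<Sum>j\<le>n. ?g x0 / real (Suc n))"
    by (intro sum_strict_mono) auto
   then show False using le[OF x] by simp
  qed
 qed
qed

lemma signed_var_close: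
 assumes L: "\<And>s s'. \<bar>f s - f s'\<bar> <= L * \<bar>s - s'\<bar>"
  and sg: "\<And>i. i <= n ==> (0 <= x i) = (0 <= y i)"
  and cl: "\<And>i. i <= Suc n ==> \<bar>cutpt x i - cutpt y i\<bar> <= e" and L0: "0 <= L"
 shows "\<bar>signed_var f n x - signed_var f n y\<bar> <= 2 * real (Suc n) * L * e"
proof -
 have "\<bar>signed_var f n x - signed_var f n y\<bar> <= (\<Sum>i\<le>n. 2 * L * e)"
  unfolding signed_var_def sum_subtractf[symmetric]
 proof (rule order_trans[OF sum_abs], rule sum_mono)
  fix i assume "i \<in> {..n}"
  then have i: "i <= n" by simp
  have "\<bar>f (cutpt x (Suc i)) - f (cutpt y (Suc i))\<bar> <= L * e"
   using L[of "cutpt x (Suc i)" "cutpt y (Suc i)"] mult_left_mono[OF cl[of "Suc i"] L0] i by linarith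
  moreover have "\<bar>f (cutpt x i) - f (cutpt y i)\<bar> <= L * e"
   using L[of "cutpt x i" "cutpt y i"] mult_left_mono[OF cl[of i] L0] i by linarith
  ultimately show "\<bar>(if 0 <= x i then 1 else - 1) * (f (cutpt x (Suc i)) - f (cutpt x i)) -
     (if 0 <= y i then 1 else - 1) * (f (cutpt y (Suc i)) - f (cutpt y i))\<bar> <= 2 * L * e"
   using sg[OF i] by auto
 qed
 then show ?thesis by (simp add: algebra_simps)
qed

text \<open>The directions hit by the map form a set of dimension n in a space of dimension n + 1,
  so some direction \<open>(a, 1)\<close> is missed. The proof counts: N^(n+1) candidate directions
  stand against a constant times N^n cells of the sphere on which Lipschitz signed variations hardly
  vary.\<close>

lemma generic_direction:
 fixes G :: "nat => real => real"
 assumes L: "\<And>j s s'. \<bar>G j s - G j s'\<bar> <= L * \<bar>s - s'\<bar>" and L0: "0 <= L"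
  and nz: "\<And>x. x \<in> topspace (nsphere n) ==> \<exists>j\<le>Suc n. signed_var (G j) n x \<noteq> 0"
 obtains a :: "nat => real" where
  "\<And>x. x \<in> topspace (nsphere n) ==>
    \<exists>j\<le>n. signed_var (G j) n x - a j * signed_var (G (Suc n)) n x \<noteq> 0"
proof -
 have cont: "continuous_on UNIV (G j)" for j
 proof (rule lipschitz_on_continuous_on)
  show "L-lipschitz_on UNIV (G j)"
   by (rule lipschitz_onI) (use L L0 in \<open>auto simp: dist_real_def\<close>)
 qed
 have cm: "continuous_map (nsphere n) euclideanreal (\<lambda>x. signed_var (G j) n x)" for j
  by (intro continuous_map_signed_var cont continuous_map_nsphere_projection)
 obtain c where c: "c > 0" "\<And>x. x \<in> topspace (nsphere n) ==> \<exists>j\<le>Suc n. c <= \<bar>signed_var (G j) n x\<bar>"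
  using nonvanishing_lower_bound[of "Suc n" n "\<lambda>x j. signed_var (G j) n x"] cm nz by metis
 \<comment> \<open>Two candidate directions differ by at least 1/N in some slope; this
   \<open>K\<close> makes the variation over one cell, of order L / (K N), too small to allow both
   in the same cell.\<close>
 obtain K :: nat where K: "real K > 4 * real (Suc n) * L / c" using reals_Archimedean2 by blast
 \<comment> \<open>With this value N^(n+1) exceeds the number of sign patterns times boxes of cut
   points, at most \<open>2 ^ Suc n * ((K + 1) * N) ^ n\<close>.\<close>
 define N :: nat where "N = Suc (2 ^ Suc n * (K + 1) ^ n)"
 have N0: "N > 0" by (simp add: N_def)
 show thesis
 proof (rule ccontr)
  assume nthesis: "\<not> thesis"
  have bad: "\<exists>x. x \<in> topspace (nsphere n) \<and>
    (\<forall>j\<le>n. signed_var (G j) n x = a j * signed_var (G (Suc n)) n x)" for a :: "nat => real"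
   using that[of a] nthesis by auto
  define av where "av k j = real (k j) / real N" for k :: "nat => nat" and j
  define X where "X k = (SOME x. x \<in> topspace (nsphere n) \<and>
    (\<forall>j\<le>n. signed_var (G j) n x = av k j * signed_var (G (Suc n)) n x))" for k :: "nat => nat"
  have X: "X k \<in> topspace (nsphere n)"
    "\<And>j. j <= n ==> signed_var (G j) n (X k) = av k j * signed_var (G (Suc n)) n (X k)" for k
   using someI_ex[OF bad[of "av k"]] unfolding X_def by auto
  define A where "A = PiE {..n} (\<lambda>_. {..<N})"
  \<comment> \<open>Only the interior cut points 1, ..., n are recorded: on the sphere cut point 0
    is 0 and cut point \<open>Suc n\<close> is 1.\<close>
  define cell where "cell k = (restrict (\<lambda>i. 0 <= X k i) {..n},
    restrict (\<lambda>i. nat \<lfloor>real (K * N) * cutpt (X k) i\<rfloor>) {1..n})" for k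
  define B where "B = PiE {..n} (\<lambda>_. UNIV :: bool set) \<times> PiE {1..n} (\<lambda>_. {..K * N})"
  have cut1: "cutpt (X k) i <= 1" if "i <= Suc n" for k i
   using cutpt_mono[OF that, of "X k"] cutpt_last[OF X(1)] by simp
  have "cell ` A \<subseteq> B"
  proof
   fix z assume "z \<in> cell ` A"
   then obtain k where k: "z = cell k" by auto
   have "nat \<lfloor>real (K * N) * cutpt (X k) i\<rfloor> <= K * N" if "i \<in> {1..n}" for i
   proof -
    have "real (K * N) * cutpt (X k) i <= real (K * N) * 1"
     using that by (intro mult_left_mono cut1) auto
    then have "\<lfloor>real (K * N) * cutpt (X k) i\<rfloor> <= int (K * N)" by linarith
    then show ?thesis by linarith
   qed
   then show "z \<in> B" unfolding k cell_def B_def by auto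
  qed
  moreover have finB: "finite B" unfolding B_def by (intro finite_cartesian_product finite_PiE) auto
  moreover have "card B < card A"
  proof -
   have "card B = 2 ^ Suc n * (K * N + 1) ^ n"
    unfolding B_def by (simp add: card_cartesian_product card_PiE add.commute)
   also have "\<dots> <= 2 ^ Suc n * ((K + 1) * N) ^ n"
    using N0 by (intro mult_left_mono power_mono) auto
   also have "\<dots> = (2 ^ Suc n * (K + 1) ^ n) * N ^ n" by (simp only: power_mult_distrib mult.assoc)
   also have "\<dots> < N * N ^ n" using N0 by (intro mult_strict_right_mono) (auto simp: N_def)
   also have "\<dots> = card A" unfolding A_def by (simp add: card_PiE)
   finally show ?thesis .
  qed
  ultimately have "\<not> inj_on cell A"
   using card_inj_on_le[of cell A B] by auto
  then obtain k k' where kk: "k \<in> A" "k' \<in> A" "k \<noteq> k'" "cell k = cell k'" unfolding inj_on_def by blast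
  then obtain j where j: "j <= n" "k j \<noteq> k' j"
   unfolding A_def by (metis PiE_ext atMost_iff)
  have sg: "(0 <= X k i) = (0 <= X k' i)" if "i <= n" for i
   using kk(4) that unfolding cell_def by (auto dest!: fun_cong[where x=i])
  have K0: "0 < real (K * N)"
  proof -
   have "0 <= 4 * real (Suc n) * L / c" using L0 c by auto
   then have "0 < real K" using K by linarith
   then show ?thesis using N0 by simp
  qed
  have cl: "\<bar>cutpt (X k) i - cutpt (X k') i\<bar> <= 1 / real (K * N)" if i: "i <= Suc n" for i
  proof (cases "i = 0 \<or> i = Suc n")
   case True
   then show ?thesis using cutpt_last[OF X(1)] by auto
  next
   case False
   then have "i \<in> {1..n}" using i by auto
   then have "nat \<lfloor>real (K * N) * cutpt (X k) i\<rfloor> = nat \<lfloor>real (K * N) * cutpt (X k') i\<rfloor>"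
    using kk(4) unfolding cell_def by (auto dest!: fun_cong[where x=i])
   moreover have "0 <= \<lfloor>real (K * N) * cutpt (X l) i\<rfloor>" for l using cutpt_nonneg[of "X l" i] by auto
   ultimately have "\<lfloor>real (K * N) * cutpt (X k) i\<rfloor> = \<lfloor>real (K * N) * cutpt (X k') i\<rfloor>"
    by (metis nat_0_le)
   then have "\<bar>real (K * N) * cutpt (X k) i - real (K * N) * cutpt (X k') i\<bar> <= 1" by linarith
   then have "real (K * N) * \<bar>cutpt (X k) i - cutpt (X k') i\<bar> <= 1"
    using K0 by (metis abs_mult abs_of_pos right_diff_distrib)
   then show ?thesis using K0 by (simp add: field_simps)
  qed
  let ?F = "\<lambda>j k. signed_var (G j) n (X k)"
  define d where "d = 2 * real (Suc n) * L * (1 / real (K * N))"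
  have close: "\<bar>?F i k - ?F i k'\<bar> <= d" for i
   unfolding d_def by (rule signed_var_close[OF L sg cl L0])
  have av01: "0 <= av l i \<and> av l i <= 1" if "l \<in> A" "i <= n" for l i
   using that N0 unfolding A_def av_def by (auto simp: PiE_iff less_imp_le)
  \<comment> \<open>The candidate slopes lie in [0, 1], so at \<open>X k\<close> the last component
    dominates all others and inherits the lower bound \<open>c\<close>.\<close>
  have big: "c <= \<bar>?F (Suc n) k\<bar>"
  proof -
   obtain i where i: "i <= Suc n" "c <= \<bar>?F i k\<bar>" using c(2)[OF X(1)] by blast
   show ?thesis
   proof (cases "i = Suc n")
    case False
    then have "i <= n" using i by simp
    then have "\<bar>?F i k\<bar> = av k i * \<bar>?F (Suc n) k\<bar>"
     using X(2)[of i k] av01[OF kk(1), of i] by (simp add: abs_mult)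
    also have "\<dots> <= 1 * \<bar>?F (Suc n) k\<bar>"
     using av01[OF kk(1) \<open>i <= n\<close>] by (intro mult_right_mono) auto
    finally show ?thesis using i by linarith
   qed (use i in simp)
  qed
  have "\<bar>av k j - av k' j\<bar> >= 1 / real N"
  proof -
   have "\<bar>real (k j) - real (k' j)\<bar> >= 1" using j(2) by linarith
   then have "\<bar>real (k j) - real (k' j)\<bar> / real N >= 1 / real N" using N0 by (simp add: divide_right_mono)
   then show ?thesis unfolding av_def by (simp add: diff_divide_distrib[symmetric])
  qed
  then have "1 / real N * c <= \<bar>av k j - av k' j\<bar> * \<bar>?F (Suc n) k\<bar>"
   using big c(1) by (intro mult_mono) auto
  also have "\<dots> = \<bar>(?F j k - ?F j k') + av k' j * (?F (Suc n) k' - ?F (Suc n) k)\<bar>"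
   using X(2)[OF j(1), of k] X(2)[OF j(1), of k'] by (simp add: abs_mult[symmetric] algebra_simps)
  also have "\<dots> <= \<bar>?F j k - ?F j k'\<bar> + \<bar>av k' j\<bar> * \<bar>?F (Suc n) k' - ?F (Suc n) k\<bar>"
   by (metis abs_mult abs_triangle_ineq)
  also have "\<dots> <= d + 1 * d"
   using close[of j] close[of "Suc n"] av01[OF kk(2) j(1)]
   by (intro add_mono mult_mono) (auto simp: abs_minus_commute)
  finally have "1 / real N * c <= 2 * d" by simp
  then have "1 / real N * c * real (K * N) <= 2 * d * real (K * N)"
   using K0 by (intro mult_right_mono) auto
  moreover have "1 / real N * c * real (K * N) = c * real K" using N0 by simp
  moreover have "2 * d * real (K * N) = 4 * real (Suc n) * L" unfolding d_def using K0 by (simp del: of_nat_mult of_nat_Suc)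
  ultimately have "c * real K <= 4 * real (Suc n) * L" by simp
  then show False using K c(1) by (simp add: field_simps)
 qed
qed

text \<open>Borsuk's theorem on odd maps, for the maps induced by signed variations. It ranges over
  all Lipschitz families because the induction step replaces the family by linear
  combinations.\<close>

definition degree_odd :: "nat => bool" where
 "degree_odd n \<longleftrightarrow> (\<forall>G L. (\<forall>j s s'. \<bar>G j s - G j s'\<bar> <= L * \<bar>s - s'\<bar>) \<and> 0 <= L \<and>
   (\<forall>x\<in>topspace (nsphere n). \<exists>j\<le>n. signed_var (G j) n x \<noteq> 0) -->
   odd (Brouwer_degree2 n (\<lambda>x. unit_vec n (\<lambda>j. signed_var (G j) n x))))"

lemma degree_signed_var_odd_0:
 fixes G :: "nat => real => real"
 assumes 0: "\<forall>x\<in>topspace (nsphere 0). \<exists>j\<le>0. signed_var (G j) 0 x \<noteq> 0"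
 shows "odd (Brouwer_degree2 0 (\<lambda>x. unit_vec 0 (\<lambda>j. signed_var (G j) 0 x)))"
proof -
 define d where "d = G 0 1 - G 0 0"
 have x0: "x 0 = 1 \<or> x 0 = - 1" "\<forall>i>0. x i = 0" if "x \<in> topspace (nsphere 0)" for x
  using that by (auto simp: topspace_nsphere_iff power2_eq_1_iff)
 have sv: "signed_var (G 0) 0 x = x 0 * d" if "x \<in> topspace (nsphere 0)" for x
  using x0[OF that] by (auto simp: signed_var_def cutpt_def d_def)
 have d0: "d \<noteq> 0" using 0 in_topspace_nsphere[of 0] sv[OF in_topspace_nsphere] by auto
 have u: "unit_vec 0 (\<lambda>j. signed_var (G j) 0 x) = (if d > 0 then id x else (\<lambda>i. if i = 0 then - x i else x i))"
  if "x \<in> topspace (nsphere 0)" for x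
  using x0[OF that] sv[OF that] d0 by (auto simp: unit_vec_def fun_eq_iff)
 show ?thesis
 proof (cases "d > 0")
  case True
  then show ?thesis using Brouwer_degree2_eq[of 0 _ id] u by simp
 next
  case False
  then show ?thesis
   using Brouwer_degree2_eq[of 0 _ "\<lambda>x i. if i = 0 then - x i else x i"] u Brouwer_degree2_reflection[of 0] by simp
 qed
qed

text \<open>For an odd self-map of the sphere that maps the equator into itself, the degree has the
  parity of the degree on the equator. Two homotopies without zeros bring the map into this form:
  the first uses a generic direction to clear common zeros of the first components on the equator,
  the second makes the last component vanish there.\<close>

lemma degree_signed_var_odd_Suc:
 fixes G :: "nat => real => real"
 assumes IH: "degree_odd n"
  and LL: "\<forall>j s s'. \<bar>G j s - G j s'\<bar> <= L * \<bar>s - s'\<bar>" and L0: "0 <= L"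
  and nn: "\<forall>x\<in>topspace (nsphere (Suc n)). \<exists>j\<le>Suc n. signed_var (G j) (Suc n) x \<noteq> 0"
 shows "odd (Brouwer_degree2 (Suc n) (\<lambda>x. unit_vec (Suc n) (\<lambda>j. signed_var (G j) (Suc n) x)))"
proof -
 have L: "\<And>j s s'. \<bar>G j s - G j s'\<bar> <= L * \<bar>s - s'\<bar>" using LL by blast
 have nz: "\<And>x. x \<in> topspace (nsphere (Suc n)) ==> \<exists>j\<le>Suc n. signed_var (G j) (Suc n) x \<noteq> 0" using nn by blast
 have cont: "continuous_on UNIV (G j)" for j
 proof (rule lipschitz_on_continuous_on)
  show "L-lipschitz_on UNIV (G j)"
   by (rule lipschitz_onI) (use L L0 in \<open>auto simp: dist_real_def\<close>)
 qed
 have sub: "x \<in> topspace (nsphere (Suc n))" "x (Suc n) = 0" if "x \<in> topspace (nsphere n)" for x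
  using that by (auto simp: topspace_nsphere_iff)
 have eq: "signed_var f (Suc n) x = signed_var f n x" if "x \<in> topspace (nsphere n)" for f x
  by (rule signed_var_Suc_zero) (use sub[OF that] in simp)
 obtain a where a: "\<And>x. x \<in> topspace (nsphere n) ==>
    \<exists>j\<le>n. signed_var (G j) n x - a j * signed_var (G (Suc n)) n x \<noteq> 0"
  using generic_direction[of G L n] L L0 nz sub eq by metis
 let ?S = "\<lambda>j x. signed_var (G j) (Suc n) x"
 define c where "c j s = G j s - (if j <= n then a j else 0) * G (Suc n) s" for j s
 have sD: "signed_var (c j) m x = signed_var (G j) m x - (if j <= n then a j else 0) * signed_var (G (Suc n)) m x" for j m x
  unfolding c_def by (rule signed_var_lincomb)
 define M where "M = L * (1 + (\<Sum>i\<le>n. \<bar>a i\<bar>))"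
 have sum0: "0 <= (\<Sum>i\<le>n. \<bar>a i\<bar>)" by (intro sum_nonneg) auto
 have M0: "0 <= M" unfolding M_def using L0 sum0 by auto
 have LD: "\<bar>c j s - c j s'\<bar> <= M * \<bar>s - s'\<bar>" for j s s'
 proof -
  let ?b = "if j <= n then a j else 0"
  have b: "\<bar>?b\<bar> <= (\<Sum>i\<le>n. \<bar>a i\<bar>)" using sum0 member_le_sum[of j "{..n}" "\<lambda>i. \<bar>a i\<bar>"] by auto
  have "\<bar>c j s - c j s'\<bar> = \<bar>(G j s - G j s') - ?b * (G (Suc n) s - G (Suc n) s')\<bar>"
   unfolding c_def by (simp add: algebra_simps)
  also have "\<dots> <= \<bar>G j s - G j s'\<bar> + \<bar>?b\<bar> * \<bar>G (Suc n) s - G (Suc n) s'\<bar>"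
   by (metis abs_mult abs_triangle_ineq4)
  also have "\<dots> <= L * \<bar>s - s'\<bar> + (\<Sum>i\<le>n. \<bar>a i\<bar>) * (L * \<bar>s - s'\<bar>)"
   using b sum0 by (intro add_mono mult_mono L) auto
  finally show ?thesis unfolding M_def by (simp add: algebra_simps)
 qed
 let ?X = "prod_topology (top_of_set {0..1}) (nsphere (Suc n))"
 have proj: "continuous_map ?X euclideanreal (\<lambda>z. snd z i)" for i
  using continuous_map_compose[OF continuous_map_snd continuous_map_nsphere_projection] by (simp add: o_def)
 have cm: "continuous_map ?X euclideanreal (\<lambda>z. ?S j (snd z))" for j
  by (intro continuous_map_signed_var cont proj)
 have cf: "continuous_map ?X euclideanreal fst"
  using continuous_map_fst continuous_map_in_subtopology by blast
 have cx: "continuous_map ?X euclideanreal (\<lambda>z. snd z (Suc n))"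
  by (rule proj)
 \<comment> \<open>Subtracting multiples of the last component from the others is an invertible
   triangular change, so no common zero can appear.\<close>
 define H1 where "H1 s x j = ?S j x - s * (if j <= n then a j else 0) * ?S (Suc n) x" for s x j
 \<comment> \<open>The factor of the last component is even in x, so oddness is kept. At s = 1 it
   vanishes exactly on the equator, where the choice of \<open>a\<close> keeps the first components
   from vanishing together.\<close>
 define H2 where "H2 s x j = (if j <= n then signed_var (c j) (Suc n) x
   else ((1 - s) + s * (x (Suc n))^2) * ?S (Suc n) x)" for s :: real and x :: "nat => real" and j
 have e1: "Brouwer_degree2 (Suc n) (\<lambda>x. unit_vec (Suc n) (H1 0 x)) = Brouwer_degree2 (Suc n) (\<lambda>x. unit_vec (Suc n) (H1 1 x))"
 proof (rule degree_homotopic_nonvanishing)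
  show "continuous_map ?X euclideanreal (\<lambda>z. H1 (fst z) (snd z) j)" for j
   unfolding H1_def by (intro continuous_intros cm cf) auto
  fix s :: real and x assume x: "x \<in> topspace (nsphere (Suc n))"
  obtain j where j: "j <= Suc n" "?S j x \<noteq> 0" using nz[OF x] by blast
  show "\<exists>j\<le>Suc n. H1 s x j \<noteq> 0"
  proof (cases "?S (Suc n) x = 0")
   case True
   then show ?thesis using j by (intro exI[of _ j]) (auto simp: H1_def)
  next
   case False
   then show ?thesis by (intro exI[of _ "Suc n"]) (auto simp: H1_def)
  qed
 qed
 have nzH2: "\<exists>j\<le>Suc n. H2 s x j \<noteq> 0"
  if x: "x \<in> topspace (nsphere (Suc n))" and s: "0 <= s" "s <= 1" for s x
 proof (cases "\<exists>j\<le>n. signed_var (c j) (Suc n) x \<noteq> 0")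
  case True
  then obtain j where "j <= n" "signed_var (c j) (Suc n) x \<noteq> 0" by blast
  then show ?thesis by (intro exI[of _ j]) (simp add: H2_def)
 next
  case False
  then have D0: "signed_var (c j) (Suc n) x = 0" if "j <= n" for j using that by blast
  have xn: "x (Suc n) \<noteq> 0"
  proof
   assume "x (Suc n) = 0"
   then have xs: "x \<in> topspace (nsphere n)" using x topspace_nsphere_minus1[of x "Suc n"] by simp
   obtain j where "j <= n" "signed_var (G j) n x - a j * signed_var (G (Suc n)) n x \<noteq> 0"
    using a[OF xs] by blast
   then show False using D0[of j] eq[OF xs] by (simp add: sD)
  qed
  have S: "?S (Suc n) x \<noteq> 0"
  proof
   assume 0: "?S (Suc n) x = 0"
   obtain j where j: "j <= Suc n" "?S j x \<noteq> 0" using nz[OF x] by blast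
   then have "j <= n" using 0 by (metis le_Suc_eq)
   then show False using D0[of j] 0 j by (simp add: sD)
  qed
  have "0 < (1 - s) + s * (x (Suc n))^2"
  proof (cases "s = 1")
   case False
   then have "0 < 1 - s" using s by simp
   moreover have "0 <= s * (x (Suc n))^2" using s by simp
   ultimately show ?thesis by linarith
  qed (use xn in simp)
  then show ?thesis using S by (intro exI[of _ "Suc n"]) (simp add: H2_def)
 qed
 have e2: "Brouwer_degree2 (Suc n) (\<lambda>x. unit_vec (Suc n) (H2 0 x)) = Brouwer_degree2 (Suc n) (\<lambda>x. unit_vec (Suc n) (H2 1 x))"
 proof (rule degree_homotopic_nonvanishing)
  show "continuous_map ?X euclideanreal (\<lambda>z. H2 (fst z) (snd z) j)" for j
   unfolding H2_def sD by (intro continuous_intros cm cf cx) auto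
  fix s :: real and x assume s: "0 <= s" "s <= 1" and x: "x \<in> topspace (nsphere (Suc n))"
  show "\<exists>j\<le>Suc n. H2 s x j \<noteq> 0" using nzH2[OF x s] .
 qed
 have e12: "H1 1 x = (\<lambda>j. if j <= Suc n then H2 0 x j else H1 1 x j)" for x
  by (auto simp: H1_def H2_def sD fun_eq_iff not_le le_Suc_eq)
 have u12: "unit_vec (Suc n) (H1 1 x) = unit_vec (Suc n) (H2 0 x)" for x
  unfolding unit_vec_def by (subst (1 2) e12) (auto simp: fun_eq_iff)
 let ?f = "\<lambda>x. unit_vec (Suc n) (H2 1 x)"
 have cmx: "continuous_map (nsphere (Suc n)) euclideanreal (\<lambda>z. ?S j z)" for j
  by (intro continuous_map_signed_var cont continuous_map_nsphere_projection)
 have nz2: "\<exists>j\<le>Suc n. H2 1 x j \<noteq> 0" if x: "x \<in> topspace (nsphere (Suc n))" for x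
  using nzH2[OF x] by simp
 have cmf: "continuous_map (nsphere (Suc n)) (nsphere (Suc n)) ?f"
 proof (rule continuous_map_unit_vec[OF _ nz2])
  show "continuous_map (nsphere (Suc n)) euclideanreal (\<lambda>x. H2 1 x j)" for j
   unfolding H2_def sD by (intro continuous_intros cmx continuous_map_nsphere_projection) auto
 qed
 have odd2: "H2 1 (\<lambda>i. - x i) j = - H2 1 x j" for x j
  by (auto simp: H2_def signed_var_neg)
 have oddf: "(?f \<circ> (\<lambda>x i. - x i)) u = ((\<lambda>x i. - x i) \<circ> ?f) u" for u
  by (auto simp: unit_vec_def odd2 fun_eq_iff)
 have feq: "?f x = unit_vec n (\<lambda>j. signed_var (c j) n x)" if x: "x \<in> topspace (nsphere n)" for x
 proof -
  have 0: "H2 1 x (Suc n) = 0" using sub[OF x] by (simp add: H2_def)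
  have "H2 1 x j = signed_var (c j) n x" if "j <= n" for j
   using that eq[OF x] by (simp add: H2_def)
  then show ?thesis unfolding unit_vec_Suc[of "H2 1 x", OF 0] by (rule unit_vec_cong)
 qed
 have nzD: "\<exists>j\<le>n. signed_var (c j) n x \<noteq> 0" if x: "x \<in> topspace (nsphere n)" for x
  using a[OF x] by (auto simp: sD)
 have "even (Brouwer_degree2 (Suc n) ?f - Brouwer_degree2 n ?f)"
 proof -
  have "?f \<in> topspace (nsphere n) \<rightarrow> topspace (nsphere n)"
  proof
   fix x assume x: "x \<in> topspace (nsphere n)"
   show "?f x \<in> topspace (nsphere n)"
    unfolding feq[OF x] by (rule unit_vec_in_nsphere[OF nzD[OF x]])
  qed
  then show ?thesis
   using Borsuk_odd_mapping_degree_step[OF cmf oddf] by simp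
 qed
 moreover have "Brouwer_degree2 n ?f = Brouwer_degree2 n (\<lambda>x. unit_vec n (\<lambda>j. signed_var (c j) n x))"
  by (rule Brouwer_degree2_eq) (rule feq)
 moreover have "odd (Brouwer_degree2 n (\<lambda>x. unit_vec n (\<lambda>j. signed_var (c j) n x)))"
  using IH[unfolded degree_odd_def, rule_format, of c M] LD M0 nzD by blast
 ultimately have "odd (Brouwer_degree2 (Suc n) ?f)" by simp
 moreover have "Brouwer_degree2 (Suc n) (\<lambda>x. unit_vec (Suc n) (H1 0 x)) = Brouwer_degree2 (Suc n) ?f"
  by (rule trans[OF e1[unfolded u12] e2])
 moreover have "H1 0 = (\<lambda>x j. ?S j x)" by (simp add: H1_def fun_eq_iff)
 ultimately show ?thesis by metis
qed

lemma degree_odd: "degree_odd n"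
proof (induction n)
 case 0
 show ?case unfolding degree_odd_def using degree_signed_var_odd_0 by metis
next
 case (Suc n)
 show ?case unfolding degree_odd_def
 proof (intro allI impI, elim conjE)
  fix G :: "nat => real => real" and L
  assume "\<forall>j s s'. \<bar>G j s - G j s'\<bar> <= L * \<bar>s - s'\<bar>" and "0 <= L"
   and "\<forall>x\<in>topspace (nsphere (Suc n)). \<exists>j\<le>Suc n. signed_var (G j) (Suc n) x \<noteq> 0"
  then show "odd (Brouwer_degree2 (Suc n) (\<lambda>x. unit_vec (Suc n) (\<lambda>j. signed_var (G j) (Suc n) x)))"
   by (rule degree_signed_var_odd_Suc[OF Suc.IH])
 qed
qed

text \<open>Without a common zero the normalized map would send a sphere to the sphere of one
  dimension less. Its restriction to the equator extends over a contractible hemisphere and so has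
  degree 0, which contradicts \<open>degree_odd\<close>.\<close>

theorem Hobby_Rice_nsphere:
 fixes G :: "nat => real => real"
 assumes L: "\<And>j s s'. \<bar>G j s - G j s'\<bar> <= L * \<bar>s - s'\<bar>" and L0: "0 <= L"
 shows "\<exists>x \<in> topspace (nsphere (Suc n)). \<forall>j\<le>n. signed_var (G j) (Suc n) x = 0"
proof (rule ccontr)
 assume "\<not> ?thesis"
 then have nz: "\<And>x. x \<in> topspace (nsphere (Suc n)) ==> \<exists>j\<le>n. signed_var (G j) (Suc n) x \<noteq> 0"
  by blast
 have cont: "continuous_on UNIV (G j)" for j
 proof (rule lipschitz_on_continuous_on)
  show "L-lipschitz_on UNIV (G j)"
   by (rule lipschitz_onI) (use L L0 in \<open>auto simp: dist_real_def\<close>)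
 qed
 have sub: "x \<in> topspace (nsphere (Suc n))" "x (Suc n) = 0" if "x \<in> topspace (nsphere n)" for x
  using that by (auto simp: topspace_nsphere_iff)
 have eq: "signed_var f (Suc n) x = signed_var f n x" if "x \<in> topspace (nsphere n)" for f x
  by (rule signed_var_Suc_zero) (use sub[OF that] in simp)
 let ?g = "\<lambda>x. unit_vec n (\<lambda>j. signed_var (G j) (Suc n) x)"
 let ?U = "subtopology (nsphere (Suc n)) {x. x (Suc n) >= 0}"
 have cg: "continuous_map (nsphere (Suc n)) (nsphere n) ?g"
  by (intro continuous_map_unit_vec continuous_map_signed_var cont continuous_map_nsphere_projection nz)
 then have cgU: "continuous_map ?U (nsphere n) ?g" by (rule continuous_map_from_subtopology)
 have cid: "continuous_map (nsphere n) ?U id"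
  using continuous_map_id_subt[of "nsphere (Suc n)" "{x. x (Suc n) = 0}"]
  unfolding continuous_map_in_subtopology subtopology_nsphere_equator by (auto simp: sub(2))
 obtain c where "homotopic_with (\<lambda>h. True) (nsphere n) (nsphere n) (?g \<circ> id) (\<lambda>x. c)"
  using nullhomotopic_through_contractible_space[OF cid cgU]
   contractible_space_upper_hemisphere[of "Suc n" "Suc n"] by auto
 then have "Brouwer_degree2 n ?g = 0"
  using Brouwer_degree2_nullhomotopic by simp
 moreover have "Brouwer_degree2 n ?g = Brouwer_degree2 n (\<lambda>x. unit_vec n (\<lambda>j. signed_var (G j) n x))"
  by (rule Brouwer_degree2_eq) (simp add: eq)
 moreover have "\<exists>j\<le>n. signed_var (G j) n x \<noteq> 0" if x: "x \<in> topspace (nsphere n)" for x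
  using nz[OF sub(1)[OF x]] by (simp only: eq[OF x])
 then have "odd (Brouwer_degree2 n (\<lambda>x. unit_vec n (\<lambda>j. signed_var (G j) n x)))"
  using degree_odd[of n, unfolded degree_odd_def, rule_format, of G L] L L0 by blast
 ultimately show False by simp
qed

theorem Hobby_Rice:
 fixes g :: "real => 'a::euclidean_space"
 assumes lip: "K-lipschitz_on {0..1} g"
 obtains u :: "nat => real" and S :: "nat => bool" where
  "u 0 = 0" "u (Suc DIM('a)) = 1" "mono u"
  "(\<Sum>i\<le>DIM('a). (if S i then 1 else - 1) *\<^sub>R (g (u (Suc i)) - g (u i))) = 0"
proof -
 define N where "N = DIM('a)"
 obtain b :: "nat => 'a" where b: "bij_betw b {0..<N} Basis"
  using ex_bij_betw_nat_finite[OF finite_Basis] unfolding N_def by blast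
 obtain n where n: "N = Suc n" using DIM_positive[where 'a='a] unfolding N_def by (metis gr0_implies_Suc)
 \<comment> \<open>Clamping to [0, 1] makes the coordinate functions globally Lipschitz, as the
   version on the sphere demands; cut points are not affected.\<close>
 define cl :: "real => real" where "cl s = max 0 (min 1 s)" for s
 define G where "G j s = (if j < N then g (cl s) \<bullet> b j else 0)" for j s
 have K0: "0 <= K" using lip lipschitz_on_nonneg by blast
 have bB: "b j \<in> Basis" if "j < N" for j using b that by (auto simp: bij_betw_def)
 have L: "\<bar>G j s - G j s'\<bar> <= K * \<bar>s - s'\<bar>" for j s s'
 proof (cases "j < N")
  case True
  have "\<bar>G j s - G j s'\<bar> = \<bar>(g (cl s) - g (cl s')) \<bullet> b j\<bar>"
   using True by (simp add: G_def inner_diff_left)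
  also have "\<dots> <= norm (g (cl s) - g (cl s'))" by (rule Basis_le_norm[OF bB[OF True]])
  also have "\<dots> <= K * dist (cl s) (cl s')"
   using lipschitz_onD[OF lip, of "cl s" "cl s'"] by (simp add: dist_norm cl_def)
  also have "\<dots> <= K * \<bar>s - s'\<bar>"
   using K0 by (intro mult_left_mono) (auto simp: cl_def dist_real_def)
  finally show ?thesis .
 qed (use K0 in \<open>simp add: G_def\<close>)
 have "\<exists>x\<in>topspace (nsphere N). \<forall>j\<le>n. signed_var (G j) N x = 0"
  unfolding n by (rule Hobby_Rice_nsphere[OF L K0])
 then obtain x where x: "x \<in> topspace (nsphere N)" "\<forall>j\<le>n. signed_var (G j) N x = 0" ..
 have c01: "cl (cutpt x i) = cutpt x i" if "i <= Suc N" for i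
  using cutpt_mono[OF that, of x] cutpt_last[OF x(1)] cutpt_nonneg[of x i] by (auto simp: cl_def)
 let ?v = "\<Sum>i\<le>N. (if 0 <= x i then 1 else - 1) *\<^sub>R (g (cutpt x (Suc i)) - g (cutpt x i))"
 have "?v \<bullet> b j = 0" if j: "j < N" for j
 proof -
  have "?v \<bullet> b j = (\<Sum>i\<le>N. (if 0 <= x i then 1 else - 1) * (G j (cutpt x (Suc i)) - G j (cutpt x i)))"
   unfolding inner_sum_left
   by (rule sum.cong) (use j in \<open>auto simp: G_def c01 inner_diff_left\<close>)
  also have "\<dots> = signed_var (G j) N x" by (simp add: signed_var_def)
  finally show ?thesis using x(2) j n by simp
 qed
 note comp = this
 have "?v \<bullet> c = 0" if c: "c \<in> Basis" for c
 proof -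
  have "c \<in> b ` {0..<N}" using b c by (simp add: bij_betw_def)
  then obtain j where "j < N" "c = b j" by auto
  then show ?thesis using comp by blast
 qed
 then have v0: "?v = 0" by (rule euclidean_all_zero_iff[THEN iffD1, rule_format])
 show thesis
 proof (rule that[of "cutpt x" "\<lambda>i. 0 <= x i"])
  show "cutpt x (Suc DIM('a)) = 1" using cutpt_last[OF x(1)] unfolding N_def .
  show "(\<Sum>i\<le>DIM('a). (if 0 <= x i then 1 else - 1) *\<^sub>R (g (cutpt x (Suc i)) - g (cutpt x i))) = 0"
   using v0 unfolding N_def .
 qed (simp_all add: mono_def cutpt_mono)
qed

section \<open>Truncated Lagrangians and polygonal travel\<close>

text \<open>A hyperplane separates (p, f p) from the strict epigraph. It cannot be vertical, since f
  is finite everywhere; dividing by its vertical coefficient gives the subgradient.\<close>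

lemma subgradient_exists:
 fixes f :: "'a::euclidean_space => real"
 assumes f: "convex_on UNIV f"
 shows "\<exists>v. \<forall>q. f p + v \<bullet> (q - p) <= f q"
proof -
 let ?T = "{z :: 'a \<times> real. f (fst z) < snd z}"
 have cT: "convex ?T"
 proof (rule convexI)
  fix z w :: "'a \<times> real" and u v :: real
  assume z: "z \<in> ?T" and w: "w \<in> ?T" and uv: "0 <= u" "0 <= v" "u + v = 1"
  have "f (u *\<^sub>R fst z + v *\<^sub>R fst w) <= u * f (fst z) + v * f (fst w)"
   using f uv unfolding convex_on_def by auto
  also have "\<dots> < u * snd z + v * snd w"
  proof (cases "u = 0")
   case False
   then have "u * f (fst z) < u * snd z" using z uv by auto
   moreover have "v * f (fst w) <= v * snd w" using w uv by (auto intro: mult_left_mono)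
   ultimately show ?thesis by simp
  qed (use w uv in auto)
  finally show "u *\<^sub>R z + v *\<^sub>R w \<in> ?T" by simp
 qed
 have "(p, f p + 1) \<in> ?T" by simp
 then have ne: "?T \<noteq> {}" by blast
 obtain a b where ab: "a \<noteq> 0" "\<forall>x\<in>{(p, f p)}. inner a x <= b" "\<forall>x\<in>?T. inner a x >= b"
  using separating_hyperplane_sets[of "{(p, f p)}" ?T] cT ne by auto
 obtain v c where a: "a = (v, c)" by (cases a)
 have key: "v \<bullet> p + c * f p <= v \<bullet> q + c * t" if "f q < t" for q t
 proof -
  have "a \<bullet> (p, f p) <= a \<bullet> (q, t)" using ab(2,3) that by force
  then show ?thesis by (simp add: a)
 qed
 have le: "v \<bullet> p + c * f p <= v \<bullet> q + c * f q" for q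
 proof (rule tendsto_lowerbound)
  show "((\<lambda>e. v \<bullet> q + c * (f q + e)) \<longlongrightarrow> v \<bullet> q + c * f q) (at_right 0)"
   by (auto intro!: tendsto_eq_intros)
  show "\<forall>\<^sub>F e in at_right 0. v \<bullet> p + c * f p <= v \<bullet> q + c * (f q + e)"
   using key by (auto simp: eventually_at_right_field intro!: exI[of _ 1])
 qed auto
 have "c >= 0" using key[of p "f p + 1"] by (auto simp: algebra_simps)
 moreover have "c \<noteq> 0"
 proof
  assume "c = 0"
  then have "v \<bullet> p <= v \<bullet> (p - v)" using le[of "p - v"] by simp
  then have "v \<bullet> v <= 0" by (simp add: inner_diff_right)
  then have "v = 0" using inner_gt_zero_iff[of v] by linarith
  then show False using ab(1) a \<open>c = 0\<close> by (simp add: zero_prod_def)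
 qed
 ultimately have pos: "c > 0" by simp
 have "f p + (- v /\<^sub>R c) \<bullet> (q - p) <= f q" for q
 proof -
  have "c * ((- v /\<^sub>R c) \<bullet> (q - p)) = - (v \<bullet> (q - p))" using pos by simp
  then have "c * (f p + (- v /\<^sub>R c) \<bullet> (q - p)) <= c * f q"
   using le[of q] unfolding distrib_left by (simp add: inner_diff_right)
  then show ?thesis using pos by simp
 qed
 then show ?thesis by blast
qed

text \<open>For h > 0 this is h times the Lagrangian at velocity d / h, with the supremum restricted
  to |p| \<le> R; for h = 0 and R \<ge> 0 it is R |d|, the price of a jump. Passing to this
  perspective makes it jointly sublinear in (d, h).\<close>

definition ell :: "('a::euclidean_space => 'a => real) => real => 'a => 'a => real => real" where
 "ell H R w d h = (SUP p\<in>cball 0 R. p \<bullet> d - h * H w p)"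

text \<open>\<open>trav U H R T x y c\<close>: some polygonal curve in \<open>U\<close> leads from \<open>x\<close> to \<open>y\<close> in time \<open>T\<close> at cost
 at most \<open>c\<close>, where instantaneous jumps along segments are allowed at cost \<open>R\<close> per unit length.\<close>

inductive trav :: "'a::euclidean_space set => ('a => 'a => real) => real => real => 'a => 'a => real => bool"
 for U H R where
 trav_nil: "x \<in> U ==> trav U H R 0 x x 0"
| trav_step: "trav U H R T x y c ==> 0 <= h ==> closed_segment y z \<subseteq> U ==>
  (\<And>w. w \<in> closed_segment y z ==> ell H R w (z - y) h <= l) ==> trav U H R (T + h) x z (c + l)"

lemma trav_in: "trav U H R T x y c ==> x \<in> U \<and> y \<in> U \<and> 0 <= T"
 by (induction rule: trav.induct) auto

lemma trav_trans:
 "trav U H R S y z d ==> trav U H R T x y c ==> trav U H R (T + S) x z (c + d)"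
proof (induction rule: trav.induct)
 case (trav_step S y y' d h z l)
 show ?case using trav.trav_step[OF trav_step.IH[OF trav_step.prems] trav_step.hyps(2-4)] by (simp add: add.assoc)
qed simp

lemma trav_single:
 assumes "0 <= h" "closed_segment y z \<subseteq> U" "\<And>w. w \<in> closed_segment y z ==> ell H R w (z - y) h <= l"
 shows "trav U H R h y z l"
 using trav_step[OF trav_nil, of y U h z H R l] assms by auto

lemma trav_mono_set: "trav U H R T x y c ==> U \<subseteq> U' ==> trav U' H R T x y c"
 by (induction rule: trav.induct) (auto intro!: trav.intros)

lemma trav_translate:
 assumes "trav U H R T x y c" "\<And>w. w \<in> U ==> w + m \<in> U" "\<And>w p. H (w + m) p = H w p"
 shows "trav U H R T (x + m) (y + m) c"
 using assms
proof (induction rule: trav.induct)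
 case (trav_nil x)
 then show ?case by (intro trav.trav_nil) auto
next
 case (trav_step T x y c h z l)
 have seg: "closed_segment (y + m) (z + m) = (\<lambda>w. w + m) ` closed_segment y z"
  using closed_segment_translation[of m y z] by (simp add: add.commute)
 have e: "ell H R (w + m) d h = ell H R w d h" for w d
  by (simp add: ell_def trav_step.prems(2))
 show ?case
  by (rule trav.trav_step[OF trav_step.IH[OF trav_step.prems] trav_step.hyps(2)])
   (use trav_step seg e in auto)
qed

text \<open>Uniformity in y is assumed in place of periodicity, so that the same theory covers the
  effective Hamiltonian on the whole space as well as the oscillating one.\<close>

locale hamiltonian =
 fixes H :: "'a::euclidean_space => 'a => real"
 assumes convex: "convex_on UNIV (H y)"
  and zero: "H y 0 = 0"
  and nonneg: "0 <= H y p"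
  and locally_bounded: "\<exists>M. \<forall>y p. norm p <= R --> H y p <= M"
  and coercive: "\<exists>r. \<forall>y p. r <= norm p --> K < H y p"
  and equicontinuous: "0 < e ==> \<exists>d>0. \<forall>y y' p. norm p <= R --> dist y y' < d --> \<bar>H y p - H y' p\<bar> < e"
begin

lemma ell_bdd: "0 <= h ==> bdd_above ((\<lambda>p. p \<bullet> d - h * H w p) ` cball 0 R)"
proof (rule bdd_aboveI2)
 fix p :: 'a assume h: "0 <= h" and "p \<in> cball 0 R"
 then have "p \<bullet> d <= R * norm d"
  using norm_cauchy_schwarz[of p d] mult_right_mono[of "norm p" R "norm d"] by auto
 then show "p \<bullet> d - h * H w p <= R * norm d" using mult_nonneg_nonneg[OF h nonneg[of w p]] by linarith
qed

lemma ell_ge: "0 <= h ==> norm p <= R ==> p \<bullet> d - h * H w p <= ell H R w d h"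
 unfolding ell_def by (rule cSUP_upper[OF _ ell_bdd]) auto

lemma ell_le:
 assumes "0 <= R" "\<And>p. norm p <= R ==> p \<bullet> d - h * H w p <= c"
 shows "ell H R w d h <= c"
 unfolding ell_def by (rule cSUP_least) (use assms in auto)

lemma ell_nonneg: "0 <= R ==> 0 <= h ==> 0 <= ell H R w d h"
 using ell_ge[of h 0 R d w] by (simp add: zero)

lemma ell_le_norm:
 assumes "0 <= R" "0 <= h" shows "ell H R w d h <= R * norm d"
proof (rule ell_le[OF assms(1)])
 fix p :: 'a assume p: "norm p <= R"
 have "p \<bullet> d <= norm p * norm d" by (rule norm_cauchy_schwarz)
 also have "\<dots> <= R * norm d" using p by (rule mult_right_mono) simp
 finally show "p \<bullet> d - h * H w p <= R * norm d" using mult_nonneg_nonneg[OF assms(2) nonneg[of w p]] by linarith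
qed

lemma ell_lower:
 assumes r: "0 <= r" "r <= R" and h: "0 <= h" and M: "\<And>p. norm p <= r ==> H w p <= M"
 shows "r * norm d - h * M <= ell H R w d h"
proof (cases "d = 0")
 case True
 have "0 <= M" using M[of 0] r by (simp add: zero)
 then have "0 <= h * M" using h by simp
 moreover have "0 <= ell H R w d h" using ell_nonneg[of R h w d] r h by simp
 ultimately show ?thesis using True by simp
next
 case False
 let ?p = "(r / norm d) *\<^sub>R d"
 have n: "norm ?p = r" using False r by simp
 have "?p \<bullet> d = r * norm d" using False by (simp add: dot_square_norm power2_eq_square)
 moreover have "h * H w ?p <= h * M" using h M[of ?p] n by (intro mult_left_mono) auto
 ultimately show ?thesis using ell_ge[OF h, of ?p R d w] n r by linarith
qed

lemma ell_scale:
 assumes "0 <= R" "0 <= h" "0 <= s" shows "ell H R w (s *\<^sub>R d) (s * h) <= s * ell H R w d h"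
proof (rule ell_le[OF assms(1)])
 fix p :: 'a assume "norm p <= R"
 then have "s * (p \<bullet> d - h * H w p) <= s * ell H R w d h"
  using assms by (intro mult_left_mono ell_ge) auto
 then show "p \<bullet> s *\<^sub>R d - s * h * H w p <= s * ell H R w d h" by (simp add: algebra_simps)
qed

lemma ell_add:
 assumes "0 <= R" "0 <= h" "0 <= h'"
 shows "ell H R w (d + d') (h + h') <= ell H R w d h + ell H R w d' h'"
proof (rule ell_le[OF assms(1)])
 fix p :: 'a assume "norm p <= R"
 then show "p \<bullet> (d + d') - (h + h') * H w p <= ell H R w d h + ell H R w d' h'"
  using ell_ge[of h p R d w] ell_ge[of h' p R d' w] assms by (simp add: algebra_simps)
qed

lemma ell_change_point:
 assumes "0 <= R" "0 <= h" "\<And>p. norm p <= R ==> H w' p <= H w p + e"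
 shows "ell H R w d h <= ell H R w' d h + h * e"
proof (rule ell_le[OF assms(1)])
 fix p :: 'a assume p: "norm p <= R"
 have "h * H w' p <= h * (H w p + e)" using assms p by (intro mult_left_mono) auto
 then show "p \<bullet> d - h * H w p <= ell H R w' d h + h * e"
  using ell_ge[OF assms(2) p, of d w'] by (simp add: algebra_simps)
qed

text \<open>A momentum is optimal in the Legendre transform at each of its own subgradients, so the
  truncated supremum cannot exceed the value at p.\<close>

lemma ell_subgradient:
 assumes v: "\<And>q. H w p + v \<bullet> (q - p) <= H w q" and R: "0 <= R" and h: "0 <= h"
 shows "ell H R w (h *\<^sub>R v) h <= h * (p \<bullet> v - H w p)"
proof (rule ell_le[OF R])
 fix q :: 'a
 have "h * (q \<bullet> v - H w q) <= h * (p \<bullet> v - H w p)"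
  using v[of q] h by (intro mult_left_mono) (auto simp: inner_diff_right inner_commute)
 then show "q \<bullet> h *\<^sub>R v - h * H w q <= h * (p \<bullet> v - H w p)" by (simp add: algebra_simps)
qed

text \<open>One unit step from p in the direction of v raises \<open>H\<close> by at least |v|, and
  \<open>H\<close> is nonnegative.\<close>

lemma subgradient_bound:
 assumes v: "\<And>q. H w p + v \<bullet> (q - p) <= H w q" and M: "\<And>q. norm q <= norm p + 1 ==> H w q <= M"
 shows "norm v <= M"
proof (cases "v = 0")
 case True
 then show ?thesis using M[of 0] by (simp add: zero)
next
 case False
 let ?q = "p + v /\<^sub>R norm v"
 have "norm ?q <= norm p + 1" using norm_triangle_ineq[of p "v /\<^sub>R norm v"] False by simp
 then have "H w ?q <= M" by (rule M)
 moreover have "v \<bullet> (?q - p) = norm v" using False by (simp add: dot_square_norm power2_eq_square)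
 ultimately show ?thesis using v[of ?q] nonneg[of w p] by linarith
qed

lemma trav_cost_nonneg: "trav U H R T x y c ==> 0 <= R ==> 0 <= c"
proof (induction rule: trav.induct)
 case (trav_step T x y c h z l)
 have "ell H R y (z - y) h <= l" by (rule trav_step(4)) simp
 then have "0 <= l" using ell_nonneg[of R h y "z - y"] trav_step by linarith
 then show ?case using trav_step by auto
qed simp

lemma trav_jump: "closed_segment y z \<subseteq> U ==> 0 <= R ==> trav U H R 0 y z (R * norm (z - y))"
 by (rule trav_single) (auto intro: ell_le_norm)

lemma trav_weaken:
 assumes t: "trav U H R T x y c" and R: "0 <= R" and "T <= T'" "c <= c'"
 shows "trav U H R T' x y c'"
proof -
 have "trav U H R (T + (T' - T)) x y (c + (c' - c))"
 proof (rule trav_step[OF t])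
  show "ell H R w (y - y) (T' - T) <= c' - c" for w
   using ell_le_norm[of R "T' - T" w 0] assms by simp
 qed (use assms trav_in[OF t] in auto)
 then show ?thesis by simp
qed

lemma trav_wait: "x \<in> U ==> 0 <= R ==> 0 <= T ==> trav U H R T x x 0"
 using trav_weaken[OF trav_nil] by auto

text \<open>Momenta up to r have \<open>H\<close> at most M, so length is charged at slope r up to M
  per unit of time. This confines almost optimal travels and controls the loss when an initial piece
  is dropped.\<close>

lemma trav_lower_bound:
 assumes t: "trav U H R T x y c" and R: "0 <= r" "r <= R" and M: "\<And>w p. norm p <= r ==> H w p <= M"
 shows "r * norm (y - x) - T * M <= c"
 using t
proof (induction rule: trav.induct)
 case (trav_step T x y c h z l)
 have "r * norm (z - y) - h * M <= l"
  using trav_step(4)[of y] ell_lower[OF R trav_step(2), of y M "z - y"] M by auto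
 moreover have "r * norm (z - x) <= r * norm (z - y) + r * norm (y - x)"
  unfolding distrib_left[symmetric] using R norm_triangle_ineq[of "z - y" "y - x"]
  by (intro mult_left_mono) auto
 ultimately show ?case using trav_step.IH by (simp add: algebra_simps)
qed simp

text \<open>The parameter is not time, because time stands still during a jump; position, time and
  cost move together along one Lipschitz curve. Each parameter interval is again a travel, and it
  lies in the image of that interval, so travels can be cut and localized at will.\<close>

lemma trav_curve:
 assumes "trav U H R T x y c" and R: "0 <= R"
 shows "\<exists>N f L. 0 <= N \<and> L-lipschitz_on {0..N} f \<and> f (0::real) = (x, 0, 0) \<and> f N = (y, T, c) \<and>
  fst ` f ` {0..N} \<subseteq> U \<and> (\<forall>a b. 0 <= a --> a <= b --> b <= N --> trav (fst ` f ` {a..b}) H R (fst (snd (f b)) - fst (snd (f a)))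
    (fst (f a)) (fst (f b)) (snd (snd (f b)) - snd (snd (f a))))"
 using assms(1)
proof (induction rule: trav.induct)
 case (trav_nil x)
 show ?case
  by (rule exI[of _ 0], rule exI[of _ "\<lambda>_. (x, 0, 0)"], rule exI[of _ 0])
   (use trav_nil in \<open>auto simp: lipschitz_on_def image_constant_conv intro: trav.trav_nil\<close>)
next
 case (trav_step T x y c h z l)
 obtain N :: real and f L where N: "0 <= N" "L-lipschitz_on {0..N} f" "f 0 = (x, 0, 0)" "f N = (y, T, c)" "fst ` f ` {0..N} \<subseteq> U"
  and tr0: "\<forall>a b. 0 <= a --> a <= b --> b <= N --> trav (fst ` f ` {a..b}) H R (fst (snd (f b)) - fst (snd (f a)))
    (fst (f a)) (fst (f b)) (snd (snd (f b)) - snd (snd (f a)))"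
  using trav_step.IH by (elim exE conjE) (rule that, assumption+)
 note tr = tr0[rule_format]
 define G where "G s = (y, T, c) + (s - N) *\<^sub>R (z - y, h, l)" for s
 define g where "g s = (if s <= N then f s else G s)" for s
 have GN: "G N = f N" using N by (simp add: G_def)
 have lipG: "(norm (z - y, h, l))-lipschitz_on {N..N + 1} G"
 proof (rule lipschitz_onI)
  fix s t
  have "G s - G t = (s - t) *\<^sub>R (z - y, h, l)" by (simp add: G_def algebra_simps)
  then have "norm (G s - G t) = \<bar>s - t\<bar> * norm (z - y, h, l)" by (simp only: norm_scaleR)
  then show "dist (G s) (G t) <= norm (z - y, h, l) * dist s t"
   by (simp only: dist_norm dist_real_def mult.commute) simp
 qed simp
 have lip: "(max L (norm (z - y, h, l)))-lipschitz_on {0..N + 1} g"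
  unfolding g_def by (rule lipschitz_on_concat_max[OF N(2) lipG GN[symmetric]])
 have part: "trav (fst ` G ` {a..b}) H R (fst (snd (G b)) - fst (snd (G a))) (fst (G a)) (fst (G b)) (snd (snd (G b)) - snd (snd (G a)))"
  if ab: "N <= a" "a <= b" "b <= N + 1" for a b
 proof -
  have G: "fst (G s) = y + (s - N) *\<^sub>R (z - y)" "fst (snd (G s)) = T + (s - N) * h" "snd (snd (G s)) = c + (s - N) * l" for s
   by (auto simp: G_def)
  have in_seg: "y + (s - N) *\<^sub>R (z - y) \<in> closed_segment y z" if "N <= s" "s <= N + 1" for s
   using that by (auto simp: in_segment algebra_simps intro!: exI[of _ "s - N"])
  have sub: "closed_segment (fst (G a)) (fst (G b)) \<subseteq> closed_segment y z"
   unfolding G using in_seg ab by (intro closed_segment_subset) auto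
  have d: "fst (G b) - fst (G a) = (b - a) *\<^sub>R (z - y)" "fst (snd (G b)) - fst (snd (G a)) = (b - a) * h"
    "snd (snd (G b)) - snd (snd (G a)) = (b - a) * l"
   unfolding G by (simp_all add: algebra_simps)
  show ?thesis
   unfolding d(2,3)
  proof (rule trav_single)
   show "0 <= (b - a) * h" using ab trav_step by auto
   show "closed_segment (fst (G a)) (fst (G b)) \<subseteq> fst ` G ` {a..b}"
   proof
    fix w assume "w \<in> closed_segment (fst (G a)) (fst (G b))"
    then obtain u where u: "0 <= u" "u <= 1" "w = (1 - u) *\<^sub>R fst (G a) + u *\<^sub>R fst (G b)"
     by (auto simp: in_segment)
    have "fst (G (a + u * (b - a))) = w" unfolding u(3) G by (simp add: algebra_simps)
    moreover have "a + u * (b - a) \<in> {a..b}" using u ab mult_left_le_one_le[of "b - a" u] by auto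
    ultimately show "w \<in> fst ` G ` {a..b}" by blast
   qed
   fix w assume "w \<in> closed_segment (fst (G a)) (fst (G b))"
   then have "ell H R w (z - y) h <= l" using sub trav_step(4) by blast
   then have "(b - a) * ell H R w (z - y) h <= (b - a) * l" using ab by (intro mult_left_mono) auto
   then show "ell H R w (fst (G b) - fst (G a)) ((b - a) * h) <= (b - a) * l"
    unfolding d(1) using ell_scale[OF R trav_step(2), of "b - a" w "z - y"] ab by linarith
  qed
 qed
 have gG: "g s = G s" if "N <= s" for s using that GN by (auto simp: g_def)
 have gf: "g s = f s" if "s <= N" for s using that by (simp add: g_def)
 have "trav (fst ` g ` {a..b}) H R (fst (snd (g b)) - fst (snd (g a))) (fst (g a)) (fst (g b)) (snd (snd (g b)) - snd (snd (g a)))"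
  if ab: "0 <= a" "a <= b" "b <= N + 1" for a b
 proof (cases "b <= N")
  case True
  then have "g ` {a..b} = f ` {a..b}" by (intro image_cong) (auto simp: gf)
  then show ?thesis using tr[of a b] ab True by (simp add: gf)
 next
  case b: False
  show ?thesis
  proof (cases "a <= N")
   case True
   have "trav (fst ` f ` {a..N}) H R (fst (snd (G N)) - fst (snd (f a))) (fst (f a)) (fst (G N)) (snd (snd (G N)) - snd (snd (f a)))"
    unfolding GN by (rule tr) (use True ab N(1) in simp_all)
   moreover have "fst ` f ` {a..N} \<subseteq> fst ` g ` {a..b}" using b by (force simp: image_iff gf)
   ultimately have 1: "trav (fst ` g ` {a..b}) H R (fst (snd (G N)) - fst (snd (f a))) (fst (f a)) (fst (G N)) (snd (snd (G N)) - snd (snd (f a)))"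
    by (rule trav_mono_set)
   have "trav (fst ` G ` {N..b}) H R (fst (snd (G b)) - fst (snd (G N))) (fst (G N)) (fst (G b)) (snd (snd (G b)) - snd (snd (G N)))"
    by (rule part) (use ab b in simp_all)
   moreover have "fst ` G ` {N..b} \<subseteq> fst ` g ` {a..b}"
   proof -
    have "G ` {N..b} = g ` {N..b}" by (rule image_cong) (auto simp: gG)
    then show ?thesis using True by (simp only:) (intro image_mono, auto)
   qed
   ultimately have 2: "trav (fst ` g ` {a..b}) H R (fst (snd (G b)) - fst (snd (G N))) (fst (G N)) (fst (G b)) (snd (snd (G b)) - snd (snd (G N)))"
    by (rule trav_mono_set)
   have e: "(u - v) + (w - u) = w - v" for u v w :: real by simp
   from trav_trans[OF 2 1]
   have "trav (fst ` g ` {a..b}) H R (fst (snd (G b)) - fst (snd (f a))) (fst (f a)) (fst (G b)) (snd (snd (G b)) - snd (snd (f a)))"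
    by (simp only: e)
   then show ?thesis using True b by (simp add: gf gG)
  next
   case False
   then have "g ` {a..b} = G ` {a..b}" by (intro image_cong) (auto simp: gG)
   then show ?thesis using part[of a b] ab b False by (simp add: gG)
  qed
 qed
 note all = this
 have D0: "g 0 = (x, 0, 0)" using N by (simp add: g_def)
 have DN: "g (N + 1) = (z, T + h, c + l)" by (simp add: g_def G_def)
 have N1: "0 <= N + 1" using N(1) by simp
 have sub: "fst ` g ` {0..N + 1} \<subseteq> U"
 proof
  fix w assume "w \<in> fst ` g ` {0..N + 1}"
  then obtain s where w: "w = fst (g s)" and s: "s \<in> {0..N + 1}" by blast
  show "w \<in> U"
  proof (cases "s <= N")
   case True
   then have "w \<in> fst ` f ` {0..N}" unfolding w using s by (simp add: gf)
   then show ?thesis using N(5) by blast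
  next
   case False
   then have "fst (g s) \<in> closed_segment y z"
    using s by (auto simp: gG G_def in_segment algebra_simps intro!: exI[of _ "s - N"])
   then show ?thesis using trav_step(3) w by blast
  qed
 qed
 show ?case
  by (rule exI[of _ "N + 1"], rule exI[of _ g], rule exI[of _ "max L (norm (z - y, h, l))"], intro conjI allI impI)
   (rule N1 lip D0 DN sub | (rule all; assumption))+
qed

lemma trav_curve_unit:
 assumes "trav U H R T x y c" and R: "0 <= R"
 obtains X :: "real => 'a" and u k :: "real => real" and L where
  "L-lipschitz_on {0..1} (\<lambda>s. (X s, u s, k s))"
  "X 0 = x" "u 0 = 0" "k 0 = 0" "X 1 = y" "u 1 = T" "k 1 = c"
  "\<And>a b. 0 <= a ==> a <= b ==> b <= 1 ==> trav (X ` {a..b}) H R (u b - u a) (X a) (X b) (k b - k a)"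
  "X ` {0..1} \<subseteq> U"
proof -
 obtain N :: real and G L where N: "0 <= N" "L-lipschitz_on {0..N} G" "G 0 = (x, 0, 0)" "G N = (y, T, c)" "fst ` G ` {0..N} \<subseteq> U"
  and tr0: "\<forall>a b. 0 <= a --> a <= b --> b <= N --> trav (fst ` G ` {a..b}) H R (fst (snd (G b)) - fst (snd (G a)))
    (fst (G a)) (fst (G b)) (snd (snd (G b)) - snd (snd (G a)))"
  using trav_curve[OF assms] by (elim exE conjE) (rule that, assumption+)
 note tr = tr0[rule_format]
 have sc: "N * s \<in> {0..N}" if "s \<in> {0..1}" for s
  using that N(1) mult_left_mono[of s 1 N] by auto
 have lip: "(L * N)-lipschitz_on {0..1} (\<lambda>s. G (N * s))"
 proof (rule lipschitz_onI)
  fix s t :: real assume "s \<in> {0..1}" "t \<in> {0..1}"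
  then have "dist (G (N * s)) (G (N * t)) <= L * dist (N * s) (N * t)"
   using lipschitz_onD[OF N(2)] sc by blast
  then show "dist (G (N * s)) (G (N * t)) <= L * N * dist s t"
   using N(1) by (simp add: dist_real_def abs_mult flip: right_diff_distrib)
 qed (use lipschitz_on_nonneg[OF N(2)] N(1) in simp)
 show thesis
 proof (rule that[of "L * N" "\<lambda>s. fst (G (N * s))" "\<lambda>s. fst (snd (G (N * s)))" "\<lambda>s. snd (snd (G (N * s)))"])
  fix a b :: real assume "0 <= a" "a <= b" "b <= 1"
  then have "0 <= N * a" "N * a <= N * b" "N * b <= N"
   using N(1) mult_left_mono[of b 1 N] by (auto intro: mult_left_mono)
  then have "trav (fst ` G ` {N * a..N * b}) H R (fst (snd (G (N * b))) - fst (snd (G (N * a)))) (fst (G (N * a)))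
    (fst (G (N * b))) (snd (snd (G (N * b))) - snd (snd (G (N * a))))" by (rule tr)
  moreover have "fst ` G ` {N * a..N * b} \<subseteq> (\<lambda>s. fst (G (N * s))) ` {a..b}"
  proof
   fix w assume "w \<in> fst ` G ` {N * a..N * b}"
   then obtain r where w: "w = fst (G r)" and r: "r \<in> {N * a..N * b}" by blast
   have "\<exists>s\<in>{a..b}. r = N * s"
   proof (cases "N = 0")
    case True
    then show ?thesis using r \<open>a <= b\<close> by auto
   next
    case False
    then show ?thesis using r N(1) by (intro bexI[of _ "r / N"]) (auto simp: field_simps)
   qed
   then show "w \<in> (\<lambda>s. fst (G (N * s))) ` {a..b}" unfolding w by blast
  qed
  ultimately show "trav ((\<lambda>s. fst (G (N * s))) ` {a..b}) H R (fst (snd (G (N * b))) - fst (snd (G (N * a)))) (fst (G (N * a)))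
    (fst (G (N * b))) (snd (snd (G (N * b))) - snd (snd (G (N * a))))" by (rule trav_mono_set)
 next
  show "(\<lambda>s. fst (G (N * s))) ` {0..1} \<subseteq> U" using N(5) sc by blast
 qed (simp_all add: lip N(3,4))
qed

text \<open>Elapsed time is a continuous component of the curve and takes the value S by the
  intermediate value theorem; the travel is cut there.\<close>

lemma trav_split:
 assumes t: "trav U H R (S + T) x z c" and R: "0 <= R" and ST: "0 <= S" "0 <= T"
 obtains y c1 c2 where "trav U H R S x y c1" "trav U H R T y z c2" "c = c1 + c2"
proof -
 obtain X :: "real => 'a" and u k L where c: "L-lipschitz_on {0..1} (\<lambda>s. (X s, u s, k s))"
  "X 0 = x" "u 0 = 0" "k 0 = 0" "X 1 = z" "u 1 = S + T" "k 1 = c"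
  "\<And>a b. 0 <= a ==> a <= b ==> b <= 1 ==> trav (X ` {a..b}) H R (u b - u a) (X a) (X b) (k b - k a)"
  "X ` {0..1} \<subseteq> U"
  by (rule trav_curve_unit[OF t R], rule that) assumption+
 have tU: "trav U H R (u b - u a) (X a) (X b) (k b - k a)" if "0 <= a" "a <= b" "b <= 1" for a b
  by (rule trav_mono_set[OF c(8)[OF that]]) (use c(9) that in fastforce)
 have "continuous_on {0..1} (\<lambda>s. fst (snd (X s, u s, k s)))"
  by (intro continuous_on_fst continuous_on_snd lipschitz_on_continuous_on[OF c(1)])
 then have "continuous_on {0..1} u" by simp
 then obtain s where s: "0 <= s" "s <= 1" "u s = S"
  using IVT'[of u 0 S 1] c(3,6) ST by auto
 show thesis
 proof (rule that)
  show "trav U H R S x (X s) (k s)" using tU[OF order_refl s(1,2)] by (simp only: c(2-7) s(3) diff_0_right)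
  show "trav U H R T (X s) z (c - k s)"
   using tU[OF s(1,2) order_refl] by (simp only: c(2-7) s(3) add_diff_cancel_left')
  show "c = k s + (c - k s)" by simp
 qed
qed

end

section \<open>Viscosity solutions and travel costs\<close>

text \<open>Serves to choose one positive parameter meeting several smallness requirements at
  once.\<close>

lemma small_scale:
 fixes ps :: "(real \<times> real) list"
 assumes "\<forall>(a, b)\<in>set ps. 0 < b"
 shows "\<exists>d>0. \<forall>(a, b)\<in>set ps. a * d <= b"
 using assms
proof (induction ps)
 case (Cons q ps)
 then obtain d where d: "0 < d" "\<forall>(a, b)\<in>set ps. a * d <= b" by auto
 define e where "e = min d (snd q / (\<bar>fst q\<bar> + 1))"
 have e: "0 < e" "e <= d" "e * (\<bar>fst q\<bar> + 1) <= snd q"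
  using d Cons.prems by (auto simp: e_def simp flip: pos_le_divide_eq)
 have "e * fst q <= e * (\<bar>fst q\<bar> + 1)" using e(1) by (intro mult_left_mono) auto
 then have "fst q * e <= snd q" unfolding mult.commute[of "fst q"] using e(3) by (rule order_trans)
 moreover have "a * e <= b" if "(a, b) \<in> set ps" for a b
 proof (cases "0 <= a")
  case True
  then show ?thesis using d(2) that e(2) mult_left_mono[OF e(2) True] by force
 next
  case False
  then have "a * e <= 0" using e(1) by (simp add: mult_nonpos_nonneg)
  then show ?thesis using Cons.prems that by force
 qed
 ultimately show ?case using e by (intro exI[of _ e]) (auto simp: case_prod_beta)
qed (auto intro: exI[of _ 1])

abbreviation HJ_sub :: "('a::euclidean_space => 'a => real) => 'a set => ('a \<times> real => real) => bool" where
 "HJ_sub H U z \<equiv> visc_subsolution (\<lambda>(x, t) (p, s). s + H x p) (U \<times> {0<..}) z"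

abbreviation HJ_super :: "('a::euclidean_space => 'a => real) => 'a set => ('a \<times> real => real) => bool" where
 "HJ_super H U z \<equiv> visc_supersolution (\<lambda>(x, t) (p, s). s + H x p) (U \<times> {0<..}) z"

lemma C1_quadratic:
 fixes q0 :: "'a::euclidean_space"
 shows "C1_fun (\<lambda>q. a * (norm (q - q0))^2) (\<lambda>q. (2 * a) *\<^sub>R (q - q0))"
 unfolding C1_fun_def
proof (intro conjI allI)
 fix q :: 'a
 have "((\<lambda>q. a * ((q - q0) \<bullet> (q - q0))) has_derivative (\<lambda>h. h \<bullet> ((2 * a) *\<^sub>R (q - q0)))) (at q)"
  by (auto intro!: derivative_eq_intros simp: inner_commute algebra_simps)
 then show "GDERIV (\<lambda>q. a * (norm (q - q0))^2) q :> (2 * a) *\<^sub>R (q - q0)"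
  by (simp add: gderiv_def power2_norm_eq_inner)
qed (intro continuous_intros)

text \<open>The quadratic penalty beats the linear lower bound, so minimization reduces to a large
  compact ball. The minimizers are the contact points of inf-convolutions and, after a change of
  sign, of sup-convolutions.\<close>

lemma penalized_minimum:
 fixes q0 :: "'b::euclidean_space"
 assumes S: "closed S" "S \<noteq> {}" and f: "continuous_on S f" and d: "0 < a"
  and lb: "\<And>q. q \<in> S ==> - A - B * norm (q - q0) <= f q"
 shows "\<exists>m\<in>S. \<forall>q\<in>S. f m + (norm (m - q0))^2 / (2 * a) <= f q + (norm (q - q0))^2 / (2 * a)"
proof -
 let ?g = "\<lambda>q. f q + (norm (q - q0))^2 / (2 * a)"
 obtain q1 where q1: "q1 \<in> S" using S by blast
 define C where "C = \<bar>B\<bar> + 1 + \<bar>A\<bar> + \<bar>?g q1\<bar>"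
 define c where "c = max (2 * a * C + 1) (norm (q1 - q0))"
 let ?K = "S \<inter> cball q0 c"
 have "compact ?K" using S(1) by (rule closed_Int_compact) simp
 moreover have q1K: "q1 \<in> ?K" using q1 by (simp add: c_def dist_norm norm_minus_commute)
 moreover have "continuous_on ?K ?g"
  by (intro continuous_intros continuous_on_subset[OF f]) (use d in auto)
 ultimately obtain m where m: "m \<in> ?K" "\<forall>q\<in>?K. ?g m <= ?g q"
  using continuous_attains_inf[of ?K ?g] by blast
 have "?g m <= ?g q" if q: "q \<in> S" for q
 proof (cases "q \<in> ?K")
  case False
  let ?r = "norm (q - q0)"
  have r: "2 * a * C + 1 <= ?r" using False q by (auto simp: c_def dist_norm norm_minus_commute)
  have C1: "1 <= C" by (simp add: C_def)
  have r1: "1 <= ?r" using r d C1 mult_pos_pos[of "2 * a" C] by linarith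
  have "2 * a * C * ?r <= ?r * ?r" using r r1 by (intro mult_right_mono) auto
  then have "C * ?r <= ?r\<^sup>2 / (2 * a)" using d by (simp add: field_simps power2_eq_square)
  moreover have "C * ?r >= \<bar>B\<bar> * ?r + (1 + \<bar>A\<bar> + \<bar>?g q1\<bar>) * 1"
   unfolding C_def using r1 mult_left_mono[of 1 ?r "1 + \<bar>A\<bar> + \<bar>?g q1\<bar>"] by (simp add: algebra_simps)
  moreover have "B * ?r <= \<bar>B\<bar> * ?r" by (intro mult_right_mono) auto
  moreover have "- A - B * ?r <= f q" by (rule lb[OF q])
  moreover have "A <= \<bar>A\<bar>" "?g q1 <= \<bar>?g q1\<bar>" by (rule abs_ge_self)+
  ultimately have "?g q1 <= ?g q" unfolding mult_1_right by linarith
  then show ?thesis using bspec[OF m(2) q1K] by linarith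
 qed (use m in blast)
 then show ?thesis using m by blast
qed

text \<open>Bounds the distance d between a contact point and its base point: the penalty d^2 / (2
  a) can be at most the affine growth C + B d, which forces d to be small with a.\<close>

lemma small_root:
 fixes d :: real
 assumes le: "d\<^sup>2 <= 2 * a * (C + B * d)" and "0 < s" "0 <= d" "0 <= C" "0 <= B"
  and a: "0 <= a" "2 * a * (C / s + B) <= s"
 shows "d <= s"
proof (rule ccontr)
 assume "\<not> d <= s"
 then have d: "s < d" by simp
 have "C <= C / s * d" using d assms by (simp add: field_simps mult_left_mono)
 then have "C + B * d <= (C / s + B) * d" by (simp add: algebra_simps)
 then have "2 * a * (C + B * d) <= 2 * a * ((C / s + B) * d)" using a by (intro mult_left_mono) auto
 then have "d * d <= (2 * a * (C / s + B)) * d" using le by (simp add: power2_eq_square algebra_simps)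
 also have "\<dots> <= s * d" using a assms by (intro mult_right_mono) auto
 finally show False using d assms by auto
qed

section \<open>Sup- and inf-convolutions of solutions\<close>

lemma norm_Pair_sq: "(norm (a, b))^2 = (norm a)^2 + (norm b)^2"
 by (simp add: norm_Pair)

text \<open>In space only affine growth is demanded, not a Lipschitz bound, because correctors are a
  priori merely continuous and periodic. \<open>K1\<close> bounds the decrease rate in time, and
  \<open>R\<close> is a norm from which \<open>H\<close> exceeds \<open>K1\<close>.\<close>

locale evolution = hamiltonian H
 for H :: "'a::euclidean_space => 'a => real" +
 fixes U :: "'a set" and z :: "'a \<times> real => real" and A B K K1 R :: real
 assumes opn: "open U" and nonempty: "U \<noteq> {}"
  and cont: "continuous_on (closure U \<times> {0..}) z"
  and growth: "\<And>x y t. x \<in> closure U ==> y \<in> closure U ==> 0 <= t ==> \<bar>z (x, t) - z (y, t)\<bar> <= A + B * norm (x - y)"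
  and time_lip: "\<And>x s t. x \<in> closure U ==> 0 <= s ==> 0 <= t ==> \<bar>z (x, t) - z (x, s)\<bar> <= K * \<bar>t - s\<bar>"
  and time_low: "\<And>x s h. x \<in> closure U ==> 0 <= s ==> 0 <= h ==> z (x, s) - K1 * h <= z (x, s + h)"
  and parms_nonneg: "0 <= A" "0 <= B" "0 <= K" "0 <= K1"
  and thr: "\<And>y p. R <= norm p ==> K1 < H y p"
begin

abbreviation "S \<equiv> closure U \<times> {0::real..}"

lemma R_pos: "0 < R"
 using thr[of 0 undefined] parms_nonneg zero by force

lemma two_point:
 assumes "(x, s) \<in> S" "(y, t) \<in> S"
 shows "\<bar>z (x, s) - z (y, t)\<bar> <= A + B * norm (x - y) + K * \<bar>s - t\<bar>"
 using growth[of x y s] time_lip[of y t s] assms by auto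

lemma closed_S: "closed S"
 by (intro closed_Times) auto

lemma S_ne: "S \<noteq> {}"
proof -
 obtain u where "u \<in> U" using nonempty by blast
 then show ?thesis using closure_subset by blast
qed

lemma lower_growth: "\<exists>A' B'. \<forall>q\<in>S. - A' - B' * norm (q - q0) <= z q \<and> z q <= A' + B' * norm (q - q0)"
proof -
 obtain u where u: "u \<in> closure U" using nonempty closure_subset by blast
 obtain x0 t0 where q0: "q0 = (x0, t0)" by (cases q0)
 let ?A = "\<bar>z (u, 0)\<bar> + A + B * norm (x0 - u) + K * \<bar>t0\<bar>"
 have "\<bar>z q\<bar> <= ?A + (B + K) * norm (q - q0)" if q: "q \<in> S" for q
 proof -
  obtain x t where xt: "q = (x, t)" by (cases q)
  have "\<bar>z (x, t) - z (u, 0)\<bar> <= A + B * norm (x - u) + K * \<bar>t - 0\<bar>"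
   using two_point[of x t u 0] q u xt by auto
  moreover have "B * norm (x - u) <= B * norm (q - q0) + B * norm (x0 - u)"
  proof -
   have "norm (x - u) <= norm (x - x0) + norm (x0 - u)" using norm_triangle_ineq[of "x - x0" "x0 - u"] by simp
   moreover have "norm (x - x0) <= norm (q - q0)" using norm_fst_le[of "x - x0" "t - t0"] by (simp add: xt q0)
   ultimately have "norm (x - u) <= norm (q - q0) + norm (x0 - u)" by simp
   then show ?thesis using parms_nonneg mult_left_mono[of "norm (x - u)" "norm (q - q0) + norm (x0 - u)" B] by (simp add: algebra_simps)
  qed
  moreover have "K * \<bar>t - 0\<bar> <= K * norm (q - q0) + K * \<bar>t0\<bar>"
  proof -
   have "\<bar>t - t0\<bar> <= norm (q - q0)" using norm_snd_le[of "t - t0" "x - x0"] by (simp add: xt q0)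
   then show ?thesis using parms_nonneg mult_left_mono[of "\<bar>t - 0\<bar>" "norm (q - q0) + \<bar>t0\<bar>" K] by (simp add: algebra_simps)
  qed
  ultimately show ?thesis by (simp add: xt algebra_simps)
 qed
 note bound = this
 show ?thesis
 proof (rule exI[of _ ?A], rule exI[of _ "B + K"], rule ballI)
  fix q assume "q \<in> S"
  from bound[OF this]
  show "- ?A - (B + K) * norm (q - q0) <= z q \<and> z q <= ?A + (B + K) * norm (q - q0)"
   by linarith
 qed
qed

lemma minimizer:
 assumes "0 < d"
 shows "\<exists>m\<in>S. \<forall>q\<in>S. z m + (norm (m - q0))^2 / (2 * d) <= z q + (norm (q - q0))^2 / (2 * d)"
proof -
 obtain A' B' where ab: "\<And>q. q \<in> S ==> - A' - B' * norm (q - q0) <= z q" using lower_growth[of q0] by blast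
 show ?thesis by (rule penalized_minimum[OF closed_S S_ne cont assms ab])
qed

lemma maximizer:
 assumes "0 < d"
 shows "\<exists>m\<in>S. \<forall>q\<in>S. z q - (norm (q - q0))^2 / (2 * d) <= z m - (norm (m - q0))^2 / (2 * d)"
proof -
 obtain A' B' where ab: "\<And>q. q \<in> S ==> z q <= A' + B' * norm (q - q0)" using lower_growth[of q0] by blast
 have "\<exists>m\<in>S. \<forall>q\<in>S. - z m + (norm (m - q0))^2 / (2 * d) <= - z q + (norm (q - q0))^2 / (2 * d)"
  by (rule penalized_minimum[OF closed_S S_ne _ assms, of _ A' B'])
   (use ab cont in \<open>auto intro: continuous_on_minus simp: algebra_simps\<close>)
 then show ?thesis by (auto simp: algebra_simps)
qed

lemma penalty_time:
 assumes "0 < a" "(s - t)^2 / (2 * a) <= K * \<bar>s - t\<bar>" shows "\<bar>s - t\<bar> <= 2 * K * a"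
proof -
 have "\<bar>s - t\<bar> * \<bar>s - t\<bar> <= 2 * K * a * \<bar>s - t\<bar>"
  using assms by (simp add: field_simps power2_eq_square)
 then show ?thesis using parms_nonneg assms(1) mult_right_le_imp_le[of "\<bar>s - t\<bar>" "\<bar>s - t\<bar>" "2 * K * a"]
  by (cases "s = t") auto
qed

text \<open>Comparing the contact point with the same place at the base time isolates the time
  penalty, which the Lipschitz bound in time then limits.\<close>

lemma max_time:
 assumes d: "0 < a" and m: "(Y, s) \<in> S" and t: "0 <= t"
  and mx: "\<And>q. q \<in> S ==> z q - (norm (q - (x, t)))^2 / (2 * a) <= z (Y, s) - (norm ((Y, s) - (x, t)))^2 / (2 * a)"
 shows "\<bar>s - t\<bar> <= 2 * K * a"
proof -
 have "z (Y, t) - (norm (Y - x))^2 / (2 * a) <= z (Y, s) - ((norm (Y - x))^2 + (s - t)^2) / (2 * a)"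
  using mx[of "(Y, t)"] m t by (simp add: norm_Pair_sq)
 then have "(s - t)^2 / (2 * a) <= z (Y, s) - z (Y, t)" by (simp add: add_divide_distrib)
 also have "\<dots> <= K * \<bar>s - t\<bar>" using time_lip[of Y t s] m t by auto
 finally show ?thesis by (rule penalty_time[OF d])
qed

lemma min_time:
 assumes d: "0 < a" and m: "(Y, s) \<in> S" and t: "0 <= t"
  and mx: "\<And>q. q \<in> S ==> z (Y, s) + (norm ((Y, s) - (x, t)))^2 / (2 * a) <= z q + (norm (q - (x, t)))^2 / (2 * a)"
 shows "\<bar>s - t\<bar> <= 2 * K * a"
proof -
 have "z (Y, s) + ((norm (Y - x))^2 + (s - t)^2) / (2 * a) <= z (Y, t) + (norm (Y - x))^2 / (2 * a)"
  using mx[of "(Y, t)"] m t by (simp add: norm_Pair_sq)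
 then have "(s - t)^2 / (2 * a) <= z (Y, t) - z (Y, s)" by (simp add: add_divide_distrib)
 also have "\<dots> <= K * \<bar>s - t\<bar>" using time_lip[of Y t s] m t by auto
 finally show ?thesis by (rule penalty_time[OF d])
qed

lemma limit_small_quadratic:
 fixes a b c :: real
 assumes "0 < e" "\<And>h. 0 < h ==> h < e ==> a <= b + c * h" shows "a <= b"
proof (rule tendsto_lowerbound)
 show "((\<lambda>h. b + c * h) \<longlongrightarrow> b) (at_right 0)" by (auto intro!: tendsto_eq_intros)
 show "\<forall>\<^sub>F h in at_right 0. a <= b + c * h"
  using assms by (auto simp: eventually_at_right_field)
qed auto

text \<open>The penalty is the test function at the contact point. Comparison with slightly later
  times shows that its time slope is at least \<open>- K1\<close>; the equation then leaves no room
  for a momentum longer than \<open>R\<close>. This takes the place of a Lipschitz bound in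
  space.\<close>

lemma max_test:
 assumes sub: "HJ_sub H U z"
  and d: "0 < a" and Y: "Y \<in> U" "0 < s"
  and mx: "\<And>q. q \<in> S ==> z q - (norm (q - (x, t)))^2 / (2 * a) <= z (Y, s) - (norm ((Y, s) - (x, t)))^2 / (2 * a)"
 shows "(s - t) / a + H Y ((Y - x) /\<^sub>R a) <= 0" and "norm ((Y - x) /\<^sub>R a) <= R"
proof -
 let ?q = "(x, t)"
 have YS: "(Y, s) \<in> S" using Y closure_subset by auto
 have C1: "C1_fun (\<lambda>q. (1 / (2 * a)) * (norm (q - ?q))^2) (\<lambda>q. (2 * (1 / (2 * a))) *\<^sub>R (q - ?q))"
  by (rule C1_quadratic)
 have ev: "\<forall>\<^sub>F q in at (Y, s) within (U \<times> {0<..}). z q - (1 / (2 * a)) * (norm (q - ?q))^2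
    <= z (Y, s) - (1 / (2 * a)) * (norm ((Y, s) - ?q))^2"
  unfolding eventually_at
  by (intro exI[of _ 1]) (use mx closure_subset[of U] in auto)
 have "(Y, s) \<in> U \<times> {0<..}" using Y by simp
 from sub[unfolded visc_subsolution_def, rule_format, OF this C1 ev]
 have "(case (Y, s) of (x, t) => \<lambda>(p, s). s + H x p) ((2 * (1 / (2 * a))) *\<^sub>R ((Y, s) - ?q)) <= 0" .
 moreover have "2 * (1 / (2 * a)) = inverse a" using d by (simp add: field_simps)
 ultimately show eq: "(s - t) / a + H Y ((Y - x) /\<^sub>R a) <= 0"
  unfolding divide_inverse_commute[of "s - t"]
  by (simp only: diff_Pair scaleR_Pair prod.case real_scaleR_def)
 have "- K1 <= (s - t) / a"
 proof (rule limit_small_quadratic[of 1 _ _ "1 / (2 * a)"])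
  fix h :: real assume h: "0 < h" "h < 1"
  have "z (Y, s + h) - ((norm (Y - x))^2 + (s + h - t)^2) / (2 * a) <= z (Y, s) - ((norm (Y - x))^2 + (s - t)^2) / (2 * a)"
   using YS h mx[of "(Y, s + h)"] by (simp add: norm_Pair_sq)
  moreover have "z (Y, s) - K1 * h <= z (Y, s + h)" using time_low[of Y s h] YS h by auto
  ultimately have "- K1 * h <= ((s + h - t)^2 - (s - t)^2) / (2 * a)" by (simp add: diff_divide_distrib add_divide_distrib)
  also have "(s + h - t)^2 - (s - t)^2 = h * (2 * (s - t) + h)" by (simp add: power2_eq_square algebra_simps)
  also have "h * (2 * (s - t) + h) / (2 * a) = h * ((s - t) / a + 1 / (2 * a) * h)"
   using d by (simp add: field_simps)
  finally have "h * (- K1) <= h * ((s - t) / a + 1 / (2 * a) * h)" by (simp only: mult.commute[of h "- K1"])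
  then show "- K1 <= (s - t) / a + 1 / (2 * a) * h" by (rule mult_left_le_imp_le[OF _ h(1)])
 qed simp
 then show "norm ((Y - x) /\<^sub>R a) <= R" using eq thr[of "(Y - x) /\<^sub>R a" Y] by force
qed

text \<open>Here the equation bounds \<open>H\<close> from below and hence not the momentum. Only
  the time slope is controlled, by comparison with earlier times; \<open>velocity_exists\<close>
  shortens the momentum afterwards.\<close>

lemma min_test:
 assumes sup: "HJ_super H (closure U) z"
  and d: "0 < a" and Y: "Y \<in> closure U" "0 < s"
  and mx: "\<And>q. q \<in> S ==> z (Y, s) + (norm ((Y, s) - (x, t)))^2 / (2 * a) <= z q + (norm (q - (x, t)))^2 / (2 * a)"
 shows "0 <= (t - s) / a + H Y ((x - Y) /\<^sub>R a)" and "- K1 <= (t - s) / a"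
proof -
 let ?q = "(x, t)"
 have YS: "(Y, s) \<in> S" using Y by auto
 have C1: "C1_fun (\<lambda>q. (- 1 / (2 * a)) * (norm (q - ?q))^2) (\<lambda>q. (2 * (- 1 / (2 * a))) *\<^sub>R (q - ?q))"
  by (rule C1_quadratic)
 have ev: "\<forall>\<^sub>F q in at (Y, s) within (closure U \<times> {0<..}). z (Y, s) - (- 1 / (2 * a)) * (norm ((Y, s) - ?q))^2
    <= z q - (- 1 / (2 * a)) * (norm (q - ?q))^2"
  unfolding eventually_at
  by (intro exI[of _ 1]) (use mx in auto)
 have "(Y, s) \<in> closure U \<times> {0<..}" using Y by simp
 from sup[unfolded visc_supersolution_def, rule_format, OF this C1 ev]
 have "0 <= (case (Y, s) of (x, t) => \<lambda>(p, s). s + H x p) ((2 * (- 1 / (2 * a))) *\<^sub>R ((Y, s) - ?q))" .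
 moreover have "2 * (- 1 / (2 * a)) = - inverse a" using d by (simp add: field_simps)
 moreover have "(- inverse a) *\<^sub>R ((Y, s) - ?q) = ((x - Y) /\<^sub>R a, (t - s) / a)"
  unfolding divide_inverse_commute[of "t - s"]
  by (simp only: diff_Pair scaleR_Pair real_scaleR_def scaleR_minus_left scaleR_diff_right
   mult_minus_left right_diff_distrib minus_diff_eq) simp
 ultimately show "0 <= (t - s) / a + H Y ((x - Y) /\<^sub>R a)" by (simp only: prod.case)
 show "- K1 <= (t - s) / a"
 proof (rule limit_small_quadratic[of s _ _ "1 / (2 * a)"])
  fix h :: real assume h: "0 < h" "h < s"
  have "z (Y, s) + ((norm (Y - x))^2 + (s - t)^2) / (2 * a) <= z (Y, s - h) + ((norm (Y - x))^2 + (s - h - t)^2) / (2 * a)"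
   using YS h mx[of "(Y, s - h)"] by (simp add: norm_Pair_sq)
  moreover have "z (Y, s - h) - K1 * h <= z (Y, s)" using time_low[of Y "s - h" h] YS h by auto
  ultimately have "- K1 * h <= ((s - h - t)^2 - (s - t)^2) / (2 * a)" by (simp add: diff_divide_distrib add_divide_distrib)
  also have "(s - h - t)^2 - (s - t)^2 = h * (2 * (t - s) + h)" by (simp add: power2_eq_square algebra_simps)
  also have "h * (2 * (t - s) + h) / (2 * a) = h * ((t - s) / a + 1 / (2 * a) * h)"
   using d by (simp add: field_simps)
  finally have "h * (- K1) <= h * ((t - s) / a + 1 / (2 * a) * h)" by (simp only: mult.commute[of h "- K1"])
  then show "- K1 <= (t - s) / a + 1 / (2 * a) * h" by (rule mult_left_le_imp_le[OF _ h(1)])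
 qed (use Y in simp)
qed

lemma max_near:
 assumes d: "0 < a" "2 * a * ((A + 2 * K\<^sup>2 * a) / b + B) <= b" and b: "0 < b"
  and m: "(Y, s) \<in> S" and x: "x \<in> closure U" "0 <= t"
  and mx: "\<And>q. q \<in> S ==> z q - (norm (q - (x, t)))^2 / (2 * a) <= z (Y, s) - (norm ((Y, s) - (x, t)))^2 / (2 * a)"
 shows "norm (Y - x) <= b"
proof (rule small_root[OF _ b _ _ _ _ d(2)])
 have 1: "\<bar>s - t\<bar> <= 2 * K * a" by (rule max_time[OF d(1) m x(2) mx])
 have "z (x, t) <= z (Y, s) - ((norm (Y - x))^2 + (s - t)^2) / (2 * a)"
  using mx[of "(x, t)"] x by (simp add: norm_Pair_sq)
 then have "(norm (Y - x))^2 / (2 * a) + (s - t)^2 / (2 * a) <= z (Y, s) - z (x, t)" by (simp add: add_divide_distrib)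
 moreover have "0 <= (s - t)^2 / (2 * a)" using d by simp
 ultimately have "(norm (Y - x))^2 / (2 * a) <= z (Y, s) - z (x, t)" by linarith
 also have "\<dots> <= A + B * norm (Y - x) + K * \<bar>s - t\<bar>" using two_point[OF m, of x t] x by auto
 also have "\<dots> <= A + B * norm (Y - x) + K * (2 * K * a)" using 1 parms_nonneg by (simp add: mult_left_mono)
 finally show "(norm (Y - x))^2 <= 2 * a * (A + 2 * K\<^sup>2 * a + B * norm (Y - x))"
  using d by (simp add: field_simps power2_eq_square)
qed (use parms_nonneg d in auto)

text \<open>The sup-convolution satisfies the equation at contact points with momenta bounded by
  \<open>R\<close>. One backward step along the segment therefore costs at most the Lagrangian, up
  to an error quadratic in the step, and subdividing the segment makes the total error
  vanish.\<close>

lemma subsolution_step: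
 assumes sub: "HJ_sub H U z"
  and seg: "closed_segment y y' \<subseteq> U" and h: "0 <= h" and s: "0 < s"
  and l: "\<And>w. w \<in> closed_segment y y' ==> ell H R w (y' - y) h <= l"
 shows "z (y', s + h) <= z (y, s) + l"
proof (rule field_le_epsilon)
 fix e :: real assume e: "0 < e"
 \<comment> \<open>The error consists of \<open>h * e'\<close> from moving the base point of
   \<open>H\<close> to the contact point and of \<open>e'\<close> from replacing the sup-convolution
   by \<open>z\<close> at the start.\<close>
 define e' where "e' = e / (h + 2)"
 have "e' * (h + 2) = e" using h by (simp add: e'_def)
 then have e': "0 < e'" "e' * h + 2 * e' = e" using e h zero_less_mult_pos2[of e' "h + 2"] by (auto simp: algebra_simps)
 have yU: "y \<in> U" "y' \<in> U" using seg by auto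
 obtain r where r: "0 < r" "(\<Union>x\<in>closed_segment y y'. ball x r) \<subseteq> U"
  using compact_subset_open_imp_ball_epsilon_subset[OF compact_segment opn seg] by blast
 obtain d1 where d1: "0 < d1" "\<And>w w' p. norm p <= R ==> dist w w' < d1 ==> \<bar>H w p - H w' p\<bar> < e'"
  using equicontinuous[OF e'(1), of R] by blast
 have "continuous (at (y, s) within S) z"
  using cont yU s closure_subset[of U] by (auto simp: continuous_on_eq_continuous_within)
 then obtain d2 where d2: "0 < d2" "\<And>q. q \<in> S ==> dist q (y, s) < d2 ==> dist (z q) (z (y, s)) < e'"
  unfolding continuous_within_eps_delta using e'(1) by blast
 obtain g where "0 < g" "\<forall>(a, b)\<in>set [(2, r), (2, d1), (4, d2)]. a * g <= b"
   using small_scale[of "[(2, r), (2, d1), (4, d2)]"] r d1 d2 by auto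
 then have g: "0 < g" "g < r" "g < d1" "g < d2 / 2" by auto
 let ?c = "2 * ((A + 2 * K\<^sup>2) / g + B)"
 have c0: "0 <= ?c" using parms_nonneg g by auto
 obtain f where "0 < f" "\<forall>(a, b)\<in>set [(1, 1), (?c, g), (2 * K, s / 2), (2 * K, d2 / 4)]. a * f <= b"
   using small_scale[of "[(1, 1), (?c, g), (2 * K, s / 2), (2 * K, d2 / 4)]"] g s d2 by auto
 then have f: "0 < f" "f <= 1" "?c * f <= g" "2 * K * f < s" "2 * K * f < d2 / 2" using s d2 by auto
 have f1: "2 * f * ((A + 2 * K\<^sup>2 * f) / g + B) <= g"
 proof -
  have "2 * K\<^sup>2 * f <= 2 * K\<^sup>2 * 1" using f by (intro mult_left_mono) auto
  then have "(A + 2 * K\<^sup>2 * f) / g <= (A + 2 * K\<^sup>2) / g" using g by (intro divide_right_mono) auto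
  then have "2 * f * ((A + 2 * K\<^sup>2 * f) / g + B) <= 2 * f * ((A + 2 * K\<^sup>2) / g + B)"
   using f by (intro mult_left_mono) auto
  also have "\<dots> <= g" using f(3) by (simp only: ac_simps)
  finally show ?thesis .
 qed
 note Kf = f(4,5)
 have "\<forall>q0. \<exists>m. m \<in> S \<and> (\<forall>q\<in>S. z q - (norm (q - q0))^2 / (2 * f) <= z m - (norm (m - q0))^2 / (2 * f))"
  using maximizer[OF f(1)] by blast
 then obtain m where m: "\<And>q0. m q0 \<in> S"
   "\<And>q0 q. q \<in> S ==> z q - (norm (q - q0))^2 / (2 * f) <= z (m q0) - (norm (m q0 - q0))^2 / (2 * f)"
  using choice[of "\<lambda>q0 m. m \<in> S \<and> (\<forall>q\<in>S. z q - (norm (q - q0))^2 / (2 * f) <= z m - (norm (m - q0))^2 / (2 * f))"]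
  by blast
 define zs where "zs q0 = z (m q0) - (norm (m q0 - q0))^2 / (2 * f)" for q0
 let ?d = "y' - y"
 \<comment> \<open>The old contact point (Y, u) is kept as a competitor at the shifted base point.
   Expanding its penalty gives the pairing with momentum and time slope, plus a remainder quadratic
   in a.\<close>
 have step: "zs (x, t) <= zs (x - a *\<^sub>R ?d, t - a * h) + a * (l + h * e') + a\<^sup>2 * (((norm ?d)^2 + h\<^sup>2) / (2 * f))"
  if x: "x \<in> closed_segment y y'" and t: "s <= t" and a: "0 <= a" for x t a
 proof -
  obtain Y u where Y: "m (x, t) = (Y, u)" by (cases "m (x, t)")
  have YS: "(Y, u) \<in> S" using m(1)[of "(x, t)"] Y by simp
  have mx: "z q - (norm (q - (x, t)))^2 / (2 * f) <= z (Y, u) - (norm ((Y, u) - (x, t)))^2 / (2 * f)"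
   if "q \<in> S" for q using m(2)[OF that, of "(x, t)"] Y by simp
  have xU: "x \<in> closure U" using x seg closure_subset by blast
  have t0: "0 <= t" using t s by simp
  have Yx: "norm (Y - x) <= g" by (rule max_near[OF f(1) f1 g(1) YS xU t0 mx])
  have YU: "Y \<in> U" using r(2) x Yx g(2) by (force simp: dist_norm norm_minus_commute)
  have "\<bar>u - t\<bar> <= 2 * K * f" by (rule max_time[OF f(1) YS t0 mx])
  then have u0: "0 < u" using Kf t by linarith
  let ?P = "(Y - x) /\<^sub>R f" and ?Q = "(u - t) / f"
  have PQ: "?Q + H Y ?P <= 0" "norm ?P <= R" using max_test[OF sub f(1) YU u0 mx] by auto
  let ?q = "(x - a *\<^sub>R ?d, t - a * h)"
  have "z (Y, u) - (norm ((Y, u) - ?q))^2 / (2 * f) <= zs ?q"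
   unfolding zs_def by (rule m(2)[OF YS])
  moreover have "(norm ((Y, u) - ?q))^2 = (norm ((Y, u) - (x, t)))^2
    + 2 * f * (a * (?P \<bullet> ?d + ?Q * h)) + a\<^sup>2 * ((norm ?d)^2 + h\<^sup>2)"
  proof -
   have iP: "?P \<bullet> ?d = ((Y - x) \<bullet> ?d) / f" by (simp only: inner_scaleR_left divide_inverse_commute)
   have "(norm (Y - x + a *\<^sub>R ?d))^2 = (norm (Y - x))^2 + 2 * a * ((Y - x) \<bullet> ?d) + a\<^sup>2 * (norm ?d)^2"
    by (simp only: power2_norm_eq_inner) (simp add: inner_add_left inner_add_right inner_commute power2_eq_square algebra_simps)
   moreover have "(u - t + a * h)^2 = (u - t)^2 + 2 * a * ((u - t) * h) + a\<^sup>2 * h\<^sup>2"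
    by (simp add: power2_eq_square algebra_simps)
   moreover have "2 * f * (a * (?P \<bullet> ?d + ?Q * h)) = 2 * a * ((Y - x) \<bullet> ?d) + 2 * a * ((u - t) * h)"
    unfolding iP using f(1) by (simp add: field_simps)
   moreover have "(norm ((Y, u) - ?q))^2 = (norm (Y - x + a *\<^sub>R ?d))^2 + (u - t + a * h)^2"
    by (simp add: norm_Pair_sq algebra_simps)
   moreover have "(norm ((Y, u) - (x, t)))^2 = (norm (Y - x))^2 + (u - t)^2" by (simp add: norm_Pair_sq)
   ultimately show ?thesis by (simp add: algebra_simps)
  qed
  ultimately have "z (Y, u) - ((norm ((Y, u) - (x, t)))^2
    + 2 * f * (a * (?P \<bullet> ?d + ?Q * h)) + a\<^sup>2 * ((norm ?d)^2 + h\<^sup>2)) / (2 * f) <= zs ?q" by simp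
  moreover have "(X + 2 * f * b + a\<^sup>2 * c) / (2 * f) = X / (2 * f) + b + a\<^sup>2 * (c / (2 * f))" for X b c
   using f(1) by (simp add: add_divide_distrib)
  moreover have "zs (x, t) = z (Y, u) - (norm ((Y, u) - (x, t)))^2 / (2 * f)" by (simp only: zs_def Y)
  ultimately have "zs (x, t) <= zs ?q + a * (?P \<bullet> ?d + ?Q * h) + a\<^sup>2 * (((norm ?d)^2 + h\<^sup>2) / (2 * f))"
   by simp
  moreover have "a * (?P \<bullet> ?d + ?Q * h) <= a * (l + h * e')"
  proof (rule mult_left_mono[OF _ a])
   have "?Q * h <= (- H Y ?P) * h" using PQ h by (intro mult_right_mono) auto
   then have "?P \<bullet> ?d + ?Q * h <= ?P \<bullet> ?d - h * H Y ?P" by (simp add: mult.commute)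
   also have "\<dots> <= ell H R Y ?d h" by (rule ell_ge[OF h PQ(2)])
   also have "\<dots> <= ell H R x ?d h + h * e'"
   proof (rule ell_change_point)
    fix p :: 'a assume "norm p <= R"
    then have "\<bar>H x p - H Y p\<bar> < e'" using Yx g by (intro d1(2)) (auto simp: dist_norm norm_minus_commute)
    then show "H x p <= H Y p + e'" by linarith
   qed (use R_pos h in auto)
   finally show "?P \<bullet> ?d + ?Q * h <= l + h * e'" using l[OF x] by simp
  qed
  ultimately show ?thesis by linarith
 qed
 have chain: "zs (y + (real i / real N) *\<^sub>R ?d, s + real i / real N * h)
   <= zs (y, s) + real i / real N * (l + h * e') + real i * ((1 / real N)^2 * (((norm ?d)^2 + h\<^sup>2) / (2 * f)))"
  if N: "0 < N" and i: "i <= N" for i N :: nat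
  using i
 proof (induction i)
  case (Suc i)
  let ?x = "y + (real (Suc i) / real N) *\<^sub>R ?d" and ?t = "s + real (Suc i) / real N * h"
  have u1: "real (Suc i) / real N <= 1" using Suc N by simp
  have "?x \<in> closed_segment y y'"
   unfolding in_segment using u1 by (intro exI[of _ "real (Suc i) / real N"]) (auto simp: algebra_simps)
  then have "zs (?x, ?t) <= zs (?x - (1 / real N) *\<^sub>R ?d, ?t - (1 / real N) * h) + (1 / real N) * (l + h * e')
    + (1 / real N)^2 * (((norm ?d)^2 + h\<^sup>2) / (2 * f))"
   by (rule step) (use h in auto)
  moreover have "?x - (1 / real N) *\<^sub>R ?d = y + (real i / real N) *\<^sub>R ?d"
   by (simp add: add_divide_distrib algebra_simps)
  moreover have "?t - (1 / real N) * h = s + real i / real N * h"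
   by (simp add: add_divide_distrib algebra_simps)
  ultimately show ?case using Suc by (simp add: add_divide_distrib algebra_simps)
 qed simp
 have lim: "zs (y', s + h) <= zs (y, s) + (l + h * e')"
 proof (rule LIMSEQ_le_const)
  let ?C = "((norm ?d)^2 + h\<^sup>2) / (2 * f)"
  show "(\<lambda>N. zs (y, s) + (l + h * e') + ?C * inverse (real (Suc N))) \<longlonglongrightarrow> zs (y, s) + (l + h * e')"
   using tendsto_add[OF tendsto_const tendsto_mult[OF tendsto_const LIMSEQ_inverse_real_of_nat], of "zs (y, s) + (l + h * e')" ?C]
   by simp
  have "zs (y', s + h) <= zs (y, s) + (l + h * e') + ?C * inverse (real (Suc N))" for N
  proof -
   have "M * ((1 / M)^2 * c) = c * inverse M" if "M \<noteq> 0" for M c :: real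
    using that by (simp add: power2_eq_square field_simps)
   note e = this[of "real (Suc N)" ?C, OF of_nat_neq_0]
   have "real (Suc N) / real (Suc N) = 1" by simp
   then show ?thesis using chain[of "Suc N" "Suc N", OF _ order_refl] unfolding e by simp
  qed
  then show "\<exists>N0. \<forall>N\<ge>N0. zs (y', s + h) <= zs (y, s) + (l + h * e') + ?C * inverse (real (Suc N))" by blast
 qed
 have "(y', s + h) \<in> S" using yU s h closure_subset[of U] by auto
 from m(2)[OF this, of "(y', s + h)"] have up: "z (y', s + h) <= zs (y', s + h)" by (simp add: zs_def)
 have "zs (y, s) <= z (y, s) + e'"
 proof -
  obtain Y u where Y: "m (y, s) = (Y, u)" by (cases "m (y, s)")
  have YS: "(Y, u) \<in> S" using m(1)[of "(y, s)"] Y by simp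
  have mx: "z q - (norm (q - (y, s)))^2 / (2 * f) <= z (Y, u) - (norm ((Y, u) - (y, s)))^2 / (2 * f)"
   if "q \<in> S" for q using m(2)[OF that, of "(y, s)"] Y by simp
  have yc: "y \<in> closure U" "0 <= s" using yU s closure_subset by auto
  have 1: "norm (Y - y) <= g" by (rule max_near[OF f(1) f1 g(1) YS yc mx])
  have 2: "\<bar>u - s\<bar> <= 2 * K * f" by (rule max_time[OF f(1) YS yc(2) mx])
  have "dist (Y, u) (y, s) <= norm (Y - y) + \<bar>u - s\<bar>"
   using norm_Pair_le[of "Y - y" "u - s"] by (simp add: dist_norm)
  then have "dist (Y, u) (y, s) < d2" using 1 2 g(4) Kf(2) by linarith
  then have "z (Y, u) < z (y, s) + e'" using d2(2)[OF YS] by (auto simp: dist_real_def)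
  moreover have "zs (y, s) <= z (Y, u)" using f(1) by (simp add: zs_def Y)
  ultimately show ?thesis by simp
 qed
 then have "z (y', s + h) <= z (y, s) + l + (e' * h + e')" using up lim by (simp add: mult.commute)
 then show "z (y', s + h) <= z (y, s) + l + e" using e' by linarith
qed

text \<open>The equation is tested only at positive times, so a start at time 0 is reached as a
  limit, by the Lipschitz bound in time.\<close>

theorem subsolution_trav:
 assumes sub: "HJ_sub H U z"
  and tr: "trav U H R T y x c" and s: "0 <= s"
 shows "z (x, s + T) <= z (y, s) + c"
proof -
 have pos: "z (x, s + T) <= z (y, s) + c" if "0 < s" for s
  using tr
 proof (induction rule: trav.induct)
  case (trav_step T x y c h x' l)
  have "z (x', (s + T) + h) <= z (y, s + T) + l"
   by (rule subsolution_step[OF sub trav_step(3,2) _ trav_step(4)]) (use that trav_in[OF trav_step(1)] in auto)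
  then show ?case using trav_step.IH by (simp add: add.assoc)
 qed simp
 have xy: "x \<in> closure U" "y \<in> closure U" "0 <= T" using trav_in[OF tr] closure_subset by auto
 show ?thesis
 proof (rule limit_small_quadratic[of 1 _ _ "2 * K"])
  fix h :: real assume h: "0 < h" "h < 1"
  have "z (x, s + h + T) <= z (y, s + h) + c" by (rule pos) (use s h in auto)
  moreover have "\<bar>z (x, s + T) - z (x, s + h + T)\<bar> <= K * h"
   using time_lip[of x "s + h + T" "s + T"] xy s h by simp
  moreover have "\<bar>z (y, s + h) - z (y, s)\<bar> <= K * h"
   using time_lip[of y s "s + h"] xy s h by simp
  ultimately show "z (x, s + T) <= z (y, s) + c + 2 * K * h" by linarith
 qed simp
qed

end

text \<open>Qualitative regularity of the boundary: a short chord with end points close to the closure of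
 \<open>U\<close> can be translated into \<open>U\<close> by a vector short in comparison (this uses that the boundary
 is \<open>C\<^sup>1\<close>), and nearby points of \<open>U\<close> are joined by three segments of comparable length.\<close>

definition link :: "'a::euclidean_space set => 'a => 'a => real => bool" where
 "link U x y l \<longleftrightarrow> (\<exists>a b. closed_segment x a \<subseteq> U \<and> closed_segment a b \<subseteq> U \<and> closed_segment b y \<subseteq> U \<and>
   norm (a - x) + norm (b - a) + norm (y - b) <= l)"

definition regular_domain :: "'a::euclidean_space set => bool" where
 "regular_domain U \<longleftrightarrow> open U \<and>
   (\<forall>h>0. \<exists>c0>0. \<exists>d>0. \<forall>c a b a' b'. 0 < c --> c <= c0 --> norm (a - b) <= c -->
    a' \<in> closure U --> norm (a - a') <= d * c --> b' \<in> closure U --> norm (b - b') <= d * c -->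
    (\<exists>s. norm s <= h * c \<and> closed_segment (a + s) (b + s) \<subseteq> U)) \<and>
   (\<exists>r>0. \<exists>C\<ge>0. \<forall>x\<in>U. \<forall>y\<in>U. norm (x - y) < r --> link U x y (C * norm (x - y)))"

lemma regular_domainD:
 assumes "regular_domain U"
 shows "open U"
  and "0 < h ==> \<exists>c0>0. \<exists>d>0. \<forall>c a b a' b'. 0 < c --> c <= c0 --> norm (a - b) <= c -->
    a' \<in> closure U --> norm (a - a') <= d * c --> b' \<in> closure U --> norm (b - b') <= d * c -->
    (\<exists>s. norm s <= h * c \<and> closed_segment (a + s) (b + s) \<subseteq> U)"
  and "\<exists>r>0. \<exists>C\<ge>0. \<forall>x\<in>U. \<forall>y\<in>U. norm (x - y) < r --> link U x y (C * norm (x - y))"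
 using assms unfolding regular_domain_def by simp_all

lemma regular_domain_UNIV: "regular_domain (UNIV :: 'a::euclidean_space set)"
 unfolding regular_domain_def
proof (intro conjI allI impI)
 fix h :: real assume "0 < h"
 then show "\<exists>c0>0. \<exists>d>0. \<forall>c (a::'a) b a' b'. 0 < c --> c <= c0 --> norm (a - b) <= c -->
    a' \<in> closure UNIV --> norm (a - a') <= d * c --> b' \<in> closure UNIV --> norm (b - b') <= d * c -->
    (\<exists>s. norm s <= h * c \<and> closed_segment (a + s) (b + s) \<subseteq> UNIV)"
  by (intro exI[of _ 1] conjI allI impI exI[of _ "0::'a"]) auto
next
 have "link UNIV x y (1 * norm (x - y))" for x y :: 'a
  unfolding link_def by (intro exI[of _ y]) (simp add: norm_minus_commute)
 then show "\<exists>r>0. \<exists>C\<ge>0. \<forall>x\<in>UNIV. \<forall>y\<in>(UNIV :: 'a set). norm (x - y) < r --> link UNIV x y (C * norm (x - y))"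
  by (intro exI[of _ "1::real"] conjI ballI impI) auto
qed simp

section \<open>Almost optimal travels from the supersolution property\<close>

context hamiltonian begin

lemma subgradient_gain:
 assumes "\<And>q. H y p + V \<bullet> (q - p) <= H y q"
 shows "H y p <= p \<bullet> V"
 using assms[of 0] zero[of y] by (simp add: inner_commute inner_diff_right)

text \<open>The gain inequality and nonnegativity of \<open>H\<close> give p \<bullet> V \<ge> 0, so
  lengthening p to P can only increase the pairing.\<close>

lemma truncated_momentum:
 assumes V: "\<And>q. H y p + V \<bullet> (q - p) <= H y q" and R: "0 < R" "R < norm P" and p: "p = (R / norm P) *\<^sub>R P"
 shows "p \<bullet> V <= P \<bullet> V"
proof -
 have PV: "p \<bullet> V = (R / norm P) * (P \<bullet> V)" by (simp add: p)
 have l: "0 < R / norm P" "R / norm P <= 1" using R divide_pos_pos[OF R(1) less_trans[OF R]] by (auto simp: divide_le_eq)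
 have "0 <= (R / norm P) * (P \<bullet> V)" using subgradient_gain[OF V] nonneg[of y p] PV by linarith
 then have "0 <= P \<bullet> V" using l(1) by (simp only: zero_le_mult_iff) linarith
 then show ?thesis unfolding PV using mult_right_mono[OF l(2)] by fastforce
qed

lemma coercive_above:
 obtains R where "L <= R" "\<And>y p. R <= norm p ==> K < H y p"
 by (metis coercive max.bounded_iff max.cobounded1)

lemma link_trav:
 assumes "link U x y l" and R: "0 <= R"
 shows "trav U H R 0 x y (R * l)"
proof -
 obtain a b where ab: "closed_segment x a \<subseteq> U" "closed_segment a b \<subseteq> U" "closed_segment b y \<subseteq> U"
   "norm (a - x) + norm (b - a) + norm (y - b) <= l" using assms(1) unfolding link_def by blast
 have t: "trav U H R 0 x y (R * norm (a - x) + R * norm (b - a) + R * norm (y - b))"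
  using trav_trans[OF trav_jump[OF ab(3) R] trav_trans[OF trav_jump[OF ab(2) R] trav_jump[OF ab(1) R]]] by simp
 have "R * norm (a - x) + R * norm (b - a) + R * norm (y - b) = R * (norm (a - x) + norm (b - a) + norm (y - b))"
  by (simp add: distrib_left)
 also have "\<dots> <= R * l" using ab(4) R by (rule mult_left_mono)
 finally show ?thesis using trav_weaken[OF t R, of 0 "R * l"] by simp
qed

lemma ell_sum:
 assumes "finite I" "0 <= R" "0 <= h"
 shows "ell H R w (\<Sum>i\<in>I. d i) (real (card I) * h) <= (\<Sum>i\<in>I. ell H R w (d i) h)"
 using assms(1)
proof (induction I rule: finite_induct)
 case empty
 then show ?case using ell_le_norm[of R 0 w 0] assms by simp
next
 case (insert i I)
 have "ell H R w (d i + (\<Sum>i\<in>I. d i)) (h + real (card I) * h) <= ell H R w (d i) h + ell H R w (\<Sum>i\<in>I. d i) (real (card I) * h)"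
  by (rule ell_add) (use assms in auto)
 then show ?case using insert by (simp add: algebra_simps)
qed

end

text \<open>A discrete trajectory run backwards in time. The points X may leave the closure of
  \<open>U\<close>, so the Hamiltonian is read at nearby points Y of the closure. Each summand is
  the duration of a step times the Lagrangian in the Legendre form p \<bullet> V - H.\<close>

definition descent :: "('a::euclidean_space => 'a => real) => 'a set => real => real => real => ('a => real)
  => 'a => real => nat => real => bool" where
 "descent H U R M s f x T N v \<longleftrightarrow> (\<exists>X Y p V. X 0 = x \<and> (\<forall>i<N. X (Suc i) = X i - (T / real N) *\<^sub>R V i) \<and>
    (\<forall>i\<le>N. Y i \<in> closure U \<and> norm (X i - Y i) <= s) \<and>
    (\<forall>i<N. norm (p i) <= R \<and> norm (V i) <= M \<and> (\<forall>q. H (Y i) (p i) + V i \<bullet> (q - p i) <= H (Y i) q)) \<and>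
    f (Y N) + (\<Sum>i<N. T / real N * (p i \<bullet> V i - H (Y i) (p i))) <= v)"

lemma norm_fst_le': "norm (fst a) <= norm a"
 by (cases a) (simp add: norm_fst_le)

context evolution begin

text \<open>A momentum longer than \<open>R\<close> is shortened to length \<open>R\<close>. There
  \<open>H\<close> still exceeds \<open>K1\<close> \<ge> - Q, so the term with \<open>H\<close> is
  covered by the time slope and the inequality survives.\<close>

lemma velocity_exists:
 assumes PQ: "0 <= Q + H Y P" "- K1 <= Q" and M: "\<And>y p. norm p <= R + 1 ==> H y p <= M"
 shows "\<exists>p V. norm p <= R \<and> norm V <= M \<and> (\<forall>q. H Y p + V \<bullet> (q - p) <= H Y q) \<and> p \<bullet> V - H Y p <= P \<bullet> V + Q"
proof -
 define p where "p = (if norm P <= R then P else (R / norm P) *\<^sub>R P)"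
 have np: "norm p <= R" using R_pos by (auto simp: p_def)
 obtain V where V: "\<And>q. H Y p + V \<bullet> (q - p) <= H Y q" using subgradient_exists[OF convex[of Y], of p] by blast
 have "norm V <= M" by (rule subgradient_bound[OF V]) (use M np in force)
 moreover have "p \<bullet> V - H Y p <= P \<bullet> V + Q"
 proof (cases "norm P <= R")
  case True
  then show ?thesis using PQ by (simp add: p_def)
 next
  case False
  then have pP: "p = (R / norm P) *\<^sub>R P" by (simp add: p_def)
  have "norm p = R" using False R_pos by (auto simp: pP)
  then have "K1 < H Y p" by (intro thr) simp
  moreover have g: "H Y p <= p \<bullet> V" by (rule subgradient_gain[OF V])
  moreover have "p \<bullet> V <= P \<bullet> V" by (rule truncated_momentum[OF V R_pos _ pP]) (use False in simp)
  ultimately show ?thesis using PQ by linarith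
 qed
 ultimately show ?thesis using np V by blast
qed

text \<open>Euler steps along the velocities at the contact points lower the inf-convolution by the
  Lagrangian, up to an error quadratic in the step. The number of steps is left free beyond
  \<open>N0\<close>, so that it can be chosen as a multiple of a prescribed number.\<close>

lemma supersolution_raw:
 assumes sup: "HJ_super H (closure U) z"
  and x: "x \<in> closure U" and t: "0 < t" and f: "0 < f" and g: "0 < g"
  and M: "\<And>y p. norm p <= R + 1 ==> H y p <= M"
 shows "\<exists>T N0. 0 < T \<and> T <= t \<and>
  (\<forall>N\<ge>N0. 0 < N --> descent H U R M g (\<lambda>y. z (y, 0)) x T N (z (x, t) + f))"
proof -
 have M0: "0 <= M" using M[of 0 undefined] R_pos zero by simp
 obtain u0 where "0 < u0" "\<forall>(a, b)\<in>set [(2, t), (K, f / 4)]. a * u0 <= b"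
   using small_scale[of "[(2, t), (K, f / 4)]"] t f by auto
 then have u0: "0 < u0" "u0 <= t / 2" "K * u0 <= f / 4" by auto
 \<comment> \<open>The descent stops at the positive time \<open>u0\<close>: contact times stay
   within u0 / 2 of the current time and thus remain positive, where the equation can be tested. The
   rest is paid by the Lipschitz bound in time.\<close>
 define T where "T = t - u0"
 have T: "0 < T" "T <= t" using u0 t by (auto simp: T_def)
 define C0 where "C0 = 1 + A + B * (M * t) + K * (t + 2 * K)"
 have C0: "0 <= C0" unfolding C0_def using parms_nonneg M0 t by simp
 obtain d where "0 < d" "\<forall>(a, b)\<in>set [(1, 1), (2 * K, u0 / 2), (2 * (C0 / g + B), g)]. a * d <= b"
   using small_scale[of "[(1, 1), (2 * K, u0 / 2), (2 * (C0 / g + B), g)]"] g u0 by auto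
 then have d: "0 < d" "d <= 1" and Kd: "2 * K * d <= u0 / 2" and dg: "2 * d * (C0 / g + B) <= g"
  by (auto simp: ac_simps)
 have "\<forall>q0. \<exists>m. m \<in> S \<and> (\<forall>q\<in>S. z m + (norm (m - q0))^2 / (2 * d) <= z q + (norm (q - q0))^2 / (2 * d))"
  using minimizer[OF d(1)] by blast
 then obtain m where m: "\<And>q0. m q0 \<in> S"
   "\<And>q0 q. q \<in> S ==> z (m q0) + (norm (m q0 - q0))^2 / (2 * d) <= z q + (norm (q - q0))^2 / (2 * d)"
  using choice[of "\<lambda>q0 m. m \<in> S \<and> (\<forall>q\<in>S. z m + (norm (m - q0))^2 / (2 * d) <= z q + (norm (q - q0))^2 / (2 * d))"]
  by blast
 define zd where "zd q0 = z (m q0) + (norm (m q0 - q0))^2 / (2 * d)" for q0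
 define c where "c = (M\<^sup>2 + 1) / (2 * d)"
 have c0: "0 <= c" using d by (simp add: c_def)
 have mtime: "\<bar>snd (m (x', t')) - t'\<bar> <= 2 * K * d" if "0 <= t'" for x' t'
 proof -
  obtain Y s where Y: "m (x', t') = (Y, s)" by (cases "m (x', t')")
  have "(Y, s) \<in> S" using m(1)[of "(x', t')"] Y by simp
  moreover have "z (Y, s) + (norm ((Y, s) - (x', t')))^2 / (2 * d) <= z q + (norm (q - (x', t')))^2 / (2 * d)"
   if "q \<in> S" for q using m(2)[OF that, of "(x', t')"] Y by simp
  ultimately show ?thesis using min_time[OF d(1) _ that] unfolding Y snd_conv by blast
 qed
 have step: "\<exists>p V. norm p <= R \<and> norm V <= M \<and> (\<forall>q. H (fst (m (x', t'))) p + V \<bullet> (q - p) <= H (fst (m (x', t'))) q) \<and>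
   (\<forall>h\<ge>0. zd (x' - h *\<^sub>R V, t' - h) <= zd (x', t') - h * (p \<bullet> V - H (fst (m (x', t'))) p) + h\<^sup>2 * c)"
  if t': "u0 <= t'" for x' t'
 proof -
  obtain Y s where Y: "m (x', t') = (Y, s)" by (cases "m (x', t')")
  have YS: "(Y, s) \<in> S" using m(1)[of "(x', t')"] Y by simp
  have mn: "z (Y, s) + (norm ((Y, s) - (x', t')))^2 / (2 * d) <= z q + (norm (q - (x', t')))^2 / (2 * d)"
   if "q \<in> S" for q using m(2)[OF that, of "(x', t')"] Y by simp
  have "\<bar>s - t'\<bar> <= 2 * K * d" using mtime[of t' x'] t' u0 Y by simp
  then have s0: "0 < s" using Kd t' u0 by linarith
  let ?P = "(x' - Y) /\<^sub>R d" and ?Q = "(t' - s) / d"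
  have YU: "Y \<in> closure U" using YS by simp
  have PQ: "0 <= ?Q + H Y ?P" "- K1 <= ?Q" using min_test[OF sup d(1) YU s0 mn] by auto
  obtain p V where pV: "norm p <= R" "norm V <= M" "\<forall>q. H Y p + V \<bullet> (q - p) <= H Y q" "p \<bullet> V - H Y p <= ?P \<bullet> V + ?Q"
   using velocity_exists[OF PQ M] by blast
  have "zd (x' - h *\<^sub>R V, t' - h) <= zd (x', t') - h * (p \<bullet> V - H Y p) + h\<^sup>2 * c" if h: "0 <= h" for h
  proof -
   let ?q = "(x' - h *\<^sub>R V, t' - h)"
   have a1: "zd ?q <= z (Y, s) + (norm ((Y, s) - ?q))^2 / (2 * d)"
    unfolding zd_def by (rule m(2)[OF YS])
   have a2: "(norm ((Y, s) - ?q))^2 = (norm ((Y, s) - (x', t')))^2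
     + 2 * d * (- h * (?P \<bullet> V + ?Q)) + h\<^sup>2 * ((norm V)^2 + 1)"
   proof -
    have iP: "?P \<bullet> V = ((x' - Y) \<bullet> V) / d" by (simp only: inner_scaleR_left divide_inverse_commute)
    have "(norm (Y - x' + h *\<^sub>R V))^2 = (norm (Y - x'))^2 - 2 * h * ((x' - Y) \<bullet> V) + h\<^sup>2 * (norm V)^2"
     by (simp only: power2_norm_eq_inner) (simp add: inner_add_left inner_add_right inner_diff_left inner_commute power2_eq_square algebra_simps)
    moreover have "(s - t' + h)^2 = (s - t')^2 - 2 * h * (t' - s) + h\<^sup>2"
     by (simp add: power2_eq_square algebra_simps)
    moreover have "2 * d * (- h * (?P \<bullet> V + ?Q)) = - 2 * h * ((x' - Y) \<bullet> V) - 2 * h * (t' - s)"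
     unfolding iP using d(1) by (simp add: field_simps)
    moreover have "(norm ((Y, s) - ?q))^2 = (norm (Y - x' + h *\<^sub>R V))^2 + (s - t' + h)^2"
     by (simp add: norm_Pair_sq algebra_simps)
    moreover have "(norm ((Y, s) - (x', t')))^2 = (norm (Y - x'))^2 + (s - t')^2" by (simp add: norm_Pair_sq)
    ultimately show ?thesis by (simp add: algebra_simps)
   qed
   have a3: "(a + 2 * d * b + h\<^sup>2 * e) / (2 * d) = a / (2 * d) + b + h\<^sup>2 * (e / (2 * d))" for a b e
    using d(1) by (simp add: add_divide_distrib)
   have a4: "zd (x', t') = z (Y, s) + (norm ((Y, s) - (x', t')))^2 / (2 * d)" by (simp only: zd_def Y)
   have "zd ?q <= zd (x', t') - h * (?P \<bullet> V + ?Q) + h\<^sup>2 * (((norm V)^2 + 1) / (2 * d))"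
    using a1 unfolding a2 a3 a4 by simp
   moreover have "h * (p \<bullet> V - H Y p) <= h * (?P \<bullet> V + ?Q)" using pV(4) h by (rule mult_left_mono)
   moreover have "h\<^sup>2 * (((norm V)^2 + 1) / (2 * d)) <= h\<^sup>2 * c"
    unfolding c_def using d(1) pV(2) by (intro mult_left_mono divide_right_mono add_right_mono power_mono) auto
   ultimately show ?thesis by linarith
  qed
  then show ?thesis unfolding Y fst_conv using pV(1-3) by blast
 qed
 have "\<forall>q. \<exists>w. u0 <= snd q --> norm (fst w) <= R \<and> norm (snd w) <= M \<and>
   (\<forall>q'. H (fst (m q)) (fst w) + snd w \<bullet> (q' - fst w) <= H (fst (m q)) q') \<and>
   (\<forall>h\<ge>0. zd (fst q - h *\<^sub>R snd w, snd q - h) <= zd q - h * (fst w \<bullet> snd w - H (fst (m q)) (fst w)) + h\<^sup>2 * c)"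
  using step by (metis fst_conv prod.collapse snd_conv)
 then obtain W where W: "\<And>q. u0 <= snd q ==> norm (fst (W q)) <= R \<and> norm (snd (W q)) <= M \<and>
   (\<forall>q'. H (fst (m q)) (fst (W q)) + snd (W q) \<bullet> (q' - fst (W q)) <= H (fst (m q)) q') \<and>
   (\<forall>h\<ge>0. zd (fst q - h *\<^sub>R snd (W q), snd q - h) <= zd q - h * (fst (W q) \<bullet> snd (W q) - H (fst (m q)) (fst (W q))) + h\<^sup>2 * c)"
  by metis
 obtain N0 :: nat where N0: "T\<^sup>2 * c / min 1 (f / 4) <= real N0" using real_arch_simple by blast
 show ?thesis
 proof (rule exI[of _ T], rule exI[of _ N0], intro conjI T allI impI)
  fix N :: nat assume N: "N0 <= N" "0 < N"
  define h where "h = T / real N"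
  have h: "0 <= h" "real N * h = T" using T N by (auto simp: h_def)
  have err: "real i * (h\<^sup>2 * c) <= min 1 (f / 4)" if "i <= N" for i
  proof -
   have "real i * (h\<^sup>2 * c) <= real N * (h\<^sup>2 * c)" using that c0 by (intro mult_right_mono) auto
   also have "\<dots> = T\<^sup>2 * c / real N" using N by (simp add: h_def power2_eq_square field_simps)
   also have "\<dots> <= min 1 (f / 4)"
   proof -
    have p: "0 < min 1 (f / 4)" using f by simp
    have "T\<^sup>2 * c / min 1 (f / 4) <= real N" using N0 N by linarith
    then have "T\<^sup>2 * c <= real N * min 1 (f / 4)" using p by (simp only: pos_divide_le_eq)
    moreover have "0 < real N" using N by simp
    ultimately show ?thesis by (simp only: pos_divide_le_eq mult.commute)
   qed
   finally show ?thesis .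
  qed
  define X where "X = rec_nat x (\<lambda>i X. X - h *\<^sub>R snd (W (X, t - real i * h)))"
  define q where "q i = (X i, t - real i * h)" for i
  have X0: "X 0 = x" and XS: "X (Suc i) = X i - h *\<^sub>R snd (W (q i))" for i
   by (simp_all add: X_def q_def)
  define Y where "Y i = fst (m (q i))" for i
  define p where "p i = fst (W (q i))" for i
  define V where "V i = snd (W (q i))" for i
  have tq: "u0 <= snd (q i)" if "i <= N" for i
  proof -
   have "real i * h <= real N * h" using that h by (intro mult_right_mono) auto
   then show ?thesis unfolding q_def snd_conv using h(2) by (simp add: T_def)
  qed
  have pV: "norm (p i) <= R" "norm (V i) <= M" "\<And>q'. H (Y i) (p i) + V i \<bullet> (q' - p i) <= H (Y i) q'"
    "zd (q (Suc i)) <= zd (q i) - h * (p i \<bullet> V i - H (Y i) (p i)) + h\<^sup>2 * c" if "i <= N" for i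
  proof -
   note w = W[OF tq[OF that]]
   show "norm (p i) <= R" "norm (V i) <= M" "\<And>q'. H (Y i) (p i) + V i \<bullet> (q' - p i) <= H (Y i) q'"
    using w unfolding p_def V_def Y_def by blast+
   have "q (Suc i) = (fst (q i) - h *\<^sub>R snd (W (q i)), snd (q i) - h)"
    by (simp add: q_def XS algebra_simps)
   then show "zd (q (Suc i)) <= zd (q i) - h * (p i \<bullet> V i - H (Y i) (p i)) + h\<^sup>2 * c"
    using w h(1) unfolding p_def V_def Y_def by metis
  qed
  have gain: "0 <= h * (p i \<bullet> V i - H (Y i) (p i))" if "i <= N" for i
   using subgradient_gain[OF pV(3)[OF that]] h by simp
  have chain: "zd (q i) + (\<Sum>j<i. h * (p j \<bullet> V j - H (Y j) (p j))) <= z (x, t) + real i * (h\<^sup>2 * c)" if "i <= N" for i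
   using that
  proof (induction i)
   case 0
   have "zd (x, t) <= z (x, t)" using m(2)[of "(x, t)" "(x, t)"] x t by (simp add: zd_def)
   then show ?case by (simp add: q_def X0)
  next
   case (Suc i)
   then show ?case using pV(4)[of i] by (simp add: algebra_simps)
  qed
  have Xx: "norm (x - X i) <= real i * h * M" if "i <= N" for i
   using that
  proof (induction i)
   case (Suc i)
   have "norm (x - X (Suc i)) <= norm (x - X i) + norm (h *\<^sub>R V i)"
    using norm_triangle_ineq[of "x - X i" "h *\<^sub>R V i"] by (simp add: XS V_def algebra_simps)
   moreover have "norm (h *\<^sub>R V i) <= h * M" using pV(2)[of i] Suc h by (simp add: mult_left_mono)
   ultimately show ?case using Suc by (simp add: algebra_simps)
  qed (simp add: X0)
  have YU: "Y i \<in> closure U" "0 <= snd (m (q i))" for i using m(1)[of "q i"] by (auto simp: Y_def)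
  have ms: "\<bar>snd (m (q i)) - snd (q i)\<bar> <= 2 * K * d" if "i <= N" for i
   using mtime[of "snd (q i)" "fst (q i)"] tq[OF that] u0 by simp
  have zY: "z (Y i, snd (m (q i))) + (norm (X i - Y i))^2 / (2 * d) <= zd (q i)" for i
  proof -
   have "norm (X i - Y i) <= norm (m (q i) - q i)"
   proof -
    have "fst (m (q i) - q i) = Y i - X i" by (simp add: q_def Y_def)
    then show ?thesis
     using norm_fst_le'[of "m (q i) - q i"] by (simp only: norm_minus_commute[of "X i"])
   qed
   then have "(norm (X i - Y i))^2 / (2 * d) <= (norm (m (q i) - q i))^2 / (2 * d)"
    using d(1) by (intro divide_right_mono power_mono) auto
   then show ?thesis by (simp add: zd_def Y_def)
  qed
  have near: "norm (X i - Y i) <= g" if i: "i <= N" for i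
  proof (rule small_root[OF _ g _ C0 parms_nonneg(2) _ dg])
   have "0 <= (\<Sum>j<i. h * (p j \<bullet> V j - H (Y j) (p j)))" using gain i by (intro sum_nonneg) auto
   then have "zd (q i) <= z (x, t) + 1" using chain[OF i] err[OF i] by (auto simp: min_le_iff_disj)
   then have "(norm (X i - Y i))^2 / (2 * d) <= 1 + (z (x, t) - z (Y i, snd (m (q i))))" using zY[of i] by linarith
   also have "\<dots> <= 1 + (A + B * norm (x - Y i) + K * \<bar>t - snd (m (q i))\<bar>)"
    using two_point[of x t "Y i" "snd (m (q i))"] x t YU by auto
   also have "\<dots> <= 1 + (A + B * (M * t + norm (X i - Y i)) + K * (t + 2 * K))"
   proof -
    have "real i * h <= real N * h" using i h by (intro mult_right_mono) auto
    then have ih: "real i * h <= t" "0 <= real i * h" using h T by auto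
    have "norm (x - Y i) <= norm (x - X i) + norm (X i - Y i)" using norm_triangle_ineq[of "x - X i" "X i - Y i"] by simp
    moreover have "norm (x - X i) <= M * t"
     using Xx[OF i] mult_right_mono[OF ih(1) M0] by (simp add: mult.commute)
    ultimately have "B * norm (x - Y i) <= B * (M * t + norm (X i - Y i))"
     using parms_nonneg by (intro mult_left_mono) auto
    moreover have "2 * K * d <= 2 * K * 1" using d parms_nonneg by (intro mult_left_mono) auto
    then have "\<bar>t - snd (m (q i))\<bar> <= t + 2 * K" using ms[OF i] ih by (simp add: q_def)
    then have "K * \<bar>t - snd (m (q i))\<bar> <= K * (t + 2 * K)" using parms_nonneg by (intro mult_left_mono) auto
    ultimately show ?thesis by linarith
   qed
   also have "\<dots> = C0 + B * norm (X i - Y i)" by (simp add: C0_def algebra_simps)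
   finally show "(norm (X i - Y i))^2 <= 2 * d * (C0 + B * norm (X i - Y i))"
    using d(1) by (simp add: pos_divide_le_eq mult.commute)
  qed (use d in auto)
  have fin: "z (Y N, 0) + (\<Sum>i<N. h * (p i \<bullet> V i - H (Y i) (p i))) <= z (x, t) + f"
  proof -
   let ?s = "snd (m (q N))"
   have "z (Y N, ?s) <= zd (q N)"
   proof -
    have "0 <= (norm (X N - Y N))^2 / (2 * d)" using d(1) by simp
    then show ?thesis using zY[of N] by linarith
   qed
   moreover have "z (Y N, 0) <= z (Y N, ?s) + K * ?s" using time_lip[of "Y N" 0 ?s] YU[of N] by auto
   moreover have "K * ?s <= K * (2 * u0)"
   proof -
    have "snd (q N) = u0" using h(2) by (simp add: q_def T_def)
    then have "?s <= 2 * u0" using ms[of N] Kd u0 by simp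
    then show ?thesis using parms_nonneg by (intro mult_left_mono) auto
   qed
   moreover have "real N * (h\<^sup>2 * c) <= f / 4" using err[of N] by simp
   moreover have "K * (2 * u0) <= f / 2" using u0(3) by simp
   ultimately show ?thesis using chain[of N] f by linarith
  qed
  show "descent H U R M g (\<lambda>y. z (y, 0)) x T N (z (x, t) + f)"
   unfolding descent_def
  proof (rule exI[of _ X], rule exI[of _ Y], rule exI[of _ p], rule exI[of _ V], intro conjI allI impI)
   show "X (Suc i) = X i - (T / real N) *\<^sub>R V i" for i unfolding XS V_def h_def ..
   show "z (Y N, 0) + (\<Sum>i<N. T / real N * (p i \<bullet> V i - H (Y i) (p i))) <= z (x, t) + f"
    using fin unfolding h_def .
  qed (use X0 YU near pV in auto)
 qed
qed

text \<open>The raw descent stays only near the closure of \<open>U\<close>. It is cut into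
  \<open>J\<close> blocks of P steps; the chord of each block is pushed into \<open>U\<close> by a
  shift that is a small fraction of the block length, and consecutive shifted chords are joined by
  links.\<close>

theorem supersolution_trav:
 assumes sup: "HJ_super H (closure U) z"
  and dom: "regular_domain U" and uc: "uniformly_continuous_on (closure U) (\<lambda>x. z (x, 0))"
  and x: "x \<in> U" and t: "0 < t" and g: "0 < g"
 shows "\<exists>y c. trav U H R t y x c \<and> z (y, 0) + c <= z (x, t) + g"
proof -
 obtain M' where M': "\<And>y p. norm p <= R + 1 ==> H y p <= M'" using locally_bounded by blast
 define M where "M = max 1 M'"
 have M: "1 <= M" "\<And>y p. norm p <= R + 1 ==> H y p <= M" using M' by (auto simp: M_def le_max_iff_disj)
 have R0: "0 <= R" using R_pos by simp
 obtain r C where rC: "0 < r" "0 <= C" "\<And>x y. x \<in> U ==> y \<in> U ==> norm (x - y) < r ==> link U x y (C * norm (x - y))"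
  using regular_domainD(3)[OF dom] by blast
 \<comment> \<open>\<open>d\<close> is the ratio of shift to block length and is fixed first: blocks
   times block length equals M t, so all links together cost 2 R C M t d whatever the block length
   is.\<close>
 obtain d where "0 < d" "\<forall>(a, b)\<in>set [(1, 1), (2 * (R * C * M * t), g / 4)]. a * d <= b"
   using small_scale[of "[(1, 1), (2 * (R * C * M * t), g / 4)]"] g by auto
 then have d: "0 < d" "d <= 1" "2 * (R * C * M * t) * d <= g / 4" by auto
 define e where "e = g / (4 * t)"
 have e: "0 < e" "t * e = g / 4" using g t by (auto simp: e_def)
 obtain d1 where d1: "0 < d1" "\<And>w w' p. norm p <= R ==> dist w w' < d1 ==> \<bar>H w p - H w' p\<bar> < e"
  using equicontinuous[OF e(1), of R] by blast
 obtain d0 where d0: "0 < d0" "\<And>w w'. w \<in> closure U ==> w' \<in> closure U ==> dist w w' < d0 ==> dist (z (w, 0)) (z (w', 0)) < g / 4"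
  using uc[unfolded uniformly_continuous_on_def, rule_format, of "g / 4"] g by (auto simp: dist_commute)
 from regular_domainD(2)[OF dom d(1)]
 obtain f0 n where G: "0 < f0" "0 < n" and
  G': "\<forall>f a b a' b'. 0 < f --> f <= f0 --> norm (a - b) <= f -->
    a' \<in> closure U --> norm (a - a') <= n * f --> b' \<in> closure U --> norm (b - b') <= n * f -->
    (\<exists>s. norm s <= d * f \<and> closed_segment (a + s) (b + s) \<subseteq> U)"
  by (elim exE conjE) (rule that)
 note G1 = G G'[rule_format]
 obtain m where "0 < m" "\<forall>(a, b)\<in>set [(1, f0), (8, d1), (4, r), (4, d0)]. a * m <= b"
   using small_scale[of "[(1, f0), (8, d1), (4, r), (4, d0)]"] G1 d1 rC d0 by auto
 then have m: "0 < m" "m <= f0" "8 * m <= d1" "4 * m <= r" "4 * m <= d0" by auto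
 obtain J0 :: nat where J0: "M * t / m <= real J0" using real_arch_simple by blast
 define J where "J = Suc J0"
 have J: "0 < J" "M * t / real J <= m"
 proof -
  have "M * t / m <= real J" using J0 by (simp add: J_def)
  then show "M * t / real J <= m" using m(1) by (simp add: J_def pos_divide_le_eq mult.commute)
 qed (simp add: J_def)
 define f where "f = M * t / real J"
 have f: "0 < f" "f <= f0" "8 * f <= d1" "4 * f <= r" "4 * f <= d0"
 proof -
  show "0 < f" using J M t by (simp add: f_def)
  have "f <= m" using J by (simp add: f_def)
  then show "f <= f0" "8 * f <= d1" "4 * f <= r" "4 * f <= d0" using m by linarith+
 qed
 \<comment> \<open>Contact points must be close in comparison with the block length
   \<open>f\<close>, so their tolerance comes last.\<close>
 define S where "S = min (n * f) f"
 have S: "0 < S" "S <= n * f" "S <= f" using G1 f by (auto simp: S_def)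
 have xc: "x \<in> closure U" using x closure_subset by blast
 have b4: "0 < g / 4" using g by simp
 have "\<exists>T N0. 0 < T \<and> T <= t \<and>
  (\<forall>N\<ge>N0. 0 < N --> descent H U R M S (\<lambda>y. z (y, 0)) x T N (z (x, t) + g / 4))"
  by (rule supersolution_raw[OF sup xc t b4 S(1) M(2)])
 then obtain T N0 where T: "0 < T" "T <= t" and
  raw: "\<forall>N\<ge>N0. 0 < N --> descent H U R M S (\<lambda>y. z (y, 0)) x T N (z (x, t) + g / 4)"
  by (elim exE conjE) (rule that)
 define P where "P = Suc N0"
 define N where "N = J * P"
 have N: "N0 <= N" "0 < N"
 proof -
  have "1 * P <= J * P" using J by (intro mult_right_mono) auto
  then show "N0 <= N" by (simp add: N_def P_def)
  show "0 < N" using J by (simp add: N_def P_def)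
 qed
 have "descent H U R M S (\<lambda>y. z (y, 0)) x T N (z (x, t) + g / 4)" using raw N by blast
 then obtain X Y p V where X0: "X 0 = x" and XS': "\<forall>i<N. X (Suc i) = X i - (T / real N) *\<^sub>R V i"
  and Y': "\<forall>i\<le>N. Y i \<in> closure U \<and> norm (X i - Y i) <= S"
  and pV': "\<forall>i<N. norm (p i) <= R \<and> norm (V i) <= M \<and> (\<forall>q. H (Y i) (p i) + V i \<bullet> (q - p i) <= H (Y i) q)"
  and fin: "z (Y N, 0) + (\<Sum>i<N. T / real N * (p i \<bullet> V i - H (Y i) (p i))) <= z (x, t) + g / 4"
  unfolding descent_def by (elim exE conjE) (rule that)
 note XS = XS'[rule_format]
 have Y: "\<And>i. i <= N ==> Y i \<in> closure U" "\<And>i. i <= N ==> norm (X i - Y i) <= S"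
  using Y' by blast+
 have pV: "\<And>i. i < N ==> norm (p i) <= R" "\<And>i. i < N ==> norm (V i) <= M"
   "\<And>i q. i < N ==> H (Y i) (p i) + V i \<bullet> (q - p i) <= H (Y i) q"
  using pV' by blast+
 define h where "h = T / real N"
 have h: "0 <= h" "real P * h = T / real J"
 proof -
  have "0 < P" by (simp add: P_def)
  then show "0 <= h" "real P * h = T / real J" using T J by (auto simp: h_def N_def)
 qed
 have tele: "X a - X (a + k) = (\<Sum>i\<in>{a..<a + k}. h *\<^sub>R V i)" if "a + k <= N" for a k
  using that
 proof (induction k)
  case (Suc k)
  then show ?case using XS[of "a + k"] by (simp add: h_def)
 qed simp
 have Xdist: "norm (X a - X (a + k)) <= f" if k: "k <= P" "a + k <= N" for a k
 proof -
  have "norm (X a - X (a + k)) <= (\<Sum>i\<in>{a..<a + k}. h * M)"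
   unfolding tele[OF k(2)]
  proof (rule order_trans[OF norm_sum], rule sum_mono)
   fix i assume "i \<in> {a..<a + k}"
   then have "norm (V i) <= M" using k pV(2)[of i] by simp
   then show "norm (h *\<^sub>R V i) <= h * M" using h by (simp add: mult_left_mono)
  qed
  also have "\<dots> = real k * h * M" by simp
  also have "\<dots> <= real P * h * M" using k h M by (intro mult_right_mono) auto
  also have "\<dots> = T / real J * M" using h by simp
  also have "\<dots> <= t / real J * M" using T J M by (intro mult_right_mono divide_right_mono) auto
  finally show ?thesis by (simp add: f_def mult.commute)
 qed
 define b where "b j = X (j * P)" for j
 have jP: "j * P <= N" if "j <= J" for j using that by (simp add: N_def)
 have ex_s: "\<exists>s. norm s <= d * f \<and> closed_segment (b (Suc j) + s) (b j + s) \<subseteq> U" if j: "j < J" for j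
 proof (rule G1(3)[OF f(1,2), where a' = "Y (Suc j * P)" and b' = "Y (j * P)"])
  have le: "j * P + P <= N" "Suc j * P <= N" "j * P <= N" using jP[of "Suc j"] jP[of j] j by auto
  show "norm (b (Suc j) - b j) <= f"
   using Xdist[of P "j * P"] le by (simp add: b_def norm_minus_commute add.commute)
  show "Y (Suc j * P) \<in> closure U" "Y (j * P) \<in> closure U" using le Y(1) by auto
  show "norm (b (Suc j) - Y (Suc j * P)) <= n * f" "norm (b j - Y (j * P)) <= n * f"
   unfolding b_def using Y(2)[OF le(2)] Y(2)[OF le(3)] S by linarith+
 qed
 then obtain s where s: "\<And>j. j < J ==> norm (s j) <= d * f" "\<And>j. j < J ==> closed_segment (b (Suc j) + s j) (b j + s j) \<subseteq> U"
  by metis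
 have df: "d * f <= f" using d f by (simp add: mult_left_le_one_le)
 define l where "l j = (\<Sum>i\<in>{j * P..<j * P + P}. h * (p i \<bullet> V i - H (Y i) (p i)))" for j
 \<comment> \<open>The trajectory runs backwards, so the travel is assembled from its end:
   \<open>E j\<close> is the start of the part made of the first j blocks, and \<open>E 0\<close> is
   the given end point itself.\<close>
 define E where "E j = (case j of 0 => x | Suc k => b j + s k)" for j
 define L where "L = R * (C * (2 * d * f))"
 have chunk: "trav U H R (T / real J) (b (Suc j) + s j) (b j + s j) (l j + T / real J * e)" if j: "j < J" for j
 proof (rule trav_single)
  show "0 <= T / real J" using T by simp
  show "closed_segment (b (Suc j) + s j) (b j + s j) \<subseteq> U" by (rule s(2)[OF j])
  fix w assume w: "w \<in> closed_segment (b (Suc j) + s j) (b j + s j)"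
  have le: "j * P + P <= N" using jP[of "Suc j"] j by auto
  have D: "b j + s j - (b (Suc j) + s j) = (\<Sum>i\<in>{j * P..<j * P + P}. h *\<^sub>R V i)"
   using tele[OF le] by (simp add: b_def add.commute)
  have wb: "norm (w - b j) <= 2 * f"
  proof -
   have "norm (w - (b j + s j)) <= norm ((b (Suc j) + s j) - (b j + s j))"
    using segment_bound(1)[of w "b j + s j" "b (Suc j) + s j"] w by (simp add: closed_segment_commute norm_minus_commute)
   also have "\<dots> <= f" using Xdist[of P "j * P"] le by (simp add: b_def norm_minus_commute add.commute)
   finally have 1: "norm (w - (b j + s j)) <= f" .
   have "norm (w - b j) <= norm (w - (b j + s j)) + norm (s j)"
    using norm_triangle_ineq[of "w - (b j + s j)" "s j"] by simp
   then show ?thesis using 1 s(1)[OF j] df by linarith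
  qed
  have each: "ell H R w (h *\<^sub>R V i) h <= h * (p i \<bullet> V i - H (Y i) (p i)) + h * e" if i: "i \<in> {j * P..<j * P + P}" for i
  proof -
   have iN: "i < N" using i le by simp
   have k: "i = j * P + (i - j * P)" "i - j * P <= P" using i by auto
   have "norm (b j - X i) <= f" using Xdist[of "i - j * P" "j * P"] k iN unfolding b_def by simp
   then have "norm (w - Y i) <= 2 * f + f + f"
    using wb Y(2)[of i] iN S(3) norm_triangle_ineq[of "w - b j" "b j - X i"] norm_triangle_ineq[of "w - X i" "X i - Y i"] by simp
   then have near: "dist (Y i) w < d1" using f(1,3) by (simp add: dist_norm norm_minus_commute)
   have "ell H R w (h *\<^sub>R V i) h <= ell H R (Y i) (h *\<^sub>R V i) h + h * e"
   proof (rule ell_change_point[OF R0 h(1)])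
    fix q :: 'a assume "norm q <= R"
    then show "H (Y i) q <= H w q + e" using d1(2)[OF _ near, of q] by linarith
   qed
   also have "ell H R (Y i) (h *\<^sub>R V i) h <= h * (p i \<bullet> V i - H (Y i) (p i))"
    by (rule ell_subgradient[OF pV(3)[OF iN] R0 h(1)])
   finally show ?thesis by simp
  qed
  \<comment> \<open>Joint sublinearity of \<open>ell\<close> bounds the cost of the chord by the sum
    over its Euler steps, once the base points are moved to w.\<close>
  have "ell H R w (\<Sum>i\<in>{j * P..<j * P + P}. h *\<^sub>R V i) (real (card {j * P..<j * P + P}) * h)
    <= (\<Sum>i\<in>{j * P..<j * P + P}. ell H R w (h *\<^sub>R V i) h)"
   by (rule ell_sum[OF _ R0 h(1)]) simp
  also have "\<dots> <= (\<Sum>i\<in>{j * P..<j * P + P}. h * (p i \<bullet> V i - H (Y i) (p i)) + h * e)"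
   by (rule sum_mono) (rule each)
  also have "\<dots> = l j + real P * h * e" by (simp add: l_def sum.distrib)
  finally show "ell H R w (b j + s j - (b (Suc j) + s j)) (T / real J) <= l j + T / real J * e"
   unfolding D using h(2) by simp
 qed
 have EU: "E j \<in> U" if "j <= J" for j
  using that x s(2)[of "j - 1"] by (cases j) (auto simp: E_def)
 have lnk: "trav U H R 0 (b j + s j) (E j) L" if j: "j < J" for j
 proof -
  have "norm (E j - b j) <= d * f"
   using s(1)[of "j - 1"] j X0 d f by (cases j) (auto simp: E_def b_def)
  then have "norm (b j + s j - E j) <= 2 * d * f"
   using norm_triangle_ineq[of "s j" "b j - E j"] s(1)[OF j] by (simp add: norm_minus_commute algebra_simps)
  moreover have "b j + s j \<in> U" using s(2)[OF j] by auto
  moreover have "E j \<in> U" using j by (intro EU) simp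
  moreover have "2 * (d * f) < r" using df f(1,4) by linarith
  then have "2 * d * f < r" by (simp only: mult.assoc)
  ultimately have "link U (b j + s j) (E j) (C * norm (b j + s j - E j))"
   by (intro rC(3)) auto
  from link_trav[OF this R0] have "trav U H R 0 (b j + s j) (E j) (R * (C * norm (b j + s j - E j)))" .
  moreover have "R * (C * norm (b j + s j - E j)) <= L"
   unfolding L_def using \<open>norm (b j + s j - E j) <= 2 * d * f\<close> R0 rC by (intro mult_left_mono) auto
  ultimately show ?thesis using trav_weaken[OF _ R0] by blast
 qed
 have main: "trav U H R (real j * (T / real J)) (E j) x (\<Sum>i<j. l i + T / real J * e + L)" if "j <= J" for j
  using that
 proof (induction j)
  case 0
  show ?case using x by (simp add: E_def trav_nil)
 next
  case (Suc j)
  then have j: "j < J" by simp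
  have ES: "E (Suc j) = b (Suc j) + s j" by (simp add: E_def)
  have 1: "trav U H R (T / real J + 0) (E (Suc j)) (E j) (l j + T / real J * e + L)"
   unfolding ES by (rule trav_trans[OF lnk[OF j] chunk[OF j]])
  have IH: "trav U H R (real j * (T / real J)) (E j) x (\<Sum>i<j. l i + T / real J * e + L)" using Suc by simp
  from trav_trans[OF IH 1]
  have "trav U H R (T / real J + 0 + real j * (T / real J)) (E (Suc j)) x
    (l j + T / real J * e + L + (\<Sum>i<j. l i + T / real J * e + L))" .
  moreover have "T / real J + 0 + real j * (T / real J) = real (Suc j) * (T / real J)" by (simp add: add_divide_distrib distrib_right)
  ultimately show ?case by (simp add: add.commute)
 qed
 have cost: "(\<Sum>i<J. l i + T / real J * e + L) <= (\<Sum>i<N. h * (p i \<bullet> V i - H (Y i) (p i))) + g / 4 + g / 4"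
 proof -
  have "(\<Sum>i<J. l i + T / real J * e + L) = (\<Sum>i<J. l i) + T * e + real J * L"
   using J by (simp add: sum.distrib)
  moreover have "(\<Sum>i<J. l i) = (\<Sum>i<N. h * (p i \<bullet> V i - H (Y i) (p i)))"
   unfolding l_def N_def by (rule sum.nat_group)
  moreover have "T * e <= t * e" using T e by (intro mult_right_mono) auto
  then have "T * e <= g / 4" using e(2) by linarith
  moreover have "real J * L <= g / 4"
  proof -
   have 1: "real J * f = M * t" using J by (simp add: f_def)
   have "real J * L = 2 * (R * C * (real J * f)) * d" by (simp add: L_def)
   then have "real J * L = 2 * (R * C * M * t) * d" unfolding 1 by (simp only: mult.assoc)
   then show ?thesis using d(3) by simp
  qed
  ultimately show ?thesis by linarith
 qed
 have tr: "trav U H R T (E J) x (\<Sum>i<J. l i + T / real J * e + L)" using main[of J] J by simp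
 have tr': "trav U H R t (E J) x (\<Sum>i<J. l i + T / real J * e + L)"
  by (rule trav_weaken[OF tr R0 T(2)]) simp
 have "z (E J, 0) <= z (Y N, 0) + g / 4"
 proof -
  obtain k where k: "J = Suc k" by (simp add: J_def)
  have "norm (E J - X N) <= d * f" using s(1)[of k] k by (simp add: E_def b_def N_def)
  then have "norm (E J - Y N) <= 2 * f"
  proof -
   have "norm (E J - Y N) <= norm (E J - X N) + norm (X N - Y N)"
    using norm_triangle_ineq[of "E J - X N" "X N - Y N"] by simp
   moreover have "norm (X N - Y N) <= f" using Y(2)[of N] S(3) by simp
   ultimately show ?thesis using \<open>norm (E J - X N) <= d * f\<close> df by linarith
  qed
  then have "dist (z (E J, 0)) (z (Y N, 0)) < g / 4"
   using f EU[of J] Y(1)[of N] closure_subset[of U] by (intro d0(2)) (auto simp: dist_norm)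
  then show ?thesis unfolding dist_real_def by linarith
 qed
 moreover have "z (Y N, 0) + (\<Sum>i<N. h * (p i \<bullet> V i - H (Y i) (p i))) <= z (x, t) + g / 4"
  using fin unfolding h_def .
 ultimately have "z (E J, 0) + (\<Sum>i<J. l i + T / real J * e + L) <= z (x, t) + g" using cost by linarith
 then show ?thesis using tr' by blast
qed

end

section \<open>Value functions are viscosity solutions\<close>

lemma C1_fun_continuous: "C1_fun f Df ==> isCont f q"
 unfolding C1_fun_def gderiv_def using has_derivative_continuous by blast

lemma C1_fun_line:
 assumes "C1_fun f Df"
 shows "((\<lambda>h. f (q + h *\<^sub>R v)) has_real_derivative (Df (q + s *\<^sub>R v) \<bullet> v)) (at s)"
proof -
 have d: "(f has_derivative (\<lambda>h. h \<bullet> Df (q + s *\<^sub>R v))) (at (q + s *\<^sub>R v))"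
  using assms unfolding C1_fun_def gderiv_def by blast
 have "((\<lambda>h. q + h *\<^sub>R v) has_derivative (\<lambda>h. h *\<^sub>R v)) (at s)"
  by (auto intro!: derivative_eq_intros)
 from has_derivative_compose[OF this d]
 have "((\<lambda>h. f (q + h *\<^sub>R v)) has_derivative (\<lambda>h. h *\<^sub>R v \<bullet> Df (q + s *\<^sub>R v))) (at s)" .
 then show ?thesis
  unfolding has_field_derivative_def
  by (rule has_derivative_eq_rhs) (simp add: fun_eq_iff inner_commute mult.commute)
qed

lemma C1_fun_dir_ge:
 assumes "C1_fun f Df" and e: "0 < e" and le: "\<And>h. 0 < h ==> h < e ==> h * a <= f (q + h *\<^sub>R v) - f q"
 shows "a <= Df q \<bullet> v"
proof (rule tendsto_lowerbound)
 have "((\<lambda>h. (f (q + h *\<^sub>R v) - f q) / h) \<longlongrightarrow> Df q \<bullet> v) (at 0)"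
  using C1_fun_line[OF assms(1), of q v 0] by (simp add: has_field_derivative_iff)
 then show "((\<lambda>h. (f (q + h *\<^sub>R v) - f q) / h) \<longlongrightarrow> Df q \<bullet> v) (at_right 0)"
  by (rule filterlim_mono) (auto simp: at_within_le_at)
 show "\<forall>\<^sub>F h in at_right 0. a <= (f (q + h *\<^sub>R v) - f q) / h"
  unfolding eventually_at_right_field
  by (rule exI[of _ e]) (use e le in \<open>auto simp: pos_le_divide_eq mult.commute\<close>)
qed auto

lemma C1_fun_mvt:
 assumes "C1_fun f Df"
 shows "\<exists>s\<in>{0..1}. f (q + v) - f q = Df (q + s *\<^sub>R v) \<bullet> v"
proof -
 have "\<exists>s>0. s < 1 \<and> f (q + 1 *\<^sub>R v) - f (q + 0 *\<^sub>R v) = (1 - 0) * (Df (q + s *\<^sub>R v) \<bullet> v)"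
  by (rule MVT2) (use C1_fun_line[OF assms] in auto)
 then show ?thesis by (auto intro!: bexI)
qed

context hamiltonian begin

lemma lipschitz_momentum:
 assumes M: "\<And>q. norm q <= r + 1 ==> H w q <= M" and p: "norm p <= r" and q: "norm q <= r"
 shows "\<bar>H w p - H w q\<bar> <= M * norm (p - q)"
proof -
 have "H w p - H w q <= M * norm (p - q)" if p: "norm p <= r" for p q
 proof -
  obtain v where v: "\<And>q. H w p + v \<bullet> (q - p) <= H w q" using subgradient_exists[OF convex[of w], of p] by blast
  have "norm v <= M" by (rule subgradient_bound[OF v]) (use M p in force)
  have "H w p - H w q <= v \<bullet> (p - q)" using v[of q] by (simp add: inner_diff_right)
  also have "\<dots> <= norm v * norm (p - q)" by (rule norm_cauchy_schwarz)
  also have "\<dots> <= M * norm (p - q)" using \<open>norm v <= M\<close> by (rule mult_right_mono) simp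
  finally show ?thesis .
 qed
 from this[OF p, of q] this[OF q, of p] show ?thesis by (simp add: norm_minus_commute abs_le_iff)
qed

lemma joint_continuity:
 assumes "0 < e"
 shows "\<exists>d>0. \<forall>w p. dist w x < d --> dist p P < d --> \<bar>H w p - H x P\<bar> < e"
proof -
 obtain M' where M': "\<And>y q. norm q <= (norm P + 1) + 1 ==> H y q <= M'" using locally_bounded by blast
 define M where "M = max 1 M'"
 have M: "\<And>y q. norm q <= (norm P + 1) + 1 ==> H y q <= M" "1 <= M" using M' by (auto simp: M_def le_max_iff_disj)
 obtain d where d: "0 < d" "\<And>y y' p. norm p <= norm P + 1 ==> dist y y' < d ==> \<bar>H y p - H y' p\<bar> < e / 2"
  using equicontinuous[of "e / 2" "norm P + 1"] assms by auto
 show ?thesis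
 proof (rule exI[of _ "min d (min 1 (e / (2 * M)))"], intro conjI allI impI)
  show "0 < min d (min 1 (e / (2 * M)))" using d M assms by simp
  fix w p assume w: "dist w x < min d (min 1 (e / (2 * M)))" and p: "dist p P < min d (min 1 (e / (2 * M)))"
  have np: "norm p <= norm P + 1" using p norm_triangle_sub[of p P] by (simp add: dist_norm)
  have "\<bar>H w p - H x p\<bar> < e / 2" by (rule d(2)) (use np w in auto)
  moreover have "\<bar>H x p - H x P\<bar> <= M * norm (p - P)" by (rule lipschitz_momentum[OF M(1) np]) auto
  moreover have "M * norm (p - P) <= e / 2"
  proof -
   have "norm (p - P) <= e / (2 * M)" using p by (simp add: dist_norm)
   then have "M * norm (p - P) <= M * (e / (2 * M))" using M by (intro mult_left_mono) auto
   then show ?thesis using M by simp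
  qed
  ultimately show "\<bar>H w p - H x P\<bar> < e" by linarith
 qed
qed

end

text \<open>Dynamic programming is available only in the open set, where travels live; on the
  closure \<open>Z\<close> is known through continuity. The boundary part of the supersolution
  property has to be extracted from this.\<close>

locale value_function = hamiltonian H
 for H :: "'a::euclidean_space => 'a => real" +
 fixes U :: "'a set" and Z :: "'a \<times> real => real" and K1 R :: real
 assumes opn: "open U" and cont: "continuous_on (closure U \<times> {0..}) Z"
  and K1: "0 <= K1" and thr: "\<And>y p. R <= norm p ==> K1 < H y p"
  and dpp_le: "\<And>x y h c t. trav U H R h y x c ==> 0 <= t ==> Z (x, t + h) <= Z (y, t) + c"
  and dpp_ge: "\<And>x t h \<beta>. x \<in> U ==> 0 <= t ==> 0 <= h ==> 0 < \<beta> ==>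
    \<exists>y c. trav U H R h y x c \<and> Z (y, t) + c <= Z (x, t + h) + \<beta>"
  and time_low: "\<And>x s h. x \<in> closure U ==> 0 <= s ==> 0 <= h ==> Z (x, s) - K1 * h <= Z (x, s + h)"
begin

lemma R_pos: "0 < R"
 using thr[of 0 undefined] K1 zero by force

text \<open>Short straight travels give P \<bullet> V + Q \<le> L(x0, V) for every velocity V.
  Taking V as a subgradient at the truncated gradient inverts the Legendre transform, and a gradient
  longer than \<open>R\<close> is excluded by the bound Q \<ge> - \<open>K1\<close>.\<close>

lemma subsolution: "HJ_sub H U Z"
 unfolding visc_subsolution_def
proof (intro allI ballI impI)
 fix f Df and q0 :: "'a \<times> real"
 assume q0: "q0 \<in> U \<times> {0<..}" and C1: "C1_fun f Df"
  and ev: "\<forall>\<^sub>F q in at q0 within U \<times> {0<..}. Z q - f q <= Z q0 - f q0"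
 obtain x0 t0 where q: "q0 = (x0, t0)" by (cases q0)
 obtain P Q where PQ: "Df q0 = (P, Q)" by (cases "Df q0")
 have x0: "x0 \<in> U" "0 < t0" using q0 q by auto
 obtain d where d: "0 < d" "\<And>q. q \<in> U \<times> {0<..} ==> dist q q0 < d ==> Z q - f q <= Z q0 - f q0"
  using ev unfolding eventually_at by (metis order_refl)
 obtain r where r: "0 < r" "cball x0 r \<subseteq> U" using opn x0 open_contains_cball by metis
 have lowQ: "- K1 <= Q"
 proof -
  have "- K1 <= Df q0 \<bullet> (0, 1)"
  proof (rule C1_fun_dir_ge[OF C1 d(1)])
   fix h :: real assume h: "0 < h" "h < d"
   have e: "q0 + h *\<^sub>R (0, 1) = (x0, t0 + h)" by (simp add: q)
   have "Z (x0, t0 + h) - f (x0, t0 + h) <= Z q0 - f q0"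
    by (rule d(2)) (use x0 h in \<open>auto simp: q dist_Pair_Pair dist_real_def\<close>)
   moreover have "Z (x0, t0) - K1 * h <= Z (x0, t0 + h)"
    by (rule time_low) (use x0 h closure_subset in auto)
   ultimately show "h * - K1 <= f (q0 + h *\<^sub>R (0, 1)) - f q0" unfolding e q by (simp add: mult.commute)
  qed
  then show ?thesis by (simp add: PQ)
 qed
 have key: "P \<bullet> V + Q <= ell H R x0 V 1" for V
 proof (rule field_le_epsilon)
  fix e :: real assume e: "0 < e"
  obtain d1 where d1: "0 < d1" "\<And>w w' p. norm p <= R ==> dist w w' < d1 ==> \<bar>H w p - H w' p\<bar> < e"
   using equicontinuous[OF e, of R] by blast
  define n where "n = norm V + 1"
  have n: "1 <= n" "norm V <= n" by (auto simp: n_def)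
  define m where "m = min (min (r / n) (d1 / n)) (min (t0 / 2) (d / (2 * n)))"
  have m: "0 < m" using r d1 x0 d n by (simp add: m_def)
  have "- (ell H R x0 V 1 + e) <= Df q0 \<bullet> (- V, - 1)"
  proof (rule C1_fun_dir_ge[OF C1 m])
   fix h :: real assume h: "0 < h" "h < m"
   have hn: "h * n < r" "h * n < d1" "2 * (h * n) < d" "h < t0"
   proof -
    have "h < r / n" "h < d1 / n" "h < d / (2 * n)" "h < t0 / 2" using h by (auto simp: m_def)
    then show "h * n < r" "h * n < d1" "2 * (h * n) < d" "h < t0"
     using n x0 by (auto simp: pos_less_divide_eq mult.left_commute)
   qed
   have hV: "norm (h *\<^sub>R V) <= h * n" using h n by (simp add: mult_left_mono)
   have segd: "dist w x0 <= h * n" if "w \<in> closed_segment (x0 - h *\<^sub>R V) x0" for w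
   proof -
    have "norm (w - x0) <= norm (x0 - h *\<^sub>R V - x0)"
     using segment_bound(1)[of w x0 "x0 - h *\<^sub>R V"] that by (simp add: closed_segment_commute)
    then show ?thesis using hV by (simp add: dist_norm)
   qed
   have seg: "closed_segment (x0 - h *\<^sub>R V) x0 \<subseteq> U"
   proof
    fix w assume "w \<in> closed_segment (x0 - h *\<^sub>R V) x0"
    then have "w \<in> cball x0 r" using segd hn(1) by (force simp: dist_commute)
    then show "w \<in> U" using r by blast
   qed
   have tr: "trav U H R h (x0 - h *\<^sub>R V) x0 (h * (ell H R x0 V 1 + e))"
   proof (rule trav_single)
    fix w assume w: "w \<in> closed_segment (x0 - h *\<^sub>R V) x0"
    have "ell H R w (h *\<^sub>R V) (h * 1) <= h * ell H R w V 1"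
     by (rule ell_scale) (use R_pos h in auto)
    also have "\<dots> <= h * (ell H R x0 V 1 + 1 * e)"
    proof (rule mult_left_mono[OF ell_change_point])
     fix p :: 'a assume "norm p <= R"
     then have "\<bar>H x0 p - H w p\<bar> < e" using segd[OF w] hn(2) by (intro d1(2)) (auto simp: dist_commute)
     then show "H x0 p <= H w p + e" by linarith
    qed (use R_pos h in auto)
    finally show "ell H R w (x0 - (x0 - h *\<^sub>R V)) h <= h * (ell H R x0 V 1 + e)" by simp
   qed (use h seg in auto)
   have "Z (x0, (t0 - h) + h) <= Z (x0 - h *\<^sub>R V, t0 - h) + h * (ell H R x0 V 1 + e)"
    by (rule dpp_le[OF tr]) (use hn in auto)
   moreover have "Z (x0 - h *\<^sub>R V, t0 - h) - f (x0 - h *\<^sub>R V, t0 - h) <= Z q0 - f q0"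
   proof (rule d(2))
    show "(x0 - h *\<^sub>R V, t0 - h) \<in> U \<times> {0<..}" using seg hn by auto
    have "norm (- (h *\<^sub>R V), - h) <= norm (h *\<^sub>R V) + norm h"
     using norm_Pair_le[of "- (h *\<^sub>R V)" "- h"] by simp
    also have "\<dots> <= h * n + h * n" using hV h n mult_left_mono[of 1 n h] by (intro add_mono) auto
    finally show "dist (x0 - h *\<^sub>R V, t0 - h) q0 < d" using hn by (simp add: q dist_norm)
   qed
   ultimately have "- (h * (ell H R x0 V 1 + e)) <= f (x0 - h *\<^sub>R V, t0 - h) - f q0"
    unfolding q diff_add_cancel by linarith
   moreover have "q0 + h *\<^sub>R (- V, - 1) = (x0 - h *\<^sub>R V, t0 - h)" by (simp add: q)
   ultimately show "h * - (ell H R x0 V 1 + e) <= f (q0 + h *\<^sub>R (- V, - 1)) - f q0"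
    by (simp only: mult_minus_right)
  qed
  then show "P \<bullet> V + Q <= ell H R x0 V 1 + e" by (simp add: PQ)
 qed
 have "Q + H x0 P <= 0"
 proof -
  define p where "p = (if norm P <= R then P else (R / norm P) *\<^sub>R P)"
  obtain V where V: "\<And>q. H x0 p + V \<bullet> (q - p) <= H x0 q" using subgradient_exists[OF convex[of x0], of p] by blast
  have "ell H R x0 (1 *\<^sub>R V) 1 <= 1 * (p \<bullet> V - H x0 p)"
   by (rule ell_subgradient[OF V]) (use R_pos in auto)
  then have le: "P \<bullet> V + Q <= p \<bullet> V - H x0 p" using key[of V] by simp
  show ?thesis
  proof (cases "norm P <= R")
   case True
   then show ?thesis using le by (simp add: p_def)
  next
   case False
   then have pP: "p = (R / norm P) *\<^sub>R P" by (simp add: p_def)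
   have "norm p = R" using False R_pos by (auto simp: pP)
   then have "K1 < H x0 p" by (intro thr) simp
   moreover have "p \<bullet> V <= P \<bullet> V" by (rule truncated_momentum[OF V R_pos _ pP]) (use False in simp)
   ultimately show ?thesis using le lowQ by linarith
  qed
 qed
 then show "(case q0 of (x, t) => \<lambda>(p, s). s + H x p) (Df q0) <= 0" by (simp add: q[symmetric] PQ) (simp add: q)
qed

text \<open>Where the equation is violated strictly, with room g in the momentum, a travel costs
  more than the test function increases. Perturbing the momentum along each segment makes the margin
  grow with the displacement too, which matters because a jump takes no time.\<close>

lemma test_along:
 assumes C1: "C1_fun f Df" and tr: "trav W H R T y x c"
  and strict: "\<And>w s e. w \<in> W ==> a <= s ==> s <= b ==> norm e <= g ==>
    norm (fst (Df (w, s)) + e) <= R \<and> snd (Df (w, s)) + H w (fst (Df (w, s)) + e) <= - Q"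
  and g: "0 <= g" and s: "a <= s0" "s0 + T <= b"
 shows "f (x, s0 + T) - f (y, s0) <= c - Q * T - g * norm (x - y)"
 using tr s
proof (induction rule: trav.induct)
 case (trav_step T x y c h z l)
 have T0: "0 <= T" using trav_in[OF trav_step(1)] by simp
 have IH: "f (y, s0 + T) - f (x, s0) <= c - Q * T - g * norm (y - x)"
  using trav_step by simp
 let ?d = "z - y"
 obtain u where u: "u \<in> {0..1}" "f ((y, s0 + T) + (?d, h)) - f (y, s0 + T) = Df ((y, s0 + T) + u *\<^sub>R (?d, h)) \<bullet> (?d, h)"
  using C1_fun_mvt[OF C1, of "(y, s0 + T)" "(?d, h)"] by blast
 define w where "w = y + u *\<^sub>R ?d"
 define s where "s = s0 + T + u * h"
 have w: "w \<in> closed_segment y z" using u(1) unfolding w_def by (auto simp: in_segment algebra_simps intro!: exI[of _ u])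
 have uh: "0 <= u * h" "u * h <= h" using u(1) trav_step(2) by (auto simp: mult_left_le_one_le)
 have sab: "a <= s" "s <= b" using uh T0 trav_step.prems by (auto simp: s_def)
 obtain p q where pq: "Df (w, s) = (p, q)" by (cases "Df (w, s)")
 define e where "e = (if ?d = 0 then 0 else (g / norm ?d) *\<^sub>R ?d)"
 have ne: "norm e <= g" using g by (simp add: e_def)
 have ed: "e \<bullet> ?d = g * norm ?d" by (simp add: e_def dot_square_norm power2_eq_square)
 have st: "norm (p + e) <= R" "q + H w (p + e) <= - Q"
  using strict[OF _ sab ne, of w] w trav_step(3) by (auto simp: pq)
 have "(p + e) \<bullet> ?d - h * H w (p + e) <= ell H R w ?d h" by (rule ell_ge[OF trav_step(2) st(1)])
 also have "\<dots> <= l" by (rule trav_step(4)[OF w])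
 finally have 1: "(p + e) \<bullet> ?d - h * H w (p + e) <= l" .
 have "h * (q + H w (p + e)) <= h * (- Q)" using st(2) trav_step(2) by (rule mult_left_mono)
 then have "p \<bullet> ?d + q * h <= l - Q * h - g * norm ?d"
  using 1 ed by (simp add: inner_add_left algebra_simps)
 moreover have "f (z, s0 + T + h) - f (y, s0 + T) = p \<bullet> ?d + q * h"
  using u(2) pq by (simp add: w_def s_def)
 moreover have "g * norm (z - x) <= g * norm ?d + g * norm (y - x)"
  unfolding distrib_left[symmetric] using g norm_triangle_ineq[of ?d "y - x"] by (intro mult_left_mono) auto
 ultimately show ?case using IH by (simp add: algebra_simps)
qed simp

text \<open>An almost optimal travel ending at an interior point near x0 is cut after its last visit
  outside a small ball. Either the whole travel stays inside and the margin in time contradicts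
  optimality, or it crosses the ball, possibly by a jump, and the margin in displacement
  does.\<close>

lemma supersolution: "HJ_super H (closure U) Z"
 unfolding visc_supersolution_def
proof (intro allI ballI impI)
 fix g Dg and q0 :: "'a \<times> real"
 assume q0: "q0 \<in> closure U \<times> {0<..}" and C1: "C1_fun g Dg"
  and ev: "\<forall>\<^sub>F q in at q0 within closure U \<times> {0<..}. Z q0 - g q0 <= Z q - g q"
 obtain x0 t0 where q: "q0 = (x0, t0)" by (cases q0)
 obtain P Q where PQ: "Dg q0 = (P, Q)" by (cases "Dg q0")
 have x0: "x0 \<in> closure U" "0 < t0" using q0 q by auto
 obtain d where d: "0 < d" "\<And>q. q \<in> closure U \<times> {0<..} ==> dist q q0 < d ==> Z q0 - g q0 <= Z q - g q"
  using ev unfolding eventually_at by (metis order_refl)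
 have "0 <= Q + H x0 P"
 proof (rule ccontr)
  assume "\<not> ?thesis"
  then have neg: "Q + H x0 P < 0" by simp
  have "K1 >= - Q"
  proof -
   have "- K1 <= - (Dg q0 \<bullet> (0, - 1))"
   proof -
    define m where "m = min d t0"
    have "Dg q0 \<bullet> (0, - 1) <= K1"
    proof -
     have "- K1 <= - Dg q0 \<bullet> (0, - 1)"
     proof (rule C1_fun_dir_ge[of "\<lambda>q. - g q" "\<lambda>q. - Dg q" m])
      show "C1_fun (\<lambda>q. - g q) (\<lambda>q. - Dg q)"
       using C1 unfolding C1_fun_def gderiv_def
       by (auto intro!: derivative_eq_intros continuous_intros simp: fun_eq_iff)
      show "0 < m" using d x0 by (simp add: m_def)
      fix h :: real assume h: "0 < h" "h < m"
      have e: "q0 + h *\<^sub>R (0, - 1) = (x0, t0 - h)" by (simp add: q)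
      have "Z q0 - g q0 <= Z (x0, t0 - h) - g (x0, t0 - h)"
       by (rule d(2)) (use x0 h in \<open>auto simp: q m_def dist_Pair_Pair dist_real_def\<close>)
      moreover have "Z (x0, t0 - h) - K1 * h <= Z (x0, (t0 - h) + h)"
       by (rule time_low) (use x0 h in \<open>auto simp: m_def\<close>)
      ultimately show "h * - K1 <= - g (q0 + h *\<^sub>R (0, - 1)) - - g q0" unfolding e by (simp add: q mult.commute)
     qed
     then show ?thesis by simp
    qed
    then show ?thesis by simp
   qed
   then show ?thesis by (simp add: PQ)
  qed
  then have "H x0 P < K1" using neg by linarith
  then have PR: "norm P < R" using thr[of P x0] by force
  \<comment> \<open>One third of the defect absorbs the variation of \<open>H\<close>, one third
    that of the time derivative, and the last third is the strict margin.\<close>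
  define j where "j = - (Q + H x0 P) / 3"
  have j: "0 < j" "Q + H x0 P = - 3 * j" using neg by (auto simp: j_def)
  obtain d1 where d1: "0 < d1" "\<And>w p. dist w x0 < d1 ==> dist p P < d1 ==> \<bar>H w p - H x0 P\<bar> < j"
   using joint_continuity[OF j(1), of x0 P] by blast
  obtain i where "0 < i" "\<forall>(a, b)\<in>set [(4, d1), (4, R - norm P)]. a * i <= b"
   using small_scale[of "[(4, d1), (4, R - norm P)]"] d1 PR by auto
  then have i: "0 < i" "4 * i <= d1" "norm P + 4 * i <= R" by auto
  have "continuous_on UNIV Dg" using C1 unfolding C1_fun_def by blast
  then have "isCont Dg q0" by (rule continuous_on_interior) simp
  moreover have "0 < min i j" using i j by simp
  ultimately obtain d2 where d2: "0 < d2" "\<And>q. dist q q0 < d2 ==> dist (Dg q) (Dg q0) < min i j"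
   unfolding continuous_at_eps_delta by blast
  obtain f where "0 < f" "\<forall>(a, b)\<in>set [(2, d1), (4, d2), (4, d), (4, t0)]. a * f <= b"
   using small_scale[of "[(2, d1), (4, d2), (4, d), (4, t0)]"] d1 d2 d x0 by auto
  then have f: "0 < f" "f < d1" "4 * f <= d2" "4 * f <= d" "4 * f <= t0" by auto
  have near: "dist (w, s) q0 < 2 * f" if "dist w x0 < f" "t0 - f <= s" "s <= t0" for w s
  proof -
   have "dist (w, s) q0 <= dist w x0 + dist s t0"
    using norm_Pair_le[of "w - x0" "s - t0"] by (simp add: q dist_norm)
   then show ?thesis using that by (simp add: dist_real_def)
  qed
  have strict: "norm (fst (Dg (w, s)) + e) <= R \<and> snd (Dg (w, s)) + H w (fst (Dg (w, s)) + e) <= - j"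
   if w: "w \<in> ball x0 f" and s: "t0 - f <= s" "s <= t0" and e: "norm e <= i" for w s e
  proof -
   have wx: "dist w x0 < f" using w by (simp add: dist_commute)
   have "dist (Dg (w, s)) (P, Q) < min i j"
    using d2(2)[of "(w, s)"] near[OF wx s] f PQ by simp
   moreover obtain p r where pr: "Dg (w, s) = (p, r)" by (cases "Dg (w, s)")
   ultimately have p: "norm (p - P) < i" "\<bar>r - Q\<bar> < j"
    using norm_fst_le[of "p - P" "r - Q"] norm_snd_le[of "r - Q" "p - P"] by (auto simp: dist_norm)
   have "norm (p + e - P) <= norm (p - P) + norm e" using norm_triangle_ineq[of "p - P" e] by (simp add: algebra_simps)
   then have pe: "norm (p + e - P) < 2 * i" using p e by simp
   then have "norm (p + e) <= R" using norm_triangle_ineq2[of "p + e" P] i by linarith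
   moreover have "\<bar>H w (p + e) - H x0 P\<bar> < j"
    by (rule d1(2)) (use wx f pe i in \<open>auto simp: dist_norm\<close>)
   then have "r + H w (p + e) <= - j" using p(2) j(2) by linarith
   ultimately show ?thesis by (simp add: pr)
  qed
  \<comment> \<open>The total slack is 2 k: once from the near-optimal travel, once from replacing
    x0 by an interior point. It must stay below both possible gains, \<open>j * f\<close> and
    \<open>i * (f / 4)\<close>.\<close>
  obtain k where "0 < k" "\<forall>(a, b)\<in>set [(3, j * f), (3, i * (f / 4))]. a * k <= b"
   using small_scale[of "[(3, j * f), (3, i * (f / 4))]"] j i f by auto
  then have k: "0 < k" "2 * k < j * f" "2 * k < i * (f / 4)" by auto
  have "continuous (at q0 within closure U \<times> {0..}) (\<lambda>q. Z q - g q)"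
  proof (rule continuous_diff)
   have "q0 \<in> closure U \<times> {0..}" using q0 by auto
   then show "continuous (at q0 within closure U \<times> {0..}) Z"
    using cont unfolding continuous_on_eq_continuous_within by blast
   show "continuous (at q0 within closure U \<times> {0..}) g"
    by (rule continuous_at_imp_continuous_at_within[OF C1_fun_continuous[OF C1]])
  qed
  then obtain d3 where d3: "0 < d3" "\<And>q. q \<in> closure U \<times> {0..} ==> dist q q0 < d3 ==> dist (Z q - g q) (Z q0 - g q0) < k"
   unfolding continuous_within_eps_delta using k(1) by blast
  obtain x1 where x1: "x1 \<in> U" "dist x1 x0 < min d3 (f / 4)"
 proof -
   have "0 < min d3 (f / 4)" using d3 f by simp
   with x0(1) show ?thesis using that unfolding closure_approachable by blast
  qed
  have x1c: "x1 \<in> closure U" using x1 closure_subset by blast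
  have up: "Z (x1, t0) - g (x1, t0) < Z q0 - g q0 + k"
   using d3(2)[of "(x1, t0)"] x1 x1c x0 by (auto simp: q dist_Pair_Pair dist_real_def)
  have t0f: "0 <= t0 - f" "0 <= f" using f by auto
  from dpp_ge[OF x1(1) t0f k(1)]
  obtain y c where yc: "trav U H R f y x1 c" "Z (y, t0 - f) + c <= Z (x1, (t0 - f) + f) + k"
   by (elim exE conjE) (rule that)
  have R0: "0 <= R" using R_pos by simp
  obtain X :: "real => 'a" and u l L where c: "L-lipschitz_on {0..1} (\<lambda>s. (X s, u s, l s))"
   "X 0 = y" "u 0 = 0" "l 0 = 0" "X 1 = x1" "u 1 = f" "l 1 = c"
   "\<And>a b. 0 <= a ==> a <= b ==> b <= 1 ==> trav (X ` {a..b}) H R (u b - u a) (X a) (X b) (l b - l a)"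
   "X ` {0..1} \<subseteq> U"
   by (rule trav_curve_unit[OF yc(1) R0], rule that) assumption+
  have "continuous_on {0..1} (\<lambda>s. fst (X s, u s, l s))"
   by (intro continuous_on_fst lipschitz_on_continuous_on[OF c(1)])
  then have Xc: "continuous_on {0..1} X" by simp
  \<comment> \<open>Parameters at which the curve is outside the open ball of radius f / 2. The
    largest of them, or 0 if there is none, is where the final part inside the ball begins.\<close>
  define B where "B = {s \<in> {0..1}. f / 2 <= dist (X s) x0}"
  have "\<exists>a\<in>{0..1}. (a = 0 \<or> f / 2 <= dist (X a) x0) \<and> (\<forall>s\<in>{a..1}. dist (X s) x0 <= f / 2 \<or> s = a)"
  proof (cases "B = {}")
   case True
   then have "dist (X s) x0 <= f / 2" if "s \<in> {0..1}" for s using that unfolding B_def by force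
   then show ?thesis by (intro bexI[of _ 0]) auto
  next
   case False
   have "closed B" unfolding B_def
    by (intro continuous_closed_preimage_constant continuous_on_closed_Collect_le) (auto intro!: continuous_intros Xc)
   moreover have "bounded B" unfolding B_def by (rule bounded_subset[of "{0..1}"]) auto
   ultimately have "compact B" by (simp add: compact_eq_bounded_closed)
   then obtain a where a: "a \<in> B" "\<forall>s\<in>B. s <= a" using compact_attains_sup[OF _ False] by blast
   show ?thesis
   proof (rule bexI[of _ a], intro conjI ballI)
    show "a = 0 \<or> f / 2 <= dist (X a) x0" using a by (simp add: B_def)
    fix s assume s: "s \<in> {a..1}"
    show "dist (X s) x0 <= f / 2 \<or> s = a"
    proof (rule ccontr)
     assume "\<not> ?thesis"
     then have "s \<in> B" "s \<noteq> a" using s a by (auto simp: B_def)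
     then show False using a s by force
    qed
   qed (use a in \<open>simp add: B_def\<close>)
  qed
  then obtain a where a01: "a \<in> {0..1}" and a3: "a = 0 \<or> f / 2 <= dist (X a) x0"
   and a4: "\<forall>s\<in>{a..1}. dist (X s) x0 <= f / 2 \<or> s = a"
   by (elim bexE conjE) (rule that)
  have a: "0 <= a" "a <= 1" "a = 0 \<or> f / 2 <= dist (X a) x0"
   "\<And>s. s \<in> {a..1} ==> dist (X s) x0 <= f / 2 \<or> s = a"
   using a01 a3 a4 by simp_all
  have Xa: "dist (X a) x0 <= f / 2"
  proof (cases "a = 1")
   case True
   then show ?thesis using x1 c(5) f by simp
  next
   case False
   have "continuous_on {a..1} (\<lambda>s. dist (X s) x0)"
    by (intro continuous_intros continuous_on_subset[OF Xc]) (use a in auto)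
   then have "((\<lambda>s. dist (X s) x0) \<longlongrightarrow> dist (X a) x0) (at a within {a..1})"
    using a False by (simp add: continuous_on_def)
   moreover have "at a within {a..1} = at_right a" using a False by (simp add: at_within_Icc_at_right)
   ultimately have lim: "((\<lambda>s. dist (X s) x0) \<longlongrightarrow> dist (X a) x0) (at_right a)" by simp
   show ?thesis
   proof (rule tendsto_upperbound[OF lim])
    show "\<forall>\<^sub>F s in at_right a. dist (X s) x0 <= f / 2"
     unfolding eventually_at_right_field
    proof (rule exI[of _ 1], intro conjI allI impI)
     show "a < 1" using a False by simp
     show "dist (X s) x0 <= f / 2" if "a < s" "s < 1" for s using a(4)[of s] that by auto
    qed
   qed simp
  qed
  have inball: "X ` {a..1} \<subseteq> ball x0 f"
  proof
   fix w assume "w \<in> X ` {a..1}"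
   then obtain s where s: "s \<in> {a..1}" "w = X s" by blast
   then have "dist (X s) x0 <= f / 2" using a(4)[OF s(1)] Xa by auto
   then show "w \<in> ball x0 f" using s f by (simp add: dist_commute)
  qed
  have tail: "trav (X ` {a..1}) H R (f - u a) (X a) x1 (c - l a)"
   using c(8)[OF a(1,2) order_refl] by (simp only: c(5-7))
  have head: "trav (X ` {0..a}) H R (u a) y (X a) (l a)"
   using c(8)[OF order_refl a(1,2)] by (simp only: c(2-4) diff_0_right)
  have ua: "0 <= u a" "u a <= f" using trav_in[OF head] trav_in[OF tail] by auto
  have headU: "trav U H R (u a) y (X a) (l a)"
   by (rule trav_mono_set[OF head]) (use c(9) a in fastforce)
  define s0 where "s0 = t0 - f + u a"
  have 1: "Z (X a, s0) <= Z (y, t0 - f) + l a"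
   unfolding s0_def by (rule dpp_le[OF headU]) (use f in simp)
  have XaU: "X a \<in> closure U" using c(9) a01 closure_subset[of U] by blast
  have 2: "Z q0 - g q0 <= Z (X a, s0) - g (X a, s0)"
  proof (rule d(2))
   show "(X a, s0) \<in> closure U \<times> {0<..}" using XaU f ua by (auto simp: s0_def)
   have "dist (X a, s0) q0 < 2 * f" by (rule near) (use Xa f ua in \<open>auto simp: s0_def\<close>)
   then show "dist (X a, s0) q0 < d" using f by linarith
  qed
  have "g (x1, s0 + (f - u a)) - g (X a, s0) <= (c - l a) - j * (f - u a) - i * norm (x1 - X a)"
  proof (rule test_along[OF C1 tail, of "t0 - f" t0])
   show "norm (fst (Dg (w, s)) + e) <= R \<and> snd (Dg (w, s)) + H w (fst (Dg (w, s)) + e) <= - j"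
    if "w \<in> X ` {a..1}" "t0 - f <= s" "s <= t0" "norm e <= i" for w s e
    by (rule strict) (use that inball in auto)
  qed (use i ua in \<open>auto simp: s0_def\<close>)
  moreover have "s0 + (f - u a) = t0" by (simp add: s0_def)
  ultimately have 3: "g (x1, t0) - g (X a, s0) <= (c - l a) - j * (f - u a) - i * norm (x1 - X a)" by simp
  have 4: "Z (y, t0 - f) + c <= Z (x1, t0) + k" using yc(2) by simp
  have le: "j * (f - u a) + i * norm (x1 - X a) <= 2 * k" using 1 2 3 4 up by linarith
  have pos: "0 <= j * (f - u a)" "0 <= i * norm (x1 - X a)" using j i ua by auto
  show False
  proof (cases "a = 0")
   case True
   then show False using le pos k c(3) by simp
  next
   case False
   then have "f / 2 <= dist (X a) x0" using a(3) by simp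
   then have "f / 4 <= norm (x1 - X a)"
    using x1(2) dist_triangle[of "X a" x0 x1] by (simp add: dist_norm norm_minus_commute)
   then have "i * (f / 4) <= i * norm (x1 - X a)" using i by (intro mult_left_mono) auto
   then show False using le pos k by linarith
  qed
 qed
 then show "0 <= (case q0 of (x, t) => \<lambda>(p, s). s + H x p) (Dg q0)" by (simp add: q[symmetric] PQ) (simp add: q)
qed

end

section \<open>Geometry of perforated domains\<close>

text \<open>Polygons with their exact length, free of any Hamiltonian, so that geometric constants
  depend on the domain alone; \<open>conn_trav\<close> turns them into travels of duration
  0.\<close>

inductive conn :: "'a::real_normed_vector set => 'a => 'a => real => bool" for U where
 conn_nil: "x \<in> U ==> conn U x x 0"
| conn_step: "conn U x y l ==> closed_segment y z \<subseteq> U ==> conn U x z (l + norm (z - y))"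

lemma conn_in: "conn U x y l ==> x \<in> U \<and> y \<in> U \<and> norm (y - x) <= l"
proof (induction rule: conn.induct)
 case (conn_step x y l z)
 have "norm (z - x) <= norm (z - y) + norm (y - x)" using norm_triangle_ineq[of "z - y" "y - x"] by simp
 then show ?case using conn_step by auto
qed simp

lemma conn_trans: "conn U y z m ==> conn U x y l ==> conn U x z (l + m)"
proof (induction rule: conn.induct)
 case (conn_step y z m w)
 show ?case using conn.conn_step[OF conn_step.IH[OF conn_step.prems] conn_step.hyps(2)] by (simp add: add.assoc)
qed simp

lemma conn_segment: "closed_segment x y \<subseteq> U ==> conn U x y (norm (y - x))"
 using conn_step[OF conn_nil, of x U y] by auto

lemma conn_sym: "conn U x y l ==> conn U y x l"
proof (induction rule: conn.induct)
 case (conn_step x y l z)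
 have "conn U z y (norm (y - z))"
  by (rule conn_segment) (use conn_step in \<open>simp add: closed_segment_commute\<close>)
 from conn_trans[OF conn_step.IH this] show ?case by (simp add: norm_minus_commute add.commute)
qed (rule conn_nil)

lemma conn_translate:
 assumes "conn U x y l" "\<And>w. w \<in> U ==> w + m \<in> U"
 shows "conn U (x + m) (y + m) l"
 using assms
proof (induction rule: conn.induct)
 case (conn_step x y l z)
 have "closed_segment (y + m) (z + m) = (\<lambda>w. w + m) ` closed_segment y z"
  using closed_segment_translation[of m y z] by (simp add: add.commute)
 then have "closed_segment (y + m) (z + m) \<subseteq> U" using conn_step by auto
 from conn.conn_step[OF conn_step.IH[OF conn_step.prems] this] show ?case by simp
qed (auto intro: conn_nil)

lemma link_conn: "link U x y l ==> \<exists>l'\<le>l. conn U x y l'"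
proof -
 assume "link U x y l"
 then obtain a b where ab: "closed_segment x a \<subseteq> U" "closed_segment a b \<subseteq> U" "closed_segment b y \<subseteq> U"
   "norm (a - x) + norm (b - a) + norm (y - b) <= l" unfolding link_def by blast
 have "conn U x y (norm (a - x) + norm (b - a) + norm (y - b))"
  using conn_step[OF conn_step[OF conn_segment[OF ab(1)] ab(2)] ab(3)] .
 then show ?thesis using ab(4) by blast
qed

lemma (in hamiltonian) conn_trav:
 assumes "conn U x y l" and R: "0 <= R" shows "trav U H R 0 x y (R * l)"
 using assms(1)
proof (induction rule: conn.induct)
 case (conn_step x y l z)
 from trav_trans[OF trav_jump[OF conn_step(2) R] conn_step.IH] show ?case by (simp add: distrib_left)
qed (simp add: trav_nil)

lemma connected_conn:
 assumes U: "open U" "connected U" and xy: "x \<in> U" "y \<in> U"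
 shows "\<exists>l. conn U x y l"
proof (rule connected_equivalence_relation[OF U(2) xy])
 show "\<exists>l. conn U y x l" if "\<exists>l. conn U x y l" for x y using that conn_sym by blast
 show "\<exists>l. conn U x z l" if "\<exists>l. conn U x y l" "\<exists>l. conn U y z l" for x y z
  using that conn_trans by blast
 fix a assume a: "a \<in> U"
 then obtain r where r: "0 < r" "ball a r \<subseteq> U" using U(1) open_contains_ball by blast
 show "\<exists>T. openin (top_of_set U) T \<and> a \<in> T \<and> (\<forall>x\<in>T. \<exists>l. conn U a x l)"
 proof (intro exI[of _ "ball a r"] conjI ballI)
  show "openin (top_of_set U) (ball a r)" using r by (intro open_subset) auto
  fix x assume "x \<in> ball a r"
  then have "closed_segment a x \<subseteq> U" using r by (intro subset_trans[OF closed_segment_subset]) auto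
  then show "\<exists>l. conn U a x l" using conn_segment by blast
 qed (use r in simp)
qed

text \<open>A Lebesgue number for finitely many of the local balls gives the radius, and the largest
  of their constants serves everywhere by monotonicity.\<close>

lemma compact_uniform_radius:
 fixes K :: "'a::euclidean_space set" and Q :: "real => 'a set => bool"
 assumes K: "compact K" and loc: "\<And>x. x \<in> K ==> \<exists>r>0. \<exists>c. Q c (ball x r)"
  and mono: "\<And>c c' B B'. Q c B ==> c <= c' ==> B' \<subseteq> B ==> Q c' B'"
 shows "\<exists>e>0. \<exists>c. \<forall>x\<in>K. Q c (ball x e)"
proof (cases "K = {}")
 case True
 then show ?thesis by (auto intro: exI[of _ 1])
next
 case False
 obtain r c where rc: "\<And>x. x \<in> K ==> 0 < r x \<and> Q (c x) (ball x (r x))"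
  using loc by metis
 obtain F where F: "F \<subseteq> K" "finite F" "K \<subseteq> (\<Union>x\<in>F. ball x (r x))"
  by (rule compactE_image[OF K, of K "\<lambda>x. ball x (r x)"]) (use rc in auto)
 have "K \<subseteq> \<Union> ((\<lambda>x. ball x (r x)) ` F)" using F by simp
 then obtain e where e: "0 < e" "\<And>x. x \<in> K ==> \<exists>G\<in>(\<lambda>x. ball x (r x)) ` F. ball x e \<subseteq> G"
  by (rule Heine_Borel_lemma[OF K]) auto
 have FN: "F \<noteq> {}" using F False by auto
 show ?thesis
 proof (rule exI[of _ e], intro conjI e(1) exI[of _ "Max (c ` F)"] ballI)
  fix x assume "x \<in> K"
  then obtain y where y: "y \<in> F" "ball x e \<subseteq> ball y (r y)" using e(2) by blast
  show "Q (Max (c ` F)) (ball x e)"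
   by (rule mono[of "c y" "ball y (r y)"]) (use rc y F in auto)
 qed
qed

lemma C1_fun_local:
 fixes F :: "'a::euclidean_space => real"
 assumes "C1_fun F DF"
 shows "\<exists>b\<ge>1. \<forall>x\<in>cball x0 r. \<forall>y\<in>cball x0 r. \<bar>F x - F y\<bar> <= b * norm (x - y)"
  and "0 < e ==> \<exists>d>0. \<forall>x\<in>cball x0 r. \<forall>y\<in>cball x0 r. norm (x - y) < d --> norm (DF x - DF y) < e"
proof -
 have c: "continuous_on (cball x0 r) DF" using assms unfolding C1_fun_def by (meson continuous_on_subset subset_UNIV)
 have "bounded (DF ` cball x0 r)" by (intro compact_imp_bounded compact_continuous_image c) simp
 then obtain B where "\<forall>y\<in>DF ` cball x0 r. norm y <= B" unfolding bounded_iff by (elim exE)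
 then have B: "norm (DF x) <= B" if "x \<in> cball x0 r" for x using that by blast
 have "\<bar>F x - F y\<bar> <= max 1 B * norm (x - y)" if xy: "x \<in> cball x0 r" "y \<in> cball x0 r" for x y
 proof -
  obtain s where s: "s \<in> {0..1}" "F (y + (x - y)) - F y = DF (y + s *\<^sub>R (x - y)) \<bullet> (x - y)"
   using C1_fun_mvt[OF assms] by blast
  have "y + s *\<^sub>R (x - y) \<in> closed_segment y x" using s(1) by (auto simp: in_segment algebra_simps intro!: exI[of _ s])
  moreover have "closed_segment y x \<subseteq> cball x0 r" using xy by (intro closed_segment_subset) auto
  ultimately have "norm (DF (y + s *\<^sub>R (x - y))) <= B" using B by blast
  then have "\<bar>DF (y + s *\<^sub>R (x - y)) \<bullet> (x - y)\<bar> <= max 1 B * norm (x - y)"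
   by (intro order_trans[OF Cauchy_Schwarz_ineq2] mult_right_mono) auto
  then show ?thesis using s(2) by simp
 qed
 then show "\<exists>b\<ge>1. \<forall>x\<in>cball x0 r. \<forall>y\<in>cball x0 r. \<bar>F x - F y\<bar> <= b * norm (x - y)"
  by (intro exI[of _ "max 1 B"]) auto
 have "uniformly_continuous_on (cball x0 r) DF" by (rule compact_uniformly_continuous[OF c]) simp
 then show "0 < e ==> \<exists>d>0. \<forall>x\<in>cball x0 r. \<forall>y\<in>cball x0 r. norm (x - y) < d --> norm (DF x - DF y) < e"
  unfolding uniformly_continuous_on_def dist_norm by metis
qed

text \<open>Near a boundary point the closure of \<open>D\<close> is a sublevel set of a \<open>C\<^sup>1\<close> function of slope \<open>-1\<close>
 in a fixed direction.\<close>

lemma boundary_chart: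
 fixes D :: "'a::euclidean_space set"
 assumes "C1_boundary D" and x0: "x0 \<in> frontier D"
 shows "\<exists>r>0. \<exists>e F DF. norm e = 1 \<and> C1_fun F DF \<and> (\<forall>x s. F (x + s *\<^sub>R e) = F x - s) \<and>
  (\<forall>x\<in>ball x0 r. x \<in> closure D \<longleftrightarrow> F x <= 0)"
proof -
 obtain r e h Dh where r: "0 < r" and e: "norm e = 1" and h: "C1_fun h Dh"
  and eq: "D \<inter> ball x0 r = {x \<in> ball x0 r. h (x - (x \<bullet> e) *\<^sub>R e) < x \<bullet> e}"
  using assms unfolding C1_boundary_def by blast
 define P where "P x = x - (x \<bullet> e) *\<^sub>R e" for x
 define F where "F x = h (P x) - x \<bullet> e" for x
 define DF where "DF x = P (Dh (P x)) - e" for x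
 have ee: "e \<bullet> e = 1" using e by (simp add: dot_square_norm)
 have C1: "C1_fun F DF"
  unfolding C1_fun_def
 proof (intro conjI allI)
  fix x
  have d: "(h has_derivative (\<lambda>k. k \<bullet> Dh (P x))) (at (P x))" using h unfolding C1_fun_def gderiv_def by blast
  have "(P has_derivative P) (at x)" unfolding P_def by (auto intro!: derivative_eq_intros)
  from has_derivative_compose[OF this d]
  have "((\<lambda>x. h (P x)) has_derivative (\<lambda>k. P k \<bullet> Dh (P x))) (at x)" .
  then have "(F has_derivative (\<lambda>k. P k \<bullet> Dh (P x) - k \<bullet> e)) (at x)"
   unfolding F_def by (auto intro!: derivative_eq_intros)
  moreover have "(\<lambda>k. P k \<bullet> Dh (P x) - k \<bullet> e) = (\<lambda>k. k \<bullet> DF x)"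
   by (auto simp: DF_def P_def fun_eq_iff inner_diff_left inner_diff_right inner_commute)
  ultimately show "GDERIV F x :> DF x" by (simp add: gderiv_def)
 next
  have P: "continuous_on UNIV P" unfolding P_def by (intro continuous_intros)
  have "continuous_on UNIV Dh" using h unfolding C1_fun_def by blast
  note 1 = continuous_on_compose2[OF this P subset_UNIV]
  note continuous_on_compose2[OF P 1 subset_UNIV]
  then show "continuous_on UNIV DF" unfolding DF_def by (intro continuous_intros)
 qed
 have sh: "F (x + s *\<^sub>R e) = F x - s" for x s
  unfolding F_def P_def by (simp add: ee inner_add_left algebra_simps)
 have Fc: "isCont F x" for x by (rule C1_fun_continuous[OF C1])
 have D: "x \<in> D \<longleftrightarrow> F x < 0" if "x \<in> ball x0 r" for x
 proof -
  have "x \<in> D \<inter> ball x0 r \<longleftrightarrow> x \<in> {x \<in> ball x0 r. h (x - (x \<bullet> e) *\<^sub>R e) < x \<bullet> e}" by (simp only: eq)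
  then show ?thesis using that by (simp add: F_def P_def del: mem_ball)
 qed
 have "x \<in> closure D \<longleftrightarrow> F x <= 0" if x: "x \<in> ball x0 r" for x
 proof
  assume cl: "x \<in> closure D"
  show "F x <= 0"
  proof (rule ccontr)
   assume "\<not> ?thesis"
   then have "0 < F x" by simp
   then obtain d where d: "0 < d" "\<And>y. dist y x < d ==> dist (F y) (F x) < F x"
    using Fc[of x] unfolding continuous_at_eps_delta by blast
   have "0 < min d (r - dist x x0)" using d x by (simp add: dist_commute)
   then obtain y where y: "y \<in> D" "dist y x < min d (r - dist x x0)" using cl unfolding closure_approachable by blast
   have "y \<in> ball x0 r" using y(2) dist_triangle[of y x0 x] by (simp add: dist_commute)
   then have "F y < 0" using D y by blast
   then show False using d(2)[of y] y(2) \<open>0 < F x\<close> by (simp add: dist_real_def)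
  qed
 next
  assume F: "F x <= 0"
  show "x \<in> closure D"
   unfolding closure_approachable
  proof (intro allI impI)
   fix d :: real assume d: "0 < d"
   define s where "s = min d (r - dist x x0) / 2"
   have s: "0 < s" "s < d" "s < r - dist x x0" using d x by (auto simp: s_def dist_commute)
   have ds: "dist (x + s *\<^sub>R e) x = s" using s e by (simp add: dist_norm)
   have "x + s *\<^sub>R e \<in> ball x0 r" using ds s dist_triangle[of "x + s *\<^sub>R e" x0 x] by (simp add: dist_commute)
   moreover have "F (x + s *\<^sub>R e) < 0" using sh F s by simp
   ultimately have "x + s *\<^sub>R e \<in> D" using D by blast
   then show "\<exists>y\<in>D. dist y x < d" using ds s by force
  qed
 qed
 then show ?thesis using r e C1 sh by blast
qed

text \<open>Both halves of \<open>regular_domain\<close> for the complement of one hole, localized to a ball; \<open>c\<close>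
 bounds all constants involved.\<close>

definition chord_ok :: "'a::euclidean_space set => real => real => 'a set => bool" where
 "chord_ok V h c B \<longleftrightarrow> (\<forall>r a b a' b'. 0 < c --> 0 < r --> c * r <= 1 --> norm (a - b) <= r --> a \<in> B --> b \<in> B -->
   a' \<in> closure V \<inter> B --> c * norm (a - a') <= r --> b' \<in> closure V \<inter> B --> c * norm (b - b') <= r -->
   (\<exists>s. norm s <= h * r \<and> closed_segment (a + s) (b + s) \<subseteq> V))"

definition link_ok :: "'a::euclidean_space set => real => 'a set => bool" where
 "link_ok V c B \<longleftrightarrow> (\<forall>x\<in>V \<inter> B. \<forall>y\<in>V \<inter> B. link V x y (c * norm (x - y)))"

lemma chord_ok_mono:
 assumes "chord_ok V h c B" "0 < c" "c <= c'" "B' \<subseteq> B" shows "chord_ok V h c' B'"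
 unfolding chord_ok_def
proof (intro allI impI)
 fix r a b a' b'
 assume c': "0 < c'" and r: "0 < r" "c' * r <= 1" and ab: "norm (a - b) <= r" "a \<in> B'" "b \<in> B'"
  "a' \<in> closure V \<inter> B'" "c' * norm (a - a') <= r" "b' \<in> closure V \<inter> B'" "c' * norm (b - b') <= r"
 have "c * r <= c' * r" "c * norm (a - a') <= c' * norm (a - a')" "c * norm (b - b') <= c' * norm (b - b')"
  using assms r by (auto intro!: mult_right_mono)
 then have "c * r <= 1" "c * norm (a - a') <= r" "c * norm (b - b') <= r" using r ab by linarith+
 moreover have "a \<in> B" "b \<in> B" "a' \<in> closure V \<inter> B" "b' \<in> closure V \<inter> B" using ab assms(4) by auto
 ultimately show "\<exists>s. norm s <= h * r \<and> closed_segment (a + s) (b + s) \<subseteq> V"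
  using assms(1)[unfolded chord_ok_def, rule_format, of r a b a' b'] assms(2) r(1) ab(1) by blast
qed

lemma link_mono: "link V x y l ==> l <= l' ==> link V x y l'"
 unfolding link_def by (meson order_trans)

lemma link_ok_mono:
 assumes "link_ok V c B" "c <= c'" "B' \<subseteq> B" shows "link_ok V c' B'"
 unfolding link_ok_def
proof (intro ballI)
 fix x y assume xy: "x \<in> V \<inter> B'" "y \<in> V \<inter> B'"
 then have "link V x y (c * norm (x - y))" using assms unfolding link_ok_def by blast
 then show "link V x y (c' * norm (x - y))" by (rule link_mono) (use assms in \<open>auto intro: mult_right_mono\<close>)
qed

lemma ball_small:
 assumes "w \<in> ball x0 (r / 4)" "norm (v - w) <= r / 2" "0 < r" shows "v \<in> ball x0 r"
 using assms dist_triangle[of x0 v w] by (simp add: dist_norm norm_minus_commute)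

text \<open>Link: pushing both points out of the hole by the Lipschitz constant of F times their
  distance leaves room for a straight segment. Chord: F is nearly affine along the chord, so it
  falls below its values at the ends only by a small fraction of the length, which an outward shift
  by that fraction repairs.\<close>

lemma boundary_regular:
 fixes D :: "'a::euclidean_space set"
 assumes "C1_boundary D" and x0: "x0 \<in> frontier D"
 shows "\<exists>r>0. \<exists>c. link_ok (- closure D) c (ball x0 r)"
  and "0 < h ==> h <= 1 ==> \<exists>r>0. \<exists>c>0. chord_ok (- closure D) h c (ball x0 r)"
proof -
 obtain r e F DF where r: "0 < r" and e: "norm e = 1" and C1: "C1_fun F DF"
  and sh: "\<And>x s. F (x + s *\<^sub>R e) = F x - s" and K: "\<And>x. x \<in> ball x0 r ==> x \<in> closure D \<longleftrightarrow> F x <= 0"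
  using boundary_chart[OF assms] by blast
 obtain g where g: "1 <= g" "\<And>x y. x \<in> cball x0 r ==> y \<in> cball x0 r ==> \<bar>F x - F y\<bar> <= g * norm (x - y)"
  using C1_fun_local(1)[OF C1, of x0 r] by blast
 have shm: "F (x - s *\<^sub>R e) = F x + s" for x s using sh[of x "- s"] by simp
 have inV: "x \<in> - closure D" if "x \<in> ball x0 r" "0 < F x" for x using K that by auto
 define q where "q = r / (8 * g)"
 have q: "0 < q" "8 * (g * q) = r" using r g(1) by (auto simp: q_def)
 have "1 * q <= g * q" using g(1) q(1) by (intro mult_right_mono) auto
 then have "q <= r / 8" using q(2) by linarith
 note q = q this
 show "\<exists>r>0. \<exists>c. link_ok (- closure D) c (ball x0 r)"
 proof (rule exI[of _ q], intro conjI q(1) exI[of _ "2 * g + 1"])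
  show "link_ok (- closure D) (2 * g + 1) (ball x0 q)"
   unfolding link_ok_def
  proof (intro ballI)
   fix x y assume x: "x \<in> - closure D \<inter> ball x0 q" and y: "y \<in> - closure D \<inter> ball x0 q"
   have xr: "x \<in> ball x0 (r / 4)" "y \<in> ball x0 (r / 4)" using x y q(3) r by auto
   have xr': "x \<in> ball x0 r" "y \<in> ball x0 r" using xr r by auto
   have Fp: "0 < F x" "0 < F y" using x y K[OF xr'(1)] K[OF xr'(2)] by auto
   define t where "t = g * norm (x - y)"
   have xy: "norm (x - y) < 2 * q" using x y dist_triangle2[of x y x0] by (auto simp: dist_norm norm_minus_commute)
   have t: "0 <= t" "t <= r / 4"
   proof -
    show "0 <= t" using g by (simp add: t_def)
    have "t <= g * (2 * q)" unfolding t_def using g xy by (intro mult_left_mono) auto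
    then show "t <= r / 4" using q by simp
   qed
   have down: "closed_segment v (v - t *\<^sub>R e) \<subseteq> - closure D" if v: "v \<in> ball x0 (r / 4)" "0 < F v" for v
   proof
    fix w assume "w \<in> closed_segment v (v - t *\<^sub>R e)"
    then obtain u where u: "0 <= u" "u <= 1" "w = v - (u * t) *\<^sub>R e"
     by (auto simp: in_segment algebra_simps)
    have ut: "0 <= u * t" "u * t <= t" using u t by (auto simp: mult_left_le_one_le)
    have "w \<in> ball x0 r" by (rule ball_small[OF v(1) _ r]) (use u ut t e r in simp)
    moreover have "0 < F w" unfolding u(3) shm using v ut by simp
    ultimately show "w \<in> - closure D" by (rule inV)
   qed
   have mid: "closed_segment (x - t *\<^sub>R e) (y - t *\<^sub>R e) \<subseteq> - closure D"
   proof
    fix w assume "w \<in> closed_segment (x - t *\<^sub>R e) (y - t *\<^sub>R e)"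
    then obtain u where u: "0 <= u" "u <= 1" "w = (1 - u) *\<^sub>R (x - t *\<^sub>R e) + u *\<^sub>R (y - t *\<^sub>R e)"
     by (auto simp: in_segment)
    define v where "v = (1 - u) *\<^sub>R x + u *\<^sub>R y"
    have w: "w = v - t *\<^sub>R e" unfolding u(3) v_def by (simp add: algebra_simps)
    have "v \<in> closed_segment x y" unfolding v_def using u by (auto simp: in_segment)
    then have vx: "norm (v - x) <= norm (x - y)" using segment_bound(1)[of v x y] by (simp add: norm_minus_commute)
    have "norm (v - x) <= r / 4" using vx xy q by simp
    then have vb: "v \<in> ball x0 r" using ball_small[OF xr(1) _ r] r by simp
    have "norm (w - x) <= norm (v - x) + t" unfolding w using norm_triangle_ineq4[of "v - x" "t *\<^sub>R e"] e t by (simp add: algebra_simps)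
    then have "w \<in> ball x0 r" using ball_small[OF xr(1) _ r] vx xy q t by simp
    have "\<bar>F v - F x\<bar> <= g * norm (v - x)" using g(2)[of v x] vb xr' by auto
    moreover have "g * norm (v - x) <= t" unfolding t_def using vx g by (intro mult_left_mono) auto
    ultimately have "F x - F v <= t" by linarith
    then have "0 < F w" unfolding w shm using Fp by simp
    with \<open>w \<in> ball x0 r\<close> show "w \<in> - closure D" by (rule inV)
   qed
   show "link (- closure D) x y ((2 * g + 1) * norm (x - y))"
    unfolding link_def
   proof (rule exI[of _ "x - t *\<^sub>R e"], rule exI[of _ "y - t *\<^sub>R e"], intro conjI)
    show "closed_segment (y - t *\<^sub>R e) y \<subseteq> - closure D" using down[OF xr(2) Fp(2)] by (simp add: closed_segment_commute)
    show "norm (x - t *\<^sub>R e - x) + norm (y - t *\<^sub>R e - (x - t *\<^sub>R e)) + norm (y - (y - t *\<^sub>R e)) <= (2 * g + 1) * norm (x - y)"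
     using e t(1) by (simp add: t_def norm_minus_commute algebra_simps)
   qed (use down[OF xr(1) Fp(1)] mid in auto)
  qed
 qed
 assume h: "0 < h" "h <= 1"
 obtain d where d: "0 < d" "\<And>x y. x \<in> cball x0 r ==> y \<in> cball x0 r ==> norm (x - y) < d ==> norm (DF x - DF y) < h / 8"
  using C1_fun_local(2)[OF C1, of "h / 8" x0 r] h by auto
 \<comment> \<open>The three entries control the variation of F between an end point and its
   companion in the closure, the oscillation of the gradient along the chord, and the size of the
   chart.\<close>
 define c where "c = max (4 * g / h) (max (2 / d) (8 / r))"
 have c: "0 < c" "4 * g <= c * h" "2 <= c * d" "8 <= c * r"
 proof -
  have "4 * g / h <= c" "2 / d <= c" "8 / r <= c" by (auto simp: c_def)
  then show "4 * g <= c * h" "2 <= c * d" "8 <= c * r" using h d r by (auto simp: pos_divide_le_eq)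
  show "0 < c" using \<open>8 / r <= c\<close> r by (meson divide_pos_pos less_le_trans zero_less_numeral)
 qed
 show "\<exists>r>0. \<exists>c>0. chord_ok (- closure D) h c (ball x0 r)"
 proof (rule exI[of _ "r / 4"], intro conjI exI[of _ c] c(1))
  show "chord_ok (- closure D) h c (ball x0 (r / 4))"
   unfolding chord_ok_def
  proof (intro allI impI)
   fix f a b a' b'
   assume f: "0 < f" "c * f <= 1" and ab: "norm (a - b) <= f" and a: "a \<in> ball x0 (r / 4)" and b: "b \<in> ball x0 (r / 4)"
    and a': "a' \<in> closure (- closure D) \<inter> ball x0 (r / 4)" "c * norm (a - a') <= f"
    and b': "b' \<in> closure (- closure D) \<inter> ball x0 (r / 4)" "c * norm (b - b') <= f"
   have fr: "8 * f <= r" "2 * f <= d"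
   proof -
    have "8 * f <= (c * r) * f" using c(4) f by (intro mult_right_mono) auto
    also have "\<dots> = r * (c * f)" by simp
    also have "\<dots> <= r * 1" using f r by (intro mult_left_mono) auto
    finally show "8 * f <= r" by simp
    have "2 * f <= (c * d) * f" using c(3) f by (intro mult_right_mono) auto
    also have "\<dots> = d * (c * f)" by simp
    also have "\<dots> <= d * 1" using f d by (intro mult_left_mono) auto
    finally show "2 * f <= d" by simp
   qed
   have low: "- (h * f / 4) <= F v" if v: "v \<in> ball x0 (r / 4)" and v': "v' \<in> closure (- closure D) \<inter> ball x0 (r / 4)" "c * norm (v - v') <= f" for v v'
   proof -
    have v'b: "v' \<in> ball x0 r" "v \<in> ball x0 r" using v v' r by auto
    have "0 <= F v'"
    proof (rule ccontr)
     assume "\<not> ?thesis"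
     then have "0 < - F v'" by simp
     then obtain i where i: "0 < i" "\<And>y. dist y v' < i ==> dist (F y) (F v') < - F v'"
      using C1_fun_continuous[OF C1, of v'] unfolding continuous_at_eps_delta by blast
     have "0 < min i (r - dist v' x0)" using i v'b by (simp add: dist_commute)
     have "v' \<in> closure (- closure D)" using v' by blast
     from this[unfolded closure_approachable, rule_format, OF \<open>0 < min i (r - dist v' x0)\<close>]
     obtain y where y: "y \<in> - closure D" "dist y v' < min i (r - dist v' x0)" by blast
     have "y \<in> ball x0 r" using y(2) dist_triangle[of y x0 v'] by (simp add: dist_commute)
     then have "0 < F y" using K y by auto
     then show False using i(2)[of y] y(2) \<open>0 < - F v'\<close> by (simp add: dist_real_def)
    qed
    moreover have "\<bar>F v - F v'\<bar> <= g * norm (v - v')" using g(2)[of v v'] v'b by auto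
    moreover have "g * norm (v - v') <= h * f / 4"
    proof -
     have "4 * g * norm (v - v') <= c * h * norm (v - v')" using c(2) by (intro mult_right_mono) auto
     also have "\<dots> = h * (c * norm (v - v'))" by simp
     also have "\<dots> <= h * f" using v' h by (intro mult_left_mono) auto
     finally show ?thesis by simp
    qed
    ultimately show ?thesis by linarith
   qed
   define s where "s = - (h * f) *\<^sub>R e"
   have ns: "norm s = h * f" using e h f by (simp add: s_def)
   have hf: "h * f <= f" "0 < h * f" using h f by (auto simp: mult_left_le_one_le)
   have "closed_segment (a + s) (b + s) \<subseteq> - closure D"
   proof
    fix w' assume "w' \<in> closed_segment (a + s) (b + s)"
    then obtain u where u: "0 <= u" "u <= 1" "w' = (1 - u) *\<^sub>R (a + s) + u *\<^sub>R (b + s)"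
     by (auto simp: in_segment)
    define w where "w = (1 - u) *\<^sub>R a + u *\<^sub>R b"
    have w': "w' = w + s" unfolding u(3) w_def by (simp add: algebra_simps)
    have wa: "w - a = u *\<^sub>R (b - a)" "w - b = (1 - u) *\<^sub>R (a - b)" by (simp_all add: w_def algebra_simps)
    have nwa: "norm (w - a) <= f" "norm (w - b) <= f"
    proof -
     have "u * norm (b - a) <= 1 * f" using u ab f by (intro mult_mono) (auto simp: norm_minus_commute)
     then show "norm (w - a) <= f" using u by (simp add: wa)
     have "(1 - u) * norm (a - b) <= 1 * f" using u ab f by (intro mult_mono) auto
     then show "norm (w - b) <= f" using u by (simp add: wa)
    qed
    have wb: "w \<in> ball x0 r" by (rule ball_small[OF a _ r]) (use nwa fr f in linarith)
    have cb: "a \<in> cball x0 r" "b \<in> cball x0 r" "w \<in> cball x0 r" using a b wb r by auto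
    have lin: "F v + DF a \<bullet> (w - v) - h / 8 * f <= F w" if v: "v \<in> cball x0 r" "norm (w - v) <= f" "norm (v - a) <= f" for v
    proof -
     obtain Q where Q: "Q \<in> {0..1}" "F (v + (w - v)) - F v = DF (v + Q *\<^sub>R (w - v)) \<bullet> (w - v)"
      using C1_fun_mvt[OF C1] by blast
     let ?X = "v + Q *\<^sub>R (w - v)"
     have xs: "?X \<in> closed_segment v w" using Q(1) by (auto simp: in_segment algebra_simps intro!: exI[of _ Q])
     have "closed_segment v w \<subseteq> cball x0 r" using v cb by (intro closed_segment_subset) auto
     moreover have "closed_segment v w \<subseteq> cball a f"
      using v nwa by (intro closed_segment_subset) (auto simp: dist_norm norm_minus_commute)
     ultimately have "?X \<in> cball x0 r" "norm (?X - a) <= f" using xs by (auto simp: dist_norm norm_minus_commute)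
     then have "norm (DF ?X - DF a) < h / 8" using d(2)[of ?X a] cb fr f by auto
     then have "\<bar>(DF ?X - DF a) \<bullet> (w - v)\<bar> <= h / 8 * f"
      using v h by (intro order_trans[OF Cauchy_Schwarz_ineq2] mult_mono) auto
     then have "DF a \<bullet> (w - v) - h / 8 * f <= DF ?X \<bullet> (w - v)" unfolding inner_diff_left by linarith
     moreover have "F w - F v = DF ?X \<bullet> (w - v)" using Q(2) by simp
     ultimately show ?thesis by linarith
    qed
    have "F a + DF a \<bullet> (w - a) - h / 8 * f <= F w" by (rule lin) (use cb nwa f in auto)
    moreover have "F b + DF a \<bullet> (w - b) - h / 8 * f <= F w"
     by (rule lin) (use cb nwa ab in \<open>auto simp: norm_minus_commute\<close>)
    moreover have "- (h * f / 4) <= F a" "- (h * f / 4) <= F b" using low[OF a a'] low[OF b b'] by auto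
    ultimately have 1: "- (h * f / 4) + DF a \<bullet> (w - a) - h / 8 * f <= F w"
     and 2: "- (h * f / 4) + DF a \<bullet> (w - b) - h / 8 * f <= F w" by linarith+
    \<comment> \<open>Both expansions use the gradient at a. In the combination with weights 1 - u
      and u the linear terms cancel, because w is the corresponding combination of a and b.\<close>
    have "(1 - u) * (- (h * f / 4) + DF a \<bullet> (w - a) - h / 8 * f) + u * (- (h * f / 4) + DF a \<bullet> (w - b) - h / 8 * f)
      <= (1 - u) * F w + u * F w"
     using u by (intro add_mono mult_left_mono 1 2) auto
    also have "\<dots> = F w" by (simp add: algebra_simps)
    also have "(1 - u) * (- (h * f / 4) + DF a \<bullet> (w - a) - h / 8 * f) + u * (- (h * f / 4) + DF a \<bullet> (w - b) - h / 8 * f)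
      = - (3 / 8) * (h * f) + DF a \<bullet> ((1 - u) *\<^sub>R (w - a) + u *\<^sub>R (w - b))"
    proof -
     have e8: "h / 8 * f = h * f / 8" by simp
     show ?thesis unfolding e8 inner_add_right inner_scaleR_right right_diff_distrib left_diff_distrib distrib_left by simp
    qed
    also have "(1 - u) *\<^sub>R (w - a) + u *\<^sub>R (w - b) = 0" unfolding wa by (simp add: algebra_simps)
    finally have Fw: "- (3 / 8) * (h * f) <= F w" by simp
    have "F w' = F w + h * f" unfolding w' s_def using sh[of w "- (h * f)"] by simp
    then have "0 < F w'" using Fw hf by linarith
    moreover have "w' \<in> ball x0 r"
    proof (rule ball_small[OF a _ r])
     have "norm (w' - a) <= norm (w - a) + norm s" unfolding w' using norm_triangle_ineq[of "w - a" s] by (simp add: algebra_simps)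
     then show "norm (w' - a) <= r / 2" using nwa ns hf fr f by linarith
    qed
    ultimately show "w' \<in> - closure D" using inV by blast
   qed
   then show "\<exists>s. norm s <= h * f \<and> closed_segment (a + s) (b + s) \<subseteq> - closure D" using ns by (intro exI[of _ s]) simp
  qed
 qed (use r in simp)
qed

text \<open>Balls inside \<open>D\<close> contain no point of the closure of the complement, so
  there both claims are vacuous; boundary points have charts, and compactness makes the constants
  uniform.\<close>

lemma closure_regular:
 fixes D :: "'a::euclidean_space set"
 assumes D: "C1_boundary D" "open D" "bounded D"
 shows "\<exists>e>0. \<exists>c. \<forall>x\<in>closure D. link_ok (- closure D) c (ball x e)"
  and "0 < h ==> h <= 1 ==> \<exists>e>0. \<exists>c. \<forall>x\<in>closure D. 0 < c \<and> chord_ok (- closure D) h c (ball x e)"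
proof -
 have K: "compact (closure D)" using D by (simp add: compact_closure)
 have cs: "x \<in> frontier D \<or> (\<exists>r>0. ball x r \<subseteq> D)" if "x \<in> closure D" for x
  using that D(2) open_contains_ball[of D] by (auto simp: frontier_def interior_open)
 show "\<exists>e>0. \<exists>c. \<forall>x\<in>closure D. link_ok (- closure D) c (ball x e)"
 proof (rule compact_uniform_radius[OF K])
  fix x assume "x \<in> closure D"
  from cs[OF this] show "\<exists>r>0. \<exists>c. link_ok (- closure D) c (ball x r)"
  proof
   assume "x \<in> frontier D" then show ?thesis by (rule boundary_regular(1)[OF D(1)])
  next
   assume "\<exists>r>0. ball x r \<subseteq> D"
   then obtain r where r: "0 < r" "ball x r \<subseteq> D" by blast
   then have "link_ok (- closure D) 0 (ball x r)" using closure_subset unfolding link_ok_def by blast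
   then show ?thesis using r(1) by blast
  qed
 qed (rule link_ok_mono)
 assume h: "0 < h" "h <= 1"
 show "\<exists>e>0. \<exists>c. \<forall>x\<in>closure D. 0 < c \<and> chord_ok (- closure D) h c (ball x e)"
 proof (rule compact_uniform_radius[OF K])
  fix x assume "x \<in> closure D"
  from cs[OF this] show "\<exists>r>0. \<exists>c. 0 < c \<and> chord_ok (- closure D) h c (ball x r)"
  proof
   assume "x \<in> frontier D"
   from boundary_regular(2)[OF D(1) this h] show ?thesis .
  next
   assume "\<exists>r>0. ball x r \<subseteq> D"
   then obtain r where r: "0 < r" "ball x r \<subseteq> D" by blast
   have "closure (- closure D) \<inter> D = {}"
    using open_Int_closure_eq_empty[OF D(2), of "- closure D"] closure_subset[of D] by blast
   then have "chord_ok (- closure D) h 1 (ball x r)" using r unfolding chord_ok_def by blast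
   then show ?thesis using r(1) by (metis zero_less_one)
  qed
 next
  fix c c' and B B' :: "'a set" assume "0 < c \<and> chord_ok (- closure D) h c B" "c <= c'" "B' \<subseteq> B"
  then show "0 < c' \<and> chord_ok (- closure D) h c' B'" using chord_ok_mono by (metis less_le_trans)
 qed
qed

section \<open>Lattice cells and uniform connections in perforated domains\<close>

definition cell :: "real ^ 'n => real ^ 'n" where
 "cell x = (\<chi> i. of_int \<lfloor>x $ i + 1/2\<rfloor>)"

lemma cell_lattice: "cell x \<in> int_lattice" by (simp add: cell_def int_lattice_def)

lemma int_lattice_add: "m \<in> int_lattice ==> k \<in> int_lattice ==> m + k \<in> int_lattice"
 and int_lattice_minus: "m \<in> int_lattice ==> - m \<in> int_lattice"
 and int_lattice_0: "0 \<in> int_lattice"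
 by (auto simp: int_lattice_def)

lemma cell_bounds: "x $ i - 1/2 <= cell x $ i" "cell x $ i <= x $ i + 1/2"
 using floor_correct[of "x $ i + 1/2"] unfolding cell_def by (simp_all, linarith+)

lemma cell_eq:
 assumes "m \<in> int_lattice" "\<And>i. \<bar>x $ i - m $ i\<bar> < 1/2" shows "cell x = m"
proof -
 have "of_int \<lfloor>x $ i + 1/2\<rfloor> = m $ i" for i
 proof -
  obtain k where k: "m $ i = of_int k" using assms(1) unfolding int_lattice_def by (auto elim: Ints_cases)
  have "\<lfloor>x $ i + 1/2\<rfloor> = k" using assms(2)[of i] k by (intro floor_unique) linarith+
  then show ?thesis using k by simp
 qed
 then show ?thesis by (simp add: cell_def vec_eq_iff)
qed

lemma finite_lattice_box: "finite {m \<in> int_lattice. \<forall>i. \<bar>m $ i\<bar> <= (B::real)}"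
proof (rule finite_subset)
 show "finite ((\<lambda>f. \<chi> i. real_of_int (f i)) ` (UNIV \<rightarrow>\<^sub>E {- \<lceil>B\<rceil>..\<lceil>B\<rceil>}))"
  by (intro finite_imageI finite_PiE) auto
 show "{m \<in> int_lattice. \<forall>i. \<bar>m $ i\<bar> <= B} \<subseteq> (\<lambda>f. \<chi> i. real_of_int (f i)) ` (UNIV \<rightarrow>\<^sub>E {- \<lceil>B\<rceil>..\<lceil>B\<rceil>})"
 proof
  fix m assume m: "m \<in> {m \<in> int_lattice. \<forall>i. \<bar>m $ i\<bar> <= B}"
  have fl: "of_int \<lfloor>m $ i\<rfloor> = m $ i" for i using m by (auto simp: int_lattice_def elim: Ints_cases)
  have "\<lfloor>m $ i\<rfloor> \<in> {- \<lceil>B\<rceil>..\<lceil>B\<rceil>}" for i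
  proof -
   have "\<bar>m $ i\<bar> <= B" using m by blast
   then have "real_of_int \<lfloor>m $ i\<rfloor> <= of_int \<lceil>B\<rceil>" "- real_of_int \<lceil>B\<rceil> <= of_int \<lfloor>m $ i\<rfloor>"
    using fl[of i] le_of_int_ceiling[of B] by linarith+
   then show ?thesis by (simp flip: of_int_minus)
  qed
  then show "m \<in> (\<lambda>f. \<chi> i. real_of_int (f i)) ` (UNIV \<rightarrow>\<^sub>E {- \<lceil>B\<rceil>..\<lceil>B\<rceil>})"
   by (intro image_eqI[of _ _ "\<lambda>i. \<lfloor>m $ i\<rfloor>"]) (auto simp: fl vec_eq_iff)
 qed
qed

lemma norm_le_card:
 fixes x :: "real^'n"
 assumes "\<And>i. \<bar>x $ i\<bar> <= B" shows "norm x <= real CARD('n) * B"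
proof -
 have "norm x <= (\<Sum>i\<in>UNIV. \<bar>x $ i\<bar>)" by (rule norm_le_l1_cart)
 also have "\<dots> <= (\<Sum>i\<in>(UNIV::'n set). B)" using assms by (rule sum_mono)
 finally show ?thesis by simp
qed

lemma dist_ball: "y \<in> ball a r \<longleftrightarrow> norm (y - a) < r" by (simp add: dist_norm norm_minus_commute)

lemma finite_net:
 fixes S :: "'a::euclidean_space set"
 assumes "bounded S" "0 < r"
 obtains F where "F \<subseteq> S" "finite F" "closure S \<subseteq> (\<Union>x\<in>F. ball x r)"
proof -
 have "compact (closure S)" using assms(1) by (simp add: compact_closure)
 moreover have "closure S \<subseteq> (\<Union>x\<in>S. ball x r)"
 proof
  fix y assume "y \<in> closure S"
  then obtain x where "x \<in> S" "dist x y < r" using assms(2) unfolding closure_approachable by blast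
  then show "y \<in> (\<Union>x\<in>S. ball x r)" by auto
 qed
 ultimately obtain F where "F \<subseteq> S" "finite F" "closure S \<subseteq> (\<Union>x\<in>F. ball x r)"
  by (rule compactE_image[OF _ open_ball])
 then show thesis by (rule that)
qed

locale hole =
 fixes D :: "(real ^ 'n) set"
 assumes adm: "admissible_hole D"
begin

lemma bounded_hole: "bounded D"
proof -
 have "norm x <= real CARD('n)" if "x \<in> D" for x
 proof -
  have c: "- 1/2 < x $ i \<and> x $ i < 1/2" for i using adm that closure_subset unfolding admissible_hole_def by blast
  have "norm x <= (\<Sum>i\<in>UNIV. \<bar>x $ i\<bar>)" by (rule norm_le_l1_cart)
  also have "\<dots> <= (\<Sum>i\<in>(UNIV::'n set). 1)"
  proof (rule sum_mono)
   fix i :: 'n show "\<bar>x $ i\<bar> <= 1" using c[of i] by linarith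
  qed
  finally show ?thesis by simp
 qed
 then show ?thesis unfolding bounded_iff by blast
qed

lemma in_perforated: "x \<in> perforated D J \<longleftrightarrow> (\<forall>m\<in>int_lattice - J. x - m \<notin> closure D)"
proof -
 have "x \<in> (\<lambda>y. m + y) ` closure D \<longleftrightarrow> x - m \<in> closure D" for m
  by (auto intro!: image_eqI[of _ _ "x - m"])
 then show ?thesis by (auto simp: perforated_def)
qed

text \<open>The closed hole is compact in the open unit cube, hence at positive distance from its
  faces: near x only the hole of the cell of x can be met. This reduces local questions to a single
  hole.\<close>

lemma separated: "\<exists>k>0. \<forall>m\<in>int_lattice. \<forall>x y. norm (y - x) < k --> y - m \<in> closure D --> m = cell x"
proof -
 let ?Q = "{x::real^'n. \<forall>i. - 1/2 < x $ i \<and> x $ i < 1/2}"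
 have "?Q = (\<Inter>i. {x. - 1/2 < x $ i} \<inter> {x. x $ i < 1/2})" by auto
 moreover have "open \<dots>"
  by (intro open_INT open_Int open_halfspace_component_gt_cart open_halfspace_component_lt_cart ballI finite)
 ultimately have Q: "open ?Q" by simp
 have "compact (closure D)" using bounded_hole by (simp add: compact_closure)
 moreover have "closure D \<subseteq> ?Q" using adm unfolding admissible_hole_def by blast
 ultimately obtain k where k: "0 < k" "(\<Union>x\<in>closure D. ball x k) \<subseteq> ?Q"
  using compact_subset_open_imp_ball_epsilon_subset[OF _ Q] by blast
 have "m = cell x" if "m \<in> int_lattice" "norm (y - x) < k" "y - m \<in> closure D" for m x y
 proof -
  have "x - m \<in> ball (y - m) k" using that by (simp add: dist_norm)
  then have "x - m \<in> ?Q" using k(2) that(3) by blast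
  then have "\<bar>x $ i - m $ i\<bar> < 1/2" for i
  proof -
   have "- 1/2 < (x - m) $ i \<and> (x - m) $ i < 1/2" using \<open>x - m \<in> ?Q\<close> by blast
   then show ?thesis unfolding vector_minus_component by linarith
  qed
  from cell_eq[OF that(1) this] show ?thesis by simp
 qed
 then show ?thesis using k(1) by blast
qed

text \<open>The holes form an infinite union of closed sets, which is closed because near each point
  at most one of them occurs.\<close>

lemma open_perforated: "open (perforated D J)"
proof -
 obtain k where k: "0 < k" "\<And>m x y. m \<in> int_lattice ==> norm (y - x) < k ==> y - m \<in> closure D ==> m = cell x"
  using separated by blast
 show ?thesis
  unfolding open_contains_ball
 proof
  fix x assume x: "x \<in> perforated D J"
  obtain r where r: "0 < r" "cell x \<notin> J --> ball (x - cell x) r \<subseteq> - closure D"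
  proof (cases "cell x \<in> J")
   case False
   then have "x - cell x \<in> - closure D" using x cell_lattice unfolding in_perforated by blast
   then obtain r where "0 < r" "ball (x - cell x) r \<subseteq> - closure D"
    using open_contains_ball[of "- closure D"] by auto
   then show thesis using that by blast
  qed (use that[of 1] in simp)
  have "ball x (min r k) \<subseteq> perforated D J"
  proof
   fix y assume "y \<in> ball x (min r k)"
   then have y: "norm (y - x) < r" "norm (y - x) < k" by (auto simp: dist_norm norm_minus_commute)
   show "y \<in> perforated D J"
    unfolding in_perforated
   proof
    fix m assume m: "m \<in> int_lattice - J"
    show "y - m \<notin> closure D"
    proof
     assume c: "y - m \<in> closure D"
     then have mc: "m = cell x" using k(2)[OF _ y(2)] m by blast
     have "y - m \<in> ball (x - cell x) r" using y(1) by (simp add: mc dist_norm norm_minus_commute)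
     then show False using r(2) c m mc by blast
    qed
   qed
  qed
  then show "\<exists>e>0. ball x e \<subseteq> perforated D J" using r k by (intro exI[of _ "min r k"]) simp
 qed
qed

text \<open>Within a fixed distance of a point at most one hole is visible. Either it is absent or
  far, and short segments are free, or the situation is a translate of the complement of
  \<open>closure D\<close>.\<close>

lemma regular_perforated: "regular_domain (perforated D J)"
proof -
 let ?U = "perforated D J" and ?V = "- closure D"
 have D: "C1_boundary D" "open D" using adm unfolding admissible_hole_def by blast+
 obtain f where f: "0 < f" "\<And>m x y. m \<in> int_lattice ==> norm (y - x) < f ==> y - m \<in> closure D ==> m = cell x"
  using separated by blast
 have loc: "S \<subseteq> ?U" if S: "S \<subseteq> ball x f" "cell x \<notin> J ==> (\<lambda>y. y - cell x) ` S \<subseteq> ?V" for S x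
 proof
  fix y assume y: "y \<in> S"
  show "y \<in> ?U"
   unfolding in_perforated
  proof
   fix m assume m: "m \<in> int_lattice - J"
   show "y - m \<notin> closure D"
   proof
    assume c: "y - m \<in> closure D"
    have "norm (y - x) < f" using y S(1) dist_ball by blast
    then have "m = cell x" using f(2) c m by blast
    then show False using S(2) y c m by blast
   qed
  qed
 qed
 have sub: "x - cell w \<in> ?V" if "x \<in> ?U" "cell w \<notin> J" for x w
  using that cell_lattice unfolding in_perforated by blast
 have segt: "(\<lambda>y. y - v) ` closed_segment a b = closed_segment (a - v) (b - v)" for a b v :: "real^'n"
  using closed_segment_translation[of "- v" a b] by simp
 have far: "closed_segment x y \<subseteq> ?U"
  if "norm (y - x) < f" "norm (y - x) < e" "cell x \<notin> J ==> \<forall>k\<in>closure D. e <= norm (x - cell x - k)" for x y e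
 proof (rule loc)
  have w: "norm (w - x) <= norm (y - x)" if "w \<in> closed_segment x y" for w
   using segment_bound(1)[OF that] by (simp add: norm_minus_commute)
  then show "closed_segment x y \<subseteq> ball x f" using that(1) dist_ball by (meson le_less_trans subsetI)
  assume J: "cell x \<notin> J"
  show "(\<lambda>y. y - cell x) ` closed_segment x y \<subseteq> ?V"
  proof (rule image_subsetI, rule ComplI)
   fix w assume ws: "w \<in> closed_segment x y" and c: "w - cell x \<in> closure D"
   have "e <= norm (x - cell x - (w - cell x))" using that(3)[OF J] c by blast
   then show False using w[OF ws] that(2) by (simp add: norm_minus_commute)
  qed
 qed
 show ?thesis
  unfolding regular_domain_def
 proof (intro conjI open_perforated allI impI)
  fix h' :: real assume h': "0 < h'"
  define h where "h = min 1 h'"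
  have h: "0 < h" "h <= 1" "h <= h'" using h' by (auto simp: h_def)
  obtain e c where e: "0 < e" and ec: "\<And>x. x \<in> closure D ==> 0 < c \<and> chord_ok ?V h c (ball x e)"
   using closure_regular(2)[OF D bounded_hole h(1,2)] by blast
  have c: "0 < c"
  proof -
   have "0 \<in> closure D" using adm closure_subset unfolding admissible_hole_def by blast
   then show ?thesis using ec by blast
  qed
  obtain g where "0 < g" "\<forall>(a, b)\<in>set [(1, 1), (c, 1)]. a * g <= b"
   using small_scale[of "[(1, 1), (c, 1)]"] by auto
  then have g: "0 < g" "g <= 1" "c * g <= 1" by auto
  obtain d0 where "0 < d0" "\<forall>(a, b)\<in>set [(4, f), (8, e), (c, 1)]. a * d0 <= b"
   using small_scale[of "[(4, f), (8, e), (c, 1)]"] f(1) e by auto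
  then have d0: "0 < d0" "d0 <= f / 4" "d0 <= e / 8" "c * d0 <= 1" by auto
  show "\<exists>d0>0. \<exists>g>0. \<forall>d a b a' b'. 0 < d --> d <= d0 --> norm (a - b) <= d -->
    a' \<in> closure ?U --> norm (a - a') <= g * d --> b' \<in> closure ?U --> norm (b - b') <= g * d -->
    (\<exists>s. norm s <= h' * d \<and> closed_segment (a + s) (b + s) \<subseteq> ?U)"
  proof (rule exI[of _ d0], intro conjI d0(1), rule exI[of _ g], intro conjI g(1) allI impI)
   fix d a b a' b'
   assume d: "0 < d" "d <= d0" and ab: "norm (a - b) <= d" and a': "a' \<in> closure ?U" "norm (a - a') <= g * d"
    and b': "b' \<in> closure ?U" "norm (b - b') <= g * d"
   have ba: "norm (b - a) <= d" using ab by (simp add: norm_minus_commute)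
   let ?m = "cell a"
   show "\<exists>s. norm s <= h' * d \<and> closed_segment (a + s) (b + s) \<subseteq> ?U"
   proof (cases "?m \<notin> J --> (\<forall>k\<in>closure D. e / 2 <= norm (a - ?m - k))")
    case True
    have "norm (b - a) < f" "norm (b - a) < e / 2" using ba d d0 e f by linarith+
    from far[OF this] True have "closed_segment a b \<subseteq> ?U" by blast
    then show ?thesis using h' d by (intro exI[of _ 0]) simp
   next
    case False
    then obtain k where J: "?m \<notin> J" and k: "k \<in> closure D" "norm (a - ?m - k) < e / 2" by force
    have gd: "g * d <= 1 * d" using g d by (intro mult_right_mono) auto
    have near: "v - ?m \<in> ball k e" if "norm (v - a) <= 2 * d" for v
    proof -
     have "norm (v - ?m - k) <= norm (v - a) + norm (a - ?m - k)"
      using norm_triangle_ineq[of "v - a" "a - ?m - k"] by (simp add: algebra_simps)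
     then have "norm (v - ?m - k) < e" using that k d d0 e by linarith
     then show ?thesis by (simp only: dist_ball)
    qed
    have cl: "v - ?m \<in> closure ?V" if "v \<in> closure ?U" for v
    proof -
     have "?U \<subseteq> (+) ?m ` ?V" using sub[OF _ J] by (intro subsetI image_eqI[of _ _ "_ - ?m"]) auto
     then have "closure ?U \<subseteq> (+) ?m ` closure ?V" by (metis closure_mono closure_translation)
     then show ?thesis using that by auto
    qed
    have "norm (b' - a) <= norm (b - b') + norm (b - a)"
     using norm_triangle_ineq4[of "b - a" "b - b'"] by (simp add: algebra_simps)
    then have n: "norm (a - a) <= 2 * d" "norm (b - a) <= 2 * d" "norm (a' - a) <= 2 * d" "norm (b' - a) <= 2 * d"
     using ba a' b' gd d norm_minus_commute[of a a'] by (simp, linarith+)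
    have c1: "c * d <= 1" using mult_left_mono[OF d(2), of c] c d0(4) by linarith
    have "c * norm (a - a') <= c * (g * d)" "c * norm (b - b') <= c * (g * d)"
     using a' b' c by (auto intro: mult_left_mono)
    moreover have "c * (g * d) <= d" using mult_right_mono[OF g(3), of d] d by (simp add: mult.assoc)
    ultimately have c2: "c * norm (a - a') <= d" "c * norm (b - b') <= d" by linarith+
    have ck: "chord_ok ?V h c (ball k e)" using ec[OF k(1)] by blast
    have "\<exists>s. norm s <= h * d \<and> closed_segment (a - ?m + s) (b - ?m + s) \<subseteq> ?V"
     by (rule ck[unfolded chord_ok_def, rule_format, of d _ _ "a' - ?m" "b' - ?m"])
      (use c d c1 c2 ab near n cl a' b' in auto)
    then obtain s where s: "norm s <= h * d" "closed_segment (a - ?m + s) (b - ?m + s) \<subseteq> ?V" by blast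
    have hd: "h * d <= 1 * d" "h * d <= h' * d" using h d by (auto intro: mult_right_mono)
    have "closed_segment (a + s) (b + s) \<subseteq> ?U"
    proof (rule loc[of _ a])
     have "norm (a + s - a) < f" using s hd d d0 f(1) by (simp, linarith)
     moreover have "norm (b + s - a) < f"
     proof -
      have "norm (b + s - a) <= norm (b - a) + norm s" using norm_triangle_ineq[of "b - a" s] by (simp add: algebra_simps)
      then show ?thesis using ba s hd d d0 f(1) by linarith
     qed
     ultimately show "closed_segment (a + s) (b + s) \<subseteq> ball a f"
      by (intro closed_segment_subset) (simp_all only: dist_ball convex_ball)
     show "(\<lambda>y. y - ?m) ` closed_segment (a + s) (b + s) \<subseteq> ?V"
      using s(2) by (simp add: segt algebra_simps)
    qed
    then show ?thesis using s hd by (intro exI[of _ s]) auto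
   qed
  qed
 next
  obtain e c where e: "0 < e" and ec: "\<And>x. x \<in> closure D ==> link_ok ?V c (ball x e)"
   using closure_regular(1)[OF D bounded_hole] by blast
  define C where "C = max 1 c"
  have C: "1 <= C" "c <= C" by (auto simp: C_def)
  obtain r where "0 < r" "\<forall>(a, b)\<in>set [(2, e), (C, f)]. a * r <= b"
   using small_scale[of "[(2, e), (C, f)]"] f(1) e by auto
  then have r: "0 < r" "r <= e / 2" "C * r <= f" by auto
  show "\<exists>r>0. \<exists>C\<ge>0. \<forall>x\<in>?U. \<forall>y\<in>?U. norm (x - y) < r --> link ?U x y (C * norm (x - y))"
  proof (rule exI[of _ r], intro conjI r(1), rule exI[of _ C], intro conjI ballI impI)
   show "0 <= C" using C by simp
   fix x y assume xy: "x \<in> ?U" "y \<in> ?U" "norm (x - y) < r"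
   let ?m = "cell x"
   have yx: "norm (y - x) < r" "norm (y - x) < e / 2" using xy r by (auto simp: norm_minus_commute)
   have "1 * norm (x - y) <= C * norm (x - y)" using C by (intro mult_right_mono) auto
   then have Cxy: "norm (x - y) <= C * norm (x - y)" by simp
   have "C * norm (x - y) < C * r" using C xy by (intro mult_strict_left_mono) auto
   then have Cf: "C * norm (x - y) < f" using r by simp
   show "link ?U x y (C * norm (x - y))"
   proof (cases "?m \<notin> J --> (\<forall>k\<in>closure D. e / 2 <= norm (x - ?m - k))")
    case True
    have "norm (y - x) < f" using Cxy Cf by (simp add: norm_minus_commute)
    from far[OF this yx(2)] True have "closed_segment x y \<subseteq> ?U" by blast
    then show ?thesis unfolding link_def using xy Cxy by (intro exI[of _ y]) (auto simp: norm_minus_commute)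
   next
    case False
    then obtain k where J: "?m \<notin> J" and k: "k \<in> closure D" "norm (x - ?m - k) < e / 2" by force
    have "norm (y - ?m - k) <= norm (y - x) + norm (x - ?m - k)"
     using norm_triangle_ineq[of "y - x" "x - ?m - k"] by (simp add: algebra_simps)
    then have "norm (y - ?m - k) < e" "norm (x - ?m - k) < e" using yx k e by linarith+
    then have "x - ?m \<in> ?V \<inter> ball k e" "y - ?m \<in> ?V \<inter> ball k e" using sub[OF _ J] xy by (simp_all only: dist_ball Int_iff simp_thms)
    then have "link ?V (x - ?m) (y - ?m) (c * norm (x - ?m - (y - ?m)))" using ec[OF k(1)] unfolding link_ok_def by blast
    then have "link ?V (x - ?m) (y - ?m) (c * norm (x - y))" by simp
    moreover have "c * norm (x - y) <= C * norm (x - y)" using C by (intro mult_right_mono) auto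
    ultimately have "link ?V (x - ?m) (y - ?m) (C * norm (x - y))" using link_mono by blast
    then obtain a b where ab: "closed_segment (x - ?m) a \<subseteq> ?V" "closed_segment a b \<subseteq> ?V" "closed_segment b (y - ?m) \<subseteq> ?V"
     and l: "norm (a - (x - ?m)) + norm (b - a) + norm (y - ?m - b) <= C * norm (x - y)"
     unfolding link_def by blast
    define a' b' where "a' = a + ?m" and "b' = b + ?m"
    have ab': "closed_segment (x - ?m) (a' - ?m) \<subseteq> ?V" "closed_segment (a' - ?m) (b' - ?m) \<subseteq> ?V" "closed_segment (b' - ?m) (y - ?m) \<subseteq> ?V"
     using ab by (simp_all add: a'_def b'_def)
    have l': "norm (a' - x) + norm (b' - a') + norm (y - b') <= C * norm (x - y)"
     using l by (simp add: a'_def b'_def algebra_simps)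
    have "norm (b' - x) <= norm (b' - a') + norm (a' - x)" using norm_triangle_ineq[of "b' - a'" "a' - x"] by simp
    then have nn: "norm (x - x) < f" "norm (a' - x) < f" "norm (b' - x) < f" "norm (y - x) < f"
     using l' Cf Cxy f(1) norm_ge_zero[of "b' - a'"] norm_ge_zero[of "y - b'"] norm_ge_zero[of "a' - x"] norm_minus_commute[of x y]
     unfolding norm_minus_commute[of x y] by (simp_all, linarith+)
    have seg: "closed_segment v w \<subseteq> ?U" if "norm (v - x) < f" "norm (w - x) < f" "closed_segment (v - ?m) (w - ?m) \<subseteq> ?V" for v w
    proof (rule loc[of _ x])
     show "closed_segment v w \<subseteq> ball x f" using that by (intro closed_segment_subset) (simp_all only: dist_ball convex_ball)
    qed (use that segt in simp)
    show ?thesis unfolding link_def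
     by (rule exI[of _ a'], rule exI[of _ b']) (intro conjI seg nn ab' l')
   qed
  qed
 qed
qed

lemma perforated_mono: "J \<subseteq> J' ==> perforated D J \<subseteq> perforated D J'"
 unfolding perforated_def by blast

lemma perforated_translate:
 assumes "m \<in> int_lattice" "x \<in> perforated D {}" shows "x + m \<in> perforated D {}"
 unfolding in_perforated
proof
 fix k :: "real^'n" assume "k \<in> int_lattice - {}"
 then have "x - (k + - m) \<notin> closure D" using assms(1) int_lattice_add int_lattice_minus assms(2) unfolding in_perforated by blast
 then show "x + m - k \<notin> closure D" by (simp add: algebra_simps)
qed

text \<open>A vertex of the unit cube centred at \<open>cell x\<close>. It belongs to \<Omega>
  because the closed holes stay in open cubes, and it serves as the reference point of the
  cell.\<close>

definition corner :: "real ^ 'n => real ^ 'n" where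
 "corner x = cell x + (\<chi> i. 1/2)"

lemma corner_perforated: "corner x \<in> perforated D {}"
 unfolding in_perforated
proof
 fix m :: "real^'n" assume m: "m \<in> int_lattice - {}"
 show "corner x - m \<notin> closure D"
 proof
  assume "corner x - m \<in> closure D"
  then have b: "- 1/2 < corner x $ i - m $ i \<and> corner x $ i - m $ i < 1/2" for i
   using adm unfolding admissible_hole_def by (metis (mono_tags, lifting) mem_Collect_eq subsetD vector_minus_component)
  obtain i :: 'n where True by simp
  have "cell x $ i \<in> \<int>" "m $ i \<in> \<int>" using m cell_lattice[of x] by (auto simp: int_lattice_def)
  then obtain k l where k: "cell x $ i = of_int k" "m $ i = of_int l" by (metis Ints_cases)
  have "- 1/2 < real_of_int k + 1/2 - real_of_int l \<and> real_of_int k + 1/2 - real_of_int l < 1/2"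
   using b[of i] k by (simp add: corner_def)
  then have kl: "real_of_int k < real_of_int l" "real_of_int l < real_of_int k + 1" by linarith+
  have "k < l" using kl(1) by simp
  moreover have "l < k + 1" using kl(2) by (simp only: of_int_less_iff)
  ultimately show False by simp
 qed
qed

lemma cell_corner_box:
 assumes "\<And>i. cell x $ i - 1/2 <= y $ i \<and> y $ i <= cell x $ i + 1/2" "cell x \<in> J"
 shows "y \<in> perforated D J"
 unfolding in_perforated
proof
 fix m assume m: "m \<in> int_lattice - J"
 show "y - m \<notin> closure D"
 proof
  assume "y - m \<in> closure D"
  then have b: "- 1/2 < y $ i - m $ i \<and> y $ i - m $ i < 1/2" for i
   using adm unfolding admissible_hole_def by (metis (mono_tags, lifting) mem_Collect_eq subsetD vector_minus_component)
  have "cell x $ i = m $ i" for i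
  proof -
   obtain k l where k: "cell x $ i = of_int k" "m $ i = of_int l"
   proof -
    have "cell x $ i \<in> \<int>" "m $ i \<in> \<int>" using m cell_lattice[of x] by (auto simp: int_lattice_def)
    then show thesis using that by (metis Ints_cases)
   qed
   show ?thesis using b[of i] assms(1)[of i] k unfolding k of_int_diff by auto
  qed
  then show False using m assms(2) by (metis DiffD2 vec_eq_iff)
 qed
qed

text \<open>Modulo the lattice only one bounded cell matters. A finite net in it, one connection for
  each net point (from connectedness of \<Omega>), and short links to the net give a uniform
  bound.\<close>

lemma corner_conn: "\<exists>C\<ge>0. \<forall>x\<in>perforated D {}. \<exists>l\<le>C. conn (perforated D {}) x (corner x) l"
proof -
 let ?U = "perforated D {}"
 obtain r C where rC: "0 < r" "0 <= C" "\<And>x y. x \<in> ?U ==> y \<in> ?U ==> norm (x - y) < r ==> link ?U x y (C * norm (x - y))"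
  using regular_domainD(3)[OF regular_perforated] by blast
 have U: "open ?U" "connected ?U" using open_perforated adm unfolding admissible_hole_def by blast+
 define S where "S = ?U \<inter> {x. cell x = 0}"
 have "bounded S"
  unfolding bounded_iff
 proof (intro exI ballI)
  fix x assume "x \<in> S"
  then have "\<bar>x $ i\<bar> <= 1/2" for i using cell_bounds[of x i] by (auto simp: S_def)
  then show "norm x <= real CARD('n) * (1/2)" by (rule norm_le_card)
 qed
 from finite_net[OF this rC(1)]
 obtain F where F: "F \<subseteq> S" "finite F" "closure S \<subseteq> (\<Union>x\<in>F. ball x r)" .
 have "\<exists>l. conn ?U x (corner x) l" if "x \<in> F" for x
  by (rule connected_conn[OF U _ corner_perforated]) (use that F S_def in blast)
 then obtain l where l: "\<And>x. x \<in> F ==> conn ?U x (corner x) (l x)" by metis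
 define L where "L = (\<Sum>x\<in>F. \<bar>l x\<bar>)"
 have L: "0 <= L" "\<And>x. x \<in> F ==> l x <= L"
 proof -
  show "0 <= L" by (simp add: L_def sum_nonneg)
  show "l x <= L" if "x \<in> F" for x
   using member_le_sum[OF that, of "\<lambda>x. \<bar>l x\<bar>"] F by (auto simp: L_def)
 qed
 have base: "\<exists>l'\<le>C * r + L. conn ?U x (corner x) l'" if x: "x \<in> S" for x
 proof -
  obtain f where f: "f \<in> F" "norm (x - f) < r" using F x closure_subset[of S] by (force simp: dist_norm norm_minus_commute)
  have "x \<in> ?U" "f \<in> ?U" using x f F S_def by auto
  from link_conn[OF rC(3)[OF this f(2)]] obtain l' where l': "l' <= C * norm (x - f)" "conn ?U x f l'" by blast
  have "corner f = corner x" using x f F by (auto simp: S_def corner_def)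
  then have "conn ?U x (corner x) (l' + l f)" using conn_trans[OF l[OF f(1)] l'(2)] by simp
  moreover have "C * norm (x - f) <= C * r" using rC f by (intro mult_left_mono) auto
  then have "l' + l f <= C * r + L" using l'(1) L(2)[OF f(1)] by linarith
  ultimately show ?thesis by blast
 qed
 have "\<exists>l'\<le>C * r + L. conn ?U x (corner x) l'" if x: "x \<in> ?U" for x
 proof -
  have m: "- cell x \<in> int_lattice" by (intro int_lattice_minus cell_lattice)
  have b: "cell x $ i <= x $ i + 1/2" "x $ i - 1/2 < cell x $ i" for i
   using floor_correct[of "x $ i + 1/2"] unfolding cell_def by (simp_all, linarith+)
  have c0: "cell (x + - cell x) = 0"
   unfolding vec_eq_iff
  proof
   fix i
   have "\<lfloor>(x + - cell x) $ i + 1/2\<rfloor> = 0" using b[of i] by (intro floor_unique) auto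
   then show "cell (x + - cell x) $ i = 0 $ i" by (simp add: cell_def)
  qed
  then have "x + - cell x \<in> S" using perforated_translate[OF m x] by (simp add: S_def)
  from base[OF this] obtain l' where l': "l' <= C * r + L" "conn ?U (x + - cell x) (corner (x + - cell x)) l'" by blast
  from conn_translate[OF l'(2) perforated_translate[OF cell_lattice[of x]]]
  have "conn ?U (x + - cell x + cell x) (corner (x + - cell x) + cell x) l'" .
  moreover have "corner (x + - cell x) + cell x = corner x" using c0 by (simp add: corner_def add.commute)
  ultimately show ?thesis using l'(1) by auto
 qed
 then show ?thesis using rC L by (intro exI[of _ "C * r + L"]) auto
qed

text \<open>Points at distance at most 1 have cells that differ by one of finitely many lattice
  vectors, and translates of finitely many connections serve them all. Larger distances are covered
  by a chain of such steps.\<close>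

lemma corner_corner: "\<exists>C\<ge>0. \<forall>x y. \<exists>l\<le>C * (norm (x - y) + 1). conn (perforated D {}) (corner x) (corner y) l"
proof -
 let ?U = "perforated D {}" and ?B = "{m \<in> int_lattice. \<forall>i. \<bar>m $ i :: real\<bar> <= 2} :: (real^'n) set"
 let ?h = "corner (0::real^'n)"
 have c0: "cell (0::real^'n) = 0" by (simp add: cell_def vec_eq_iff)
 have cr: "corner x = ?h + cell x" for x by (simp add: corner_def c0)
 have U: "open ?U" "connected ?U" using open_perforated adm unfolding admissible_hole_def by blast+
 have "\<exists>l. conn ?U ?h (?h + m) l" if "m \<in> ?B" for m
  by (rule connected_conn[OF U corner_perforated]) (use that in \<open>intro perforated_translate corner_perforated; simp\<close>)
 then have "\<forall>m\<in>?B. \<exists>l. conn ?U ?h (?h + m) l" by blast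
 from bchoice[OF this] obtain l where "\<forall>m\<in>?B. conn ?U ?h (?h + m) (l m)" by (elim exE)
 then have l: "conn ?U ?h (?h + m) (l m)" if "m \<in> ?B" for m using that by (rule bspec)
 define L where "L = (\<Sum>m\<in>?B. \<bar>l m\<bar>)"
 have L: "0 <= L" "\<And>m. m \<in> ?B ==> l m <= L"
 proof -
  show "0 <= L" by (simp add: L_def sum_nonneg)
  show "l m <= L" if "m \<in> ?B" for m
   unfolding L_def by (rule order_trans[OF abs_ge_self member_le_sum[OF that _ finite_lattice_box]]) simp
 qed
 have step: "\<exists>l\<le>L. conn ?U (corner x) (corner y) l" if xy: "norm (x - y) <= 1" for x y :: "real^'n"
 proof -
  have m: "cell y + - cell x \<in> int_lattice" by (intro int_lattice_add int_lattice_minus cell_lattice)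
  have "\<bar>(cell y + - cell x) $ i\<bar> <= 2" for i
   using cell_bounds[of x i] cell_bounds[of y i] component_le_norm_cart[of "x - y" i] xy
   unfolding vector_add_component vector_uminus_component vector_minus_component by linarith
  then have mB: "cell y + - cell x \<in> ?B" using m by blast
  from conn_translate[OF l[OF mB] perforated_translate[OF cell_lattice[of x]]]
  have "conn ?U (corner x) (corner y) (l (cell y + - cell x))" unfolding cr[of x] cr[of y] by (simp add: algebra_simps)
  then show ?thesis using L(2)[OF mB] by blast
 qed
 have "\<exists>l\<le>L * real N. conn ?U (corner x) (corner y) l" if "norm (x - y) <= real N" for x y :: "real^'n" and N
  using that
 proof (induction N arbitrary: y)
  case 0
  then show ?case using conn_nil[OF corner_perforated[of x]] by (auto intro!: exI[of _ 0])
 next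
  case (Suc N)
  define z where "z = y + (1 / real (Suc N)) *\<^sub>R (x - y)"
  have "norm (z - y) = norm (x - y) / real (Suc N)" by (simp add: z_def)
  also have "\<dots> <= 1" using Suc.prems by (subst pos_divide_le_eq) simp_all
  finally have zy: "norm (z - y) <= 1" .
  have "x - z = (1 - 1 / real (Suc N)) *\<^sub>R (x - y)" by (simp add: z_def algebra_simps)
  moreover have e: "1 - 1 / real (Suc N) = real N / real (Suc N)" by (simp add: field_simps)
  ultimately have "norm (x - z) = real N / real (Suc N) * norm (x - y)" by simp
  also have "\<dots> <= real N / real (Suc N) * real (Suc N)" using Suc.prems by (intro mult_left_mono) auto
  finally have "norm (x - z) <= real N" by simp
  from Suc.IH[OF this] obtain l1 where l1: "l1 <= L * real N" "conn ?U (corner x) (corner z) l1" by blast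
  from step[OF zy] obtain l2 where l2: "l2 <= L" "conn ?U (corner z) (corner y) l2" by blast
  have "l1 + l2 <= L * real (Suc N)" using l1 l2 by (simp add: distrib_left)
  then show ?case using conn_trans[OF l2(2) l1(2)] by blast
 qed
 note chain = this
 show ?thesis
 proof (rule exI[of _ L], intro conjI allI L(1))
  fix x y :: "real^'n"
  have "norm (x - y) <= real (nat \<lceil>norm (x - y)\<rceil>)" by (rule real_nat_ceiling_ge)
  from chain[OF this] obtain l where l: "l <= L * real (nat \<lceil>norm (x - y)\<rceil>)" "conn ?U (corner x) (corner y) l" by blast
  have "real (nat \<lceil>norm (x - y)\<rceil>) <= norm (x - y) + 1" using norm_ge_zero[of "x - y"] by linarith
  then have "L * real (nat \<lceil>norm (x - y)\<rceil>) <= L * (norm (x - y) + 1)" using L by (intro mult_left_mono) auto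
  then show "\<exists>l\<le>L * (norm (x - y) + 1). conn ?U (corner x) (corner y) l" using l by (meson order_trans)
 qed
qed

lemma conn_mono_set: "conn U x y l ==> U \<subseteq> V ==> conn V x y l"
 by (induction rule: conn.induct) (auto intro: conn.intros)

text \<open>The constant must not depend on \<open>J\<close>. If the hole of the cell of x is
  present, x lies in \<Omega> and the bound there applies; if it is filled, the whole closed cube is
  free and a segment leads to the corner.\<close>

lemma conn_perforated:
 "\<exists>C>0. \<forall>J. \<forall>x\<in>perforated D J.
   (\<exists>l\<le>C. conn (perforated D J) x (corner x) l) \<and>
   (\<forall>y\<in>perforated D J. \<exists>l\<le>C * (norm (x - y) + 1). conn (perforated D J) x y l)"
proof -
 obtain C1 where C1: "0 <= C1" "\<And>x. x \<in> perforated D {} ==> \<exists>l\<le>C1. conn (perforated D {}) x (corner x) l"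
  using corner_conn by blast
 obtain C2 where C2: "0 <= C2" "\<And>x y. \<exists>l\<le>C2 * (norm (x - y) + 1). conn (perforated D {}) (corner x) (corner y) l"
  using corner_corner by blast
 define C3 where "C3 = C1 + real CARD('n)"
 have C3: "0 < C3" using C1 by (simp add: C3_def add_nonneg_pos)
 have 1: "\<exists>l\<le>C3. conn (perforated D J) x (corner x) l" if x: "x \<in> perforated D J" for x J
 proof (cases "cell x \<in> J")
  case False
  have "x \<in> perforated D {}"
   unfolding in_perforated
  proof
   fix m :: "real^'n" assume m: "m \<in> int_lattice - {}"
   obtain k where "0 < k" "\<And>m x y. m \<in> int_lattice ==> norm (y - x) < k ==> y - m \<in> closure D ==> m = cell x"
    using separated by blast
   then have "x - m \<in> closure D ==> m = cell x" using m by (metis DiffD1 diff_self norm_zero)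
   then show "x - m \<notin> closure D" using x m False unfolding in_perforated by blast
  qed
  then obtain l where "l <= C1" "conn (perforated D {}) x (corner x) l" using C1 by blast
  then have "conn (perforated D J) x (corner x) l" "l <= C3" using conn_mono_set perforated_mono[of "{}" J] by (auto simp: C3_def)
  then show ?thesis by blast
 next
  case True
  have "closed_segment x (corner x) \<subseteq> perforated D J"
  proof
   fix y assume "y \<in> closed_segment x (corner x)"
   moreover have "convex {y. \<forall>i. cell x $ i - 1/2 <= y $ i \<and> y $ i <= cell x $ i + 1/2}"
   proof -
    have "{y. \<forall>i. cell x $ i - 1/2 <= y $ i \<and> y $ i <= cell x $ i + 1/2} = cbox (\<chi> i. cell x $ i - 1/2) (\<chi> i. cell x $ i + 1/2)"
     by (auto simp: mem_box_cart)
    then show ?thesis by simp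
   qed
   moreover have "x \<in> {y. \<forall>i. cell x $ i - 1/2 <= y $ i \<and> y $ i <= cell x $ i + 1/2}"
   proof (intro CollectI allI conjI)
    fix i show "cell x $ i - 1/2 <= x $ i" "x $ i <= cell x $ i + 1/2" using cell_bounds[of x i] by linarith+
   qed
   moreover have "corner x \<in> {y. \<forall>i. cell x $ i - 1/2 <= y $ i \<and> y $ i <= cell x $ i + 1/2}"
    by (simp add: corner_def)
   ultimately have "y \<in> {y. \<forall>i. cell x $ i - 1/2 <= y $ i \<and> y $ i <= cell x $ i + 1/2}"
    by (meson closed_segment_subset subsetD)
   then show "y \<in> perforated D J" using cell_corner_box[OF _ True] by blast
  qed
  from conn_segment[OF this] have "conn (perforated D J) x (corner x) (norm (corner x - x))" .
  moreover have "norm (corner x - x) <= real CARD('n) * 1"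
  proof (rule norm_le_card)
   fix i show "\<bar>(corner x - x) $ i\<bar> <= 1" using cell_bounds[of x i] by (simp add: corner_def abs_le_iff)
  qed
  ultimately show ?thesis using C1(1) unfolding C3_def
   by (intro exI[of _ "norm (corner x - x)"] conjI) linarith+
 qed
 have 2: "\<exists>l\<le>(2 * C3 + C2) * (norm (x - y) + 1). conn (perforated D J) x y l" if xy: "x \<in> perforated D J" "y \<in> perforated D J" for x y J
 proof -
  obtain l1 l2 l3 where l: "l1 <= C3" "conn (perforated D J) x (corner x) l1" "l2 <= C3" "conn (perforated D J) y (corner y) l2"
   "l3 <= C2 * (norm (x - y) + 1)" "conn (perforated D {}) (corner x) (corner y) l3"
   using 1[OF xy(1)] 1[OF xy(2)] C2(2)[of x y] by (elim exE conjE) (rule that)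
  have l3: "conn (perforated D J) (corner x) (corner y) l3" using conn_mono_set[OF l(6)] perforated_mono[of "{}" J] by blast
  have "conn (perforated D J) x y (l1 + l3 + l2)"
   by (rule conn_trans[OF conn_sym[OF l(4)] conn_trans[OF l3 l(2)]])
  moreover have "l1 + l3 + l2 <= (2 * C3 + C2) * (norm (x - y) + 1)"
  proof -
   have "0 <= C3 * norm (x - y)" using C3 by simp
   then show ?thesis using l unfolding distrib_left distrib_right by linarith
  qed
  ultimately show ?thesis by blast
 qed
 show ?thesis
 proof (rule exI[of _ "2 * C3 + C2"], intro conjI allI ballI)
  show "0 < 2 * C3 + C2" using C3 C2 by linarith
  fix J and x :: "real^'n" assume x: "x \<in> perforated D J"
  have "C3 <= 2 * C3 + C2" using C3(1) C2(1) by linarith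
  then show "\<exists>l\<le>2 * C3 + C2. conn (perforated D J) x (corner x) l" using 1[OF x] by (meson order_trans)
  fix y assume y: "y \<in> perforated D J"
  show "\<exists>l\<le>(2 * C3 + C2) * (norm (x - y) + 1). conn (perforated D J) x y l" by (rule 2[OF x y])
 qed
qed

text \<open>One fixed value for all sets \<open>J\<close> of filled holes; constants built from it
  are thereby independent of the defect set.\<close>

definition conn_const :: real where
 "conn_const = (SOME C. 0 < C \<and> (\<forall>J. \<forall>x\<in>perforated D J.
   (\<exists>l\<le>C. conn (perforated D J) x (corner x) l) \<and>
   (\<forall>y\<in>perforated D J. \<exists>l\<le>C * (norm (x - y) + 1). conn (perforated D J) x y l)))"

lemma conn_const:
 "0 < conn_const"
 "x \<in> perforated D J ==> \<exists>l\<le>conn_const. conn (perforated D J) x (corner x) l"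
 "x \<in> perforated D J ==> y \<in> perforated D J ==> \<exists>l\<le>conn_const * (norm (x - y) + 1). conn (perforated D J) x y l"
 using someI_ex[OF conn_perforated, folded conn_const_def] by auto

end

section \<open>Solutions and their representation\<close>

lemma C1_fun_scale:
 fixes f :: "'a::euclidean_space => real"
 assumes "C1_fun f Df" "0 < e"
 shows "C1_fun (\<lambda>w. e * f (w /\<^sub>R e)) (\<lambda>w. Df (w /\<^sub>R e))"
 unfolding C1_fun_def
proof (intro conjI allI)
 fix x
 have d: "(f has_derivative (\<lambda>k. k \<bullet> Df (x /\<^sub>R e))) (at (x /\<^sub>R e))" using assms unfolding C1_fun_def gderiv_def by blast
 have "((\<lambda>w. w /\<^sub>R e) has_derivative (\<lambda>k. k /\<^sub>R e)) (at x)" by (auto intro!: derivative_eq_intros)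
 from has_derivative_compose[OF this d]
 have "((\<lambda>w. e * f (w /\<^sub>R e)) has_derivative (\<lambda>k. e * ((k /\<^sub>R e) \<bullet> Df (x /\<^sub>R e)))) (at x)"
  by (rule has_derivative_mult_right)
 moreover have "(\<lambda>k. e * ((k /\<^sub>R e) \<bullet> Df (x /\<^sub>R e))) = (\<lambda>k. k \<bullet> Df (x /\<^sub>R e))" using assms(2) by auto
 ultimately show "GDERIV (\<lambda>w. e * f (w /\<^sub>R e)) x :> Df (x /\<^sub>R e)" by (simp add: gderiv_def)
next
 have 1: "continuous_on UNIV Df" using assms unfolding C1_fun_def by blast
 have 2: "continuous_on UNIV (\<lambda>w::'a. w /\<^sub>R e)" by (intro continuous_intros)
 show "continuous_on UNIV (\<lambda>w. Df (w /\<^sub>R e))" by (rule continuous_on_compose2[OF 1 2 subset_UNIV])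
qed

lemma eventually_scale:
 fixes q0 :: "'a::euclidean_space"
 assumes "eventually P (at q0 within (\<lambda>w. w /\<^sub>R e) ` S)" and e: "0 < e"
 shows "eventually (\<lambda>w. P (w /\<^sub>R e)) (at (e *\<^sub>R q0) within S)"
proof -
 obtain d where d: "0 < d" "\<forall>x\<in>(\<lambda>w. w /\<^sub>R e) ` S. x \<noteq> q0 \<and> dist x q0 < d --> P x" using assms(1) unfolding eventually_at by blast
 show ?thesis
  unfolding eventually_at
 proof (intro exI[of _ "e * d"] conjI ballI impI)
  fix w assume w: "w \<in> S" "w \<noteq> e *\<^sub>R q0 \<and> dist w (e *\<^sub>R q0) < e * d"
  have "w - e *\<^sub>R q0 = e *\<^sub>R (w /\<^sub>R e - q0)" using e by (simp add: algebra_simps)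
  then have "dist w (e *\<^sub>R q0) = e * dist (w /\<^sub>R e) q0" using e by (simp add: dist_norm)
  then have "dist (w /\<^sub>R e) q0 < d" using w e by simp
  moreover have "w /\<^sub>R e \<noteq> q0" using w e by auto
  ultimately show "P (w /\<^sub>R e)" using d(2) w(1) by blast
 qed (use d e in simp)
qed

lemma visc_supersolution_dual:
 fixes z :: "'a::euclidean_space => real"
 shows "visc_supersolution F S z \<longleftrightarrow> visc_subsolution (\<lambda>x p. - F x (- p)) S (\<lambda>x. - z x)"
proof -
 have neg: "C1_fun (\<lambda>x. - f x) (\<lambda>x. - Df x)" if "C1_fun f Df" for f :: "'a => real" and Df
  using that unfolding C1_fun_def by (auto intro!: GDERIV_minus continuous_on_minus)
 show ?thesis
  unfolding visc_subsolution_def visc_supersolution_def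
 proof (intro iffI allI ballI impI)
  fix f :: "'a => real" and Df x0 assume x0: "x0 \<in> S" and C: "C1_fun f Df"
  { assume *: "\<forall>(f :: 'a => real) Df. \<forall>x0\<in>S. C1_fun f Df --> (\<forall>\<^sub>F x in at x0 within S. z x0 - f x0 <= z x - f x) --> 0 <= F x0 (Df x0)"
    and "\<forall>\<^sub>F x in at x0 within S. - z x - f x <= - z x0 - f x0"
   then show "- F x0 (- Df x0) <= 0"
    using *[rule_format, OF x0 neg[OF C]] by (simp add: algebra_simps) }
  { assume *: "\<forall>(f :: 'a => real) Df. \<forall>x0\<in>S. C1_fun f Df --> (\<forall>\<^sub>F x in at x0 within S. - z x - f x <= - z x0 - f x0) --> - F x0 (- Df x0) <= 0"
    and "\<forall>\<^sub>F x in at x0 within S. z x0 - f x0 <= z x - f x"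
   then show "0 <= F x0 (Df x0)"
    using *[rule_format, OF x0 neg[OF C]] by (simp add: algebra_simps) }
 qed
qed

lemma visc_subsolution_scale:
 fixes z :: "'a::euclidean_space => real"
 assumes e: "0 < e" and sub: "visc_subsolution F S z"
 shows "visc_subsolution (\<lambda>q. F (e *\<^sub>R q)) ((\<lambda>w. w /\<^sub>R e) ` S) (\<lambda>q. z (e *\<^sub>R q) / e)"
proof -
 have sc: "e *\<^sub>R (w /\<^sub>R e) = w" "(e *\<^sub>R w) /\<^sub>R e = w" for w :: 'a using e by auto
 have S: "e *\<^sub>R q0 \<in> S" if "q0 \<in> (\<lambda>w. w /\<^sub>R e) ` S" for q0 using that sc by auto
 have m: "e * (a / e - b) = a - e * b" for a b :: real using e by (simp add: algebra_simps)
 show ?thesis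
  unfolding visc_subsolution_def
 proof (intro allI ballI impI)
  fix f Df q0 assume q0: "q0 \<in> (\<lambda>w. w /\<^sub>R e) ` S" and C: "C1_fun f Df"
   and ev: "\<forall>\<^sub>F x in at q0 within (\<lambda>w. w /\<^sub>R e) ` S. z (e *\<^sub>R x) / e - f x <= z (e *\<^sub>R q0) / e - f q0"
  from eventually_scale[OF ev e]
  have "\<forall>\<^sub>F w in at (e *\<^sub>R q0) within S. z w - e * f (w /\<^sub>R e) <= z (e *\<^sub>R q0) - e * f ((e *\<^sub>R q0) /\<^sub>R e)"
  proof (rule eventually_mono)
   fix w assume "z (e *\<^sub>R (w /\<^sub>R e)) / e - f (w /\<^sub>R e) <= z (e *\<^sub>R q0) / e - f q0"
   from mult_left_mono[OF this, of e] e
   show "z w - e * f (w /\<^sub>R e) <= z (e *\<^sub>R q0) - e * f ((e *\<^sub>R q0) /\<^sub>R e)" by (simp only: sc m less_imp_le)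
  qed
  from sub[unfolded visc_subsolution_def, rule_format, OF S[OF q0] C1_fun_scale[OF C e] this]
  show "F (e *\<^sub>R q0) (Df q0) <= 0" by (simp only: sc)
 qed
qed

lemma visc_supersolution_scale:
 fixes z :: "'a::euclidean_space => real"
 assumes "0 < e" "visc_supersolution F S z"
 shows "visc_supersolution (\<lambda>q. F (e *\<^sub>R q)) ((\<lambda>w. w /\<^sub>R e) ` S) (\<lambda>q. z (e *\<^sub>R q) / e)"
 using visc_subsolution_scale[OF assms(1) assms(2)[unfolded visc_supersolution_dual]]
 unfolding visc_supersolution_dual by simp

lemma closure_dilate: "0 < e ==> closure (dilate e U) = dilate e (closure U)"
 unfolding dilate_def by (simp add: closure_scaleR)

text \<open>Scaling space, time and value by the same factor leaves gradients and time derivatives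
  unchanged, so the small parameter leaves the Hamiltonian while Lipschitz constants are
  preserved.\<close>

lemma state_constraint_solution_scale:
 fixes U :: "(real ^ 'n) set"
 assumes sol: "state_constraint_solution (osc_ham e H) (dilate e U) g z" and e: "0 < e"
 shows "state_constraint_solution H U (\<lambda>x. g (e *\<^sub>R x) / e) (\<lambda>(x, t). z (e *\<^sub>R x, e * t) / e)"
proof -
 let ?z = "\<lambda>(x, t). z (e *\<^sub>R x, e * t) / e"
 have z: "?z = (\<lambda>q. z (e *\<^sub>R q) / e)" by (auto simp: fun_eq_iff)
 have im: "(\<lambda>w. w /\<^sub>R e) ` (dilate e V \<times> T) = V \<times> T" if "(\<lambda>t. t / e) ` T = T" for V :: "(real^'n) set" and T
 proof -
  have "(\<lambda>w. w /\<^sub>R e) ` (dilate e V \<times> T) = V \<times> ((\<lambda>t. t / e) ` T)"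
   using e by (force simp: dilate_def divide_inverse mult.commute)
  then show ?thesis using that by simp
 qed
 have T: "(\<lambda>t. t / e) ` {0<..} = {0<..}" "(\<lambda>t. t / e) ` {0..} = {0..}"
  using e by (auto intro!: image_eqI[of _ _ "_ * e"] simp: zero_less_divide_iff)
 have F: "(\<lambda>q. (\<lambda>(x, t) (p, s). s + osc_ham e H x p) (e *\<^sub>R q)) = (\<lambda>(x, t) (p, s). s + H x p)"
  using e by (auto simp: fun_eq_iff osc_ham_def)
 obtain K where K: "K-lipschitz_on (closure (dilate e U) \<times> {0..}) z" using sol unfolding state_constraint_solution_def by blast
 have sm: "(\<lambda>q. e *\<^sub>R q) ` (closure U \<times> {0::real..}) \<subseteq> closure (dilate e U) \<times> {0..}"
 proof (rule image_subsetI)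
  fix q assume "q \<in> closure U \<times> {0::real..}"
  then have "e *\<^sub>R fst q \<in> dilate e (closure U)" "0 <= e * snd q" using e by (auto simp: dilate_def)
  then show "e *\<^sub>R q \<in> closure (dilate e U) \<times> {0..}" unfolding closure_dilate[OF e]
   by (simp add: mem_Times_iff)
 qed
 have lip: "K-lipschitz_on (closure U \<times> {0..}) ?z"
  unfolding z
 proof (rule lipschitz_onI)
  fix p q :: "(real^'n) \<times> real" assume pq: "p \<in> closure U \<times> {0..}" "q \<in> closure U \<times> {0..}"
  have "dist (z (e *\<^sub>R p)) (z (e *\<^sub>R q)) <= K * dist (e *\<^sub>R p) (e *\<^sub>R q)"
   by (rule lipschitz_onD[OF K]) (use sm pq in auto)
  also have "\<dots> = e * (K * dist p q)" using e by (simp add: dist_norm flip: scaleR_diff_right)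
  finally have "dist (z (e *\<^sub>R p)) (z (e *\<^sub>R q)) / e <= K * dist p q" using e by (subst pos_divide_le_eq) (auto simp: mult.commute)
  moreover have "dist (z (e *\<^sub>R p) / e) (z (e *\<^sub>R q) / e) = dist (z (e *\<^sub>R p)) (z (e *\<^sub>R q)) / e"
   using e by (simp add: dist_real_def flip: diff_divide_distrib)
  ultimately show "dist (z (e *\<^sub>R p) / e) (z (e *\<^sub>R q) / e) <= K * dist p q" by simp
 qed (use lipschitz_on_nonneg[OF K] in simp)
 show ?thesis
  unfolding state_constraint_solution_def
 proof (intro conjI)
  show "continuous_on (closure U \<times> {0..}) ?z" by (rule lipschitz_on_continuous_on[OF lip])
  show "\<exists>K. K-lipschitz_on (closure U \<times> {0..}) ?z" using lip by blast
  have "visc_subsolution (\<lambda>(x, t) (p, s). s + osc_ham e H x p) (dilate e U \<times> {0<..}) z"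
   using sol unfolding state_constraint_solution_def by blast
  from visc_subsolution_scale[OF e this] show "HJ_sub H U ?z"
   unfolding F z im[OF T(1)] .
  have "visc_supersolution (\<lambda>(x, t) (p, s). s + osc_ham e H x p) (dilate e (closure U) \<times> {0<..}) z"
   using sol unfolding state_constraint_solution_def closure_dilate[OF e] by blast
  from visc_supersolution_scale[OF e this] show "HJ_super H (closure U) ?z"
   unfolding F z im[OF T(1)] .
  have "z (e *\<^sub>R x, 0) = g (e *\<^sub>R x)" if "x \<in> closure U" for x
  proof -
   have "e *\<^sub>R x \<in> closure (dilate e U)" using that unfolding closure_dilate[OF e] by (auto simp: dilate_def)
   then show ?thesis using sol unfolding state_constraint_solution_def by blast
  qed
  then show "\<forall>x\<in>closure U. ?z (x, 0) = g (e *\<^sub>R x) / e" by simp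
 qed
qed

text \<open>A subdivision finer than a uniform radius chains the local bounds. It is needed because
  \<open>solution_gradient_bound\<close> speaks only of small balls.\<close>

lemma segment_lipschitz:
 fixes f :: "'a::euclidean_space => real"
 assumes C: "0 <= C" and loc: "\<And>w. w \<in> closed_segment x y ==> \<exists>r>0. C-lipschitz_on (ball w r \<inter> closed_segment x y) f"
 shows "\<bar>f x - f y\<bar> <= C * norm (x - y)"
proof -
 let ?S = "closed_segment x y"
 have "\<exists>e>0. \<exists>c::real. \<forall>w\<in>?S. C-lipschitz_on (ball w e \<inter> ?S) f"
  by (rule compact_uniform_radius[OF compact_segment]) (use loc in \<open>auto intro: lipschitz_on_subset\<close>)
 then obtain e where e: "0 < e" "\<And>w. w \<in> ?S ==> C-lipschitz_on (ball w e \<inter> ?S) f" by blast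
 obtain N0 :: nat where N0: "norm (x - y) / e < real N0" using reals_Archimedean2 by blast
 define N where "N = Suc N0"
 have "norm (x - y) / e < real N" using N0 by (simp add: N_def)
 then have N: "norm (x - y) / real N < e" "0 < real N"
  using e by (simp_all add: N_def pos_divide_less_eq mult.commute)
 define P where "P i = x + (real i / real N) *\<^sub>R (y - x)" for i
 have PS: "P i \<in> ?S" if "i <= N" for i
  unfolding P_def in_segment by (rule exI[of _ "real i / real N"]) (use that N in \<open>simp add: algebra_simps\<close>)
 have "\<bar>f x - f (P i)\<bar> <= C * (real i / real N * norm (x - y))" if "i <= N" for i
  using that
 proof (induction i)
  case (Suc i)
  have d: "P (Suc i) - P i = (1 / real N) *\<^sub>R (y - x)" by (simp add: P_def add_divide_distrib algebra_simps)
  then have n: "norm (P (Suc i) - P i) = norm (x - y) / real N" by (simp add: norm_minus_commute)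
  then have "P (Suc i) \<in> ball (P i) e \<inter> ?S" "P i \<in> ball (P i) e \<inter> ?S"
   using N PS[of i] PS[of "Suc i"] Suc.prems e(1) by (auto simp: dist_norm norm_minus_commute)
  from lipschitz_onD[OF e(2)[OF PS[of i]] this(2,1)] Suc.prems
  have "\<bar>f (P i) - f (P (Suc i))\<bar> <= C * norm (P (Suc i) - P i)" by (simp add: dist_norm norm_minus_commute)
  then have "\<bar>f (P i) - f (P (Suc i))\<bar> <= C * (norm (x - y) / real N)" unfolding n .
  moreover have "\<bar>f x - f (P i)\<bar> <= C * (real i / real N * norm (x - y))" using Suc by simp
  moreover have "C * (real i / real N * norm (x - y)) + C * (norm (x - y) / real N) = C * (real (Suc i) / real N * norm (x - y))"
   by (simp add: add_divide_distrib algebra_simps)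
  ultimately show ?case by linarith
 qed (simp add: P_def)
 from this[of N] N show ?thesis by (simp add: P_def)
qed

context hamiltonian
begin

text \<open>A first representation with a crude threshold yields the lower bound on the time derivative
 in terms of the initial data alone, which then allows any \<open>R\<close> beyond that bound.\<close>

lemma evolution_lipschitz:
 fixes z :: "'a \<times> real => real"
 assumes U: "regular_domain U" "U \<noteq> {}" and lip: "K-lipschitz_on (closure U \<times> {0..}) z"
  and sub: "HJ_sub H U z"
  and sup: "HJ_super H (closure U) z"
  and init: "\<And>x y. x \<in> closure U ==> y \<in> closure U ==> \<bar>z (x, 0) - z (y, 0)\<bar> <= L * norm (x - y)" and L: "0 <= L"
  and M: "\<And>w p. norm p <= L ==> H w p <= M" and thr: "\<And>y p. R <= norm p ==> M < H y p"
 shows "evolution H U z 0 K K M R"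
proof -
 have K: "0 <= K" by (rule lipschitz_on_nonneg[OF lip])
 have M0: "0 <= M" using M[of 0] L by (simp add: zero)
 have opn: "open U" by (rule regular_domainD(1)[OF U(1)])
 have cont: "continuous_on (closure U \<times> {0..}) z" by (rule lipschitz_on_continuous_on[OF lip])
 have growth: "\<bar>z (x, t) - z (y, t)\<bar> <= 0 + K * norm (x - y)" if "x \<in> closure U" "y \<in> closure U" "0 <= t" for x y t
  using lipschitz_onD[OF lip, of "(x, t)" "(y, t)"] that by (simp add: dist_Pair_Pair dist_norm)
 have tl: "\<bar>z (x, t) - z (x, s)\<bar> <= K * \<bar>t - s\<bar>" if "x \<in> closure U" "0 <= s" "0 <= t" for x s t
  using lipschitz_onD[OF lip, of "(x, t)" "(x, s)"] that by (simp add: dist_Pair_Pair dist_norm)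
 obtain R1 where LR1: "L <= R1" and thr1: "\<And>y p. R1 <= norm p ==> K < H y p" by (rule coercive_above) (rule that)
 have ev: "evolution H U z 0 K K K R1"
 proof (unfold_locales)
  fix x and s h :: real assume "x \<in> closure U" "0 <= s" "0 <= h"
  then show "z (x, s) - K * h <= z (x, s + h)" using tl[of x s "s + h"] by simp
 qed (fact opn U cont growth tl thr1 K order_refl)+
 have uc: "uniformly_continuous_on (closure U) (\<lambda>x. z (x, 0))"
 proof (rule lipschitz_on_uniformly_continuous)
  show "L-lipschitz_on (closure U) (\<lambda>x. z (x, 0))"
   by (rule lipschitz_onI) (use init L in \<open>auto simp: dist_norm\<close>)
 qed
 have low: "z (x, s) - M * h <= z (x, s + h)" if x: "x \<in> U" and sh: "0 <= s" "0 <= h" for x s h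
 proof (cases "h = 0")
  case False
  then have h: "0 < s + h" using sh by simp
  show ?thesis
  proof (rule field_le_epsilon)
   fix b :: real assume b: "0 < b"
   from evolution.supersolution_trav[OF ev sup U(1) uc x h b]
   obtain y c where tr: "trav U H R1 (s + h) y x c" and le: "z (y, 0) + c <= z (x, s + h) + b" by blast
   have R1: "0 <= R1" "L <= R1" using L LR1 by auto
   \<comment> \<open>The initial piece of duration h is dropped and the start moved to w. Its cost
     is at least L |w - y| - h M, so the move loses at most h M.\<close>
   have "trav U H R1 (h + s) y x c" using tr by (simp add: add.commute)
   then obtain w c1 c2 where w: "trav U H R1 h y w c1" "trav U H R1 s w x c2" "c = c1 + c2"
    by (rule trav_split[OF _ R1(1) sh(2) sh(1)])
   have "z (x, 0 + s) <= z (w, 0) + c2" by (rule evolution.subsolution_trav[OF ev sub w(2)]) simp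
   moreover have "z (w, 0) - z (y, 0) <= L * norm (w - y)"
    using init[of w y] trav_in[OF w(1)] closure_subset[of U] by (simp add: abs_le_iff subset_iff)
   moreover have "L * norm (w - y) - h * M <= c1" by (rule trav_lower_bound[OF w(1) L R1(2) M])
   ultimately show "z (x, s) - M * h <= z (x, s + h) + b" using le w(3) by (simp add: mult.commute)
  qed
 qed simp
 have low': "z (x, s) - M * h <= z (x, s + h)" if x: "x \<in> closure U" and sh: "0 <= s" "0 <= h" for x s h
 proof -
  have c: "continuous_on (closure U) (\<lambda>x. z (x, t))" if "0 <= t" for t
   by (rule continuous_on_compose2[OF cont]) (use that in \<open>auto intro!: continuous_intros\<close>)
  have "continuous_on (closure U) (\<lambda>x. z (x, s + h) - z (x, s))" by (intro continuous_on_diff c) (use sh in auto)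
  from continuous_ge_on_closure[OF this x, of "- (M * h)"] have "- (M * h) <= z (x, s + h) - z (x, s)"
   using low[OF _ sh] by force
  then show ?thesis by simp
 qed
 show ?thesis
  by (unfold_locales) (fact opn U cont growth tl low' thr K M0 order_refl)+
qed

end

text \<open>Translation by the cell brings y into a bounded set, where continuity is uniform and
  \<open>H\<close> is bounded on bounded momenta.\<close>

lemma hamiltonianI:
 fixes H :: "real ^ 'n => real ^ 'n => real"
 assumes "A1 H" "A2 H" "A3 H" "A5 H"
 shows "hamiltonian H"
proof -
 have nonneg: "0 <= H y p" and zero: "H y 0 = 0" for y p using assms(4) unfolding A5_def by metis+
 have per: "H (y - cell y) p = H y p" for y p
  using assms(1) cell_lattice[of y] int_lattice_minus unfolding A1_def by (metis diff_conv_add_uminus)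
 have per2: "H (y' - cell y) p = H y' p" for y y' p
  using assms(1) cell_lattice[of y] int_lattice_minus unfolding A1_def by (metis diff_conv_add_uminus)
 have nc: "norm (y - cell y) <= real CARD('n)" for y :: "real^'n"
 proof -
  have "\<bar>(y - cell y) $ i\<bar> <= 1" for i using cell_bounds[of y i] unfolding vector_minus_component by linarith
  then have "norm (y - cell y) <= real CARD('n) * 1" by (rule norm_le_card)
  then show ?thesis by simp
 qed
 have cont: "continuous_on S (\<lambda>(y, p). H y p)" for S using assms(1) unfolding A1_def by (meson continuous_on_subset subset_UNIV)
 show ?thesis
 proof
  show "convex_on UNIV (H y)" for y using assms(3) unfolding A3_def by blast
  show "H y 0 = 0" "0 <= H y p" for y p by (fact zero nonneg)+
  fix R :: real
  let ?S = "cball 0 (real CARD('n) + 1) \<times> cball (0::real^'n) R :: ((real^'n) \<times> (real^'n)) set"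
  have cS: "compact ?S" by (intro compact_Times) auto
  have "bounded ((\<lambda>(y, p). H y p) ` ?S)" by (intro compact_imp_bounded compact_continuous_image cS cont)
  then obtain B where "\<forall>h\<in>(\<lambda>(y, p). H y p) ` ?S. norm h <= B" unfolding bounded_iff by (elim exE)
  then have B: "H y p <= B" if "(y, p) \<in> ?S" for y p using that by (force simp: abs_le_iff)
  have "H y p <= B" if "norm p <= R" for y p
   unfolding per[of y p, symmetric] by (rule B) (use that nc[of y] in auto)
  then show "\<exists>M. \<forall>y p. norm p <= R --> H y p <= M" by blast
  fix e :: real assume e: "0 < e"
  have "uniformly_continuous_on ?S (\<lambda>(y, p). H y p)" by (rule compact_uniformly_continuous[OF cont cS])
  then obtain d where d: "0 < d" "\<And>q q'. q \<in> ?S ==> q' \<in> ?S ==> dist q' q < d ==> dist ((\<lambda>(y, p). H y p) q') ((\<lambda>(y, p). H y p) q) < e"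
   using e unfolding uniformly_continuous_on_def by meson
  show "\<exists>d>0. \<forall>y y' p. norm p <= R --> dist y y' < d --> \<bar>H y p - H y' p\<bar> < e"
  proof (rule exI[of _ "min d 1"], intro conjI allI impI)
   fix y y' p :: "real^'n" assume p: "norm p <= R" and yy: "dist y y' < min d 1"
   have eq: "dist (y - cell y) (y' - cell y) = dist y y'" by (simp add: dist_norm)
   have "norm (y' - cell y) <= norm (y - cell y) + dist y y'"
    using norm_triangle_ineq4[of "y - cell y" "y - y'"] by (simp add: dist_norm)
   then have in2: "(y - cell y, p) \<in> ?S" "(y' - cell y, p) \<in> ?S" using nc[of y] yy p by auto
   have "dist (y - cell y, p) (y' - cell y, p) < d" using yy eq by (simp add: dist_Pair_Pair)
   from d(2)[OF in2(2) in2(1) this] show "\<bar>H y p - H y' p\<bar> < e" by (simp add: per per2 dist_real_def)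
  qed (use d in simp)
 next
  fix K :: real
  have "eventually (\<lambda>p. K < (INF y. H y p)) at_infinity"
   using assms(2) unfolding A2_def filterlim_at_top_dense by blast
  then obtain r where r: "\<forall>p. r <= norm p --> K < (INF y. H y p)" unfolding eventually_at_infinity by blast
  have "K < H y p" if "r <= norm p" for y p
  proof -
   have "(INF y. H y p) <= H y p" by (rule cINF_lower) (use nonneg in \<open>auto intro!: bdd_belowI[of _ 0]\<close>)
   then show ?thesis using r that by force
  qed
  then show "\<exists>r. \<forall>y p. r <= norm p --> K < H y p" by blast
 qed
qed

section \<open>Existence of solutions on perforated domains\<close>

locale periodic_hamiltonian = hole D + hamiltonian H
 for D :: "(real ^ 'n) set" and H :: "real ^ 'n => real ^ 'n => real" +
 assumes periodic: "m \<in> int_lattice ==> H (y + m) p = H y p"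
begin

lemma perforated_nonempty: "perforated D J \<noteq> {}"
 using corner_perforated perforated_mono[of "{}" J] by blast

text \<open>Nearby points are joined by short links. At distance at least r, the additive 1 in the
  uniform bound is at most distance / r.\<close>

lemma conn_lipschitz: "\<exists>L\<ge>0. \<forall>x\<in>perforated D J. \<forall>y\<in>perforated D J. \<exists>l\<le>L * norm (x - y). conn (perforated D J) x y l"
proof -
 let ?U = "perforated D J"
 obtain r C where rC: "0 < r" "0 <= C" "\<And>x y. x \<in> ?U ==> y \<in> ?U ==> norm (x - y) < r ==> link ?U x y (C * norm (x - y))"
  using regular_domainD(3)[OF regular_perforated] by blast
 define L where "L = max C (conn_const * (1 + 1 / r))"
 have "\<exists>l\<le>L * norm (x - y). conn ?U x y l" if xy: "x \<in> ?U" "y \<in> ?U" for x y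
 proof (cases "norm (x - y) < r")
  case True
  from link_conn[OF rC(3)[OF xy True]] obtain l where l: "l <= C * norm (x - y)" "conn ?U x y l" by blast
  have "C * norm (x - y) <= L * norm (x - y)" unfolding L_def by (intro mult_right_mono) auto
  then show ?thesis using l by (meson order_trans)
 next
  case False
  obtain l where l: "l <= conn_const * (norm (x - y) + 1)" "conn ?U x y l" using conn_const(3)[OF xy] by blast
  have "conn_const * (norm (x - y) + 1) <= conn_const * (norm (x - y) + norm (x - y) / r)"
   using False rC(1) conn_const(1) by (intro mult_left_mono) auto
  also have "\<dots> = conn_const * (1 + 1 / r) * norm (x - y)" by (simp add: algebra_simps)
  also have "\<dots> <= L * norm (x - y)" unfolding L_def by (intro mult_right_mono) auto
  finally show ?thesis using l by (meson order_trans)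
 qed
 moreover have "0 <= L" using rC(2) by (simp add: L_def le_max_iff_disj)
 ultimately show ?thesis by blast
qed

lemma lipschitz_from_jumps:
 fixes V :: "(real ^ 'n) \<times> real => real"
 assumes jump: "\<And>x y t l. conn (perforated D J) y x l ==> 0 <= t ==> V (x, t) <= V (y, t) + B * l"
  and time: "\<And>x s t. x \<in> perforated D J ==> 0 <= s ==> 0 <= t ==> \<bar>V (x, t) - V (x, s)\<bar> <= M * \<bar>t - s\<bar>"
  and B: "0 <= B" and M: "0 <= M"
 shows "\<exists>K. K-lipschitz_on (perforated D J \<times> {0..}) V"
proof -
 obtain L where L: "0 <= L" "\<forall>x\<in>perforated D J. \<forall>y\<in>perforated D J. \<exists>l\<le>L * norm (x - y). conn (perforated D J) x y l"
  using conn_lipschitz by blast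
 have one: "V (x, t) <= V (y, t) + B * L * norm (y - x)" if xy: "x \<in> perforated D J" "y \<in> perforated D J" "0 <= t" for x y t
 proof -
  obtain l where l: "l <= L * norm (y - x)" "conn (perforated D J) y x l"
   using L(2)[THEN bspec, OF xy(2), THEN bspec, OF xy(1)] by (elim exE conjE)
  show ?thesis using mult_left_mono[OF l(1) B] jump[OF l(2) xy(3)] by linarith
 qed
 have "(B * L + M)-lipschitz_on (perforated D J \<times> {0..}) V"
 proof (rule lipschitz_onI)
  fix q q' assume "q \<in> perforated D J \<times> {0::real..}" "q' \<in> perforated D J \<times> {0::real..}"
  then obtain x t x' t' where q: "q = (x, t)" "q' = (x', t')" "x \<in> perforated D J" "x' \<in> perforated D J" "0 <= t" "0 <= t'"
   by (cases q, cases q') auto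
  have "\<bar>V (x, t) - V (x', t)\<bar> <= B * L * norm (x - x')"
   using one[OF q(3,4,5)] one[OF q(4,3,5)] by (simp add: norm_minus_commute abs_le_iff)
  also have "\<dots> <= B * L * dist q q'"
   using B L dist_fst_le[of q q'] by (intro mult_left_mono) (auto simp: q dist_norm)
  finally have 1: "\<bar>V (x, t) - V (x', t)\<bar> <= B * L * dist q q'" .
  have "\<bar>V (x', t) - V (x', t')\<bar> <= M * \<bar>t - t'\<bar>" by (rule time[OF q(4,6,5)])
  also have "\<dots> <= M * dist q q'"
   using M dist_snd_le[of q q'] by (intro mult_left_mono) (auto simp: q dist_real_def)
  finally show "dist (V q) (V q') <= (B * L + M) * dist q q'" using 1 unfolding q dist_real_def distrib_right by linarith
 qed (use B L M in simp)
 then show ?thesis by blast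
qed

text \<open>Travels live in the open set, so V is meaningful only there. Jumps make it Lipschitz in
  space, waiting and \<open>time_low\<close> make it Lipschitz in time, and so it extends to the
  closure.\<close>

lemma solution_from_dpp:
 fixes V :: "(real ^ 'n) \<times> real => real" and J :: "(real ^ 'n) set"
 defines "U \<equiv> perforated D J"
 assumes K1: "0 <= K1" and thr: "\<And>y p. R <= norm p ==> K1 < H y p"
  and dpp_le: "\<And>x y h c t. trav U H R h y x c ==> 0 <= t ==> V (x, t + h) <= V (y, t) + c"
  and dpp_ge: "\<And>x t h b. x \<in> U ==> 0 <= t ==> 0 <= h ==> 0 < b ==>
    \<exists>y c. trav U H R h y x c \<and> V (y, t) + c <= V (x, t + h) + b"
  and time_low: "\<And>x s h. x \<in> U ==> 0 <= s ==> 0 <= h ==> V (x, s) - K1 * h <= V (x, s + h)"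
 shows "\<exists>Z K. K-lipschitz_on (closure U \<times> {0..}) Z \<and> (\<forall>x\<in>U. \<forall>t\<ge>0. Z (x, t) = V (x, t)) \<and>
  HJ_sub H U Z \<and>
  HJ_super H (closure U) Z"
proof -
 have R: "0 <= R" using thr[of 0] zero K1 by (metis less_eq_real_def linorder_not_less norm_zero)
 have cU: "closure (U \<times> {0..}) = closure U \<times> {0::real..}" by (simp add: closure_Times)
 have "\<exists>K. K-lipschitz_on (perforated D J \<times> {0..}) V"
 proof (rule lipschitz_from_jumps[OF _ _ R K1])
  fix x y t l assume "conn (perforated D J) y x l" "0 <= (t::real)"
  from dpp_le[OF conn_trav[OF this(1) R, folded U_def] this(2)] show "V (x, t) <= V (y, t) + R * l" by simp
 next
  fix x and s t :: real assume x: "x \<in> perforated D J" and st: "0 <= s" "0 <= t"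
  have w: "V (x, a + h) <= V (x, a)" "V (x, a) - K1 * h <= V (x, a + h)" if "0 <= a" "0 <= h" for a h
  proof -
   have xU: "x \<in> U" using x unfolding U_def .
   show "V (x, a + h) <= V (x, a)" using dpp_le[OF trav_wait[OF xU R that(2)] that(1)] by simp
   show "V (x, a) - K1 * h <= V (x, a + h)" by (rule time_low[OF xU that])
  qed
  show "\<bar>V (x, t) - V (x, s)\<bar> <= K1 * \<bar>t - s\<bar>"
  proof (cases "s <= t")
   case True
   then show ?thesis using w[of s "t - s"] st by (simp add: abs_le_iff)
  next
   case False
   then show ?thesis using w[of t "s - t"] st False by (simp add: abs_le_iff)
  qed
 qed
 then obtain K where "K-lipschitz_on (U \<times> {0..}) V" unfolding U_def by blast
 from lipschitz_extend_closure[OF this] obtain Z where lip: "K-lipschitz_on (closure U \<times> {0..}) Z"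
  and ZV: "\<And>x t. x \<in> U ==> 0 <= t ==> Z (x, t) = V (x, t)" unfolding cU by auto
 have cont: "continuous_on (closure U \<times> {0..}) Z" by (rule lipschitz_on_continuous_on[OF lip])
 have vf: "value_function H U Z K1 R"
 proof (unfold_locales)
  show "open U" unfolding U_def by (rule open_perforated)
  show "Z (x, t + h) <= Z (y, t) + c" if "trav U H R h y x c" "0 <= t" for x y h c t
   using dpp_le[OF that] ZV trav_in[OF that(1)] that(2) by simp
  show "\<exists>y c. trav U H R h y x c \<and> Z (y, t) + c <= Z (x, t + h) + b" if "x \<in> U" "0 <= t" "0 <= h" "0 < b" for x t h b
  proof -
   obtain y c where yc: "trav U H R h y x c" "V (y, t) + c <= V (x, t + h) + b" using dpp_ge[OF \<open>x \<in> U\<close> \<open>0 <= t\<close> \<open>0 <= h\<close> \<open>0 < b\<close>] by blast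
   then show ?thesis using ZV trav_in[OF yc(1)] that by (intro exI[of _ y] exI[of _ c]) simp
  qed
  show "Z (x, s) - K1 * h <= Z (x, s + h)" if x: "x \<in> closure U" and sh: "0 <= s" "0 <= h" for x s h
  proof -
   have c: "continuous_on (closure U) (\<lambda>x. Z (x, t))" if "0 <= t" for t
    by (rule continuous_on_compose2[OF cont]) (use that in \<open>auto intro!: continuous_intros\<close>)
   have "continuous_on (closure U) (\<lambda>x. Z (x, s + h) - Z (x, s))" by (intro continuous_on_diff c) (use sh in auto)
   from continuous_ge_on_closure[OF this x, of "- (K1 * h)"] have "- (K1 * h) <= Z (x, s + h) - Z (x, s)"
    using time_low[OF _ sh] ZV sh by force
   then show ?thesis by simp
  qed
 qed (fact cont K1 thr)+
 show ?thesis
  using lip ZV value_function.subsolution[OF vf] value_function.supersolution[OF vf] by blast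
qed

text \<open>The infimum of initial value plus travel cost is the candidate. A bound of
  \<open>H\<close> on momenta up to the Lipschitz constant of g limits its decrease in time, and the
  threshold \<open>R\<close> is chosen accordingly.\<close>

lemma exists_solution:
 assumes g: "L-lipschitz_on UNIV g"
 shows "\<exists>z. state_constraint_solution H (perforated D J) g z"
proof -
 define U where "U = perforated D J"
 have L: "0 <= L" by (rule lipschitz_on_nonneg[OF g])
 have gl: "\<bar>g x - g y\<bar> <= L * norm (x - y)" for x y using lipschitz_onD[OF g, of x y] by (simp add: dist_norm)
 obtain M where M: "\<And>y p. norm p <= L ==> H y p <= M" using locally_bounded by blast
 have M0: "0 <= M" using M[of 0] L by (simp add: zero)
 obtain R where R: "L <= R" and thr: "\<And>y p. R <= norm p ==> M < H y p" by (rule coercive_above) (rule that)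
 have R: "0 <= R" "L <= R" using L R by auto
 define S where "S x t = {g y + c | y c. trav U H R t y x c}" for x t
 define V where "V q = Inf (S (fst q) (snd q))" for q
 have low: "g x - M * t <= g y + c" if "trav U H R t y x c" for x y t c
  using gl[of x y] trav_lower_bound[OF that L R(2) M] by (simp add: abs_le_iff mult.commute)
 have bdd: "bdd_below (S x t)" for x t
  unfolding S_def using low by (intro bdd_belowI[of _ "g x - M * t"]) auto
 have Vle: "V (x, t) <= g y + c" if "trav U H R t y x c" for x y t c
  unfolding V_def by (rule cInf_lower) (use that bdd in \<open>auto simp: S_def\<close>)
 have ne: "S x t \<noteq> {}" if "x \<in> U" "0 <= t" for x t
  using trav_wait[OF that(1) R(1) that(2)] unfolding S_def by blast
 have Vge: "\<exists>y c. trav U H R t y x c \<and> g y + c < V (x, t) + a" if "x \<in> U" "0 <= t" "0 < a" for x t a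
 proof -
  have "Inf (S x t) < V (x, t) + a" using that by (simp add: V_def)
  from cInf_lessD[OF ne[OF that(1,2)] this] show ?thesis unfolding S_def by blast
 qed
 have Vlow: "b <= V (x, t)" if "x \<in> U" "0 <= t" "\<And>y c. trav U H R t y x c ==> b <= g y + c" for x t b
  unfolding V_def by (rule cInf_greatest) (use ne[OF that(1,2)] that(3) in \<open>auto simp: S_def\<close>)
 have V0: "V (x, 0) = g x" if "x \<in> U" for x
 proof (rule antisym)
  show "V (x, 0) <= g x" using Vle[OF trav_nil[OF that]] by simp
  show "g x <= V (x, 0)" by (rule Vlow[OF that]) (use low in force)+
 qed
 have d1: "V (x, t + h) <= V (y, t) + c" if tr: "trav U H R h y x c" and t: "0 <= t" for x y h c t
 proof -
  have y: "y \<in> U" using trav_in[OF tr] by blast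
  show ?thesis
  proof (rule field_le_epsilon)
   fix a :: real assume "0 < a"
   from Vge[OF y t this] obtain w d where w: "trav U H R t w y d" "g w + d < V (y, t) + a" by blast
   from Vle[OF trav_trans[OF tr w(1)]] w(2) show "V (x, t + h) <= V (y, t) + c + a" by linarith
  qed
 qed
 have d2: "\<exists>y c. trav U H R h y x c \<and> V (y, t) + c <= V (x, t + h) + a" if x: "x \<in> U" and t: "0 <= t" "0 <= h" and a: "0 < a" for x t h a
 proof -
  from Vge[OF x _ a, of "t + h"] t obtain w d where w: "trav U H R (t + h) w x d" "g w + d < V (x, t + h) + a" by auto
  from trav_split[OF w(1) R(1) t] obtain y c1 c2 where y: "trav U H R t w y c1" "trav U H R h y x c2" "d = c1 + c2" .
  have "V (y, t) + c2 <= V (x, t + h) + a" using Vle[OF y(1)] y(3) w(2) by linarith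
  then show ?thesis using y(2) by blast
 qed
 have d3: "V (x, s) - M * h <= V (x, s + h)" if x: "x \<in> U" and sh: "0 <= s" "0 <= h" for x s h
 proof (rule Vlow[OF x])
   fix y c assume tr: "trav U H R (s + h) y x c"
   have "trav U H R (h + s) y x c" using tr by (simp add: add.commute)
   from trav_split[OF this R(1) sh(2,1)] obtain w c1 c2 where w: "trav U H R h y w c1" "trav U H R s w x c2" "c = c1 + c2" .
   show "V (x, s) - M * h <= g y + c" using Vle[OF w(2)] low[OF w(1)] w(3) by linarith
 qed (use sh in simp)
 have "\<exists>Z K. K-lipschitz_on (closure U \<times> {0..}) Z \<and> (\<forall>x\<in>U. \<forall>t\<ge>0. Z (x, t) = V (x, t)) \<and>
  HJ_sub H U Z \<and>
  HJ_super H (closure U) Z"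
  by (rule solution_from_dpp[of M R J V, folded U_def]) (fact M0 thr d1 d2 d3)+
 then obtain Z K where Z: "K-lipschitz_on (closure U \<times> {0..}) Z" "\<forall>x\<in>U. \<forall>t\<ge>0. Z (x, t) = V (x, t)"
  "HJ_sub H U Z"
  "HJ_super H (closure U) Z" by (elim exE conjE)
 have Z0: "Z (x, 0) = g x" if "x \<in> closure U" for x
 proof -
  have cont: "continuous_on (closure U \<times> {0..}) Z" by (rule lipschitz_on_continuous_on[OF Z(1)])
  have "continuous_on (closure U) (\<lambda>x. Z (x, 0))"
   by (rule continuous_on_compose2[OF cont]) (auto intro!: continuous_intros)
  moreover have "continuous_on (closure U) g" using lipschitz_on_continuous_on[OF g] continuous_on_subset by blast
  ultimately have "continuous_on (closure U) (\<lambda>x. Z (x, 0) - g x)" by (rule continuous_on_diff)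
  from continuous_constant_on_closure[OF this, of 0] V0 Z(2) have "Z (x, 0) - g x = 0" using that by auto
  then show ?thesis by simp
 qed
 show ?thesis
  unfolding state_constraint_solution_def using Z(1,3,4) Z0 lipschitz_on_continuous_on[OF Z(1)] unfolding U_def by blast
qed

text \<open>The gradient bound, tested on the complement of a single hole far away, controls the initial data.\<close>

lemma initial_lipschitz:
 fixes x y :: "real ^ 'n"
 assumes bound: "solution_gradient_bound H D G C0" and C0: "0 <= C0" and g: "A4 g" "grad_Linf_norm g = G"
 shows "\<bar>g x - g y\<bar> <= C0 * norm (x - y)"
proof -
 obtain L where L: "L-lipschitz_on UNIV g" using g unfolding A4_def by blast
 \<comment> \<open>The gradient bound covers only proper subsets of the lattice, so one hole must
   remain. It is placed on the diagonal so far out that it cannot meet the segment from x to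
   y.\<close>
 define k :: real where "k = of_int \<lceil>norm x + norm y + 1\<rceil>"
 define m :: "real^'n" where "m = (\<chi> i. k)"
 have m: "m \<in> int_lattice" by (simp add: m_def k_def int_lattice_def)
 define J where "J = int_lattice - {m}"
 have J: "J \<subset> int_lattice" using m by (auto simp: J_def)
 define U where "U = perforated D J"
 have seg: "closed_segment x y \<subseteq> U"
 proof
  fix w assume w: "w \<in> closed_segment x y"
  have "closed_segment x y \<subseteq> cball 0 (norm x + norm y)" by (intro closed_segment_subset) auto
  then have nw: "norm w <= norm x + norm y" using w by auto
  show "w \<in> U"
   unfolding U_def in_perforated
  proof
   fix m' assume "m' \<in> int_lattice - J"
   then have m': "m' = m" by (auto simp: J_def)
   show "w - m' \<notin> closure D"
   proof
    assume "w - m' \<in> closure D"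
    then have "- 1/2 < w $ i - k" for i
     using adm unfolding admissible_hole_def m' by (auto simp: m_def dest!: subsetD)
    moreover obtain i :: 'n where True by simp
    ultimately have "- 1/2 < w $ i - k" by blast
    moreover have "norm x + norm y + 1 <= k" unfolding k_def by (rule le_of_int_ceiling)
    ultimately show False using component_le_norm_cart[of w i] nw by (simp add: abs_le_iff)
   qed
  qed
 qed
 obtain z where z: "state_constraint_solution H U g z" using exists_solution[OF L] unfolding U_def by blast
 have e1: "osc_ham 1 H = H" "dilate 1 V = V" for V :: "(real^'n) set" by (auto simp: osc_ham_def dilate_def)
 have loc: "\<exists>r>0. C0-lipschitz_on (ball w r \<inter> U) (\<lambda>y. z (y, t))" if "w \<in> U" "0 < t" for w t
  using bound[unfolded solution_gradient_bound_def, rule_format, of J 1 g z w t] J g z that unfolding U_def e1 by simp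
 have seg_t: "\<bar>z (x, t) - z (y, t)\<bar> <= C0 * norm (x - y)" if t: "0 < t" for t
 proof -
  show ?thesis
  proof (rule segment_lipschitz[OF C0, where f = "\<lambda>w. z (w, t)"])
   fix w assume w: "w \<in> closed_segment x y"
   obtain r where r: "0 < r" "C0-lipschitz_on (ball w r \<inter> U) (\<lambda>y. z (y, t))" using loc[OF _ t] w seg by blast
   have "C0-lipschitz_on (ball w r \<inter> closed_segment x y) (\<lambda>y. z (y, t))"
    by (rule lipschitz_on_subset[OF r(2)]) (use seg in blast)
   then show "\<exists>r>0. C0-lipschitz_on (ball w r \<inter> closed_segment x y) (\<lambda>w. z (w, t))" using r(1) by blast
  qed
 qed
 have U: "x \<in> closure U" "y \<in> closure U" using seg closure_subset[of U] by auto
 have cont: "continuous_on (closure U \<times> {0..}) z" using z unfolding state_constraint_solution_def by blast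
 have c: "continuous_on {0..} (\<lambda>t. z (v, t))" if "v \<in> closure U" for v
  by (rule continuous_on_compose2[OF cont]) (use that in \<open>auto intro!: continuous_intros\<close>)
 have "continuous_on (closure {0<..}) (\<lambda>t. \<bar>z (x, t) - z (y, t)\<bar>)" unfolding closure_greaterThan
  by (intro continuous_on_rabs continuous_on_diff c U)
 from continuous_le_on_closure[OF this, of 0 "C0 * norm (x - y)"] seg_t
 have "\<bar>z (x, 0) - z (y, 0)\<bar> <= C0 * norm (x - y)" by simp
 moreover have "z (x, 0) = g x" "z (y, 0) = g y" using z U unfolding state_constraint_solution_def by blast+
 ultimately show ?thesis by simp
qed

end

section \<open>The cell problem\<close>

text \<open>Iteration handles integer multiples with an error of B per summand. Monotonicity carries
  this over to real ratios, and the supremum of the quotients (a S - B) / S is the slope.\<close>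

lemma almost_additive:
 fixes a :: "real => real"
 assumes add: "\<And>s t. 0 <= s ==> 0 <= t ==> \<bar>a (s + t) - a s - a t\<bar> <= B"
  and mono: "\<And>s t. 0 <= s ==> s <= t ==> a t <= a s"
 shows "\<exists>b. \<forall>t\<ge>0. \<bar>a t - b * t\<bar> <= B"
proof -
 have B: "0 <= B" "\<bar>a 0\<bar> <= B" using add[of 0 0] by auto
 have mult: "\<bar>a (real k * t) - real k * a t\<bar> <= real k * B + B" if t: "0 <= t" for k t
 proof (induction k)
  case (Suc k)
  have "\<bar>a (real k * t + t) - a (real k * t) - a t\<bar> <= B" by (rule add) (use t in auto)
  then show ?case using Suc by (simp add: algebra_simps)
 qed (use B in simp)
 have key: "a S - B <= S / T * (a T + B)" if S: "0 < S" and T: "0 < T" for S T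
 proof (rule ccontr)
  assume "\<not> ?thesis"
  then have d: "0 < a S - B - S / T * (a T + B)" (is "0 < ?d") by simp
  obtain k :: nat where "(2 * B + \<bar>a T + B\<bar>) / ?d < real k" using reals_Archimedean2 by blast
  then have k: "2 * B + \<bar>a T + B\<bar> < real k * ?d" using d by (simp add: pos_divide_less_eq)
  define N where "N = nat \<lfloor>real k * S / T\<rfloor>"
  have "0 <= real k * S / T" using S T by simp
  then have N: "real N <= real k * S / T" "real k * S / T <= real N + 1" unfolding N_def by linarith+
  have "real N * T <= real k * S" using N(1) T by (simp add: pos_le_divide_eq)
  then have 1: "a (real k * S) <= a (real N * T)" using T by (intro mono) auto
  define X where "X = (real k * S / T - real N) * (a T + B)"
  have 2: "\<bar>X\<bar> <= 1 * \<bar>a T + B\<bar>"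
   unfolding X_def abs_mult using N by (intro mult_right_mono) auto
  have 3: "real k * ?d = real k * a S - real k * B - (X + real N * a T + real N * B)"
   unfolding X_def by (simp add: algebra_simps add_divide_distrib)
  have 4: "- (a (real k * S) - real k * a S) <= real k * B + B" "a (real N * T) - real N * a T <= real N * B + B" "- X <= \<bar>a T + B\<bar>"
   using mult[OF less_imp_le[OF S], of k] mult[OF less_imp_le[OF T], of N] 2 by (simp_all only: abs_le_iff mult_1)
  show False using k 1 4 unfolding 3 by linarith
 qed
 define b where "b = Sup ((\<lambda>S. (a S - B) / S) ` {0<..})"
 have key': "(a S - B) / S <= (a T + B) / T" if "0 < S" "0 < T" for S T
  using key[OF that] that by (simp add: field_simps)
 have "(a t - B) / t <= b" if "0 < t" for t
  unfolding b_def by (rule cSUP_upper) (use that key'[OF _ zero_less_one] in \<open>auto intro!: bdd_aboveI[of _ "(a 1 + B) / 1"]\<close>)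
 moreover have "b <= (a t + B) / t" if "0 < t" for t
  unfolding b_def by (rule cSUP_least) (use that key' in \<open>auto intro: exI[of _ 1]\<close>)
 ultimately have "\<bar>a t - b * t\<bar> <= B" if "0 < t" for t
  using that by (simp add: pos_divide_le_eq pos_le_divide_eq abs_le_iff) (metis add.commute diff_le_eq minus_diff_eq neg_le_iff_le)
 then have "\<bar>a t - b * t\<bar> <= B" if "0 <= t" for t using that B by (cases "t = 0") auto
 then show ?thesis by blast
qed

lemma norm_cell: "norm (x - cell x) <= real CARD('n)" for x :: "real ^ 'n"
proof -
 have "norm (x - cell x) <= real CARD('n) * 1"
 proof (rule norm_le_card)
  fix i show "\<bar>(x - cell x) $ i\<bar> <= 1" using cell_bounds[of x i] unfolding vector_minus_component by linarith
 qed
 then show ?thesis by simp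
qed

context hole
begin

lemma closure_translate:
 assumes m: "m \<in> int_lattice" and x: "x \<in> closure (perforated D {})"
 shows "x + m \<in> closure (perforated D {})"
proof -
 have "(\<lambda>x. m + x) ` closure (perforated D {}) = closure ((\<lambda>x. m + x) ` perforated D {})" by (simp add: closure_translation)
 also have "\<dots> \<subseteq> closure (perforated D {})"
  using perforated_translate[OF m] by (intro closure_mono) (auto simp: add.commute)
 finally show ?thesis using x by (auto simp: add.commute)
qed

lemma periodic_uniform:
 fixes v :: "real ^ 'n => real"
 assumes cont: "continuous_on (closure (perforated D {})) v"
  and per: "\<And>y m. y \<in> closure (perforated D {}) ==> m \<in> int_lattice ==> v (y + m) = v y"
 shows "\<exists>B. \<forall>y\<in>closure (perforated D {}). \<bar>v y\<bar> <= B"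
  and "uniformly_continuous_on (closure (perforated D {})) v"
proof -
 let ?W = "closure (perforated D {})"
 define S where "S = ?W \<inter> cball 0 (real CARD('n) + 1)"
 have cS: "compact S" unfolding S_def by (intro closed_Int_compact) auto
 have vS: "continuous_on S v" using cont by (rule continuous_on_subset) (simp add: S_def)
 have sh: "y - cell x \<in> ?W" "v (y - cell x) = v y" if "y \<in> ?W" for x y
  using closure_translate[OF int_lattice_minus[OF cell_lattice[of x]] that] per[OF that int_lattice_minus[OF cell_lattice[of x]]] by simp_all
 have "bounded (v ` S)" by (intro compact_imp_bounded compact_continuous_image vS cS)
 then obtain B where "\<forall>h\<in>v ` S. norm h <= B" unfolding bounded_iff by (elim exE)
 then have B: "\<bar>v y\<bar> <= B" if "y \<in> S" for y using that by simp
 have "\<bar>v y\<bar> <= B" if "y \<in> ?W" for y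
  unfolding sh(2)[OF that, of y, symmetric] by (rule B) (use sh(1)[OF that] norm_cell[of y] in \<open>auto simp: S_def\<close>)
 then show "\<exists>B. \<forall>y\<in>?W. \<bar>v y\<bar> <= B" by blast
 have uS: "uniformly_continuous_on S v" by (rule compact_uniformly_continuous[OF vS cS])
 show "uniformly_continuous_on ?W v"
  unfolding uniformly_continuous_on_def
 proof (intro allI impI)
  fix e :: real assume "0 < e"
  then obtain d where d: "0 < d" "\<forall>x\<in>S. \<forall>x'\<in>S. dist x' x < d --> dist (v x') (v x) < e"
   using uS unfolding uniformly_continuous_on_def by blast
  show "\<exists>d>0. \<forall>x\<in>?W. \<forall>x'\<in>?W. dist x' x < d --> dist (v x') (v x) < e"
  proof (rule exI[of _ "min d 1"], intro conjI ballI impI)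
   fix x x' assume x: "x \<in> ?W" "x' \<in> ?W" and dx: "dist x' x < min d 1"
   have e: "dist (x' - cell x) (x - cell x) = dist x' x" by (simp add: dist_norm)
   have "norm (x' - cell x) <= norm (x - cell x) + dist x' x"
    using norm_triangle_ineq[of "x - cell x" "x' - x"] by (simp add: dist_norm)
   then have "x - cell x \<in> S" "x' - cell x \<in> S" using sh(1)[OF x(1)] sh(1)[OF x(2)] norm_cell[of x] dx by (auto simp: S_def)
   then have "dist (v (x' - cell x)) (v (x - cell x)) < e" using d(2) dx e by simp
   then show "dist (v x') (v x) < e" using sh(2) x by simp
  qed (use d in simp)
 qed
qed

text \<open>Closeness to the net is measured by connections inside \<Omega>, not by Euclidean
  distance, since it is along connections that travel costs are compared.\<close>

lemma conn_net:
 assumes lip: "\<And>x y. x \<in> perforated D {} ==> y \<in> perforated D {} ==> \<exists>l\<le>L * norm (x - y). conn (perforated D {}) x y l"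
  and L: "0 <= L" and d: "0 < d"
 shows "\<exists>F. finite F \<and> F \<subseteq> perforated D {} \<and>
  (\<forall>x\<in>perforated D {}. \<exists>f\<in>F. \<exists>m\<in>int_lattice. \<exists>l\<le>d. conn (perforated D {}) f (x + m) l)"
proof -
 let ?U = "perforated D {}"
 obtain r where "0 < r" "\<forall>(a, b)\<in>set [(L, d)]. a * r <= b"
   using small_scale[of "[(L, d)]"] d by auto
 then have r: "0 < r" "L * r <= d" by auto
 define S where "S = ?U \<inter> cball 0 (real CARD('n))"
 have "bounded S" by (auto simp: S_def intro: bounded_subset[OF bounded_cball])
 from finite_net[OF this r(1)]
 obtain F where F: "F \<subseteq> S" "finite F" "closure S \<subseteq> (\<Union>x\<in>F. ball x r)" .
 show ?thesis
 proof (rule exI[of _ F], intro conjI ballI F(2))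
  show "F \<subseteq> ?U" using F by (auto simp: S_def)
  fix x assume x: "x \<in> ?U"
  let ?m = "- cell x"
  have m: "?m \<in> int_lattice" by (intro int_lattice_minus cell_lattice)
  have xm: "x + ?m \<in> S" using perforated_translate[OF m x] norm_cell[of x] by (simp add: S_def)
  then obtain f where f: "f \<in> F" "x + ?m \<in> ball f r" using F(3) closure_subset[of S] by blast
  have "f \<in> ?U" "x + ?m \<in> ?U" using f F xm by (auto simp: S_def)
  then obtain l where l: "l <= L * norm (f - (x + ?m))" "conn ?U f (x + ?m) l" using lip by blast
  have "L * norm (f - (x + ?m)) <= L * r" using f L by (intro mult_left_mono) (auto simp: dist_norm)
  then have "l <= d" using l(1) r(2) by linarith
  then show "\<exists>f\<in>F. \<exists>m\<in>int_lattice. \<exists>l\<le>d. conn ?U f (x + m) l" using l(2) f(1) m by blast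
 qed
qed

end

section \<open>Correctors as special solutions of the evolution problem\<close>

lemma C1_fun_slice:
 fixes f :: "('a::euclidean_space) \<times> real => real"
 assumes "C1_fun f Df" shows "C1_fun (\<lambda>x. f (x, t) - p \<bullet> x) (\<lambda>x. fst (Df (x, t)) - p)"
 unfolding C1_fun_def
proof (intro conjI allI)
 fix x
 have d: "(f has_derivative (\<lambda>k. k \<bullet> Df (x, t))) (at (x, t))" using assms unfolding C1_fun_def gderiv_def by blast
 have "((\<lambda>x. (x, t)) has_derivative (\<lambda>k. (k, 0))) (at x)" by (auto intro!: derivative_eq_intros)
 from has_derivative_compose[OF this d]
 have "((\<lambda>x. f (x, t)) has_derivative (\<lambda>k. (k, 0) \<bullet> Df (x, t))) (at x)" .
 then have "((\<lambda>x. f (x, t) - p \<bullet> x) has_derivative (\<lambda>k. (k, 0) \<bullet> Df (x, t) - p \<bullet> k)) (at x)"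
  by (auto intro!: derivative_eq_intros)
 moreover have "(\<lambda>k. (k, 0) \<bullet> Df (x, t) - p \<bullet> k) = (\<lambda>k. k \<bullet> (fst (Df (x, t)) - p))"
  by (auto simp: fun_eq_iff inner_diff_right inner_commute inner_prod_def)
 ultimately show "GDERIV (\<lambda>x. f (x, t) - p \<bullet> x) x :> fst (Df (x, t)) - p" by (simp add: gderiv_def)
next
 have 1: "continuous_on UNIV Df" using assms unfolding C1_fun_def by blast
 have 2: "continuous_on UNIV (\<lambda>x::'a. (x, t))" by (intro continuous_intros)
 note continuous_on_compose2[OF 1 2 subset_UNIV]
 then show "continuous_on UNIV (\<lambda>x. fst (Df (x, t)) - p)" by (intro continuous_intros)
qed

lemma C1_fun_extend:
 fixes f :: "'a::euclidean_space => real"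
 assumes "C1_fun f Df"
 shows "C1_fun (\<lambda>q. f (fst q) + p \<bullet> fst q - c * snd q) (\<lambda>q. (Df (fst q) + p, - c))"
 unfolding C1_fun_def
proof (intro conjI allI)
 fix q :: "'a \<times> real"
 have d: "(f has_derivative (\<lambda>k. k \<bullet> Df (fst q))) (at (fst q))" using assms unfolding C1_fun_def gderiv_def by blast
 have "(fst has_derivative fst) (at q)" by (intro derivative_intros)
 from has_derivative_compose[OF this d]
 have "((\<lambda>q. f (fst q) + p \<bullet> fst q - c * snd q) has_derivative (\<lambda>k. fst k \<bullet> Df (fst q) + p \<bullet> fst k - c * snd k)) (at q)"
  by (auto intro!: derivative_eq_intros)
 moreover have "(\<lambda>k. fst k \<bullet> Df (fst q) + p \<bullet> fst k - c * snd k) = (\<lambda>k. k \<bullet> (Df (fst q) + p, - c))"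
  by (auto simp: fun_eq_iff inner_add_right inner_commute inner_prod_def)
 ultimately show "GDERIV (\<lambda>q. f (fst q) + p \<bullet> fst q - c * snd q) q :> (Df (fst q) + p, - c)" by (simp add: gderiv_def)
next
 have 1: "continuous_on UNIV Df" using assms unfolding C1_fun_def by blast
 have 2: "continuous_on UNIV (\<lambda>q::'a \<times> real. fst q)" by (intro continuous_intros)
 note continuous_on_compose2[OF 1 2 subset_UNIV]
 then show "continuous_on UNIV (\<lambda>q::'a \<times> real. (Df (fst q) + p, - c))" by (intro continuous_intros)
qed

lemma eventually_slice:
 fixes t :: real and x :: "'a::metric_space"
 assumes "eventually P (at (x, t) within S \<times> {0<..})" "0 < t"
 shows "eventually (\<lambda>y. P (y, t)) (at x within S)"
proof -
 obtain d where d: "0 < d" "\<forall>q\<in>S \<times> {0<..}. q \<noteq> (x, t) \<and> dist q (x, t) < d --> P q" using assms(1) unfolding eventually_at by blast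
 have "P (y, t)" if "y \<in> S" "y \<noteq> x" "dist y x < d" for y
  by (rule d(2)[rule_format]) (use that assms(2) in \<open>auto simp: dist_Pair_Pair\<close>)
 then show ?thesis unfolding eventually_at using d(1) by (intro exI[of _ d]) auto
qed

text \<open>Along the line x = x0 the function is affine in time, so at an extremum in the interior
  of the time axis the test function must have its slope.\<close>

lemma time_derivative_at_extremum:
 fixes b :: "('a::euclidean_space) \<times> real => real"
 assumes C: "C1_fun b Db" and t0: "0 < t0" and x0: "x0 \<in> S"
  and ev: "(\<forall>\<^sub>F q in at (x0, t0) within S \<times> {0<..}. w (fst q) - c * snd q - b q <= w x0 - c * t0 - b (x0, t0)) \<or>
   (\<forall>\<^sub>F q in at (x0, t0) within S \<times> {0<..}. w x0 - c * t0 - b (x0, t0) <= w (fst q) - c * snd q - b q)"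
 shows "snd (Db (x0, t0)) = - c"
proof -
 define f where "f t = - c * t - b (x0, t)" for t
 have d: "(b has_derivative (\<lambda>k. k \<bullet> Db (x0, t0))) (at (x0, t0))" using C unfolding C1_fun_def gderiv_def by blast
 have "((\<lambda>t. (x0, t)) has_derivative (\<lambda>k. (0, k))) (at t0)" by (auto intro!: derivative_eq_intros)
 from has_derivative_compose[OF this d]
 have "((\<lambda>t. b (x0, t)) has_derivative (\<lambda>k. (0, k) \<bullet> Db (x0, t0))) (at t0)" .
 then have "(f has_derivative (\<lambda>k. - c * k - (0, k) \<bullet> Db (x0, t0))) (at t0)"
  unfolding f_def by (auto intro!: derivative_eq_intros)
 moreover have "(\<lambda>k. - c * k - (0, k) \<bullet> Db (x0, t0)) = (*) (- c - snd (Db (x0, t0)))"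
  by (auto simp: fun_eq_iff inner_prod_def algebra_simps)
 ultimately have der: "(f has_real_derivative (- c - snd (Db (x0, t0)))) (at t0)" by (simp add: has_field_derivative_def)
 have near: "\<exists>d>0. \<forall>t. \<bar>t0 - t\<bar> < d --> P (x0, t)" if "eventually P (at (x0, t0) within S \<times> {0<..})" "P (x0, t0)" for P
 proof -
  from that(1)[unfolded eventually_at]
  obtain d where d: "0 < d" "\<forall>q\<in>S \<times> {0<..}. q \<noteq> (x0, t0) \<and> dist q (x0, t0) < d --> P q" by (elim exE conjE)
  have "P (x0, t)" if "\<bar>t0 - t\<bar> < min d t0" for t
   using d(2)[rule_format, of "(x0, t)"] that x0 \<open>P (x0, t0)\<close> by (cases "t = t0") (auto simp: dist_Pair_Pair dist_real_def)
  then show ?thesis using d(1) t0 by (intro exI[of _ "min d t0"]) auto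
 qed
 have "- c - snd (Db (x0, t0)) = 0"
  using ev
 proof
  assume "\<forall>\<^sub>F q in at (x0, t0) within S \<times> {0<..}. w (fst q) - c * snd q - b q <= w x0 - c * t0 - b (x0, t0)"
  from near[OF this] obtain d where d: "0 < d" "\<forall>t. \<bar>t0 - t\<bar> < d --> f t <= f t0" by (auto simp: f_def)
  show ?thesis by (rule DERIV_local_max[OF der d])
 next
  assume "\<forall>\<^sub>F q in at (x0, t0) within S \<times> {0<..}. w x0 - c * t0 - b (x0, t0) <= w (fst q) - c * snd q - b q"
  from near[OF this] obtain d where d: "0 < d" "\<forall>t. \<bar>t0 - t\<bar> < d --> f t0 <= f t" by (auto simp: f_def)
  show ?thesis by (rule DERIV_local_min[OF der d])
 qed
 then show ?thesis by simp
qed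

text \<open>Adding p \<bullet> x - c t turns the stationary problem into the evolution problem, so
  the representation by travels applies to correctors as well.\<close>

lemma visc_cell_subsolution:
 fixes v :: "'a::euclidean_space => real"
 shows "visc_subsolution (\<lambda>y q. H y (p + q) - c) S v \<longleftrightarrow>
   HJ_sub H S (\<lambda>(x, t). v x + p \<bullet> x - c * t)" (is "?A \<longleftrightarrow> ?B")
proof -
 have up: "eventually P (at (x, 1::real) within S \<times> {0<..})" if "eventually (\<lambda>y. \<forall>t. P (y, t)) (at x within S)" "\<forall>t. P (x, t)" for P x
 proof -
  from that(1)[unfolded eventually_at]
  obtain d where d: "0 < d" "\<forall>y\<in>S. y \<noteq> x \<and> dist y x < d --> (\<forall>t. P (y, t))" by (elim exE conjE)
  have "P q" if "q \<in> S \<times> {0<..}" "dist q (x, 1) < d" for q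
  proof (cases "fst q = x")
   case True
   then show ?thesis using \<open>\<forall>t. P (x, t)\<close> by (metis prod.collapse)
  next
   case False
   have "dist (fst q) x < d" using dist_fst_le[of q "(x, 1)"] that by simp
   then show ?thesis using d(2) False that by (metis mem_Times_iff prod.collapse)
  qed
  then show ?thesis unfolding eventually_at using d(1) by blast
 qed
 show "?A \<longleftrightarrow> ?B"
 proof
  assume A: ?A
  show ?B
   unfolding visc_subsolution_def
  proof (intro allI ballI impI)
   fix f Df q0 assume q0: "q0 \<in> S \<times> {0<..}" and C: "C1_fun f Df"
    and ev: "\<forall>\<^sub>F q in at q0 within S \<times> {0<..}. (\<lambda>(x, t). v x + p \<bullet> x - c * t) q - f q <= (\<lambda>(x, t). v x + p \<bullet> x - c * t) q0 - f q0"
   obtain x0 t0 where q: "q0 = (x0, t0)" "x0 \<in> S" "0 < t0" using q0 by auto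
   have s: "snd (Df (x0, t0)) = - c"
    by (rule time_derivative_at_extremum[OF C q(3,2), of "\<lambda>x. v x + p \<bullet> x"]) (use ev q in \<open>simp add: case_prod_beta\<close>)
   from eventually_slice[OF ev[unfolded q] q(3)]
   have "\<forall>\<^sub>F y in at x0 within S. v y - (f (y, t0) - p \<bullet> y) <= v x0 - (f (x0, t0) - p \<bullet> x0)"
    by (rule eventually_mono) simp
   from A[unfolded visc_subsolution_def, rule_format, OF q(2) C1_fun_slice[OF C] this] s
   show "(\<lambda>(x, t) (p, s). s + H x p) q0 (Df q0) <= 0" by (simp add: q case_prod_beta)
  qed
 next
  assume B: ?B
  show ?A
   unfolding visc_subsolution_def
  proof (intro allI ballI impI)
   fix f Df x0 assume x0: "x0 \<in> S" and C: "C1_fun f Df" and ev: "\<forall>\<^sub>F x in at x0 within S. v x - f x <= v x0 - f x0"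
   have "\<forall>\<^sub>F q in at (x0, 1) within S \<times> {0<..}. (\<lambda>(x, t). v x + p \<bullet> x - c * t) q - (f (fst q) + p \<bullet> fst q - c * snd q) <=
     (\<lambda>(x, t). v x + p \<bullet> x - c * t) (x0, 1) - (f (fst (x0, 1)) + p \<bullet> fst (x0, 1::real) - c * snd (x0, 1))"
    by (rule up) (use ev in simp_all)
   from B[unfolded visc_subsolution_def, rule_format, OF _ C1_fun_extend[OF C] this] x0
   show "H x0 (p + Df x0) - c <= 0" by (simp add: add.commute)
  qed
 qed
qed

lemma visc_cell_supersolution:
 fixes v :: "'a::euclidean_space => real"
 shows "visc_supersolution (\<lambda>y q. H y (p + q) - c) S v \<longleftrightarrow>
   HJ_super H S (\<lambda>(x, t). v x + p \<bullet> x - c * t)"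
proof -
 have "(\<lambda>y q. - (H y (p + - q) - c)) = (\<lambda>y q. - H y (- (- p + q)) - - c)"
  "(\<lambda>x r. - (\<lambda>(x, t) (p, s). s + H x p) x (- r)) = (\<lambda>(x, t :: real) (p, s). s + - H x (- p))"
  "(\<lambda>x. - (\<lambda>(x, t). v x + p \<bullet> x - c * t) x) = (\<lambda>(x, t). - v x + - p \<bullet> x - - c * t)"
  by (auto simp: fun_eq_iff)
 with visc_cell_subsolution[of "\<lambda>y q. - H y (- q)" "- p" "- c" S "\<lambda>x. - v x"]
 show ?thesis unfolding visc_supersolution_dual by (simp only:)
qed

lemma visc_subsolution_cong:
 assumes "\<And>q. q \<in> S ==> z' q = z q" "visc_subsolution F S z"
 shows "visc_subsolution F S z'"
 unfolding visc_subsolution_def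
proof (intro allI ballI impI)
 fix f Df q0 assume q0: "q0 \<in> S" and C: "C1_fun f Df" and E: "\<forall>\<^sub>F x in at q0 within S. z' x - f x <= z' q0 - f q0"
 have "\<forall>\<^sub>F x in at q0 within S. (z' x - f x <= z' q0 - f q0) = (z x - f x <= z q0 - f q0)"
  using assms(1) q0 by (auto simp: eventually_at_filter)
 from eventually_subst[OF this] E have "\<forall>\<^sub>F x in at q0 within S. z x - f x <= z q0 - f q0" by blast
 from assms(2)[unfolded visc_subsolution_def, rule_format, OF q0 C this] show "F q0 (Df q0) <= 0" .
qed

lemma visc_supersolution_cong:
 "(\<And>q. q \<in> S ==> z' q = z q) ==> visc_supersolution F S z ==> visc_supersolution F S z'"
 unfolding visc_supersolution_dual by (rule visc_subsolution_cong[of S _ "\<lambda>x. - z x"]) auto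

section \<open>Free costs and the effective constant\<close>

context periodic_hamiltonian
begin

abbreviation "\<Omega> \<equiv> perforated D {}"

text \<open>This is the value at (x, T) of the evolution with initial datum p \<bullet> y, minus p
  \<bullet> x. Subtracting the linear part makes it periodic in x.\<close>

definition free_cost :: "real => real ^ 'n => real => real ^ 'n => real" where
 "free_cost R p T x = Inf {c - p \<bullet> (x - y) | y c. trav \<Omega> H R T y x c}"

end

locale momentum = periodic_hamiltonian D H
 for D :: "(real ^ 'n) set" and H :: "real ^ 'n => real ^ 'n => real" +
 fixes R M :: real and p :: "real ^ 'n"
 assumes pR: "norm p <= R" and pM: "\<And>w q. norm q <= norm p ==> H w q <= M"
begin

lemma R0: "0 <= R" using pR norm_ge_zero order_trans by blast

lemma M0: "0 <= M" using pM[of 0] by (simp add: zero)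

abbreviation "FC \<equiv> free_cost R p"

lemma trav_low: assumes "trav \<Omega> H R T y x c" shows "- (T * M) <= c - p \<bullet> (x - y)"
proof -
 show ?thesis using norm_cauchy_schwarz[of p "x - y"] trav_lower_bound[OF assms norm_ge_zero pR pM] by linarith
qed

lemma FC_bdd: "bdd_below {c - p \<bullet> (x - y) | y c. trav \<Omega> H R T y x c}"
 using trav_low by (intro bdd_belowI[of _ "- (T * M)"]) auto

lemma FC_le: "trav \<Omega> H R T y x c ==> FC T x <= c - p \<bullet> (x - y)"
 unfolding free_cost_def by (rule cInf_lower[OF _ FC_bdd]) blast

lemma FC_ne: "x \<in> \<Omega> ==> 0 <= T ==> {c - p \<bullet> (x - y) | y c. trav \<Omega> H R T y x c} \<noteq> {}"
 using trav_wait[OF _ R0] by blast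

lemma FC_approx:
 assumes "x \<in> \<Omega>" "0 <= T" "0 < b" shows "\<exists>y c. trav \<Omega> H R T y x c \<and> c - p \<bullet> (x - y) < FC T x + b"
 using cInf_lessD[OF FC_ne[OF assms(1,2)], of "FC T x + b"] assms(3) unfolding free_cost_def by auto

lemma FC_greatest:
 assumes "x \<in> \<Omega>" "0 <= T" "\<And>y c. trav \<Omega> H R T y x c ==> b <= c - p \<bullet> (x - y)" shows "b <= FC T x"
 unfolding free_cost_def by (rule cInf_greatest[OF FC_ne[OF assms(1,2)]]) (use assms(3) in blast)

lemma FC_low: "x \<in> \<Omega> ==> 0 <= T ==> - (T * M) <= FC T x"
 by (rule FC_greatest) (auto intro: trav_low)

lemma FC_step:
 assumes tr: "trav \<Omega> H R T y x c" and S: "0 <= S" shows "FC (S + T) x <= FC S y + (c - p \<bullet> (x - y))"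
proof (rule field_le_epsilon)
 fix b :: real assume b: "0 < b"
 have y: "y \<in> \<Omega>" using trav_in[OF tr] by blast
 obtain w d where w: "trav \<Omega> H R S w y d" "d - p \<bullet> (y - w) < FC S y + b" using FC_approx[OF y S b] by blast
 have "p \<bullet> (x - w) = p \<bullet> (x - y) + p \<bullet> (y - w)" by (simp add: inner_diff_right)
 then show "FC (S + T) x <= FC S y + (c - p \<bullet> (x - y)) + b" using FC_le[OF trav_trans[OF tr w(1)]] w(2) by linarith
qed

lemma FC_split:
 assumes x: "x \<in> \<Omega>" and ST: "0 <= S" "0 <= T" and b: "0 < b"
 shows "\<exists>y c. trav \<Omega> H R T y x c \<and> FC S y + (c - p \<bullet> (x - y)) < FC (S + T) x + b"
proof -
 obtain w d where w: "trav \<Omega> H R (S + T) w x d" "d - p \<bullet> (x - w) < FC (S + T) x + b"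
  using FC_approx[OF x _ b, of "S + T"] ST by auto
 obtain y c1 c2 where y: "trav \<Omega> H R S w y c1" "trav \<Omega> H R T y x c2" "d = c1 + c2"
  by (rule trav_split[OF w(1) R0 ST])
 have "p \<bullet> (x - w) = p \<bullet> (x - y) + p \<bullet> (y - w)" by (simp add: inner_diff_right)
 then have "FC S y + (c2 - p \<bullet> (x - y)) < FC (S + T) x + b" using FC_le[OF y(1)] y(3) w(2) by linarith
 then show ?thesis using y(2) by blast
qed

lemma FC_conn:
 assumes c: "conn \<Omega> y x l" and T: "0 <= T" shows "FC T x <= FC T y + 2 * R * l"
proof -
 have "FC (T + 0) x <= FC T y + (R * l - p \<bullet> (x - y))" by (rule FC_step[OF conn_trav[OF c R0] T])
 moreover have "- (p \<bullet> (x - y)) <= R * l"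
 proof -
  have "- (p \<bullet> (x - y)) <= norm p * norm (x - y)" using norm_cauchy_schwarz[of p "- (x - y)"] by (simp only: inner_minus_right norm_minus_cancel)
  also have "\<dots> <= R * l" using pR R0 conn_in[OF c] by (intro mult_mono) auto
  finally show ?thesis .
 qed
 ultimately show ?thesis by simp
qed

lemma FC_periodic:
 assumes "x \<in> \<Omega>" "0 <= T" "m \<in> int_lattice" shows "FC T (x + m) = FC T x"
proof -
 have le: "FC T (x + m) <= FC T x" if x: "x \<in> \<Omega>" and m: "m \<in> int_lattice" for x m
 proof (rule field_le_epsilon)
  fix b :: real assume "0 < b"
  then obtain y c where yc: "trav \<Omega> H R T y x c" "c - p \<bullet> (x - y) < FC T x + b" using FC_approx[OF x assms(2)] by blast
  from FC_le[OF trav_translate[OF yc(1) perforated_translate[OF m] periodic[OF m]]]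
  have "FC T (x + m) <= c - p \<bullet> (x + m - (y + m))" .
  moreover have "x + m - (y + m) = x - y" by simp
  ultimately show "FC T (x + m) <= FC T x + b" using yc(2) by (simp only:)
 qed
 show ?thesis using le[OF assms(1,3)] le[OF perforated_translate[OF assms(3,1)] int_lattice_minus[OF assms(3)]] by simp
qed

definition osc :: real where "osc = 2 * R * (conn_const * (2 * real CARD('n) + 1))"

text \<open>By periodicity one point may be replaced by a translate in or near the cell of the
  other; a connection of uniformly bounded length then compares the values. The bound does not grow
  with T.\<close>

lemma FC_osc:
 assumes x: "x \<in> \<Omega>" "y \<in> \<Omega>" and T: "0 <= T" shows "FC T x <= FC T y + osc"
proof -
 let ?m = "cell x + - cell y"
 have m: "?m \<in> int_lattice" by (intro int_lattice_add int_lattice_minus cell_lattice)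
 have y': "y + ?m \<in> \<Omega>" by (rule perforated_translate[OF m x(2)])
 have "norm (y + ?m - x) <= norm (y - cell y) + norm (x - cell x)"
  using norm_triangle_ineq4[of "y - cell y" "x - cell x"] by (simp add: algebra_simps)
 then have d: "norm (y + ?m - x) <= 2 * real CARD('n)" using norm_cell[of x] norm_cell[of y] by linarith
 obtain l where l: "l <= conn_const * (norm (y + ?m - x) + 1)" "conn \<Omega> (y + ?m) x l"
  using conn_const(3)[OF y' x(1)] by blast
 have "conn_const * (norm (y + ?m - x) + 1) <= conn_const * (2 * real CARD('n) + 1)"
  using d conn_const(1) by (intro mult_left_mono) auto
 then have "2 * R * l <= osc" unfolding osc_def using l(1) R0 by (intro mult_left_mono) auto
 then show ?thesis using FC_conn[OF l(2) T] FC_periodic[OF x(2) T m] by linarith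
qed

text \<open>Cutting or joining travels at time t changes the value only by the oscillation in space,
  so at a reference point the free cost is almost additive in time. Minus its slope is the effective
  constant.\<close>

lemma FC_linear: "\<exists>c. 0 <= c \<and> c <= M \<and> (\<forall>x\<in>\<Omega>. \<forall>T\<ge>0. \<bar>FC T x + c * T\<bar> <= 3 * osc)"
proof -
 define o' where "o' = corner (0::real^'n)"
 have o': "o' \<in> \<Omega>" unfolding o'_def by (rule corner_perforated)
 have osc: "0 <= osc" using FC_osc[OF o' o' order_refl] by simp
 have add: "\<bar>FC (s + t) o' - FC s o' - FC t o'\<bar> <= 2 * osc" if st: "0 <= s" "0 <= t" for s t
 proof -
  have "FC (s + t) o' - FC s o' - FC t o' <= osc"
  proof (rule field_le_epsilon)
   fix b :: real assume "0 < b"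
   then obtain y c where yc: "trav \<Omega> H R t y o' c" "c - p \<bullet> (o' - y) < FC t o' + b" using FC_approx[OF o' st(2)] by blast
   show "FC (s + t) o' - FC s o' - FC t o' <= osc + b"
    using trav_in[OF yc(1)] FC_step[OF yc(1) st(1)] FC_osc[OF _ o' st(1), of y] yc(2) by linarith
  qed
  moreover have "- (FC (s + t) o' - FC s o' - FC t o') <= osc"
  proof (rule field_le_epsilon)
   fix b :: real assume "0 < b"
   then obtain y c where yc: "trav \<Omega> H R t y o' c" "FC s y + (c - p \<bullet> (o' - y)) < FC (s + t) o' + b" using FC_split[OF o' st] by blast
   show "- (FC (s + t) o' - FC s o' - FC t o') <= osc + b"
    using trav_in[OF yc(1)] FC_le[OF yc(1)] FC_osc[OF o' _ st(1), of y] yc(2) by linarith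
  qed
  ultimately show ?thesis using osc by linarith
 qed
 have mono: "FC t o' <= FC s o'" if "0 <= s" "s <= t" for s t
  using FC_step[OF trav_wait[OF o' R0, of "t - s"] that(1)] that by simp
 obtain S where S: "\<And>t. 0 <= t ==> \<bar>FC t o' - S * t\<bar> <= 2 * osc" using almost_additive[OF add mono] by blast
 have S0: "S <= 0"
 proof (rule ccontr)
  assume "\<not> ?thesis"
  then have s: "0 < S" by simp
  define t where "t = (FC 0 o' + 2 * osc + 1) / S"
  have t: "0 <= t" "S * t = FC 0 o' + 2 * osc + 1" using S[of 0] s by (auto simp: t_def)
  show False using S[OF t(1)] mono[OF order_refl t(1)] t(2) by linarith
 qed
 have SM: "- S <= M"
 proof (rule ccontr)
  assume "\<not> ?thesis"
  then have s: "0 < - S - M" by simp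
  define t where "t = (2 * osc + 1) / (- S - M)"
  have t: "0 <= t" "(- S - M) * t = 2 * osc + 1" using s osc by (auto simp: t_def)
  have "- S * t - M * t = 2 * osc + 1" using t(2) by (simp add: algebra_simps)
  moreover have "- (M * t) <= FC t o'" using FC_low[OF o' t(1)] by (simp add: mult.commute)
  ultimately show False using S[OF t(1)] by (simp add: abs_le_iff)
 qed
 show ?thesis
 proof (intro exI[of _ "- S"] conjI ballI allI impI)
  fix x T assume "x \<in> \<Omega>" "0 <= (T::real)"
  then show "\<bar>FC T x + - S * T\<bar> <= 3 * osc" using FC_osc[OF _ o', of x T] FC_osc[OF o', of x T] S[of T] by (simp add: abs_le_iff)
 qed (use S0 SM in auto)
qed

text \<open>The corrector is \<open>liminf\<close> of the normalized costs as \<open>T \<rightarrow> \<infinity>\<close>; uniformity of the limit turns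
 the semigroup property of the costs into dynamic programming for the limit.\<close>

lemma weak_KAM:
 assumes c': "\<forall>x\<in>\<Omega>. \<forall>T\<ge>0. \<bar>FC T x + c * T\<bar> <= B"
 shows "\<exists>v. (\<forall>x\<in>\<Omega>. \<forall>m\<in>int_lattice. v (x + m) = v x) \<and>
  (\<forall>T y x d. trav \<Omega> H R T y x d --> v x <= v y + (d - p \<bullet> (x - y)) + c * T) \<and>
  (\<forall>x\<in>\<Omega>. \<forall>T\<ge>0. \<forall>e>0. \<exists>y d. trav \<Omega> H R T y x d \<and> v y + (d - p \<bullet> (x - y)) + c * T <= v x + e)"
proof -
 have c: "\<bar>FC T x + c * T\<bar> <= B" if "x \<in> \<Omega>" "0 <= T" for x T using c' that by blast
 define P where "P S x = (INF T\<in>{S..}. FC T x + c * T)" for S x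
 define v where "v x = (SUP S\<in>{0..}. P S x)" for x
 have bb: "bdd_below ((\<lambda>T. FC T x + c * T) ` {S..})" if "x \<in> \<Omega>" "0 <= S" for x S
 proof (rule bdd_belowI2)
  fix T assume "T \<in> {S..}"
  then have "\<bar>FC T x + c * T\<bar> <= B" using that by (intro c) auto
  then show "- B <= FC T x + c * T" by linarith
 qed
 have Ple: "P S x <= FC T x + c * T" if "x \<in> \<Omega>" "0 <= S" "S <= T" for S x T
  unfolding P_def by (rule cINF_lower[OF bb[OF that(1,2)]]) (use that in auto)
 have PB: "P S x <= B" if "x \<in> \<Omega>" "0 <= S" for S x
  using Ple[OF that order_refl] c[OF that] by (simp add: abs_le_iff)
 have Pge: "b <= P S x" if "\<And>T. S <= T ==> b <= FC T x + c * T" for b S x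
  unfolding P_def by (rule cINF_greatest) (use that in auto)
 have Papp: "\<exists>T\<ge>S. FC T x + c * T < P S x + e" if "x \<in> \<Omega>" "0 <= S" "0 < e" for x S e
 proof -
  have "(INF T\<in>{S..}. FC T x + c * T) < P S x + e" using that by (simp add: P_def)
  then show ?thesis using cINF_less_iff[OF _ bb[OF that(1,2)]] by auto
 qed
 have ba: "bdd_above ((\<lambda>S. P S x) ` {0..})" if "x \<in> \<Omega>" for x using PB[OF that] by (intro bdd_aboveI2[of _ _ B]) auto
 have Pv: "P S x <= v x" if "x \<in> \<Omega>" "0 <= S" for S x unfolding v_def by (rule cSUP_upper[OF _ ba]) (use that in auto)
 have vle: "v x <= b" if "\<And>S. 0 <= S ==> P S x <= b" for x b unfolding v_def by (rule cSUP_least) (use that in auto)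
 have vapp: "\<exists>S\<ge>0. v x < P S x + e" if x: "x \<in> \<Omega>" and e: "0 < e" for x e
 proof -
  have "v x - e < (SUP S\<in>{0..}. P S x)" using e by (simp add: v_def)
  then obtain S where "S \<in> {0..}" "v x - e < P S x" using less_cSUP_iff[OF _ ba[OF x]] by auto
  then show ?thesis by (intro exI[of _ S]) auto
 qed
 have Pmono: "P S x <= P S' x" if "x \<in> \<Omega>" "0 <= S" "S <= S'" for S S' x
  by (rule Pge) (use that in \<open>auto intro: Ple\<close>)
 have Pconn: "P S x <= P S y + 2 * R * l" if "conn \<Omega> y x l" "0 <= S" for S x y l
 proof -
  have "P S x - 2 * R * l <= P S y"
  proof (rule Pge)
   fix T assume "S <= T"
   have "FC T x <= FC T y + 2 * R * l" by (rule FC_conn[OF that(1)]) (use that \<open>S <= T\<close> in simp)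
   then show "P S x - 2 * R * l <= FC T y + c * T" using Ple[of x S T] conn_in[OF that(1)] that \<open>S <= T\<close> by auto
  qed
  then show ?thesis by simp
 qed
 have vconn: "v x <= v y + 2 * R * l" if "conn \<Omega> y x l" for x y l
 proof (rule vle)
  fix S :: real assume "0 <= S"
  then show "P S x <= v y + 2 * R * l" using Pconn[OF that] Pv[of y S] conn_in[OF that] by force
 qed
 have Pper: "P S (x + m) = P S x" if "x \<in> \<Omega>" "0 <= S" "m \<in> int_lattice" for S x m
  unfolding P_def by (rule INF_cong) (use that FC_periodic in auto)
 have vper: "v (x + m) = v x" if "x \<in> \<Omega>" "m \<in> int_lattice" for x m
  unfolding v_def by (rule SUP_cong) (use that Pper in auto)
 have dpp: "v x <= v y + (d - p \<bullet> (x - y)) + c * T" if tr: "trav \<Omega> H R T y x d" for T y x d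
 proof (rule vle)
  fix S :: real assume S: "0 <= S"
  have T: "0 <= T" and x: "x \<in> \<Omega>" and y: "y \<in> \<Omega>" using trav_in[OF tr] by auto
  have "P S x - (d - p \<bullet> (x - y)) - c * T <= P S y"
  proof (rule Pge)
   fix T' assume T': "S <= T'"
   have "P S x <= FC (T' + T) x + c * (T' + T)" by (rule Ple[OF x S]) (use T T' in simp)
   then show "P S x - (d - p \<bullet> (x - y)) - c * T <= FC T' y + c * T'"
    using FC_step[OF tr, of T'] S T' unfolding distrib_left by linarith
  qed
  then show "P S x <= v y + (d - p \<bullet> (x - y)) + c * T" using Pv[OF y S] by linarith
 qed
 \<comment> \<open>A finite net modulo the lattice suffices: \<open>P S\<close> and \<open>v\<close>
   inherit from the free costs the control along connections, and \<open>P S\<close> increases with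
   S.\<close>
 have unif: "\<exists>S\<ge>0. \<forall>x\<in>\<Omega>. v x <= P S x + e" if e: "0 < e" for e
 proof -
  obtain L where L: "0 <= L" "\<forall>x\<in>\<Omega>. \<forall>y\<in>\<Omega>. \<exists>l\<le>L * norm (x - y). conn \<Omega> x y l" using conn_lipschitz by blast
  obtain g where "0 < g" "\<forall>(a, b)\<in>set [(2 * R, e / 3)]. a * g <= b"
   using small_scale[of "[(2 * R, e / 3)]"] e by auto
  then have g: "0 < g" "2 * R * g <= e / 3" by auto
  obtain F where F: "finite F" "F \<subseteq> \<Omega>" "\<forall>x\<in>\<Omega>. \<exists>f\<in>F. \<exists>m\<in>int_lattice. \<exists>l\<le>g. conn \<Omega> f (x + m) l"
   using conn_net[OF L(2)[rule_format] L(1) g(1)] by blast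
  have "\<forall>f\<in>F. \<exists>S\<ge>0. v f < P S f + e / 3" using vapp F(2) e by auto
  from bchoice[OF this] obtain s where s: "\<forall>f\<in>F. 0 <= s f \<and> v f < P (s f) f + e / 3" by blast
  define S where "S = sum s F"
  have S: "s f <= S" "0 <= S" if "f \<in> F" for f
   unfolding S_def using s F(1) that by (auto intro!: member_le_sum sum_nonneg)
  have S0: "0 <= S" unfolding S_def using s by (intro sum_nonneg) auto
  have "v x <= P S x + e" if x: "x \<in> \<Omega>" for x
  proof -
   obtain f m l where f: "f \<in> F" "m \<in> int_lattice" "l <= g" "conn \<Omega> f (x + m) l" using F(3) x by blast
   have fU: "f \<in> \<Omega>" using f F by blast
   have "2 * R * l <= e / 3" using mult_left_mono[OF f(3), of "2 * R"] R0 g(2) by linarith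
   moreover have "v (x + m) <= v f + 2 * R * l" by (rule vconn[OF f(4)])
   moreover have "P S f <= P S (x + m) + 2 * R * l" by (rule Pconn[OF conn_sym[OF f(4)] S0])
   moreover have "P (s f) f <= P S f" by (rule Pmono[OF fU]) (use s f S in auto)
   ultimately show ?thesis using s f(1) vper[OF x f(2)] Pper[OF x S0 f(2)] by force
  qed
  then show ?thesis using S0 by blast
 qed
 have "\<exists>y d. trav \<Omega> H R T y x d \<and> v y + (d - p \<bullet> (x - y)) + c * T <= v x + e"
  if x: "x \<in> \<Omega>" and T: "0 <= T" and e: "0 < e" for x T e
 proof -
  have b3: "0 < e / 3" using e by simp
  obtain S where S: "0 <= S" "\<forall>x\<in>\<Omega>. v x <= P S x + e / 3" using unif[OF b3] by blast
  \<comment> \<open>T' almost attains the infimum in \<open>P (S + T) x\<close>. Splitting off the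
    last stretch of duration T leaves a time T' - T \<ge> S, which is admissible in
    \<open>P S y\<close>.\<close>
  obtain T' where T': "S + T <= T'" "FC T' x + c * T' < P (S + T) x + e / 3" using Papp[OF x _ b3, of "S + T"] S T by auto
  have s: "0 <= T' - T" "S <= T' - T" using T' S by auto
  obtain y d where y: "trav \<Omega> H R T y x d" "FC (T' - T) y + (d - p \<bullet> (x - y)) < FC (T' - T + T) x + e / 3"
   using FC_split[OF x s(1) T b3] by blast
  have yU: "y \<in> \<Omega>" using trav_in[OF y(1)] by blast
  have "P S y <= FC (T' - T) y + c * (T' - T)" by (rule Ple[OF yU S(1) s(2)])
  moreover have "P (S + T) x <= v x" by (rule Pv[OF x]) (use S T in simp)
  moreover have "v y <= P S y + e / 3" using S(2) yU by blast
  ultimately have "v y + (d - p \<bullet> (x - y)) + c * T <= v x + e" using y(2) T'(2) unfolding right_diff_distrib by simp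
  then show ?thesis using y(1) by blast
 qed
 then show ?thesis using vper dpp by blast
qed

end

context periodic_hamiltonian
begin

text \<open>Besides the corrector itself, the error bound for the free cost matters: it depends on
  \<open>R\<close> and the domain but neither on T nor otherwise on p.\<close>

lemma corrector_exists:
 assumes pr: "norm p <= r" and rR: "r <= R" and M: "\<And>w q. norm q <= r ==> H w q <= M"
  and thr: "\<And>y q. R <= norm q ==> M < H y q"
 shows "\<exists>c v. is_corrector H \<Omega> p c v \<and> 0 <= c \<and> c <= M \<and>
  (\<forall>x\<in>\<Omega>. \<forall>T\<ge>0. \<bar>free_cost R p T x + c * T\<bar> <= 6 * R * (conn_const * (2 * real CARD('n) + 1)))"
proof -
 interpret momentum D H R M p
 proof
  show "norm p <= R" using pr rR by linarith
  show "H w q <= M" if "norm q <= norm p" for w q by (rule M) (use that pr in linarith)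
 qed
 obtain c where c: "0 <= c" "c <= M" "\<forall>x\<in>\<Omega>. \<forall>T\<ge>0. \<bar>FC T x + c * T\<bar> <= 3 * osc" using FC_linear by blast
 obtain v where vper: "\<forall>x\<in>\<Omega>. \<forall>m\<in>int_lattice. v (x + m) = v x" and
  v1: "\<forall>T y x d. trav \<Omega> H R T y x d --> v x <= v y + (d - p \<bullet> (x - y)) + c * T" and
  v2: "\<forall>x\<in>\<Omega>. \<forall>T\<ge>0. \<forall>b>0. \<exists>y d. trav \<Omega> H R T y x d \<and> v y + (d - p \<bullet> (x - y)) + c * T <= v x + b"
  using weak_KAM[OF c(3)] by (elim exE conjE) (rule that)
 define V where "V q = v (fst q) + p \<bullet> fst q - c * snd q" for q
 have thr': "c < H y q" if "R <= norm q" for y q using thr[OF that, of y] c(2) by linarith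
 have "\<exists>Z K. K-lipschitz_on (closure \<Omega> \<times> {0..}) Z \<and> (\<forall>x\<in>\<Omega>. \<forall>t\<ge>0. Z (x, t) = V (x, t)) \<and>
  HJ_sub H \<Omega> Z \<and>
  HJ_super H (closure \<Omega>) Z"
 proof (rule solution_from_dpp[OF c(1) thr'])
  fix x y h d t assume "trav \<Omega> H R h y x d"
  with v1 have "v x <= v y + (d - p \<bullet> (x - y)) + c * h" by blast
  then show "V (x, t + h) <= V (y, t) + d" by (simp add: V_def inner_diff_right distrib_left)
 next
  fix x and t h b :: real assume "x \<in> \<Omega>" "0 <= h" "0 < b"
  with v2 obtain y d where y: "trav \<Omega> H R h y x d" "v y + (d - p \<bullet> (x - y)) + c * h <= v x + b" by blast
  have "V (y, t) + d <= V (x, t + h) + b" using y(2) by (simp add: V_def inner_diff_right distrib_left)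
  then show "\<exists>y c. trav \<Omega> H R h y x c \<and> V (y, t) + c <= V (x, t + h) + b" using y(1) by blast
 qed (simp_all add: V_def distrib_left)
 then obtain Z K where Z: "K-lipschitz_on (closure \<Omega> \<times> {0..}) Z" and ZV: "\<And>x t. x \<in> \<Omega> ==> 0 <= t ==> Z (x, t) = V (x, t)"
  and sub: "HJ_sub H \<Omega> Z"
  and sup: "HJ_super H (closure \<Omega>) Z" by (elim exE conjE) (rule that, auto)
 define w where "w x = Z (x, 0) - p \<bullet> x" for x
 have cont: "continuous_on (closure \<Omega> \<times> {0..}) Z" by (rule lipschitz_on_continuous_on[OF Z])
 have cx: "continuous_on (closure \<Omega>) (\<lambda>x. Z (x, t))" if "0 <= t" for t
  by (rule continuous_on_compose2[OF cont]) (use that in \<open>auto intro!: continuous_intros\<close>)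
 have wc: "continuous_on (closure \<Omega>) w" unfolding w_def by (intro continuous_intros cx) simp
 have Zw: "Z (x, t) = w x + p \<bullet> x - c * t" if x: "x \<in> closure \<Omega>" and t: "0 <= t" for x t
 proof -
  have "continuous_on (closure \<Omega>) (\<lambda>x. Z (x, t) - Z (x, 0))" using cx[OF t] cx[of 0] by (intro continuous_on_diff) auto
  from continuous_constant_on_closure[OF this _ x, of "- c * t"] have "Z (x, t) - Z (x, 0) = - c * t"
   using ZV t by (simp add: V_def)
  then show ?thesis by (simp add: w_def)
 qed
 have wper: "w (y + m) = w y" if y: "y \<in> closure \<Omega>" and m: "m \<in> int_lattice" for y m
 proof -
  have "continuous_on (closure \<Omega>) (\<lambda>y. w (y + m))"
   by (rule continuous_on_compose2[OF wc]) (use closure_translate[OF m] in \<open>auto intro!: continuous_intros\<close>)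
  then have "continuous_on (closure \<Omega>) (\<lambda>y. w (y + m) - w y)" using wc by (rule continuous_on_diff)
  from continuous_constant_on_closure[OF this _ y, of 0] have "w (y + m) - w y = 0"
   using ZV perforated_translate[OF m] vper m by (simp add: w_def V_def)
  then show ?thesis by simp
 qed
 have e: "(case q of (x, t) => w x + p \<bullet> x - c * t) = Z q" if "q \<in> closure \<Omega> \<times> {0<..}" for q
  using that Zw by auto
 have s1: "HJ_sub H \<Omega> (\<lambda>(x, t). w x + p \<bullet> x - c * t)"
  by (rule visc_subsolution_cong[OF _ sub]) (use e closure_subset[of \<Omega>] in auto)
 have s2: "HJ_super H (closure \<Omega>) (\<lambda>(x, t). w x + p \<bullet> x - c * t)"
  by (rule visc_supersolution_cong[OF _ sup]) (use e in auto)
 have "is_corrector H \<Omega> p c w"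
  unfolding is_corrector_def visc_cell_subsolution visc_cell_supersolution using wc wper s1 s2 by blast
 then show ?thesis using c by (intro exI[of _ c] exI[of _ w]) (simp add: osc_def mult.assoc)
qed

text \<open>An arbitrary corrector is only continuous and periodic, hence bounded; its oscillation
  enters as the additive constant in the spatial growth.\<close>

lemma corrector_evolution:
 assumes cor: "is_corrector H \<Omega> p c v" and thr: "\<And>y q. R <= norm q ==> max c 0 < H y q"
 shows "\<exists>B. (\<forall>y\<in>\<Omega>. \<bar>v y\<bar> <= B) \<and>
  (\<forall>T y x d. trav \<Omega> H R T y x d --> v x + p \<bullet> x - c * T <= v y + p \<bullet> y + d) \<and>
  (\<forall>x\<in>\<Omega>. \<forall>T>0. \<exists>y d. trav \<Omega> H R T y x d \<and> v y + p \<bullet> y + d <= v x + p \<bullet> x - c * T + 1)"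
proof -
 let ?z = "\<lambda>(x, t). v x + p \<bullet> x - c * t"
 have vc: "continuous_on (closure \<Omega>) v" and per: "\<And>y m. y \<in> closure \<Omega> ==> m \<in> int_lattice ==> v (y + m) = v y"
  and sub: "HJ_sub H \<Omega> ?z"
  and sup: "HJ_super H (closure \<Omega>) ?z"
  using cor unfolding is_corrector_def visc_cell_subsolution visc_cell_supersolution by blast+
 obtain B where B: "\<And>y. y \<in> closure \<Omega> ==> \<bar>v y\<bar> <= B" using periodic_uniform(1)[OF vc, rule_format, OF per] by blast
 have ev: "evolution H \<Omega> ?z (2 * \<bar>B\<bar>) (norm p) \<bar>c\<bar> (max c 0) R"
 proof (unfold_locales)
  show "continuous_on (closure \<Omega> \<times> {0..}) ?z"
   unfolding case_prod_beta by (intro continuous_intros continuous_on_compose2[OF vc]) auto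
  show "\<bar>?z (x, t) - ?z (y, t)\<bar> <= 2 * \<bar>B\<bar> + norm p * norm (x - y)" if "x \<in> closure \<Omega>" "y \<in> closure \<Omega>" for x y t
  proof -
   have "\<bar>p \<bullet> (x - y)\<bar> <= norm p * norm (x - y)" by (rule Cauchy_Schwarz_ineq2)
   then show ?thesis using B[OF that(1)] B[OF that(2)] unfolding inner_diff_right prod.case by linarith
  qed
  show "\<bar>?z (x, t) - ?z (x, s)\<bar> <= \<bar>c\<bar> * \<bar>t - s\<bar>" for x s t
   by (simp add: abs_minus_commute flip: right_diff_distrib abs_mult)
  show "?z (x, s) - max c 0 * h <= ?z (x, s + h)" if "0 <= h" for x s h
   using mult_right_mono[of c "max c 0" h] that by (simp add: distrib_left)
 qed (use thr in \<open>auto simp: open_perforated perforated_nonempty\<close>)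
 have uc: "uniformly_continuous_on (closure \<Omega>) (\<lambda>x. ?z (x, 0))"
 proof -
  have "uniformly_continuous_on (closure \<Omega>) (\<lambda>x. p \<bullet> x)"
   by (rule bounded_linear.uniformly_continuous_on[OF bounded_linear_inner_right uniformly_continuous_on_id])
  moreover have "uniformly_continuous_on (closure \<Omega>) v" by (rule periodic_uniform(2)[OF vc]) (rule per)
  ultimately have "uniformly_continuous_on (closure \<Omega>) (\<lambda>x. v x + p \<bullet> x)" by (intro uniformly_continuous_on_add)
  then show ?thesis by simp
 qed
 show ?thesis
 proof (rule exI[of _ B], intro conjI ballI allI impI)
  show "\<bar>v y\<bar> <= B" if "y \<in> \<Omega>" for y using B that closure_subset by blast
  show "v x + p \<bullet> x - c * T <= v y + p \<bullet> y + d" if "trav \<Omega> H R T y x d" for T y x d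
   using evolution.subsolution_trav[OF ev sub that order_refl] by simp
  show "\<exists>y d. trav \<Omega> H R T y x d \<and> v y + p \<bullet> y + d <= v x + p \<bullet> x - c * T + 1" if "x \<in> \<Omega>" "0 < T" for x T
   using evolution.supersolution_trav[OF ev sup regular_perforated uc that zero_less_one] by simp
 qed
qed

text \<open>A travel almost optimal for one corrector must satisfy the inequality of the other. This
  keeps (c - c') T bounded above for all T, so c \<le> c'.\<close>

lemma corrector_unique:
 assumes "is_corrector H \<Omega> p c v" "is_corrector H \<Omega> p c' v'" shows "c = c'"
proof -
 have le: "c <= c'" if cv: "is_corrector H \<Omega> p c v" and cv': "is_corrector H \<Omega> p c' v'" for c v c' v'
 proof (rule ccontr)
  assume "\<not> ?thesis"
  then have d: "0 < c - c'" by simp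
  obtain R where R: "\<And>y q. R <= norm q ==> max c 0 < H y q" using coercive by blast
  have R': "max c' 0 < H y q" if "R <= norm q" for y q using R[OF that, of y] d by simp
  obtain B where B: "\<forall>y\<in>\<Omega>. \<bar>v y\<bar> <= B" "\<forall>x\<in>\<Omega>. \<forall>T>0. \<exists>y d. trav \<Omega> H R T y x d \<and> v y + p \<bullet> y + d <= v x + p \<bullet> x - c * T + 1"
   using corrector_evolution[OF cv R] by blast
  obtain B' where B': "\<forall>y\<in>\<Omega>. \<bar>v' y\<bar> <= B'" "\<forall>T y x d. trav \<Omega> H R T y x d --> v' x + p \<bullet> x - c' * T <= v' y + p \<bullet> y + d"
   using corrector_evolution[OF cv' R'] by blast
  have x: "corner 0 \<in> \<Omega>" by (rule corner_perforated)
  have nn: "0 <= B" "0 <= B'" using B(1) B'(1) x by force+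
  define T where "T = (2 * B + 2 * B' + 2) / (c - c')"
  have T: "0 < T" "(c - c') * T = 2 * B + 2 * B' + 2" using d nn by (auto simp: T_def)
  from B(2) x T(1) obtain y e where y: "trav \<Omega> H R T y (corner 0) e" "v y + p \<bullet> y + e <= v (corner 0) + p \<bullet> corner 0 - c * T + 1" by blast
  have yU: "y \<in> \<Omega>" using trav_in[OF y(1)] by blast
  have "v' (corner 0) + p \<bullet> corner 0 - c' * T <= v' y + p \<bullet> y + e" using B'(2) y(1) by blast
  moreover have "\<bar>v y\<bar> <= B" "\<bar>v (corner 0)\<bar> <= B" "\<bar>v' y\<bar> <= B'" "\<bar>v' (corner 0)\<bar> <= B'" using B(1) B'(1) x yU by auto
  ultimately show False using y(2) T(2) unfolding left_diff_distrib abs_le_iff by linarith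
 qed
 show ?thesis using le[OF assms] le[OF assms(2,1)] by simp
qed

lemma effective_hamiltonian_eq: "is_corrector H \<Omega> p c v ==> effective_hamiltonian H \<Omega> p = c"
 unfolding effective_hamiltonian_def by (rule the_equality) (use corrector_unique in blast)+

abbreviation "Hbar \<equiv> effective_hamiltonian H \<Omega>"

text \<open>A Fenchel inequality between travel costs and the effective Hamiltonian, attained up to
  a constant from some starting point. That constant is uniform in T, in the end points and in |p|
  \<le> r.\<close>

theorem effective_cost:
 assumes pr: "norm p <= r" and rR: "r <= R" and M: "\<And>w q. norm q <= r ==> H w q <= M"
  and thr: "\<And>y q. R <= norm q ==> M < H y q"
 defines "B \<equiv> 6 * R * (conn_const * (2 * real CARD('n) + 1)) + 1"
 shows "0 <= Hbar p" "Hbar p <= M" "0 <= B"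
  and "trav \<Omega> H R T y x c ==> p \<bullet> (x - y) - Hbar p * T - B <= c"
  and "x \<in> \<Omega> ==> 0 <= T ==> \<exists>y c. trav \<Omega> H R T y x c \<and> c <= p \<bullet> (x - y) - Hbar p * T + B"
proof -
 interpret momentum D H R M p
 proof
  show "norm p <= R" using pr rR by linarith
  show "H w q <= M" if "norm q <= norm p" for w q by (rule M) (use that pr in linarith)
 qed
 obtain v where v: "is_corrector H \<Omega> p (Hbar p) v" "0 <= Hbar p" "Hbar p <= M"
  and b: "\<forall>x\<in>\<Omega>. \<forall>T\<ge>0. \<bar>FC T x + Hbar p * T\<bar> <= B - 1"
 proof -
  have "\<exists>c v. is_corrector H \<Omega> p c v \<and> 0 <= c \<and> c <= M \<and> (\<forall>x\<in>\<Omega>. \<forall>T\<ge>0. \<bar>FC T x + c * T\<bar> <= B - 1)"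
   unfolding B_def add_diff_cancel_right' by (rule corrector_exists[OF pr rR]) (fact M thr)+
  then obtain c v where "is_corrector H \<Omega> p c v" "0 <= c" "c <= M" "\<forall>x\<in>\<Omega>. \<forall>T\<ge>0. \<bar>FC T x + c * T\<bar> <= B - 1" by blast
  with effective_hamiltonian_eq[OF this(1)] that show thesis by simp
 qed
 show "0 <= Hbar p" "Hbar p <= M" using v by auto
 show "0 <= B" unfolding B_def using R0 conn_const(1) by simp
 show "p \<bullet> (x - y) - Hbar p * T - B <= c" if tr: "trav \<Omega> H R T y x c"
 proof -
  have "\<bar>FC T x + Hbar p * T\<bar> <= B - 1" using b trav_in[OF tr] by blast
  then show ?thesis using FC_le[OF tr] by linarith
 qed
 show "\<exists>y c. trav \<Omega> H R T y x c \<and> c <= p \<bullet> (x - y) - Hbar p * T + B" if x: "x \<in> \<Omega>" and T: "0 <= T"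
 proof -
  have "\<bar>FC T x + Hbar p * T\<bar> <= B - 1" using b x T by blast
  moreover obtain y c where "trav \<Omega> H R T y x c" "c - p \<bullet> (x - y) < FC T x + 1" using FC_approx[OF x T zero_less_one] by blast
  ultimately show ?thesis by (intro exI[of _ y] exI[of _ c]) auto
 qed
qed

end

section \<open>Almost linear functions\<close>

lemma le_of_linear_bound:
 fixes a b C :: real
 assumes "\<And>T. 0 < T ==> a * T <= b * T + C" shows "a <= b"
proof (rule ccontr)
 assume "\<not> ?thesis"
 then have d: "0 < a - b" by simp
 define T where "T = (\<bar>C\<bar> + 1) / (a - b)"
 have T: "0 < T" "(a - b) * T = \<bar>C\<bar> + 1" using d by (auto simp: T_def)
 show False using assms[OF T(1)] T(2) unfolding left_diff_distrib by linarith
qed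

text \<open>A function that is additive under doubling and subadditive, both up to bounded errors, has
 affine minorants that are sharp up to a bounded error.\<close>

lemma almost_linear:
 fixes m :: "'a::euclidean_space => real"
 assumes lip: "\<And>q q'. \<bar>m q - m q'\<bar> <= c * norm (q - q')"
  and sub: "\<And>q q'. m (q + q') <= m q + m q' + C" and half: "\<And>q. 2 * m q <= m (2 *\<^sub>R q) + C"
 shows "\<exists>X. m q0 - C <= X \<bullet> q0 \<and> (\<forall>q. X \<bullet> q <= m q + C)"
proof -
 have dbl: "m (2 *\<^sub>R q) <= 2 * m q + C" for q using sub[of q q] by (simp add: scaleR_2)
 \<comment> \<open>Dyadic averages of m at large scales. With C added they decrease by almost
   subadditivity, with C subtracted they increase by the halving inequality, so the limit stays
   within C of m.\<close>
 define b where "b q k = (m ((2::real) ^ k *\<^sub>R q) + C) / 2 ^ k" for q k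
 define e where "e q k = (m ((2::real) ^ k *\<^sub>R q) - C) / 2 ^ k" for q k
 have C: "0 <= C" using half[of 0] dbl[of 0] by simp
 have dec: "decseq (b q)" for q
 proof (rule decseq_SucI)
  fix k show "b q (Suc k) <= b q k"
  proof -
   have "(m (2 *\<^sub>R (2 ^ k *\<^sub>R q)) + C) / 2 <= m (2 ^ k *\<^sub>R q) + C" using dbl[of "2 ^ k *\<^sub>R q"] by simp
   from divide_right_mono[OF this, of "2 ^ k"] show ?thesis by (simp add: b_def divide_divide_eq_left)
  qed
 qed
 have inc: "incseq (e q)" for q
 proof (rule incseq_SucI)
  fix k show "e q k <= e q (Suc k)"
  proof -
   have "m (2 ^ k *\<^sub>R q) - C <= (m (2 *\<^sub>R (2 ^ k *\<^sub>R q)) - C) / 2" using half[of "2 ^ k *\<^sub>R q"] by simp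
   from divide_right_mono[OF this, of "2 ^ k"] show ?thesis by (simp add: e_def divide_divide_eq_left)
  qed
 qed
 have eb: "e q k <= b q k" for q k using C by (auto simp: e_def b_def intro!: divide_right_mono)
 have lower: "m q - C <= b q k" for q k
  using incseqD[OF inc[of q], of 0 k] eb[of q k] by (simp add: e_def)
 have "\<exists>L. b q \<longlonglongrightarrow> L" for q
 proof -
  have "\<forall>k. m q - C <= b q k" using lower by blast
  from decseq_convergent[OF dec this] show ?thesis by blast
 qed
 then have "\<exists>N. \<forall>q. b q \<longlonglongrightarrow> N q" by metis
 then obtain N where N: "\<And>q. b q \<longlonglongrightarrow> N q" by blast
 have low: "m q - C <= N q" for q by (rule LIMSEQ_le_const[OF N]) (use lower in auto)
 have up: "N q <= m q + C" for q
  using decseq_ge[OF dec N, of q 0] by (simp add: b_def)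
 have p0: "(\<lambda>k. K / 2 ^ k) \<longlonglongrightarrow> 0" for K :: real
  using LIMSEQ_divide_realpow_zero[of 2 K] by simp
 have Nsub: "N (q + q') <= N q + N q'" for q q'
 proof (rule LIMSEQ_le[OF N tendsto_add[OF N N]], intro exI allI impI)
  fix k show "b (q + q') k <= b q k + b q' k"
  proof -
   have "m (2 ^ k *\<^sub>R (q + q')) + C <= (m (2 ^ k *\<^sub>R q) + C) + (m (2 ^ k *\<^sub>R q') + C)"
    using sub[of "2 ^ k *\<^sub>R q" "2 ^ k *\<^sub>R q'"] by (simp add: scaleR_add_right)
   then show ?thesis unfolding b_def add_divide_distrib[symmetric] by (rule divide_right_mono) simp
  qed
 qed
 have N2: "N (2 ^ j *\<^sub>R q) = 2 ^ j * N q" for q and j :: nat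
 proof (rule LIMSEQ_unique[OF N])
  have "(\<lambda>k. b q (k + j)) \<longlonglongrightarrow> N q" by (rule LIMSEQ_ignore_initial_segment[OF N])
  then have "(\<lambda>k. 2 ^ j * b q (k + j)) \<longlonglongrightarrow> 2 ^ j * N q" by (rule tendsto_mult_left)
  moreover have "2 ^ j * b q (k + j) = b (2 ^ j *\<^sub>R q) k" for k by (simp add: b_def power_add)
  ultimately show "b (2 ^ j *\<^sub>R q) \<longlonglongrightarrow> 2 ^ j * N q" by simp
 qed
 have N0: "N 0 = 0" using N2[of 1 0] by simp
 have Nlip: "\<bar>N q - N q'\<bar> <= c * norm (q - q')" for q q'
 proof (rule LIMSEQ_le_const2[OF tendsto_rabs[OF tendsto_diff[OF N N]]], intro exI allI impI)
  fix k
  have "\<bar>m (2 ^ k *\<^sub>R q) - m (2 ^ k *\<^sub>R q')\<bar> <= c * norm ((2::real) ^ k *\<^sub>R (q - q'))"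
   using lip[of "2 ^ k *\<^sub>R q" "2 ^ k *\<^sub>R q'"] by (simp add: scaleR_diff_right)
  then have "\<bar>m (2 ^ k *\<^sub>R q) - m (2 ^ k *\<^sub>R q')\<bar> / 2 ^ k <= c * norm (q - q')"
   by (simp add: pos_divide_le_eq mult.commute mult.left_commute)
  then show "\<bar>b q k - b q' k\<bar> <= c * norm (q - q')"
   unfolding b_def diff_divide_distrib[symmetric] by simp
 qed
 have Nnat: "N (real k *\<^sub>R q) <= real k * N q" for k q
 proof (induction k)
  case (Suc k)
  have "N (real k *\<^sub>R q + q) <= N (real k *\<^sub>R q) + N q" by (rule Nsub)
  then show ?case using Suc by (simp add: scaleR_add_left algebra_simps)
 qed (simp add: N0)
 \<comment> \<open>Dyadic numbers k / 2^j approximate s from below; for them homogeneity follows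
   from \<open>N2\<close> and \<open>Nnat\<close>, and the Lipschitz bound controls the
   remainder.\<close>
 have Nhom: "N (s *\<^sub>R q) <= s * N q" if s: "0 <= s" for s q
 proof (rule LIMSEQ_le_const[of "\<lambda>j. s * N q + (\<bar>c * norm q\<bar> + \<bar>N q\<bar>) / 2 ^ j"], goal_cases)
  case 1
  show ?case using tendsto_add[OF tendsto_const p0] by simp
 next
  case 2
  show ?case
  proof (intro exI allI impI)
   fix j :: nat
   define k where "k = nat \<lfloor>s * 2 ^ j\<rfloor>"
   have k: "real k <= s * 2 ^ j" "s * 2 ^ j <= real k + 1"
   proof -
    have "0 <= s * 2 ^ j" using s by simp
    then show "real k <= s * 2 ^ j" "s * 2 ^ j <= real k + 1" unfolding k_def by linarith+
   qed
   define d where "d = s - real k / 2 ^ j"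
   have d: "0 <= d" "d <= 1 / 2 ^ j"
   proof -
    have "real k / 2 ^ j <= s" using k(1) by (simp add: pos_divide_le_eq)
    then show "0 <= d" by (simp add: d_def)
    have "s <= (real k + 1) / 2 ^ j" using k(2) by (simp add: pos_le_divide_eq)
    then show "d <= 1 / 2 ^ j" by (simp add: d_def add_divide_distrib)
   qed
   have "2 ^ j * N ((real k / 2 ^ j) *\<^sub>R q) = N (real k *\<^sub>R q)" unfolding N2[symmetric] by simp
   also have "\<dots> <= real k * N q" by (rule Nnat)
   finally have "N ((real k / 2 ^ j) *\<^sub>R q) <= real k / 2 ^ j * N q" by (simp add: field_simps)
   moreover have "real k / 2 ^ j * N q = s * N q - d * N q" by (simp add: d_def algebra_simps)
   moreover have "- (d * N q) <= \<bar>N q\<bar> / 2 ^ j"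
   proof -
    have "d * - N q <= d * \<bar>N q\<bar>" using d(1) by (intro mult_left_mono) auto
    then have "- (d * N q) <= d * \<bar>N q\<bar>" by simp
    also have "\<dots> <= 1 / 2 ^ j * \<bar>N q\<bar>" using d by (intro mult_right_mono) auto
    finally show ?thesis by simp
   qed
   moreover have "N (s *\<^sub>R q) - N ((real k / 2 ^ j) *\<^sub>R q) <= \<bar>c * norm q\<bar> / 2 ^ j"
   proof -
    have "s *\<^sub>R q - (real k / 2 ^ j) *\<^sub>R q = d *\<^sub>R q" by (simp add: d_def scaleR_diff_left)
    then have "N (s *\<^sub>R q) - N ((real k / 2 ^ j) *\<^sub>R q) <= d * (c * norm q)"
     using Nlip[of "s *\<^sub>R q" "(real k / 2 ^ j) *\<^sub>R q"] d(1) by (simp add: mult.left_commute)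
    also have "\<dots> <= d * \<bar>c * norm q\<bar>" using d by (intro mult_left_mono) auto
    also have "\<dots> <= 1 / 2 ^ j * \<bar>c * norm q\<bar>" using d by (intro mult_right_mono) auto
    finally show ?thesis by simp
   qed
   ultimately show "N (s *\<^sub>R q) <= s * N q + (\<bar>c * norm q\<bar> + \<bar>N q\<bar>) / 2 ^ j" unfolding add_divide_distrib by linarith
  qed
 qed
 have "convex_on UNIV N"
  unfolding convex_on_def
 proof (intro conjI ballI allI impI)
  fix x y :: 'a and u v :: real assume uv: "0 <= u" "0 <= v"
  show "N (u *\<^sub>R x + v *\<^sub>R y) <= u * N x + v * N y"
   using Nsub[of "u *\<^sub>R x" "v *\<^sub>R y"] Nhom[OF uv(1), of x] Nhom[OF uv(2), of y] by linarith
 qed simp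
 then obtain X where X: "\<And>q. N q0 + X \<bullet> (q - q0) <= N q" using subgradient_exists by blast
 have "X \<bullet> q0 <= N q0" using X[of "2 *\<^sub>R q0"] N2[of 1 q0] by (simp add: scaleR_2)
 moreover have "N q0 <= X \<bullet> q0" using X[of 0] by (simp add: N0)
 ultimately have eq: "X \<bullet> q0 = N q0" by simp
 have "X \<bullet> q <= m q + C" for q using X[of q] eq up[of q] by (simp add: inner_diff_right)
 then show ?thesis using eq low[of q0] by (intro exI[of _ X]) auto
qed

section \<open>The effective Hamiltonian\<close>

context periodic_hamiltonian
begin

abbreviation "effective_cost_bounds r R M B ==
 \<forall>p. norm p <= r --> 0 <= Hbar p \<and> Hbar p <= M \<and>
  (\<forall>T y x c. trav \<Omega> H R T y x c --> p \<bullet> (x - y) - Hbar p * T - B <= c) \<and>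
  (\<forall>x\<in>\<Omega>. \<forall>T\<ge>0. \<exists>y c. trav \<Omega> H R T y x c \<and> c <= p \<bullet> (x - y) - Hbar p * T + B)"

lemma effective_cost_exists:
 assumes r: "0 <= r"
 shows "\<exists>R M B. r <= R \<and> 0 <= B \<and> effective_cost_bounds r R M B"
proof -
 obtain M where M: "\<And>w q. norm q <= r ==> H w q <= M" using locally_bounded by blast
 obtain R where rR: "r <= R" and thr: "\<And>y p. R <= norm p ==> M < H y p" by (rule coercive_above) (rule that)
 let ?B = "6 * R * (conn_const * (2 * real CARD('n) + 1)) + 1"
 note E = effective_cost[OF _ rR, where M = M]
 have a: "0 <= ?B" using E(3)[of 0] r M thr by simp
 have b: "0 <= Hbar p \<and> Hbar p <= M \<and>
  (\<forall>T y x c. trav \<Omega> H R T y x c --> p \<bullet> (x - y) - Hbar p * T - ?B <= c) \<and>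
  (\<forall>x\<in>\<Omega>. \<forall>T\<ge>0. \<exists>y c. trav \<Omega> H R T y x c \<and> c <= p \<bullet> (x - y) - Hbar p * T + ?B)" if p: "norm p <= r" for p
 proof (intro conjI allI impI ballI)
  show "0 <= Hbar p" "Hbar p <= M" by (rule E(1)[OF p] E(2)[OF p]; fact M thr)+
  show "p \<bullet> (x - y) - Hbar p * T - ?B <= c" if "trav \<Omega> H R T y x c" for T y x c
   by (rule E(4)[OF p _ _ that]) (fact M thr)+
  show "\<exists>y c. trav \<Omega> H R T y x c \<and> c <= p \<bullet> (x - y) - Hbar p * T + ?B" if "x \<in> \<Omega>" "0 <= T" for x T
   by (rule E(5)[OF p _ _ that]) (fact M thr)+
 qed
 show ?thesis
  by (rule exI[of _ R], rule exI[of _ M], rule exI[of _ ?B], intro conjI rR a, intro allI impI, rule b)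
qed

text \<open>Coercivity of the effective Hamiltonian needs a cost that does not involve
  \<open>R\<close>, since \<open>R\<close> grows with the momentum. Crossing length l in time r l
  costs at most r l: convexity gives H(w, q) \<ge> |q| / r once |q| > r.\<close>

lemma conn_trav_slow:
 assumes r: "0 < r" "\<And>y q. r <= norm q ==> 1 < H y q" and R: "0 <= R" and c: "conn U x y l"
 shows "trav U H R (r * l) x y (r * l)"
 using c
proof (induction rule: conn.induct)
 case (conn_step x y l z)
 have le: "ell H R w (z - y) (r * norm (z - y)) <= r * norm (z - y)" for w
 proof (rule ell_le[OF R])
  fix q :: "real^'n" assume "norm q <= R"
  have qd: "q \<bullet> (z - y) <= norm q * norm (z - y)" by (rule norm_cauchy_schwarz)
  show "q \<bullet> (z - y) - r * norm (z - y) * H w q <= r * norm (z - y)"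
  proof (cases "norm q <= r")
   case True
   have "norm q * norm (z - y) <= r * norm (z - y)" using True by (intro mult_right_mono) auto
   moreover have "0 <= r * norm (z - y) * H w q" using r nonneg by simp
   ultimately show ?thesis using qd by linarith
  next
   case False
   then have q: "r < norm q" "0 < norm q" using r(1) by auto
   define s where "s = r / norm q"
   have s: "0 < s" "s <= 1" using q r(1) by (auto simp: s_def)
   have "norm (s *\<^sub>R q) = r" using q r(1) by (simp add: s_def)
   then have "1 < H w (s *\<^sub>R q)" using r(2) by simp
   also have "s *\<^sub>R q = (1 - s) *\<^sub>R 0 + s *\<^sub>R q" by simp
   also have "H w \<dots> <= (1 - s) * H w 0 + s * H w q"
    using convex[of w] s unfolding convex_on_def by (metis UNIV_I diff_add_cancel diff_ge_0_iff_ge less_imp_le)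
   finally have "1 <= s * H w q" by (simp add: zero)
   then have "norm q <= norm q * (s * H w q)" using q(2) by simp
   also have "\<dots> = r * H w q" using q(2) by (simp add: s_def)
   finally have "norm q * norm (z - y) <= r * H w q * norm (z - y)" by (rule mult_right_mono) simp
   moreover have "r * H w q * norm (z - y) = r * norm (z - y) * H w q" by simp
   moreover have "0 <= r * norm (z - y)" using r by simp
   ultimately show ?thesis using qd by linarith
  qed
 qed
 have "trav U H R (r * norm (z - y)) y z (r * norm (z - y))"
  by (rule trav_single) (use conn_step.hyps(2) le r in auto)
 from trav_trans[OF this conn_step.IH] show ?case by (simp add: distrib_left)
qed (simp add: trav_nil)

text \<open>The properties follow from the Fenchel inequality for large T, where the constant error
  disappears. Coercivity tests it on a slow travel over a long distance in the direction of
  p.\<close>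

theorem hamiltonian_effective: "hamiltonian (\<lambda>_::real^'n. Hbar)"
proof
 have o': "corner (0::real^'n) \<in> \<Omega>" by (rule corner_perforated)
 show "convex_on UNIV Hbar"
  unfolding convex_on_def
 proof (intro conjI ballI allI impI)
  fix p q :: "real^'n" and u v :: real assume uv: "0 <= u" "0 <= v" "u + v = 1"
  define r where "r = norm p + norm q"
  let ?p = "u *\<^sub>R p + v *\<^sub>R q"
  have "norm ?p <= u * norm p + v * norm q" using norm_triangle_ineq[of "u *\<^sub>R p" "v *\<^sub>R q"] uv by simp
  also have "\<dots> <= 1 * norm p + 1 * norm q" using uv by (intro add_mono mult_right_mono) auto
  finally have n: "norm ?p <= r" "norm p <= r" "norm q <= r" "0 <= r" by (auto simp: r_def)
  from effective_cost_exists[OF n(4)] obtain R M B where B: "r <= R" "0 <= B" and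
   E: "effective_cost_bounds r R M B"
   by (elim exE conjE) (rule that)
  show "Hbar ?p <= u * Hbar p + v * Hbar q"
  proof (rule le_of_linear_bound)
   fix T :: real assume "0 < T"
   with E n o' obtain y c where yc: "trav \<Omega> H R T y (corner 0) c" "c <= ?p \<bullet> (corner 0 - y) - Hbar ?p * T + B"
    by (meson less_imp_le)
   have 1: "p \<bullet> (corner 0 - y) - Hbar p * T - B <= c" "q \<bullet> (corner 0 - y) - Hbar q * T - B <= c"
    using E n yc(1) by blast+
   have "u * (p \<bullet> (corner 0 - y) - Hbar p * T - B) + v * (q \<bullet> (corner 0 - y) - Hbar q * T - B) <= u * c + v * c"
    using uv 1 by (intro add_mono mult_left_mono) auto
   also have "u * c + v * c = c" using uv(3) by (metis distrib_right mult_1)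
   also have "u * (p \<bullet> (corner 0 - y) - Hbar p * T - B) + v * (q \<bullet> (corner 0 - y) - Hbar q * T - B)
     = ?p \<bullet> (corner 0 - y) - (u * Hbar p + v * Hbar q) * T - (u + v) * B"
    by (simp add: inner_add_left algebra_simps)
   finally show "Hbar ?p * T <= (u * Hbar p + v * Hbar q) * T + 2 * B" using yc(2) uv(3) by simp
  qed
 qed simp
 show Hb0: "Hbar 0 = 0"
 proof (rule antisym)
  from effective_cost_exists[OF order_refl] obtain R M B where B: "0 <= R" "0 <= B" and
   E: "effective_cost_bounds 0 R M B"
   by (elim exE conjE) (rule that)
  note E0 = E[THEN spec, THEN mp, OF eq_refl[OF norm_zero]]
  show "0 <= Hbar 0" by (rule E0[THEN conjunct1])
  show "Hbar 0 <= 0"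
  proof (rule le_of_linear_bound)
   fix T :: real assume "0 < T"
   then obtain y c where yc: "trav \<Omega> H R T y (corner 0) c" "c <= 0 \<bullet> (corner 0 - y) - Hbar 0 * T + B"
    using E0[THEN conjunct2, THEN conjunct2, THEN conjunct2, THEN bspec, OF o', THEN spec, of T] by (auto simp only: less_imp_le)
   show "Hbar 0 * T <= 0 * T + B" using yc(2)[unfolded inner_zero_left] trav_cost_nonneg[OF yc(1) B(1)] by simp
  qed
 qed
 have nn: "0 <= Hbar p" for p using effective_cost_exists[of "norm p"] by auto
 show "0 <= Hbar p" for p by (rule nn)
 show "\<exists>M. \<forall>(y::real^'n) p. norm p <= R --> Hbar p <= M" for R
 proof -
  obtain M where "\<forall>p. norm p <= max 0 R --> Hbar p <= M" using effective_cost_exists[of "max 0 R"] by auto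
  then show ?thesis by (intro exI[of _ M]) auto
 qed
 show "\<exists>r. \<forall>(y::real^'n) p. r <= norm p --> K < Hbar p" for K
 proof -
  obtain r where r': "1 <= r" and r2: "\<And>y p. r <= norm p ==> 1 < H y p" by (rule coercive_above) (rule that)
  have r: "0 < r" "\<And>y p. r <= norm p ==> 1 < H y p" using r' r2 by auto
  let ?n = "real CARD('n)"
  have "norm p <= (Hbar p + 1) * (r * conn_const)" if p: "p \<noteq> 0" for p
  proof -
   from effective_cost_exists[OF norm_ge_zero[of p]] obtain R M B where B: "norm p <= R" "0 <= B" and
    E: "effective_cost_bounds (norm p) R M B"
    by (elim exE conjE) (rule that)
   have R: "0 <= R" using B norm_ge_zero order_trans by blast
   have "norm p * norm p <= ((Hbar p + 1) * (r * conn_const)) * norm p"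
   proof (rule le_of_linear_bound)
    fix s :: real assume s: "0 < s"
    \<comment> \<open>Rounding the displacement s p to a lattice vector keeps the end point in
      \<Omega>, at an error bounded independently of s.\<close>
    let ?m = "cell (s *\<^sub>R p)"
    let ?x = "corner 0 + ?m"
    have nm: "norm (s *\<^sub>R p - ?m) <= ?n" by (rule norm_cell)
    have x: "?x \<in> \<Omega>" by (rule perforated_translate[OF cell_lattice o'])
    obtain l where l: "l <= conn_const * (norm (corner 0 - ?x) + 1)" "conn \<Omega> (corner 0) ?x l"
     using conn_const(3)[OF o' x] by blast
    have "norm ?m <= norm (s *\<^sub>R p) + norm (s *\<^sub>R p - ?m)" using norm_triangle_ineq4[of "s *\<^sub>R p" "s *\<^sub>R p - ?m"] by simp
    then have "norm (corner 0 - ?x) + 1 <= s * norm p + ?n + 1" using nm s by simp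
    from mult_left_mono[OF this, of conn_const] have l': "l <= conn_const * (s * norm p + ?n + 1)"
     using l(1) conn_const(1) by linarith
    have "p \<bullet> (?x - corner 0) - Hbar p * (r * l) - B <= r * l"
     using E conn_trav_slow[OF r R l(2)] by blast
    then have 1: "p \<bullet> ?m - B <= (Hbar p + 1) * (r * l)" by (simp add: distrib_right)
    have "(Hbar p + 1) * (r * l) <= (Hbar p + 1) * (r * (conn_const * (s * norm p + ?n + 1)))"
     using nn[of p] r(1) l' by (intro mult_left_mono) auto
    moreover have "p \<bullet> (s *\<^sub>R p - ?m) <= norm p * ?n"
     using norm_cauchy_schwarz[of p "s *\<^sub>R p - ?m"] mult_left_mono[OF nm, of "norm p"] by simp
    then have "s * (norm p * norm p) <= p \<bullet> ?m + norm p * ?n"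
     by (simp add: inner_diff_right dot_square_norm power2_eq_square)
    ultimately have "s * (norm p * norm p) <= (Hbar p + 1) * (r * (conn_const * (s * norm p + ?n + 1))) + B + norm p * ?n"
     using 1 by linarith
    then show "norm p * norm p * s <= ((Hbar p + 1) * (r * conn_const)) * norm p * s + ((Hbar p + 1) * (r * conn_const) * (?n + 1) + B + norm p * ?n)"
     by (simp add: algebra_simps)
   qed
   then show ?thesis using p by simp
  qed
  note bound = this
  have rc: "0 < r * conn_const" using r conn_const(1) by simp
  have "K < Hbar p" if "(\<bar>K\<bar> + 2) * (r * conn_const) <= norm p" for p
  proof -
   have "0 < (\<bar>K\<bar> + 2) * (r * conn_const)" by (intro mult_pos_pos rc) simp
   then have "0 < norm p" using that by linarith
   then have "(\<bar>K\<bar> + 2) * (r * conn_const) <= (Hbar p + 1) * (r * conn_const)" using bound[of p] that by force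
   then show ?thesis using rc by (simp add: mult_le_cancel_right)
  qed
  then show ?thesis by blast
 qed
 show "\<exists>d>0. \<forall>(y::real^'n) y' p. norm p <= R --> dist y y' < d --> \<bar>Hbar p - Hbar p\<bar> < e" if "0 < e" for R e :: real
  using that by (intro exI[of _ 1]) simp
qed

end

section \<open>Effective travel costs\<close>

context periodic_hamiltonian
begin

definition displacement_cost :: "real => real => real => (real ^ 'n) \<times> real => real" where
 "displacement_cost R a K q =
   Inf {c + a * norm (x - y - fst q) + K * \<bar>S - snd q\<bar> | S y x c. trav \<Omega> H R S y x c}"

text \<open>After a lattice translation any two points are at distance at most twice the dimension;
  this bounds the price of connecting them by jumps.\<close>

definition join_cost :: "real => real" where
 "join_cost R = R * (conn_const * (2 * real CARD('n) + 1))"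

lemma trav_relocate:
 assumes R: "0 <= R" and t: "trav \<Omega> H R S y x c" and w: "w \<in> \<Omega>"
 shows "\<exists>m. trav \<Omega> H R S (y + m) w (c + join_cost R) \<and> norm (x + m - w) <= 2 * real CARD('n)"
proof -
 let ?m = "cell w + - cell x"
 have m: "?m \<in> int_lattice" by (intro int_lattice_add int_lattice_minus cell_lattice)
 have xm: "x + ?m \<in> \<Omega>" using trav_in[OF t] perforated_translate[OF m] by blast
 have "norm (x + ?m - w) <= norm (x - cell x) + norm (w - cell w)"
  using norm_triangle_ineq4[of "x - cell x" "w - cell w"] by (simp add: algebra_simps)
 then have d: "norm (x + ?m - w) <= 2 * real CARD('n)" using norm_cell[of x] norm_cell[of w] by linarith
 obtain l where l: "l <= conn_const * (norm (x + ?m - w) + 1)" "conn \<Omega> (x + ?m) w l"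
  using conn_const(3)[OF xm w] by blast
 have "conn_const * (norm (x + ?m - w) + 1) <= conn_const * (2 * real CARD('n) + 1)"
  using d conn_const(1) by (intro mult_left_mono) auto
 then have j: "R * l <= join_cost R" unfolding join_cost_def using l(1) R by (intro mult_left_mono) auto
 have "trav \<Omega> H R (S + 0) (y + ?m) w (c + R * l)"
  by (rule trav_trans[OF conn_trav[OF l(2) R] trav_translate[OF t perforated_translate[OF m] periodic[OF m]]])
 from trav_weaken[OF this R, of S "c + join_cost R"] j d show ?thesis by (intro exI[of _ ?m]) simp
qed

lemma trav_join:
 assumes R: "0 <= R" and t: "trav \<Omega> H R S y x c" "trav \<Omega> H R S' y' x' c'"
 shows "\<exists>w. trav \<Omega> H R (S + S') w x' (c + c' + join_cost R) \<and> norm ((x' - w) - ((x - y) + (x' - y'))) <= 2 * real CARD('n)"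
proof -
 obtain m where m: "trav \<Omega> H R S (y + m) y' (c + join_cost R)" "norm (x + m - y') <= 2 * real CARD('n)"
  using trav_relocate[OF R t(1)] trav_in[OF t(2)] by blast
 have "trav \<Omega> H R (S + S') (y + m) x' (c + c' + join_cost R)" using trav_trans[OF t(2) m(1)] by (simp add: ac_simps)
 moreover have "(x' - (y + m)) - ((x - y) + (x' - y')) = - (x + m - y')" by simp
 ultimately show ?thesis using m(2) by (intro exI[of _ "y + m"]) (simp only: norm_minus_cancel simp_thms)
qed

text \<open>Lattice translations bring the end of each selected piece near the start of the next. A
  junction costs at most \<open>join_cost R\<close> and distorts the total displacement by a bounded
  amount, while durations add exactly.\<close>

lemma trav_pieces:
 fixes X :: "real => real ^ 'n" and u a :: "real => real"
 assumes R: "0 <= R"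
  and piece: "\<And>i. i \<in> G ==> i < k ==> trav \<Omega> H R (u (s (Suc i)) - u (s i)) (X (s i)) (X (s (Suc i))) (a (s (Suc i)) - a (s i))"
 shows "\<exists>y x. trav \<Omega> H R (\<Sum>i\<in>G \<inter> {..<k}. u (s (Suc i)) - u (s i)) y x
   ((\<Sum>i\<in>G \<inter> {..<k}. a (s (Suc i)) - a (s i)) + real k * join_cost R) \<and>
  norm ((x - y) - (\<Sum>i\<in>G \<inter> {..<k}. X (s (Suc i)) - X (s i))) <= real k * (2 * real CARD('n))"
 using piece
proof (induction k)
 case 0
 show ?case using trav_nil[OF corner_perforated[of 0]] by (intro exI[of _ "corner 0"]) simp
next
 case (Suc k)
 have J: "0 <= join_cost R" unfolding join_cost_def using R conn_const(1) by simp
 have "trav \<Omega> H R (u (s (Suc i)) - u (s i)) (X (s i)) (X (s (Suc i))) (a (s (Suc i)) - a (s i))" if "i \<in> G" "i < k" for i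
  by (rule Suc.prems) (use that in auto)
 from Suc.IH[OF this] obtain y x where yx: "trav \<Omega> H R (\<Sum>i\<in>G \<inter> {..<k}. u (s (Suc i)) - u (s i)) y x
   ((\<Sum>i\<in>G \<inter> {..<k}. a (s (Suc i)) - a (s i)) + real k * join_cost R)"
  "norm ((x - y) - (\<Sum>i\<in>G \<inter> {..<k}. X (s (Suc i)) - X (s i))) <= real k * (2 * real CARD('n))" by blast
 show ?case
 proof (cases "k \<in> G")
  case False
  then have e: "G \<inter> {..<Suc k} = G \<inter> {..<k}" by (auto simp: less_Suc_eq)
  have "trav \<Omega> H R (\<Sum>i\<in>G \<inter> {..<k}. u (s (Suc i)) - u (s i)) y x
   ((\<Sum>i\<in>G \<inter> {..<k}. a (s (Suc i)) - a (s i)) + real (Suc k) * join_cost R)"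
   by (rule trav_weaken[OF yx(1) R]) (use J in \<open>auto simp: distrib_right\<close>)
  moreover have "norm ((x - y) - (\<Sum>i\<in>G \<inter> {..<k}. X (s (Suc i)) - X (s i))) <= real (Suc k) * (2 * real CARD('n))"
   using yx(2) by (simp add: distrib_right)
  ultimately show ?thesis unfolding e by blast
 next
  case True
  then have "G \<inter> {..<Suc k} = insert k (G \<inter> {..<k})" by (auto simp: less_Suc_eq)
  then have e: "(\<Sum>i\<in>G \<inter> {..<Suc k}. f i) = (\<Sum>i\<in>G \<inter> {..<k}. f i) + f k" for f :: "nat => 'b::ab_group_add"
   by (simp add: add.commute)
  obtain w where w: "trav \<Omega> H R ((\<Sum>i\<in>G \<inter> {..<k}. u (s (Suc i)) - u (s i)) + (u (s (Suc k)) - u (s k))) w (X (s (Suc k)))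
    (((\<Sum>i\<in>G \<inter> {..<k}. a (s (Suc i)) - a (s i)) + real k * join_cost R) + (a (s (Suc k)) - a (s k)) + join_cost R)"
   "norm ((X (s (Suc k)) - w) - ((x - y) + (X (s (Suc k)) - X (s k)))) <= 2 * real CARD('n)"
   using trav_join[OF R yx(1) Suc.prems[OF True lessI]] by blast
  have ec: "((\<Sum>i\<in>G \<inter> {..<k}. a (s (Suc i)) - a (s i)) + real k * join_cost R) + (a (s (Suc k)) - a (s k)) + join_cost R
   = (\<Sum>i\<in>G \<inter> {..<Suc k}. a (s (Suc i)) - a (s i)) + real (Suc k) * join_cost R"
   unfolding e by (simp add: distrib_right)
  have "norm ((X (s (Suc k)) - w) - (\<Sum>i\<in>G \<inter> {..<Suc k}. X (s (Suc i)) - X (s i))) <=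
   norm ((X (s (Suc k)) - w) - ((x - y) + (X (s (Suc k)) - X (s k)))) + norm ((x - y) - (\<Sum>i\<in>G \<inter> {..<k}. X (s (Suc i)) - X (s i)))"
   unfolding e by (rule order_trans[OF _ norm_triangle_ineq]) (simp add: algebra_simps)
  also have "\<dots> <= 2 * real CARD('n) + real k * (2 * real CARD('n))" by (rule add_mono[OF w(2) yx(2)])
  also have "\<dots> = real (Suc k) * (2 * real CARD('n))" by (simp add: distrib_right)
  finally show ?thesis using w(1) unfolding ec e by blast
 qed
qed

text \<open>By the Hobby--Rice theorem a travel can be cut into boundedly many pieces that form two groups
 of equal displacement and duration; the cheaper group is rearranged into a single travel.\<close>

lemma trav_halve:
 assumes R: "0 <= R" and tr: "trav \<Omega> H R S y x c"
 defines "k \<equiv> real (DIM(real ^ 'n) + 2)"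
 shows "\<exists>y' x' c'. trav \<Omega> H R (S / 2) y' x' c' \<and> 2 * c' <= c + 2 * (k * join_cost R) \<and>
  norm ((x' - y') - (1/2) *\<^sub>R (x - y)) <= k * (2 * real CARD('n))"
proof -
 obtain X :: "real => real ^ 'n" and u d :: "real => real" and L where
  lip: "L-lipschitz_on {0..1} (\<lambda>s. (X s, u s, d s))"
  and ends: "X 0 = y" "u 0 = 0" "d 0 = 0" "X 1 = x" "u 1 = S" "d 1 = c"
  and sub: "\<And>a b. 0 <= a ==> a <= b ==> b <= 1 ==> trav (X ` {a..b}) H R (u b - u a) (X a) (X b) (d b - d a)"
  and XU: "X ` {0..1} \<subseteq> \<Omega>"
  by (rule trav_curve_unit[OF tr R], rule that) assumption+
 \<comment> \<open>Only displacement and time are balanced, a vector of dimension n + 1, which gives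
   n + 2 pieces for space dimension n. The cost is left out: one of the two groups carries at most
   half of it.\<close>
 define g where "g s = (X s, u s)" for s
 have "L-lipschitz_on {0..1} g"
 proof (rule lipschitz_onI)
  fix a b :: real assume ab: "a \<in> {0..1}" "b \<in> {0..1}"
  have "dist (g a) (g b) <= dist (X a, u a, d a) (X b, u b, d b)"
   unfolding g_def dist_Pair_Pair by (intro real_sqrt_le_mono add_mono order_refl power_mono) auto
  also have "\<dots> <= L * dist a b" by (rule lipschitz_onD[OF lip ab])
  finally show "dist (g a) (g b) <= L * dist a b" .
 qed (rule lipschitz_on_nonneg[OF lip])
 from Hobby_Rice[OF this] obtain s :: "nat => real" and e :: "nat => bool" where
  s: "s 0 = 0" "s (Suc DIM((real ^ 'n) \<times> real)) = 1" "mono s"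
  and z: "(\<Sum>i\<le>DIM((real ^ 'n) \<times> real). (if e i then 1 else - 1) *\<^sub>R (g (s (Suc i)) - g (s i))) = 0"
  by blast
 define N where "N = Suc DIM((real ^ 'n) \<times> real)"
 have N: "real N = k" by (simp add: N_def k_def)
 have s01: "0 <= s i" "s i <= 1" if "i <= N" for i
  using monoD[OF s(3), of 0 i] monoD[OF s(3), of i N] s that by (auto simp: N_def)
 have piece: "trav \<Omega> H R (u (s (Suc i)) - u (s i)) (X (s i)) (X (s (Suc i))) (d (s (Suc i)) - d (s i))" if "i < N" for i
 proof -
  have "trav (X ` {s i..s (Suc i)}) H R (u (s (Suc i)) - u (s i)) (X (s i)) (X (s (Suc i))) (d (s (Suc i)) - d (s i))"
   by (rule sub) (use s01 that monoD[OF s(3), of i "Suc i"] in auto)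
  moreover have "X ` {s i..s (Suc i)} \<subseteq> \<Omega>"
   using XU s01(1)[of i] s01(2)[of "Suc i"] that by (intro subset_trans[OF _ XU] image_mono) auto
  ultimately show ?thesis by (rule trav_mono_set)
 qed
 define P where "P = {i. e i}"
 have tel: "(\<Sum>i<N. f (s (Suc i)) - f (s i)) = f 1 - f 0" for f :: "real => 'b::ab_group_add"
  using sum_lessThan_telescope[of "\<lambda>i. f (s i)" N] s by (simp add: N_def)
 have split: "(\<Sum>i\<in>P \<inter> {..<N}. f i) + (\<Sum>i\<in>- P \<inter> {..<N}. f i) = (\<Sum>i<N. f i)" for f :: "nat => 'b::ab_group_add"
  by (subst sum.union_disjoint[symmetric]) (auto intro!: sum.cong)
 have "(\<Sum>i<N. (if e i then 1 else - 1) *\<^sub>R (g (s (Suc i)) - g (s i))) = 0"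
  using z by (simp add: N_def lessThan_Suc_atMost)
 also have "(\<Sum>i<N. (if e i then 1 else - 1) *\<^sub>R (g (s (Suc i)) - g (s i)))
   = (\<Sum>i\<in>P \<inter> {..<N}. g (s (Suc i)) - g (s i)) - (\<Sum>i\<in>- P \<inter> {..<N}. g (s (Suc i)) - g (s i))"
  unfolding split[symmetric] by (simp add: P_def sum_negf[symmetric])
 finally have eq: "(\<Sum>i\<in>P \<inter> {..<N}. g (s (Suc i)) - g (s i)) = (\<Sum>i\<in>- P \<inter> {..<N}. g (s (Suc i)) - g (s i))" by simp
 have tot: "(\<Sum>i\<in>P \<inter> {..<N}. g (s (Suc i)) - g (s i)) + (\<Sum>i\<in>- P \<inter> {..<N}. g (s (Suc i)) - g (s i)) = (x - y, S)"
  unfolding split tel by (simp add: g_def ends)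
 have half: "(\<Sum>i\<in>G \<inter> {..<N}. g (s (Suc i)) - g (s i)) = (1/2) *\<^sub>R (x - y, S)" if "G = P \<or> G = - P" for G
 proof -
  have "2 *\<^sub>R (\<Sum>i\<in>G \<inter> {..<N}. g (s (Suc i)) - g (s i)) = (x - y, S)"
   using that eq tot by (auto simp: scaleR_2)
  then have "(1/2) *\<^sub>R (2 *\<^sub>R (\<Sum>i\<in>G \<inter> {..<N}. g (s (Suc i)) - g (s i))) = (1/2) *\<^sub>R (x - y, S)" by (rule arg_cong)
  then show ?thesis by simp
 qed
 have "(\<Sum>i\<in>P \<inter> {..<N}. d (s (Suc i)) - d (s i)) + (\<Sum>i\<in>- P \<inter> {..<N}. d (s (Suc i)) - d (s i)) = c"
  unfolding split tel by (simp add: ends)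
 then have "2 * (\<Sum>i\<in>P \<inter> {..<N}. d (s (Suc i)) - d (s i)) <= c \<or>
   2 * (\<Sum>i\<in>- P \<inter> {..<N}. d (s (Suc i)) - d (s i)) <= c" by linarith
 then obtain G where G: "G = P \<or> G = - P" "2 * (\<Sum>i\<in>G \<inter> {..<N}. d (s (Suc i)) - d (s i)) <= c" by blast
 have fs: "fst (\<Sum>i\<in>A. g (s (Suc i)) - g (s i)) = (\<Sum>i\<in>A. X (s (Suc i)) - X (s i))"
  "snd (\<Sum>i\<in>A. g (s (Suc i)) - g (s i)) = (\<Sum>i\<in>A. u (s (Suc i)) - u (s i))" for A
  by (simp_all add: fst_sum snd_sum g_def)
 have hX: "(\<Sum>i\<in>G \<inter> {..<N}. X (s (Suc i)) - X (s i)) = (1/2) *\<^sub>R (x - y)"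
  and ht: "(\<Sum>i\<in>G \<inter> {..<N}. u (s (Suc i)) - u (s i)) = S / 2"
  unfolding fs[symmetric] half[OF G(1)] by simp_all
 have "\<exists>y x. trav \<Omega> H R (\<Sum>i\<in>G \<inter> {..<N}. u (s (Suc i)) - u (s i)) y x
   ((\<Sum>i\<in>G \<inter> {..<N}. d (s (Suc i)) - d (s i)) + real N * join_cost R) \<and>
  norm ((x - y) - (\<Sum>i\<in>G \<inter> {..<N}. X (s (Suc i)) - X (s i))) <= real N * (2 * real CARD('n))"
  by (rule trav_pieces[OF R]) (rule piece)
 then obtain y' x' where "trav \<Omega> H R (S / 2) y' x' ((\<Sum>i\<in>G \<inter> {..<N}. d (s (Suc i)) - d (s i)) + k * join_cost R)"
  "norm ((x' - y') - (1/2) *\<^sub>R (x - y)) <= k * (2 * real CARD('n))"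
  unfolding hX ht N by (elim exE conjE)
 then show ?thesis using G(2)
  by (intro exI[of _ y'] exI[of _ x'] exI[of _ "(\<Sum>i\<in>G \<inter> {..<N}. d (s (Suc i)) - d (s i)) + k * join_cost R"]) simp
qed

text \<open>Penalizing missed displacement and time makes the least cost a Lipschitz function of all
  (X, T), realized exactly by a travel or not. Joining gives almost subadditivity and
  \<open>trav_halve\<close> the converse under doubling, so \<open>almost_linear\<close> yields a
  slope that is sharp at (X, T) and valid for every travel.\<close>

lemma displacement_cost_dual:
 assumes R: "0 <= R" and a: "0 <= a" and K: "0 <= K"
 shows "\<exists>C\<ge>0. \<forall>X T. \<exists>p h.
  (\<exists>S y x c. trav \<Omega> H R S y x c \<and> c + a * norm (x - y - X) + K * \<bar>S - T\<bar> <= p \<bullet> X - h * T + C) \<and>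
  (\<forall>S y x c. trav \<Omega> H R S y x c --> p \<bullet> (x - y) - h * S <= c + C)"
proof -
 define k where "k = real (DIM(real ^ 'n) + 2)"
 let ?n = "2 * real CARD('n)"
 define A where "A q = {c + a * norm (x - y - fst q) + K * \<bar>S - snd q\<bar> | S y x c. trav \<Omega> H R S y x c}" for q
 define m where "m q = Inf (A q)" for q
 define C where "C = 2 * (k * join_cost R) + 2 * a * (k * ?n)"
 have J: "0 <= join_cost R" unfolding join_cost_def using R conn_const(1) by simp
 have k: "1 <= k" by (simp add: k_def)
 have bdd: "bdd_below (A q)" for q
  unfolding A_def using trav_cost_nonneg R a K by (intro bdd_belowI[of _ 0]) (auto intro!: add_nonneg_nonneg mult_nonneg_nonneg)
 have ne: "A q \<noteq> {}" for q unfolding A_def using trav_nil[OF corner_perforated[of 0]] by blast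
 have le: "m (X, T) <= c + a * norm (x - y - X) + K * \<bar>S - T\<bar>" if "trav \<Omega> H R S y x c" for S y x c X T
  unfolding m_def by (rule cInf_lower[OF _ bdd]) (use that in \<open>auto simp: A_def\<close>)
 have app: "\<exists>S y x c. trav \<Omega> H R S y x c \<and> c + a * norm (x - y - X) + K * \<bar>S - T\<bar> < m (X, T) + e" if "0 < e" for X T e
 proof -
  have "Inf (A (X, T)) < m (X, T) + e" using that by (simp add: m_def)
  from cInf_lessD[OF ne this] show ?thesis unfolding A_def by auto
 qed
 have lip1: "m q <= m q' + (a + K) * norm (q - q')" for q q'
 proof (rule field_le_epsilon)
  fix e :: real assume "0 < e"
  obtain X T X' T' where q: "q = (X, T)" "q' = (X', T')" by (cases q, cases q')
  obtain S y x c where t: "trav \<Omega> H R S y x c" "c + a * norm (x - y - X') + K * \<bar>S - T'\<bar> < m (X', T') + e"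
   using app[OF \<open>0 < e\<close>] by blast
  have "norm (x - y - X) <= norm (x - y - X') + norm (X - X')"
   using norm_triangle_ineq4[of "x - y - X'" "X - X'"] by (simp add: algebra_simps)
  also have "norm (X - X') <= norm (q - q')" using norm_fst_le[of "X - X'" "T - T'"] by (simp add: q)
  finally have 1: "a * norm (x - y - X) <= a * norm (x - y - X') + a * norm (q - q')"
   using a by (simp add: mult_left_mono flip: distrib_left)
  have "\<bar>S - T\<bar> <= \<bar>S - T'\<bar> + \<bar>T - T'\<bar>" by linarith
  also have "\<bar>T - T'\<bar> <= norm (q - q')" using norm_snd_le[of "T - T'" "X - X'"] by (simp add: q)
  finally have 2: "K * \<bar>S - T\<bar> <= K * \<bar>S - T'\<bar> + K * norm (q - q')"
   using K by (simp add: mult_left_mono flip: distrib_left)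
  show "m q <= m q' + (a + K) * norm (q - q') + e"
   using le[OF t(1), of X T] t(2) 1 2 unfolding q[symmetric] distrib_right by linarith
 qed
 have lip: "\<bar>m q - m q'\<bar> <= (a + K) * norm (q - q')" for q q'
  using lip1[of q q'] lip1[of q' q] by (simp add: norm_minus_commute abs_le_iff)
 have kj: "join_cost R <= 2 * (k * join_cost R)" "a * ?n <= 2 * a * (k * ?n)"
 proof -
  have "1 * join_cost R <= (2 * k) * join_cost R" using J k by (intro mult_right_mono) auto
  then show "join_cost R <= 2 * (k * join_cost R)" by simp
  have "1 * (a * ?n) <= (2 * k) * (a * ?n)" using a k by (intro mult_right_mono) auto
  then show "a * ?n <= 2 * a * (k * ?n)" by (simp add: algebra_simps)
 qed
 have sub: "m (q + q') <= m q + m q' + C" for q q'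
 proof (rule field_le_epsilon)
  fix e :: real assume "0 < e"
  then have e: "0 < e / 2" by simp
  obtain X T X' T' where q: "q = (X, T)" "q' = (X', T')" by (cases q, cases q')
  obtain S y x c where t: "trav \<Omega> H R S y x c" "c + a * norm (x - y - X) + K * \<bar>S - T\<bar> < m (X, T) + e / 2"
   using app[OF e] by blast
  obtain S' y' x' c' where t': "trav \<Omega> H R S' y' x' c'" "c' + a * norm (x' - y' - X') + K * \<bar>S' - T'\<bar> < m (X', T') + e / 2"
   using app[OF e] by blast
  obtain w where w: "trav \<Omega> H R (S + S') w x' (c + c' + join_cost R)" "norm ((x' - w) - ((x - y) + (x' - y'))) <= ?n"
   using trav_join[OF R t(1) t'(1)] by blast
  have "norm (x' - w - (X + X')) <= norm ((x' - w) - ((x - y) + (x' - y'))) + (norm (x - y - X) + norm (x' - y' - X'))"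
   by (rule order_trans[OF _ order_trans[OF norm_triangle_ineq add_left_mono[OF norm_triangle_ineq]]]) (simp add: algebra_simps)
  then have "norm (x' - w - (X + X')) <= ?n + (norm (x - y - X) + norm (x' - y' - X'))" using w(2) by linarith
  from mult_left_mono[OF this a]
  have 1: "a * norm (x' - w - (X + X')) <= a * ?n + (a * norm (x - y - X) + a * norm (x' - y' - X'))" by (simp only: distrib_left)
  have "\<bar>S + S' - (T + T')\<bar> <= \<bar>S - T\<bar> + \<bar>S' - T'\<bar>" by linarith
  from mult_left_mono[OF this K] have 2: "K * \<bar>S + S' - (T + T')\<bar> <= K * \<bar>S - T\<bar> + K * \<bar>S' - T'\<bar>" by (simp only: distrib_left)
  have "m (X + X', T + T') <= (c + c' + join_cost R) + a * norm (x' - w - (X + X')) + K * \<bar>S + S' - (T + T')\<bar>" by (rule le[OF w(1)])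
  then show "m (q + q') <= m q + m q' + C + e" using 1 2 t(2) t'(2) kj unfolding q C_def by simp
 qed
 have half: "2 * m q <= m (2 *\<^sub>R q) + C" for q
 proof (rule field_le_epsilon)
  fix e :: real assume "0 < e"
  obtain X T where q: "q = (X, T)" by (cases q)
  obtain S y x c where t: "trav \<Omega> H R S y x c" "c + a * norm (x - y - 2 *\<^sub>R X) + K * \<bar>S - 2 * T\<bar> < m (2 *\<^sub>R X, 2 * T) + e"
   using app[OF \<open>0 < e\<close>] by blast
  obtain y' x' c' where t': "trav \<Omega> H R (S / 2) y' x' c'" "2 * c' <= c + 2 * (k * join_cost R)"
   "norm ((x' - y') - (1/2) *\<^sub>R (x - y)) <= k * ?n"
   using trav_halve[OF R t(1)] unfolding k_def by blast
  have "norm (x' - y' - X) <= norm ((x' - y') - (1/2) *\<^sub>R (x - y)) + norm ((1/2) *\<^sub>R (x - y - 2 *\<^sub>R X))"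
   by (rule order_trans[OF _ norm_triangle_ineq]) (simp add: algebra_simps)
  then have "2 * norm (x' - y' - X) <= 2 * (k * ?n) + norm (x - y - 2 *\<^sub>R X)" using t'(3) by simp
  from mult_left_mono[OF this a]
  have 1: "a * (2 * norm (x' - y' - X)) <= a * (2 * (k * ?n)) + a * norm (x - y - 2 *\<^sub>R X)" by (simp only: distrib_left)
  have "\<bar>S - 2 * T\<bar> = \<bar>2 * (S / 2 - T)\<bar>" by simp
  then have "2 * \<bar>S / 2 - T\<bar> = \<bar>S - 2 * T\<bar>" by (simp only: abs_mult abs_numeral)
  then have 2: "2 * (K * \<bar>S / 2 - T\<bar>) = K * \<bar>S - 2 * T\<bar>" by (metis mult.left_commute)
  have "m (X, T) <= c' + a * norm (x' - y' - X) + K * \<bar>S / 2 - T\<bar>" by (rule le[OF t'(1)])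
  then have "2 * m (X, T) <= 2 * c' + a * (2 * norm (x' - y' - X)) + K * \<bar>S - 2 * T\<bar>" using 2 by linarith
  moreover have "a * (2 * (k * ?n)) = 2 * a * (k * ?n)" by simp
  ultimately show "2 * m q <= m (2 *\<^sub>R q) + C + e"
   using 1 t(2) t'(2) unfolding q C_def scaleR_Pair real_scaleR_def by linarith
 qed
 have C0: "0 <= C" unfolding C_def using J a k by simp
 show ?thesis
 proof (rule exI[of _ "C + 1"], intro conjI allI)
  show "0 <= C + 1" using C0 by simp
  fix X :: "real^'n" and T :: real
  obtain b where b: "m (X, T) - C <= b \<bullet> (X, T)" "\<And>q. b \<bullet> q <= m q + C"
   using almost_linear[OF lip sub half, of "(X, T)"] by blast
  obtain S y x c where t: "trav \<Omega> H R S y x c" "c + a * norm (x - y - X) + K * \<bar>S - T\<bar> < m (X, T) + 1"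
   using app[OF zero_less_one] by blast
  have e: "b \<bullet> (X', T') = fst b \<bullet> X' - - snd b * T'" for X' T' by (simp add: inner_prod_def)
  show "\<exists>p h. (\<exists>S y x c. trav \<Omega> H R S y x c \<and> c + a * norm (x - y - X) + K * \<bar>S - T\<bar> <= p \<bullet> X - h * T + (C + 1)) \<and>
   (\<forall>S y x c. trav \<Omega> H R S y x c --> p \<bullet> (x - y) - h * S <= c + (C + 1))"
  proof (rule exI[of _ "fst b"], rule exI[of _ "- snd b"], intro conjI allI impI)
   show "\<exists>S y x c. trav \<Omega> H R S y x c \<and> c + a * norm (x - y - X) + K * \<bar>S - T\<bar> <= fst b \<bullet> X - - snd b * T + (C + 1)"
    using t b(1) unfolding e by (intro exI[of _ S] exI[of _ y] exI[of _ x] exI[of _ c]) linarith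
   show "fst b \<bullet> (x - y) - - snd b * S <= c + (C + 1)" if "trav \<Omega> H R S y x c" for S y x c
    using b(2)[of "(x - y, S)"] le[OF that, of "x - y" S] unfolding e by simp
  qed
 qed
qed

text \<open>The dual slope \<open>(p, h)\<close> may lie beyond the range of momenta for which effective costs are
 controlled; moving only slightly from \<open>p1\<close> towards \<open>p\<close> suffices for the subgradient inequality.\<close>

lemma effective_legendre:
 assumes r: "0 <= r" and R: "r + 1 <= R" and B: "0 <= B"
  and E: "\<And>p. norm p <= r + 1 ==>
   (\<forall>T y x c. trav \<Omega> H R T y x c --> p \<bullet> (x - y) - Hbar p * T - B <= c) \<and>
   (\<forall>x\<in>\<Omega>. \<forall>T\<ge>0. \<exists>y c. trav \<Omega> H R T y x c \<and> c <= p \<bullet> (x - y) - Hbar p * T + B)"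
  and dual: "\<And>S y x c. trav \<Omega> H R S y x c ==> p \<bullet> (x - y) - h * S <= c + C"
  and p1: "norm p1 <= r" and V: "\<And>q. Hbar p1 + V \<bullet> (q - p1) <= Hbar q"
 shows "p \<bullet> V - h <= p1 \<bullet> V - Hbar p1"
proof -
 obtain Q where "0 < Q" "\<forall>(a, b)\<in>set [(1, 1), (norm (p - p1), 1)]. a * Q <= b"
   using small_scale[of "[(1, 1), (norm (p - p1), 1)]"] by auto
 then have Q: "0 < Q" "Q <= 1" "Q * norm (p - p1) <= 1" by (auto simp: mult.commute)
 define q where "q = p1 + Q *\<^sub>R (p - p1)"
 have "norm q <= norm p1 + norm (Q *\<^sub>R (p - p1))" unfolding q_def by (rule norm_triangle_ineq)
 then have q: "norm q <= r + 1" using Q p1 by simp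
 have "Hbar q <= (1 - Q) * Hbar p1 + Q * h"
 proof (rule le_of_linear_bound)
  fix T :: real assume T: "0 < T"
  obtain y c where yc: "trav \<Omega> H R T y (corner 0) c" "c <= q \<bullet> (corner 0 - y) - Hbar q * T + B"
   using E[OF q] corner_perforated[of 0] T by (meson less_imp_le)
  have 1: "p1 \<bullet> (corner 0 - y) - Hbar p1 * T - B <= c" using E[of p1] p1 yc(1) by simp
  have 2: "p \<bullet> (corner 0 - y) - h * T - C <= c" using dual[OF yc(1)] by simp
  have "(1 - Q) * (p1 \<bullet> (corner 0 - y) - Hbar p1 * T - B) + Q * (p \<bullet> (corner 0 - y) - h * T - C) <= (1 - Q) * c + Q * c"
   using Q 1 2 by (intro add_mono mult_left_mono) auto
  also have "\<dots> = c" by (simp add: algebra_simps)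
  also have "(1 - Q) * (p1 \<bullet> (corner 0 - y) - Hbar p1 * T - B) + Q * (p \<bullet> (corner 0 - y) - h * T - C)
    = q \<bullet> (corner 0 - y) - ((1 - Q) * Hbar p1 + Q * h) * T - ((1 - Q) * B + Q * C)"
   by (simp add: q_def inner_add_left inner_diff_left algebra_simps)
  finally show "Hbar q * T <= ((1 - Q) * Hbar p1 + Q * h) * T + (B + ((1 - Q) * B + Q * C))" using yc(2) by linarith
 qed
 moreover have "Hbar p1 + V \<bullet> (Q *\<^sub>R (p - p1)) <= Hbar q" using V[of q] by (simp add: q_def)
 ultimately have "Q * (V \<bullet> (p - p1)) <= Q * (h - Hbar p1)" by (simp add: algebra_simps)
 then show ?thesis using Q(1) by (simp add: inner_diff_right inner_commute)
qed

end

section \<open>Comparison at unit scale\<close>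

context periodic_hamiltonian
begin

lemma state_constraint_evolution:
 assumes ham: "hamiltonian F" and U: "regular_domain U" "U \<noteq> {}" and sol: "state_constraint_solution F U g z"
  and g: "\<And>x y. \<bar>g x - g y\<bar> <= L * norm (x - y)" and L: "0 <= L"
  and M: "\<And>w p. norm p <= L ==> F w p <= M" and thr: "\<And>y p. R <= norm p ==> M < F y p"
 obtains K where "evolution F U z 0 K K M R" "HJ_sub F U z"
  "HJ_super F (closure U) z"
  "uniformly_continuous_on (closure U) (\<lambda>x. z (x, 0))" "\<And>x. x \<in> closure U ==> z (x, 0) = g x"
  "K-lipschitz_on (closure U \<times> {0..}) z"
proof -
 obtain K where K: "K-lipschitz_on (closure U \<times> {0..}) z"
  and sub: "HJ_sub F U z"
  and sup: "HJ_super F (closure U) z"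
  and ini: "\<forall>x\<in>closure U. z (x, 0) = g x"
  using sol unfolding state_constraint_solution_def by (elim exE conjE)
 have init: "\<bar>z (x, 0) - z (y, 0)\<bar> <= L * norm (x - y)" if "x \<in> closure U" "y \<in> closure U" for x y
  using ini that g by simp
 have ev: "evolution F U z 0 K K M R"
  by (rule hamiltonian.evolution_lipschitz[OF ham U K sub sup _ L]) (fact init M thr)+
 have "uniformly_continuous_on (closure U) (\<lambda>x. z (x, 0))"
 proof (rule lipschitz_on_uniformly_continuous)
  show "L-lipschitz_on (closure U) (\<lambda>x. z (x, 0))" by (rule lipschitz_onI) (use init L in \<open>auto simp: dist_norm\<close>)
 qed
 with that[OF ev sub sup] ini K show thesis by blast
qed

abbreviation "rate_bounds L C == \<forall>g z u. (\<forall>x y. \<bar>g x - g y\<bar> <= L * norm (x - y)) --> state_constraint_solution H \<Omega> g z -->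
  state_constraint_solution (\<lambda>x p. Hbar p) UNIV g u -->
  (\<forall>x\<in>\<Omega>. \<forall>t\<ge>0. \<bar>z (x, t) - u (x, t)\<bar> <= C) \<and>
  (\<forall>x y. \<forall>t\<ge>0. \<bar>u (x, t) - u (y, t)\<bar> <= C * norm (x - y))"

text \<open>An almost optimal travel for z obeys the Fenchel inequality and so bounds u. Conversely,
  the dual slope bounds the cost of a descent of u from below by its total displacement and
  duration, and a travel almost realizing the displacement cost competes for z. The penalty weights
  \<open>L\<close> and \<open>M\<close> pay for the mismatch in the initial value and in
  time.\<close>

theorem homogenization_rate:
 assumes L: "0 <= L"
 shows "\<exists>C\<ge>0. rate_bounds L C"
proof -
 interpret Hb: hamiltonian "\<lambda>_::real^'n. Hbar" by (rule hamiltonian_effective)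
 obtain Ma where Ma: "\<forall>y p. norm p <= L --> H y p <= Ma" using locally_bounded by blast
 obtain Mb where Mb: "\<forall>(y::real^'n) p. norm p <= L --> Hbar p <= Mb" using Hb.locally_bounded by blast
 define M where "M = max Ma Mb"
 have M: "H y p <= M" "Hbar p <= M" if "norm p <= L" for y p using Ma Mb that by (auto simp: M_def le_max_iff_disj)
 have M0: "0 <= M" using M(1)[of 0] L by (simp add: zero)
 obtain R2 where R2: "\<forall>y p. R2 <= norm p --> M < H y p" using coercive by blast
 obtain Ru0 where Ru0: "\<forall>(y::real^'n) p. Ru0 <= norm p --> M < Hbar p" using Hb.coercive by blast
 define Ru where "Ru = max 0 Ru0"
 have Ru: "0 <= Ru" "\<And>p. Ru <= norm p ==> M < Hbar p" using Ru0 by (auto simp: Ru_def)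
 \<comment> \<open>\<open>effective_legendre\<close> needs one unit of momenta beyond the threshold
   of the effective Hamiltonian; \<open>R2\<close> makes the resulting \<open>R\<close> a threshold
   for \<open>H\<close> as well.\<close>
 define r where "r = max (Ru + 1) R2"
 have r: "0 <= r" "Ru + 1 <= r" "R2 <= r" using Ru by (auto simp: r_def)
 from effective_cost_exists[OF r(1)] obtain R M1 B where RB: "r <= R" "0 <= B" and
  E: "effective_cost_bounds r R M1 B"
  by (elim exE conjE) (rule that)
 have R: "0 <= R" "Ru + 1 <= R" using RB r by auto
 have thr: "M < H y p" if "R <= norm p" for y p using R2 RB r that by auto
 obtain M3 where M3: "\<And>(y::real^'n) p. norm p <= Ru + 1 ==> Hbar p <= M3" using Hb.locally_bounded by blast
 obtain C1 where C1: "0 <= C1" and dual: "\<forall>X T. \<exists>p h.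
  (\<exists>S y x c. trav \<Omega> H R S y x c \<and> c + L * norm (x - y - X) + M * \<bar>S - T\<bar> <= p \<bullet> X - h * T + C1) \<and>
  (\<forall>S y x c. trav \<Omega> H R S y x c --> p \<bullet> (x - y) - h * S <= c + C1)"
  using displacement_cost_dual[OF R(1) L M0] by (elim exE conjE)
 let ?n = "2 * real CARD('n)"
 have J: "0 <= join_cost R" unfolding join_cost_def using R conn_const(1) by simp
 define C where "C = 1 + B + C1 + L * (?n + 1) + join_cost R + Ru"
 have Cp: "0 <= C" "B + 1 <= C" "1 + C1 + L * (?n + 1) + join_cost R <= C" "Ru <= C"
  using RB C1 L J Ru by (auto simp: C_def)
 have main: "(\<forall>x\<in>\<Omega>. \<forall>t\<ge>0. \<bar>z (x, t) - u (x, t)\<bar> <= C) \<and> (\<forall>x y. \<forall>t\<ge>0. \<bar>u (x, t) - u (y, t)\<bar> <= C * norm (x - y))"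
  if g: "\<forall>x y. \<bar>g x - g y\<bar> <= L * norm (x - y)" and solz: "state_constraint_solution H \<Omega> g z"
   and solu: "state_constraint_solution (\<lambda>x p. Hbar p) UNIV g u" for g z u
 proof (intro conjI ballI allI impI)
  obtain K where z: "evolution H \<Omega> z 0 K K M R"
   "HJ_sub H \<Omega> z"
   "HJ_super H (closure \<Omega>) z"
   "uniformly_continuous_on (closure \<Omega>) (\<lambda>x. z (x, 0))" "\<And>x. x \<in> closure \<Omega> ==> z (x, 0) = g x"
   by (rule state_constraint_evolution[OF hamiltonian_axioms regular_perforated perforated_nonempty solz g[rule_format] L M(1) thr], assumption+) (rule that)
  obtain Ku where u: "evolution (\<lambda>_. Hbar) UNIV u 0 Ku Ku M Ru"
   "visc_subsolution (\<lambda>(x, t) (p, s). s + Hbar p) (UNIV \<times> {0<..}) u"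
   "visc_supersolution (\<lambda>(x, t) (p, s). s + Hbar p) (closure UNIV \<times> {0<..}) u"
   "\<And>x. x \<in> closure UNIV ==> u (x, 0) = g x"
   by (rule state_constraint_evolution[OF hamiltonian_effective regular_domain_UNIV _ solu g[rule_format] L M(2) Ru(2)], simp, assumption+) (rule that)
  fix t :: real assume t: "0 <= t"
  { fix x y :: "real^'n"
   have le: "u (x, t) <= u (y, t) + Ru * norm (x - y)" for x y
    using evolution.subsolution_trav[OF u(1,2) Hb.trav_jump[OF subset_UNIV Ru(1)] t, of x y] by simp
   have "Ru * norm (x - y) <= C * norm (x - y)" using Cp by (intro mult_right_mono) auto
   then show "\<bar>u (x, t) - u (y, t)\<bar> <= C * norm (x - y)" using le[of x y] le[of y x] by (simp add: abs_le_iff norm_minus_commute) }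
  fix x assume x: "x \<in> \<Omega>"
  have xc: "x \<in> closure \<Omega>" using x closure_subset by blast
  show "\<bar>z (x, t) - u (x, t)\<bar> <= C"
  proof (cases "t = 0")
   case True
   then show ?thesis using z(5)[OF xc] u(4)[of x] Cp by simp
  next
   case False
   then have t0: "0 < t" using t by simp
   have "u (x, t) <= z (x, t) + C"
   proof -
    obtain y c where y: "trav \<Omega> H R t y x c" "z (y, 0) + c <= z (x, t) + 1"
     using evolution.supersolution_trav[OF z(1,3) regular_perforated z(4) x t0 zero_less_one] by blast
    have yc: "y \<in> closure \<Omega>" using trav_in[OF y(1)] closure_subset by blast
    \<comment> \<open>The effective Hamiltonian does not depend on position, so one straight segment
      with the displacement and duration of the travel suffices.\<close>
    have "ell (\<lambda>_. Hbar) Ru w (x - y) t <= c + B" for w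
    proof (rule Hb.ell_le[OF Ru(1)])
     fix p :: "real^'n" assume "norm p <= Ru"
     then have "norm p <= r" using r by simp
     then have "p \<bullet> (x - y) - Hbar p * t - B <= c" using E y(1) by blast
     then show "p \<bullet> (x - y) - t * Hbar p <= c + B" by (simp add: mult.commute)
    qed
    then have "trav UNIV (\<lambda>_. Hbar) Ru t y x (c + B)" by (intro trav_single t) auto
    from evolution.subsolution_trav[OF u(1,2) this order_refl] have "u (x, t) <= g y + (c + B)" using u(4) by simp
    then show ?thesis using y(2) z(5)[OF yc] Cp(2) by linarith
   qed
   moreover have "z (x, t) <= u (x, t) + C"
   proof -
    from evolution.supersolution_raw[OF u(1,3) _ t0 zero_less_one zero_less_one M3, of x]
    obtain T N0 where T: "0 < T" "T <= t" and
     desc: "\<forall>N\<ge>N0. 0 < N --> descent (\<lambda>_. Hbar) UNIV Ru M3 1 (\<lambda>y. u (y, 0)) x T N (u (x, t) + 1)" by auto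
    define N where "N = Suc N0"
    have "descent (\<lambda>_. Hbar) UNIV Ru M3 1 (\<lambda>y. u (y, 0)) x T N (u (x, t) + 1)" using desc by (simp add: N_def)
    then obtain X Y p V where X0: "X 0 = x" and XS: "\<forall>i<N. X (Suc i) = X i - (T / real N) *\<^sub>R V i"
     and XY: "\<forall>i\<le>N. Y i \<in> closure UNIV \<and> norm (X i - Y i) <= 1"
     and pV: "\<forall>i<N. norm (p i) <= Ru \<and> norm (V i) <= M3 \<and> (\<forall>q. Hbar (p i) + V i \<bullet> (q - p i) <= Hbar q)"
     and val: "u (Y N, 0) + (\<Sum>i<N. T / real N * (p i \<bullet> V i - Hbar (p i))) <= u (x, t) + 1"
     unfolding descent_def by (elim exE conjE)
    have tel: "k <= N ==> (\<Sum>i<k. (T / real N) *\<^sub>R V i) = x - X k" for k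
    proof (induction k)
     case (Suc k)
     then have "X (Suc k) = X k - (T / real N) *\<^sub>R V k" using XS by simp
     then show ?case using Suc by simp
    qed (simp add: X0)
    \<comment> \<open>One slope serves all steps of the descent, because only its total displacement
      and duration enter; \<open>effective_legendre\<close> compares that slope with each
      step.\<close>
    from dual[THEN spec, of "x - X N", THEN spec, of T] obtain q h S y' x' c where
     tr: "trav \<Omega> H R S y' x' c" and c: "c + L * norm (x' - y' - (x - X N)) + M * \<bar>S - T\<bar> <= q \<bullet> (x - X N) - h * T + C1"
     and du: "\<forall>S y x c. trav \<Omega> H R S y x c --> q \<bullet> (x - y) - h * S <= c + C1" by (elim exE conjE)
    have "q \<bullet> V i - h <= p i \<bullet> V i - Hbar (p i)" if "i < N" for i
    proof (rule effective_legendre[OF Ru(1) R(2) RB(2)])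
     fix p :: "real^'n" assume "norm p <= Ru + 1"
     then have "norm p <= r" using r by simp
     with E show "(\<forall>T y x c. trav \<Omega> H R T y x c --> p \<bullet> (x - y) - Hbar p * T - B <= c) \<and>
      (\<forall>x\<in>\<Omega>. \<forall>T\<ge>0. \<exists>y c. trav \<Omega> H R T y x c \<and> c <= p \<bullet> (x - y) - Hbar p * T + B)" by simp
    next
     show "q \<bullet> (x - y) - h * S <= c + C1" if "trav \<Omega> H R S y x c" for S y x c using du that by blast
     show "norm (p i) <= Ru" "\<And>q. Hbar (p i) + V i \<bullet> (q - p i) <= Hbar q" using pV \<open>i < N\<close> by auto
    qed
    then have "(\<Sum>i<N. T / real N * (q \<bullet> V i - h)) <= (\<Sum>i<N. T / real N * (p i \<bullet> V i - Hbar (p i)))"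
     using T by (intro sum_mono mult_left_mono) auto
    moreover have "(\<Sum>i<N. T / real N * (q \<bullet> V i - h)) = q \<bullet> (x - X N) - h * T"
    proof -
     have "(\<Sum>i<N. T / real N * (q \<bullet> V i - h)) = q \<bullet> (\<Sum>i<N. (T / real N) *\<^sub>R V i) - real N * (T / real N * h)"
      by (simp add: inner_sum_right right_diff_distrib sum_subtractf)
     also have "real N * (T / real N * h) = h * T" by (simp add: N_def)
     finally show ?thesis unfolding tel[OF order_refl] .
    qed
    ultimately have c': "c + L * norm (x' - y' - (x - X N)) + M * \<bar>S - T\<bar> + u (Y N, 0) <= u (x, t) + 1 + C1"
     using c val by linarith
    obtain m where m: "trav \<Omega> H R S (y' + m) x (c + join_cost R)" "norm (x' + m - x) <= ?n"
     using trav_relocate[OF R(1) tr x] by blast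
    have S: "0 <= S" "y' + m \<in> closure \<Omega>" using trav_in[OF m(1)] closure_subset by auto
    have 1: "z (x, S) <= g (y' + m) + (c + join_cost R)"
     using evolution.subsolution_trav[OF z(1,2) m(1) order_refl] z(5)[OF S(2)] by simp
    have mono: "z (x, b) <= z (x, a)" if "0 <= a" "a <= b" for a b
     using evolution.subsolution_trav[OF z(1,2) trav_wait[OF x R(1), of "b - a"] that(1)] that by simp
    have 2: "z (x, t) <= z (x, T)" by (rule mono) (use T in auto)
    have 3: "z (x, T) <= z (x, S) + M * \<bar>S - T\<bar>"
    proof (cases "T <= S")
     case True
     then show ?thesis using evolution.time_low[OF z(1) xc, of T "S - T"] T by simp
    next
     case False
     then have "z (x, T) <= z (x, S)" using mono[OF S(1)] by simp
     moreover have "0 <= M * \<bar>S - T\<bar>" using M0 by simp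
     ultimately show ?thesis by linarith
    qed
    have tri: "norm (a - b + e) <= norm a + norm b + norm e" for a b e :: "real^'n"
     by (rule order_trans[OF norm_triangle_ineq add_right_mono[OF norm_triangle_ineq4]])
    have "y' + m - Y N = (x' + m - x) - (x' - y' - (x - X N)) + (X N - Y N)" by (simp add: algebra_simps)
    then have "norm (y' + m - Y N) <= norm (x' + m - x) + norm (x' - y' - (x - X N)) + norm (X N - Y N)"
     by (simp only: tri)
    also have "\<dots> <= ?n + norm (x' - y' - (x - X N)) + 1" using m(2) XY by (intro add_mono) auto
    finally have "L * norm (y' + m - Y N) <= L * (?n + norm (x' - y' - (x - X N)) + 1)" using L by (rule mult_left_mono)
    then have "L * norm (y' + m - Y N) <= L * (?n + 1) + L * norm (x' - y' - (x - X N))" by (simp add: algebra_simps)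
    moreover have "g (y' + m) <= g (Y N) + L * norm (y' + m - Y N)" using g by (simp add: abs_le_iff algebra_simps)
    moreover have "u (Y N, 0) = g (Y N)" using u(4) by simp
    ultimately show ?thesis using 1 2 3 c' Cp(3) by linarith
   qed
   ultimately show ?thesis by (simp add: abs_le_iff)
  qed
 qed
 show ?thesis
  by (rule exI[of _ C], intro conjI Cp(1) allI impI) (use main in blast)+
qed

text \<open>Everything between the first entry into the hole and the last exit is replaced by a
  single detour, so the price is per hole and not per visit. The remaining time is spent
  waiting.\<close>

lemma trav_fill_hole:
 assumes R: "0 <= R" and m: "m \<in> int_lattice" "m \<notin> F"
  and tr: "trav (perforated D (insert m F)) H R T y x c" and yx: "y \<in> perforated D F" "x \<in> perforated D F"
 shows "\<exists>c'\<le>c + R * (conn_const * (2 * real CARD('n) + 3)). trav (perforated D F) H R T y x c'"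
proof -
 let ?U = "perforated D F" and ?c = "conn_const * (2 * real CARD('n) + 3)"
 obtain X :: "real => real ^ 'n" and u f :: "real => real" and L where
  lip: "L-lipschitz_on {0..1} (\<lambda>s. (X s, u s, f s))"
  and ends: "X 0 = y" "u 0 = 0" "f 0 = 0" "X 1 = x" "u 1 = T" "f 1 = c"
  and sub: "\<And>a b. 0 <= a ==> a <= b ==> b <= 1 ==> trav (X ` {a..b}) H R (u b - u a) (X a) (X b) (f b - f a)"
  and XU: "X ` {0..1} \<subseteq> perforated D (insert m F)"
  by (rule trav_curve_unit[OF tr R], rule that) assumption+
 have cont: "continuous_on {0..1} X"
  using continuous_on_fst[OF lipschitz_on_continuous_on[OF lip]] by simp
 have off: "X s \<in> ?U" if "s \<in> {0..1}" "X s - m \<notin> closure D" for s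
  unfolding in_perforated
 proof
  fix k assume k: "k \<in> int_lattice - F"
  have "X s \<in> perforated D (insert m F)" using XU that by blast
  then show "X s - k \<notin> closure D" using k that unfolding in_perforated by (cases "k = m") auto
 qed
 have on: "X s - m \<notin> closure D" if "X s \<in> ?U" for s using that m unfolding in_perforated by blast
 have cp: "0 <= R * ?c" using R conn_const(1) by simp
 define S where "S = {s \<in> {0..1}. X s - m \<in> closure D}"
 show ?thesis
 proof (cases "S = {}")
  case True
  then have "X ` {0..1} \<subseteq> ?U" using off by (auto simp: S_def)
  with sub[of 0 1] ends have "trav ?U H R T y x c" using trav_mono_set by fastforce
  then show ?thesis using cp by (intro exI[of _ c]) simp
 next
  case False
  have "S = {0..1} \<inter> (\<lambda>s. X s - m) -` closure D" by (auto simp: S_def)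
  moreover have "closed \<dots>" by (intro continuous_closed_preimage continuous_intros cont) auto
  ultimately have cS: "compact S" using bounded_subset[of "{0..1}" S] by (auto simp: compact_eq_bounded_closed)
  obtain s1 where s1: "s1 \<in> S" "\<forall>s\<in>S. s1 <= s" using compact_attains_inf[OF cS False] by blast
  obtain s2 where s2: "s2 \<in> S" "\<forall>s\<in>S. s <= s2" using compact_attains_sup[OF cS False] by blast
  have s12: "0 <= s1" "s1 <= s2" "s2 <= 1" "s1 \<in> {0..1}" "s2 \<in> {0..1}" using s1 s2 by (auto simp: S_def)
  have nD: "norm (X s - m) <= real CARD('n)" if "s \<in> S" for s
  proof -
   have "norm (X s - m) <= real CARD('n) * 1"
   proof (rule norm_le_card)
    fix i
    have "X s - m \<in> closure D" using that by (simp add: S_def)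
    then have "- 1/2 < (X s - m) $ i \<and> (X s - m) $ i < 1/2" using adm unfolding admissible_hole_def by blast
    then show "\<bar>(X s - m) $ i\<bar> <= 1" by linarith
   qed
   then show ?thesis by simp
  qed
  have "s1 \<noteq> 0" "s2 \<noteq> 1" using s1 s2 on yx ends by (auto simp: S_def)
  then have s12': "0 < s1" "s2 < 1" using s12 by auto
  have near: "\<exists>d>0. \<forall>s'\<in>{0..1}. \<bar>s' - s\<bar> < d --> norm (X s' - X s) < 1" if "s \<in> {0..1}" for s
   using cont[unfolded continuous_on_iff, rule_format, OF that zero_less_one] by (simp add: dist_norm)
  obtain d1 where d1: "0 < d1" "\<forall>s'\<in>{0..1}. \<bar>s' - s1\<bar> < d1 --> norm (X s' - X s1) < 1" using near[OF s12(4)] by blast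
  obtain d2 where d2: "0 < d2" "\<forall>s'\<in>{0..1}. \<bar>s' - s2\<bar> < d2 --> norm (X s' - X s2) < 1" using near[OF s12(5)] by blast
  \<comment> \<open>The detour starts slightly before the entry and ends slightly after the exit,
    since the entry and exit points lie in the closed hole. Each displacement is less than 1; with
    the additive 1 of \<open>conn_const\<close> this gives the 3.\<close>
  define a where "a = max 0 (s1 - d1 / 2)"
  define b where "b = min 1 (s2 + d2 / 2)"
  have a: "0 <= a" "a < s1" "\<bar>a - s1\<bar> < d1" using s12' d1(1) by (auto simp: a_def)
  have b: "b <= 1" "s2 < b" "\<bar>b - s2\<bar> < d2" using s12' d2(1) by (auto simp: b_def)
  have ab: "a <= b" "a <= 1" "0 <= b" using a b s12 by auto
  have inU: "X s \<in> ?U" if "s \<in> {0..1}" "s < s1 \<or> s2 < s" for s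
   by (rule off[OF that(1)]) (use that s1(2) s2(2) in \<open>force simp: S_def\<close>)
  have Xa: "X a \<in> ?U" "X b \<in> ?U" using inU a b ab by auto
  have "norm (X a - X s1) < 1" "norm (X b - X s2) < 1" using d1(2) d2(2) a b ab by auto
  moreover have e: "X a - X b = (X a - X s1) + ((X s1 - m) - (X s2 - m)) - (X b - X s2)" by simp
  have "norm (X a - X b) <= norm (X a - X s1) + (norm (X s1 - m) + norm (X s2 - m)) + norm (X b - X s2)"
   unfolding e using norm_triangle_ineq4[of "(X a - X s1) + ((X s1 - m) - (X s2 - m))" "X b - X s2"]
    norm_triangle_ineq[of "X a - X s1" "(X s1 - m) - (X s2 - m)"] norm_triangle_ineq4[of "X s1 - m" "X s2 - m"] by (simp only:)
  ultimately have nab: "norm (X a - X b) + 1 <= 2 * real CARD('n) + 3" using nD[OF s1(1)] nD[OF s2(1)] by linarith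
  obtain l where l: "l <= conn_const * (norm (X a - X b) + 1)" "conn ?U (X a) (X b) l" using conn_const(3)[OF Xa] by blast
  have "l <= ?c" using l(1) mult_left_mono[OF nab, of conn_const] conn_const(1) by linarith
  then have Rl: "R * l <= R * ?c" using R by (rule mult_left_mono)
  have "X ` {0..a} \<subseteq> ?U" "X ` {b..1} \<subseteq> ?U" using inU a b ab by auto
  then have t1: "trav ?U H R (u a) y (X a) (f a)" and t3: "trav ?U H R (T - u b) (X b) x (c - f b)"
   using trav_mono_set[OF sub[of 0 a]] trav_mono_set[OF sub[of b 1]] a b ab ends by auto
  have t2: "trav (X ` {a..b}) H R (u b - u a) (X a) (X b) (f b - f a)" by (rule sub) (use a b ab in auto)
  have "trav ?U H R (u a + 0 + (u b - u a) + (T - u b)) y x (f a + R * l + 0 + (c - f b))"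
   by (rule trav_trans[OF t3 trav_trans[OF trav_wait[OF Xa(2) R] trav_trans[OF conn_trav[OF l(2) R] t1]]]) (use trav_in[OF t2] in simp)
  then have "trav ?U H R T y x (f a + R * l + (c - f b))" by simp
  moreover have "0 <= f b - f a" by (rule trav_cost_nonneg[OF t2 R])
  then have "f a + R * l + (c - f b) <= c + R * ?c" using Rl by linarith
  ultimately show ?thesis by blast
 qed
qed

lemma trav_fill_holes:
 assumes R: "0 <= R" and F: "finite F" "F \<subseteq> int_lattice"
  and tr: "trav (perforated D F) H R T y x c" and yx: "y \<in> \<Omega>" "x \<in> \<Omega>"
 shows "\<exists>c'\<le>c + R * (conn_const * (2 * real CARD('n) + 3)) * real (card F). trav \<Omega> H R T y x c'"
 using F tr
proof (induction F arbitrary: c)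
 case (insert m F)
 let ?k = "R * (conn_const * (2 * real CARD('n) + 3))"
 have "y \<in> perforated D F" "x \<in> perforated D F" using yx perforated_mono[of "{}" F] by auto
 from trav_fill_hole[OF R _ insert.hyps(2) insert.prems(2) this] insert.prems(1)
 obtain c1 where c1: "c1 <= c + ?k" "trav (perforated D F) H R T y x c1" by auto
 from insert.IH[OF _ c1(2)] insert.prems(1) obtain c2 where c2: "c2 <= c1 + ?k * real (card F)" "trav \<Omega> H R T y x c2" by auto
 have "c2 <= c + ?k * real (card (insert m F))" using c1(1) c2(1) insert.hyps by (simp add: distrib_left)
 then show ?case using c2(2) by blast
qed auto

definition holes_within :: "(real ^ 'n) set => real => (real ^ 'n) set" where
 "holes_within I r = {m \<in> I. \<forall>i. \<bar>m $ i\<bar> <= r}"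

lemma finite_holes_within: "I \<subseteq> int_lattice ==> finite (holes_within I r)"
 unfolding holes_within_def by (rule finite_subset[OF _ finite_lattice_box[of r]]) auto

text \<open>A hole can contain a point only if its index is within 1/2 of that point in each
  coordinate. Holes with index outside the box are never entered, so the curve stays admissible when
  they are restored.\<close>

lemma trav_localize:
 assumes R: "0 <= R" and I: "I \<subseteq> int_lattice" and tr: "trav (perforated D I) H R T y x c"
  and near: "\<And>w S a b. trav (perforated D I) H R S y w a ==> trav (perforated D I) H R (T - S) w x b ==> a + b = c ==> norm w + 1 <= r"
 shows "trav (perforated D (holes_within I r)) H R T y x c"
proof -
 obtain X :: "real => real ^ 'n" and u k :: "real => real" and L where
  "L-lipschitz_on {0..1} (\<lambda>s. (X s, u s, k s))"
  and ends: "X 0 = y" "u 0 = 0" "k 0 = 0" "X 1 = x" "u 1 = T" "k 1 = c"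
  and sub: "\<And>a b. 0 <= a ==> a <= b ==> b <= 1 ==> trav (X ` {a..b}) H R (u b - u a) (X a) (X b) (k b - k a)"
  and XU: "X ` {0..1} \<subseteq> perforated D I"
  by (rule trav_curve_unit[OF tr R], rule that) assumption+
 have "X s \<in> perforated D (holes_within I r)" if s: "s \<in> {0..1}" for s
  unfolding in_perforated
 proof
  fix m assume m: "m \<in> int_lattice - holes_within I r"
  have "X ` {0..s} \<subseteq> perforated D I" "X ` {s..1} \<subseteq> perforated D I" using XU s by auto
  then have "trav (perforated D I) H R (u s) y (X s) (k s)" "trav (perforated D I) H R (T - u s) (X s) x (c - k s)"
   using trav_mono_set[OF sub[of 0 s]] trav_mono_set[OF sub[of s 1]] s ends by auto
  from near[OF this] have n: "norm (X s) + 1 <= r" by simp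
  show "X s - m \<notin> closure D"
  proof
   assume c: "X s - m \<in> closure D"
   have "\<bar>m $ i\<bar> <= r" for i
   proof -
    have "- 1/2 < (X s - m) $ i \<and> (X s - m) $ i < 1/2" using adm c unfolding admissible_hole_def by blast
    then show ?thesis using component_le_norm_cart[of "X s" i] n unfolding vector_minus_component by linarith
   qed
   then have "m \<notin> I" using m by (auto simp: holes_within_def)
   moreover have "X s \<in> perforated D I" using XU s by blast
   ultimately show False using c m unfolding in_perforated by blast
  qed
 qed
 then have "X ` {0..1} \<subseteq> perforated D (holes_within I r)" by blast
 from trav_mono_set[OF sub[of 0 1] this] ends show ?thesis by simp
qed

abbreviation "hole_cost C M I (x::real^'n) t == C * (1 + real (card (holes_within I (norm x + M * t + C))))"

abbreviation "hole_close C M I z w == (\<forall>x\<in>\<Omega>. \<forall>t\<ge>0. w (x, t) <= z (x, t) \<and> z (x, t) <= w (x, t) + hole_cost C M I x t) \<and>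
  (\<forall>x\<in>perforated D I. \<forall>t\<ge>0. \<bar>w (x, t) - w (corner x, t)\<bar> <= C \<and> norm (corner x - x) <= C)"

abbreviation "hole_bounds L C M == \<forall>I g z w. I \<subseteq> int_lattice --> (\<forall>x y. \<bar>g x - g y\<bar> <= L * norm (x - y)) -->
  state_constraint_solution H \<Omega> g z --> state_constraint_solution H (perforated D I) g w -->
  hole_close C M I z w"

text \<open>Holes only remove travels, whence w \<le> z on \<Omega>. Conversely, an almost optimal
  travel pays slope L + 1 for its length, up to M t, while the datum returns at most slope L. So it
  stays within distance M t plus a constant of x, and only the holes there need detours.\<close>

theorem hole_comparison:
 assumes L: "0 <= L"
 shows "\<exists>C M. 0 <= C \<and> 0 <= M \<and> hole_bounds L C M"
proof -
 obtain M where M: "\<And>y p. norm p <= L + 1 ==> H y p <= M" using locally_bounded by blast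
 have M0: "0 <= M" using M[of 0] L by (simp add: zero)
 have Mle: "H y p <= M" if "norm p <= L" for y p by (rule M) (use that in simp)
 obtain R where R: "L + 1 <= R" and thr: "\<And>y p. R <= norm p ==> M < H y p" by (rule coercive_above) (rule that)
 have R: "0 <= R" "L + 1 <= R" using L R by auto
 let ?c = conn_const
 define k where "k = R * (?c * (2 * real CARD('n) + 3))"
 have k: "0 <= k" unfolding k_def using R conn_const(1) by simp
 define C where "C = 2 + L * ?c + R * ?c + k + ?c"
 have c0: "0 <= L * ?c" "0 <= R * ?c" "0 < ?c" using L R conn_const(1) by auto
 have C: "0 <= C" "R * ?c <= C" "?c <= C" "2 + L * ?c + R * ?c <= C" "k <= C" using k c0 by (auto simp: C_def)
 have main: "hole_close C M I z w"
  if I: "I \<subseteq> int_lattice" and g: "\<forall>x y. \<bar>g x - g y\<bar> <= L * norm (x - y)" and solz: "state_constraint_solution H \<Omega> g z"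
   and solw: "state_constraint_solution H (perforated D I) g w" for I g z w
 proof (intro conjI ballI allI impI)
  let ?W = "perforated D I"
  have OW: "\<Omega> \<subseteq> ?W" by (rule perforated_mono) simp
  obtain K where z: "evolution H \<Omega> z 0 K K M R"
   "HJ_sub H \<Omega> z"
   "HJ_super H (closure \<Omega>) z"
   "uniformly_continuous_on (closure \<Omega>) (\<lambda>x. z (x, 0))" "\<And>x. x \<in> closure \<Omega> ==> z (x, 0) = g x"
   by (rule state_constraint_evolution[OF hamiltonian_axioms regular_perforated perforated_nonempty solz g[rule_format] L Mle thr], assumption+) (rule that)
  obtain K' where w: "evolution H ?W w 0 K' K' M R"
   "HJ_sub H ?W w"
   "HJ_super H (closure ?W) w"
   "uniformly_continuous_on (closure ?W) (\<lambda>x. w (x, 0))" "\<And>x. x \<in> closure ?W ==> w (x, 0) = g x"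
   by (rule state_constraint_evolution[OF hamiltonian_axioms regular_perforated perforated_nonempty solw g[rule_format] L Mle thr], assumption+) (rule that)
  have z0: "z (x, 0) = g x" if "x \<in> \<Omega>" for x using z(5) that closure_subset by blast
  have w0: "w (x, 0) = g x" if "x \<in> ?W" for x using w(5) that closure_subset by blast
  fix x and t :: real assume t: "0 <= t"
  { assume x: "x \<in> ?W"
   obtain l where l: "l <= ?c" "conn ?W x (corner x) l" using conn_const(2)[OF x] by blast
   have "R * l <= R * ?c" using l(1) R(1) by (rule mult_left_mono)
   moreover have "w (corner x, t) <= w (x, t) + R * l" "w (x, t) <= w (corner x, t) + R * l"
    using evolution.subsolution_trav[OF w(1,2) conn_trav[OF l(2) R(1)] t]
     evolution.subsolution_trav[OF w(1,2) conn_trav[OF conn_sym[OF l(2)] R(1)] t] by simp_all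
   ultimately show "\<bar>w (x, t) - w (corner x, t)\<bar> <= C" using C(2) by (simp add: abs_le_iff)
   show "norm (corner x - x) <= C" using conn_in[OF l(2)] l(1) C(3) by linarith }
  assume x: "x \<in> \<Omega>"
  have xW: "x \<in> ?W" using x OW by blast
  show "w (x, t) <= z (x, t)"
  proof (cases "t = 0")
   case True
   then show ?thesis using z0[OF x] w0[OF xW] by simp
  next
   case False
   then have t0: "0 < t" using t by simp
   show ?thesis
   proof (rule field_le_epsilon)
    fix e :: real assume "0 < e"
    from evolution.supersolution_trav[OF z(1,3) regular_perforated z(4) x t0 this]
    obtain y c where y: "trav \<Omega> H R t y x c" "z (y, 0) + c <= z (x, t) + e" by blast
    have yO: "y \<in> \<Omega>" "y \<in> ?W" using trav_in[OF y(1)] OW by auto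
    from evolution.subsolution_trav[OF w(1,2) trav_mono_set[OF y(1) OW] order_refl] y(2)
    show "w (x, t) <= z (x, t) + e" using z0[OF yO(1)] w0[OF yO(2)] by simp
   qed
  qed
  let ?F = "holes_within I (norm x + M * t + C)"
  have CF: "C <= C * (1 + real (card ?F))" using C(1) mult_left_mono[of 1 "1 + real (card ?F)" C] by simp
  show "z (x, t) <= w (x, t) + C * (1 + real (card ?F))"
  proof (cases "t = 0")
   case True
   then show ?thesis using z0[OF x] w0[OF xW] CF C(1) by simp
  next
   case False
   then have t0: "0 < t" using t by simp
   obtain y c where y: "trav ?W H R t y x c" "w (y, 0) + c <= w (x, t) + 1"
    using evolution.supersolution_trav[OF w(1,3) regular_perforated w(4) xW t0 zero_less_one] by blast
   have yW: "y \<in> ?W" using trav_in[OF y(1)] by blast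
   have "w (x, t) <= g x" using evolution.subsolution_trav[OF w(1,2) trav_wait[OF xW R(1) t] order_refl] w0[OF xW] by simp
   moreover have "g x <= g y + L * norm (x - y)" using g by (simp add: abs_le_iff algebra_simps)
   ultimately have cle: "c <= L * norm (x - y) + 1" using y(2) w0[OF yW] by linarith
   \<comment> \<open>The start may lie in a filled hole of W; the corner of its cell belongs to
     \<Omega> and is reached at bounded cost.\<close>
   let ?y = "corner y"
   have yO: "?y \<in> \<Omega>" "?y \<in> ?W" using corner_perforated OW by auto
   obtain l where l: "l <= ?c" "conn ?W y ?y l" using conn_const(2)[OF yW] by blast
   have ny: "norm (?y - y) <= ?c" using conn_in[OF l(2)] l(1) by linarith
   have Rl: "R * l <= R * ?c" using l(1) R(1) by (rule mult_left_mono)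
   have Lc: "L * norm (?y - y) <= L * ?c" using ny L by (rule mult_left_mono)
   let ?d = "R * l + c"
   have tr: "trav ?W H R t ?y x ?d" using trav_trans[OF y(1) conn_trav[OF conn_sym[OF l(2)] R(1)]] by simp
   have dle: "?d <= L * norm (x - ?y) + (L * ?c + R * ?c + 1)"
   proof -
    have "norm (x - y) <= norm (x - ?y) + norm (?y - y)" using norm_triangle_ineq[of "x - ?y" "?y - y"] by simp
    from mult_left_mono[OF this L] have "L * norm (x - y) <= L * norm (x - ?y) + L * norm (?y - y)" by (simp only: distrib_left)
    then show ?thesis using cle Rl Lc by linarith
   qed
   have "trav (perforated D ?F) H R t ?y x ?d"
   proof (rule trav_localize[OF R(1) I tr])
    \<comment> \<open>Adding the lower bounds for both halves of the travel and subtracting the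
      upper bound of slope \<open>L\<close> leaves slope 1 for the distances through v.\<close>
    fix v S a b assume v: "trav ?W H R S ?y v a" "trav ?W H R (t - S) v x b" "a + b = ?d"
    have "(L + 1) * norm (v - ?y) - S * M <= a" by (rule trav_lower_bound[OF v(1) _ R(2) M]) (use L in simp)
    moreover have "(L + 1) * norm (x - v) - (t - S) * M <= b" by (rule trav_lower_bound[OF v(2) _ R(2) M]) (use L in simp)
    moreover have "norm (x - ?y) <= norm (x - v) + norm (v - ?y)" using norm_triangle_ineq[of "x - v" "v - ?y"] by simp
    from mult_left_mono[OF this L] have "L * norm (x - ?y) <= L * norm (x - v) + L * norm (v - ?y)" by (simp only: distrib_left)
    ultimately have "norm (v - ?y) + norm (x - v) <= M * t + (L * ?c + R * ?c + 1)"
     using dle v(3) unfolding distrib_right left_diff_distrib mult_1 mult.commute[of M] by linarith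
    moreover have "norm v <= norm x + norm (x - v)" using norm_triangle_ineq4[of x "x - v"] by simp
    ultimately show "norm v + 1 <= norm x + M * t + C" using C(4) norm_ge_zero[of "v - ?y"] by linarith
   qed
   from trav_fill_holes[OF R(1) finite_holes_within[OF I] _ this yO(1) x] I
   obtain c' where c': "c' <= ?d + k * real (card ?F)" "trav \<Omega> H R t ?y x c'" unfolding k_def holes_within_def by auto
   have "z (x, t) <= g ?y + c'" using evolution.subsolution_trav[OF z(1,2) c'(2) order_refl] z0[OF yO(1)] by simp
   moreover have "g ?y <= g y + L * norm (?y - y)" using g by (simp add: abs_le_iff algebra_simps)
   moreover have "k * real (card ?F) <= C * real (card ?F)" using C(5) by (rule mult_right_mono) simp
   ultimately show ?thesis using c'(1) y(2) w0[OF yW] Rl Lc C(4) unfolding distrib_left by linarith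
  qed
 qed
 show ?thesis
  by (rule exI[of _ C], rule exI[of _ M], intro conjI C(1) M0 allI impI) (use main in blast)+
qed

end

context periodic_hamiltonian
begin

lemma approach_closure:
 fixes z w :: "(real ^ 'n) \<times> real => real"
 assumes z: "K-lipschitz_on (closure U \<times> {0..}) z" and w: "K'-lipschitz_on (closure V \<times> {0..}) w"
  and UV: "U \<subseteq> V" and x: "x \<in> closure U" and t: "0 <= t"
 shows "\<exists>x'\<in>U. norm (x' - x) <= 1 \<and> \<bar>z (x', t) - z (x, t)\<bar> <= 1 \<and> \<bar>w (x', t) - w (x, t)\<bar> <= 1"
proof -
 have K: "0 <= K" "0 <= K'" using lipschitz_on_nonneg z w by auto
 obtain d where "0 < d" "\<forall>(a, b)\<in>set [(1, 1), (K, 1), (K', 1)]. a * d <= b"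
   using small_scale[of "[(1, 1), (K, 1), (K', 1)]"] by auto
 then have d: "0 < d" "d <= 1" "K * d <= 1" "K' * d <= 1" by auto
 obtain x' where x': "x' \<in> U" "norm (x' - x) < d" using x d(1) unfolding closure_approachable dist_norm by blast
 have cl: "x \<in> closure V" "x' \<in> closure U" "x' \<in> closure V" using x x'(1) UV closure_mono[OF UV] closure_subset by blast+
 have "\<bar>z (x', t) - z (x, t)\<bar> <= K * norm (x' - x)"
  using lipschitz_onD[OF z, of "(x', t)" "(x, t)"] x cl t by (simp add: dist_Pair_Pair dist_norm)
 also have "\<dots> <= K * d" using x'(2) K(1) by (intro mult_left_mono) auto
 finally have 1: "\<bar>z (x', t) - z (x, t)\<bar> <= 1" using d(3) by linarith
 have "\<bar>w (x', t) - w (x, t)\<bar> <= K' * norm (x' - x)"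
  using lipschitz_onD[OF w, of "(x', t)" "(x, t)"] cl t by (simp add: dist_Pair_Pair dist_norm)
 also have "\<dots> <= K' * d" using x'(2) K(2) by (intro mult_left_mono) auto
 finally have "\<bar>w (x', t) - w (x, t)\<bar> <= 1" using d(4) by linarith
 then show ?thesis using x' 1 d(2) by (intro bexI[of _ x']) auto
qed

abbreviation "unit_scale_close C M I z w u == (\<forall>x\<in>closure (perforated D I). \<forall>t\<ge>0. w (x, t) <= u (x, t) + C \<and>
   u (x, t) <= w (x, t) + hole_cost C M I x t) \<and>
  (\<forall>x\<in>closure \<Omega>. \<forall>t\<ge>0. w (x, t) <= z (x, t) \<and>
   z (x, t) <= w (x, t) + hole_cost C M I x t \<and> \<bar>z (x, t) - u (x, t)\<bar> <= C)"

abbreviation "unit_scale_bounds L C M == \<forall>I g z w u. I \<subseteq> int_lattice --> (\<forall>x y. \<bar>g x - g y\<bar> <= L * norm (x - y)) -->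
  state_constraint_solution H \<Omega> g z --> state_constraint_solution H (perforated D I) g w -->
  state_constraint_solution (\<lambda>x p. Hbar p) UNIV g u -->
  unit_scale_close C M I z w u"

text \<open>Points of W in filled holes are compared through the corner of their cell, and points of
  the closure through interior points at distance at most 1. Both moves enlarge the box by a
  constant, which is absorbed into \<open>C\<close>.\<close>

theorem unit_scale_comparison:
 assumes L: "0 <= L"
 shows "\<exists>C M. 0 < C \<and> 0 <= M \<and> unit_scale_bounds L C M"
proof -
 obtain C1 where C1: "0 <= C1" and rate: "rate_bounds L C1"
  using homogenization_rate[OF L] by (elim exE conjE)
 obtain C2 M where C2: "0 <= C2" and M: "0 <= M" and hole: "hole_bounds L C2 M"
  using hole_comparison[OF L] by (elim exE conjE)
 define Ca where "Ca = C1 * C2 + C1 + C2"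
 define C where "C = 2 + Ca + 2 * C1 + 2 * C2"
 have nn: "0 <= C1 * C2" using C1 C2 by simp
 have C: "0 < C" "1 + Ca + C1 + C2 <= C" "2 + C2 <= C" "1 + 2 * C2 <= C" "1 + 2 * C1 <= C" using nn C1 C2 unfolding C_def Ca_def by linarith+
 have main: "unit_scale_close C M I z w u"
  if I: "I \<subseteq> int_lattice" and g: "\<forall>x y. \<bar>g x - g y\<bar> <= L * norm (x - y)" and solz: "state_constraint_solution H \<Omega> g z"
   and solw: "state_constraint_solution H (perforated D I) g w" and solu: "state_constraint_solution (\<lambda>x p. Hbar p) UNIV g u" for I g z w u
 proof -
  let ?W = "perforated D I"
  let ?N = "\<lambda>r. real (card (holes_within I r))"
  have OW: "\<Omega> \<subseteq> ?W" by (rule perforated_mono) simp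
  from rate[rule_format, OF g[rule_format] solz solu]
  have zu: "\<bar>z (x, t) - u (x, t)\<bar> <= C1" if "x \<in> \<Omega>" "0 <= t" for x t using that by blast
  have uu: "\<bar>u (x, t) - u (y, t)\<bar> <= C1 * norm (x - y)" if "0 <= t" for x y t
   using rate g solz solu that by blast
  have wz: "w (x, t) <= z (x, t)" "z (x, t) <= w (x, t) + C2 * (1 + ?N (norm x + M * t + C2))" if "x \<in> \<Omega>" "0 <= t" for x t
   using hole I g solz solw that by blast+
  have ww: "\<bar>w (x, t) - w (corner x, t)\<bar> <= C2" "norm (corner x - x) <= C2" if "x \<in> ?W" "0 <= t" for x t
   using hole I g solz solw that by blast+
  have Nmono: "?N r <= ?N r'" if "r <= r'" for r r'
   unfolding of_nat_le_iff by (rule card_mono[OF finite_holes_within[OF I]]) (use that in \<open>auto simp: holes_within_def intro: order_trans\<close>)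
  have Cmult: "a + C2 * (1 + ?N r) <= C * (1 + ?N r')" if "r <= r'" "0 <= a" "a + C2 <= C" for a r r'
  proof -
   have "a + C2 * (1 + ?N r) <= a * (1 + ?N r) + C2 * (1 + ?N r)" using that(2) by (simp add: distrib_left)
   also have "\<dots> = (a + C2) * (1 + ?N r)" by (simp only: distrib_right)
   also have "\<dots> <= C * (1 + ?N r')" using that Nmono[OF that(1)] C2 C(1) by (intro mult_mono) auto
   finally show ?thesis .
  qed
  have W: "w (x, t) <= u (x, t) + Ca" "u (x, t) <= w (x, t) + Ca + C2 * (1 + ?N (norm x + M * t + 2 * C2))" if x: "x \<in> ?W" and t: "0 <= t" for x t
  proof -
   let ?x = "corner x"
   have x': "?x \<in> \<Omega>" by (rule corner_perforated)
   have "C1 * norm (?x - x) <= C1 * C2" using ww(2)[OF x t] C1 by (rule mult_left_mono)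
   then have u1: "\<bar>u (?x, t) - u (x, t)\<bar> <= C1 * C2" using uu[OF t, of ?x x] by linarith
   have "norm ?x <= norm x + C2" using norm_triangle_ineq[of x "?x - x"] ww(2)[OF x t] by simp
   then have "C2 * (1 + ?N (norm ?x + M * t + C2)) <= C2 * (1 + ?N (norm x + M * t + 2 * C2))"
    using C2 by (intro mult_left_mono add_left_mono Nmono) auto
   then show "u (x, t) <= w (x, t) + Ca + C2 * (1 + ?N (norm x + M * t + 2 * C2))"
    using u1 zu[OF x' t] wz(2)[OF x' t] ww(1)[OF x t] unfolding Ca_def abs_le_iff by linarith
   show "w (x, t) <= u (x, t) + Ca"
    using u1 zu[OF x' t] wz(1)[OF x' t] ww(1)[OF x t] unfolding Ca_def abs_le_iff by linarith
  qed
  obtain Kz where Kz: "Kz-lipschitz_on (closure \<Omega> \<times> {0..}) z" using solz unfolding state_constraint_solution_def by blast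
  obtain Kw where Kw: "Kw-lipschitz_on (closure ?W \<times> {0..}) w" using solw unfolding state_constraint_solution_def by blast
  have shift: "\<bar>u (x', t) - u (x, t)\<bar> <= C1" "norm x' <= norm x + 1" if "norm (x' - x) <= 1" "0 <= t" for x x' t
  proof -
   have "C1 * norm (x' - x) <= C1 * 1" using that(1) C1 by (rule mult_left_mono)
   then show "\<bar>u (x', t) - u (x, t)\<bar> <= C1" using uu[OF that(2), of x' x] by linarith
   show "norm x' <= norm x + 1" using norm_triangle_ineq[of x "x' - x"] that(1) by simp
  qed
  show ?thesis
  proof (intro conjI ballI allI impI)
   fix x and t :: real assume x: "x \<in> closure ?W" and t: "0 <= t"
   from approach_closure[OF Kw Kw order_refl x t]
   obtain x' where x': "x' \<in> ?W" "norm (x' - x) <= 1" "\<bar>w (x', t) - w (x, t)\<bar> <= 1" by blast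
   note s = shift[OF x'(2) t]
   show "w (x, t) <= u (x, t) + C" using W(1)[OF x'(1) t] x'(3) s(1) C(2) C2 unfolding abs_le_iff by linarith
   have "(1 + Ca + C1) + C2 * (1 + ?N (norm x' + M * t + 2 * C2)) <= C * (1 + ?N (norm x + M * t + C))"
   proof (rule Cmult)
    show "norm x' + M * t + 2 * C2 <= norm x + M * t + C" using s(2) C(4) by linarith
    show "0 <= 1 + Ca + C1" using nn C1 C2 unfolding Ca_def by linarith
   qed (fact C(2))
   then show "u (x, t) <= w (x, t) + C * (1 + ?N (norm x + M * t + C))"
    using W(2)[OF x'(1) t] x'(3) s(1) unfolding abs_le_iff by linarith
  next
   fix x and t :: real assume x: "x \<in> closure \<Omega>" and t: "0 <= t"
   from approach_closure[OF Kz Kw OW x t]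
   obtain x' where x': "x' \<in> \<Omega>" "norm (x' - x) <= 1" "\<bar>z (x', t) - z (x, t)\<bar> <= 1" "\<bar>w (x', t) - w (x, t)\<bar> <= 1" by blast
   note s = shift[OF x'(2) t]
   show "\<bar>z (x, t) - u (x, t)\<bar> <= C" using zu[OF x'(1) t] x'(3) s(1) C(5) by linarith
   have "2 + C2 * (1 + ?N (norm x' + M * t + C2)) <= C * (1 + ?N (norm x + M * t + C))"
   proof (rule Cmult)
    show "norm x' + M * t + C2 <= norm x + M * t + C" using s(2) C(4) C2 by linarith
   qed (use C(3) in auto)
   then show "z (x, t) <= w (x, t) + C * (1 + ?N (norm x + M * t + C))"
    using wz(2)[OF x'(1) t] x'(3,4) unfolding abs_le_iff by linarith
   have c: "continuous_on (closure \<Omega>) (\<lambda>x. z (x, t))"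
    by (rule continuous_on_compose2[OF lipschitz_on_continuous_on[OF Kz]]) (use t in \<open>auto intro!: continuous_intros\<close>)
   have c': "continuous_on (closure \<Omega>) (\<lambda>x. w (x, t))"
    by (rule continuous_on_compose2[OF lipschitz_on_continuous_on[OF Kw]]) (use t closure_mono[OF OW] in \<open>auto intro!: continuous_intros\<close>)
   have "w (x, t) - z (x, t) <= 0"
    by (rule continuous_le_on_closure[OF continuous_on_diff[OF c' c] x]) (use wz(1) t in simp)
   then show "w (x, t) <= z (x, t)" by simp
  qed
 qed
 show ?thesis
  by (rule exI[of _ C], rule exI[of _ M], intro conjI C(1) M allI impI) (use main in blast)+
qed

end

section \<open>Return to scale \<epsilon> and count of the holes\<close>

theorem theorem1p3:
  fixes H Hm :: "real ^ 'n \<Rightarrow> real ^ 'n \<Rightarrow> real"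
    and D :: "(real ^ 'n) set"
    and G C0 K0 M0 :: real
  assumes "2 \<le> CARD('n)"
    and "A1 H" and "A2 H" and "A3 H" and "A5 H"
    and "admissible_hole D"
    and "0 < C0" and "solution_gradient_bound H D G C0"
    and "0 < K0" and "quadratic_modification H C0 K0 Hm"
    and "0 < M0" and "velocity_bound Hm D G M0"
  shows "\<exists>C C'. 0 < C \<and> 0 < C' \<and>
    (\<forall>(g :: real ^ 'n \<Rightarrow> real) (I :: (real ^ 'n) set) (\<omega> :: real \<Rightarrow> real)
      (u :: (real ^ 'n) \<times> real \<Rightarrow> real).
      A4 g \<and> grad_Linf_norm g = G \<and>
      I \<noteq> {} \<and> I \<subset> int_lattice \<and>
      modulus_of_continuity \<omega> \<and>
      (\<forall>k\<ge>1. real (card (index_box I k)) / real k = \<omega> (1 / real k)) \<and>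
      state_constraint_solution (\<lambda>x p. effective_hamiltonian H (perforated D {}) p) UNIV g u
      \<longrightarrow>
      (\<forall>\<epsilon> (ue :: (real ^ 'n) \<times> real \<Rightarrow> real) (we :: (real ^ 'n) \<times> real \<Rightarrow> real).
        0 < \<epsilon> \<and> \<epsilon> < 1 \<and>
        state_constraint_solution (osc_ham \<epsilon> H) (dilate \<epsilon> (perforated D {})) g ue \<and>
        state_constraint_solution (osc_ham \<epsilon> H) (dilate \<epsilon> (perforated D I)) g we
        \<longrightarrow>
        (\<forall>x \<in> closure (dilate \<epsilon> (perforated D I)). \<forall>t\<ge>0. 0 < M0 * t + norm x \<longrightarrow>
          (let R = M0 * t + norm x;
               E = C * (R + 1) * \<omega> (\<epsilon> / R)
           in
             u (x, t) - E - C' * \<epsilon> \<le> we (x, t) \<and>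
             we (x, t) \<le> u (x, t) + C * \<epsilon> \<and>
             (x \<in> closure (dilate \<epsilon> (perforated D {})) \<longrightarrow>
                u (x, t) - E - C' * \<epsilon> \<le> ue (x, t) - E - C * \<epsilon> \<and>
                ue (x, t) - E - C * \<epsilon> \<le> we (x, t) \<and>
                we (x, t) \<le> ue (x, t) \<and>
                ue (x, t) \<le> u (x, t) + C * \<epsilon>) \<and>
             \<bar>we (x, t) - u (x, t)\<bar> \<le> E + C * \<epsilon>))))"
proof -
 interpret periodic_hamiltonian D H
 proof (intro periodic_hamiltonian.intro hole.intro hamiltonianI periodic_hamiltonian_axioms.intro)
  show "H (y + m) p = H y p" if "m \<in> int_lattice" for m y p using \<open>A1 H\<close> that unfolding A1_def by blast
 qed fact+
 obtain C M where C: "0 < C" and M: "0 <= M" and unit: "unit_scale_bounds C0 C M"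
  using unit_scale_comparison[OF less_imp_le[OF \<open>0 < C0\<close>]] by (elim exE conjE)
 \<comment> \<open>The comparison spreads with speed \<open>M\<close>, the claim is stated with
   \<open>M0\<close>. A box of half-width at least |X| + M' T contains the holes to be counted and
   gives 1/k \<le> \<epsilon>/R; \<open>\<kappa>\<close> converts M' t + |x| back into a multiple of
   R.\<close>
 define M' where "M' = M + M0"
 define \<kappa> where "\<kappa> = M' / M0 + 1"
 have M': "M <= M'" "M0 <= M'" "0 < M'" using M \<open>0 < M0\<close> by (auto simp: M'_def)
 have \<kappa>: "1 <= \<kappa>" using M' \<open>0 < M0\<close> by (simp add: \<kappa>_def)
 define Cf where "Cf = C * (\<kappa> + C + 1)"
 have "C * 1 <= Cf" unfolding Cf_def using C \<kappa> by (intro mult_left_mono) auto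
 then have Cf: "C <= Cf" "0 < Cf" using C by auto
 \<comment> \<open>The second constant exceeds the first by \<open>C\<close>, which pays for u \<le>
   ue + C \<epsilon> in the first inequality of the chain.\<close>
 show ?thesis
 proof (rule exI[of _ Cf], rule exI[of _ "Cf + C"], intro conjI allI impI ballI)
  show "0 < Cf" "0 < Cf + C" using Cf C by auto
  fix g :: "real ^ 'n => real" and I :: "(real ^ 'n) set" and \<omega> :: "real => real"
   and u ue we :: "(real ^ 'n) \<times> real => real" and x :: "real ^ 'n" and \<epsilon> t :: real
  assume "A4 g \<and> grad_Linf_norm g = G \<and> I \<noteq> {} \<and> I \<subset> int_lattice \<and> modulus_of_continuity \<omega> \<and>
   (\<forall>k\<ge>1. real (card (index_box I k)) / real k = \<omega> (1 / real k)) \<and>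
   state_constraint_solution (\<lambda>x p. Hbar p) UNIV g u"
  then have g: "A4 g" "grad_Linf_norm g = G" and I: "I \<subseteq> int_lattice" and \<omega>: "modulus_of_continuity \<omega>"
   and count: "\<And>k. 1 <= k ==> real (card (index_box I k)) / real k = \<omega> (1 / real k)"
   and solu: "state_constraint_solution (\<lambda>x p. Hbar p) UNIV g u" by auto
  assume "0 < \<epsilon> \<and> \<epsilon> < 1 \<and> state_constraint_solution (osc_ham \<epsilon> H) (dilate \<epsilon> \<Omega>) g ue \<and>
    state_constraint_solution (osc_ham \<epsilon> H) (dilate \<epsilon> (perforated D I)) g we"
  then have \<epsilon>: "0 < \<epsilon>" "\<epsilon> < 1" and solz: "state_constraint_solution (osc_ham \<epsilon> H) (dilate \<epsilon> \<Omega>) g ue"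
   and solw: "state_constraint_solution (osc_ham \<epsilon> H) (dilate \<epsilon> (perforated D I)) g we" by auto
  assume x: "x \<in> closure (dilate \<epsilon> (perforated D I))" and t: "0 <= t" and Rpos: "0 < M0 * t + norm x"
  define R where "R = M0 * t + norm x"
  define E where "E = Cf * (R + 1) * \<omega> (\<epsilon> / R)"
  have R: "0 < R" using Rpos by (simp add: R_def)
  define gs where "gs x = g (\<epsilon> *\<^sub>R x) / \<epsilon>" for x
  have gs: "\<bar>gs x - gs y\<bar> <= C0 * norm (x - y)" for x y
  proof -
   have "\<bar>g (\<epsilon> *\<^sub>R x) - g (\<epsilon> *\<^sub>R y)\<bar> <= C0 * norm (\<epsilon> *\<^sub>R x - \<epsilon> *\<^sub>R y)"
    by (rule initial_lipschitz[OF \<open>solution_gradient_bound H D G C0\<close> _ g]) (use \<open>0 < C0\<close> in simp)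
   also have "\<dots> = (C0 * norm (x - y)) * \<epsilon>" using \<epsilon> by (simp flip: scaleR_diff_right)
   finally have "\<bar>g (\<epsilon> *\<^sub>R x) - g (\<epsilon> *\<^sub>R y)\<bar> / \<epsilon> <= C0 * norm (x - y)" using \<epsilon> by (simp add: pos_divide_le_eq)
   then show ?thesis using \<epsilon> by (simp add: gs_def flip: diff_divide_distrib)
  qed
  have ou: "osc_ham \<epsilon> (\<lambda>x p. Hbar p) = (\<lambda>x p. Hbar p)" "dilate \<epsilon> (UNIV :: (real^'n) set) = UNIV"
   using \<epsilon> by (auto simp: osc_ham_def dilate_def fun_eq_iff intro!: surjI[of _ "\<lambda>x. x /\<^sub>R \<epsilon>"])
  define zs ws us where "zs = (\<lambda>(x, t). ue (\<epsilon> *\<^sub>R x, \<epsilon> * t) / \<epsilon>)" and "ws = (\<lambda>(x, t). we (\<epsilon> *\<^sub>R x, \<epsilon> * t) / \<epsilon>)"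
   and "us = (\<lambda>(x, t). u (\<epsilon> *\<^sub>R x, \<epsilon> * t) / \<epsilon>)"
  have sz: "state_constraint_solution H \<Omega> gs zs" unfolding gs_def zs_def by (rule state_constraint_solution_scale[OF solz \<epsilon>(1)])
  have sw: "state_constraint_solution H (perforated D I) gs ws" unfolding gs_def ws_def by (rule state_constraint_solution_scale[OF solw \<epsilon>(1)])
  have su: "state_constraint_solution (\<lambda>x p. Hbar p) UNIV gs us" unfolding gs_def us_def
   by (rule state_constraint_solution_scale[OF _ \<epsilon>(1)]) (use solu ou in simp)
  define X where "X = x /\<^sub>R \<epsilon>"
  define T where "T = t / \<epsilon>"
  have XT: "\<epsilon> *\<^sub>R X = x" "\<epsilon> * T = t" "0 <= T" using \<epsilon> t by (auto simp: X_def T_def)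
  have vals: "ue (x, t) = \<epsilon> * zs (X, T)" "we (x, t) = \<epsilon> * ws (X, T)" "u (x, t) = \<epsilon> * us (X, T)"
   using \<epsilon> XT by (auto simp: zs_def ws_def us_def)
  have clX: "X \<in> closure U" if "x \<in> closure (dilate \<epsilon> U)" for U
   using that \<epsilon> unfolding closure_dilate[OF \<epsilon>(1)] by (auto simp: dilate_def X_def)
  define N where "N = real (card (holes_within I (norm X + M * T + C)))"
  from unit[rule_format, OF I gs sz sw su] clX[OF x] XT(3)
  have w1: "ws (X, T) <= us (X, T) + C" "us (X, T) <= ws (X, T) + C * (1 + N)" unfolding N_def by blast+
  have z1: "ws (X, T) <= zs (X, T)" "zs (X, T) <= ws (X, T) + C * (1 + N)" "\<bar>zs (X, T) - us (X, T)\<bar> <= C"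
   if "x \<in> closure (dilate \<epsilon> \<Omega>)"
   using unit[rule_format, OF I gs sz sw su] clX[OF that] XT(3) unfolding N_def by blast+
  have err: "\<epsilon> * (C * N) <= E"
  proof -
   \<comment> \<open>The count of holes is known only for integer half-widths. Rounding up adds at
     most 1, hence the summand \<open>C + 1\<close> in the bound of \<epsilon> k below.\<close>
   define k where "k = nat \<lceil>norm X + M' * T + C\<rceil>"
   have s: "0 <= norm X + M' * T" using M' XT(3) by simp
   have k: "norm X + M' * T + C <= real k" "real k <= norm X + M' * T + C + 1" unfolding k_def using s C by linarith+
   have "0 < real k" using k(1) s C by linarith
   then have k1: "1 <= k" "0 < real k" by auto
   have "M * T <= M' * T" using M'(1) XT(3) by (rule mult_right_mono)
   then have "norm X + M * T + C <= real k" using k(1) by linarith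
   then have "holes_within I (norm X + M * T + C) \<subseteq> index_box I k"
    unfolding holes_within_def index_box_def by (auto intro: order_trans)
   moreover have "finite (index_box I k)" using finite_holes_within[OF I, of "real k"] by (simp add: holes_within_def index_box_def)
   ultimately have "N <= real (card (index_box I k))" unfolding N_def of_nat_le_iff by (intro card_mono)
   also have "\<dots> = real k * \<omega> (1 / real k)" using count[OF k1(1)] k1(2) by (simp add: field_simps)
   finally have N: "N <= real k * \<omega> (1 / real k)" .
   have nX: "\<epsilon> * norm X = norm x" using \<epsilon> by (simp add: X_def)
   have t': "\<epsilon> * (M' * T) = M' * t" using XT(2) by (metis mult.left_commute)
   have "R <= norm x + M' * t" unfolding R_def using M'(2) t by (simp add: mult_right_mono)
   also have "\<dots> = \<epsilon> * (norm X + M' * T)" unfolding distrib_left nX t' ..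
   also have "\<dots> <= \<epsilon> * real k" using \<epsilon> k(1) C by (intro mult_left_mono) auto
   finally have "1 / real k <= \<epsilon> / R" using R k1(2) by (simp add: field_simps)
   then have \<omega>k: "\<omega> (1 / real k) <= \<omega> (\<epsilon> / R)"
    using \<omega> \<epsilon> R k1(2) unfolding modulus_of_continuity_def mono_on_def by auto
   have \<omega>0: "0 <= \<omega> (\<epsilon> / R)" using \<omega> \<epsilon> R unfolding modulus_of_continuity_def by simp
   have "\<epsilon> * real k <= \<epsilon> * (norm X + M' * T + C + 1)" using \<epsilon> k(2) by (intro mult_left_mono) auto
   also have "\<dots> = norm x + M' * t + \<epsilon> * (C + 1)" unfolding distrib_left nX t' by simp
   also have "\<dots> <= norm x + M' * t + 1 * (C + 1)" using \<epsilon> C by (intro add_left_mono mult_right_mono) auto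
   also have "norm x + M' * t <= \<kappa> * R"
   proof -
    have "\<kappa> * R = M' * t + M' / M0 * norm x + M0 * t + norm x" using \<open>0 < M0\<close> by (simp add: \<kappa>_def R_def field_simps)
    moreover have "0 <= M' / M0 * norm x" "0 <= M0 * t" using M' \<open>0 < M0\<close> t by auto
    ultimately show ?thesis by linarith
   qed
   also have "\<kappa> * R + 1 * (C + 1) <= (\<kappa> + C + 1) * (R + 1)"
    using \<kappa> C R by (simp add: algebra_simps)
   finally have k3: "\<epsilon> * real k <= (\<kappa> + C + 1) * (R + 1)" by simp
   have "\<epsilon> * (C * N) <= \<epsilon> * (C * (real k * \<omega> (1 / real k)))" using \<epsilon> C N by (intro mult_left_mono) auto
   also have "\<dots> <= \<epsilon> * (C * (real k * \<omega> (\<epsilon> / R)))" using \<epsilon> C \<omega>k by (intro mult_left_mono) auto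
   also have "\<dots> = C * (\<epsilon> * real k) * \<omega> (\<epsilon> / R)" by simp
   also have "\<dots> <= C * ((\<kappa> + C + 1) * (R + 1)) * \<omega> (\<epsilon> / R)" using k3 C \<omega>0 by (intro mult_right_mono mult_left_mono) auto
   also have "\<dots> = E" by (simp add: E_def Cf_def mult.assoc)
   finally show ?thesis .
  qed
  have "0 <= \<epsilon> * (C * N)" using \<epsilon> C by (simp add: N_def)
  then have E0: "0 <= E" using err by linarith
  have "C * \<epsilon> <= Cf * \<epsilon>" using Cf \<epsilon> by (intro mult_right_mono) auto
  moreover have "0 <= C * \<epsilon>" using C \<epsilon> by simp
  moreover have "(Cf + C) * \<epsilon> = Cf * \<epsilon> + C * \<epsilon>" by (rule distrib_right)
  ultimately have Ce: "C * \<epsilon> <= Cf * \<epsilon>" "0 <= C * \<epsilon>" "(Cf + C) * \<epsilon> = Cf * \<epsilon> + C * \<epsilon>" by blast+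
  have mul: "\<epsilon> * a <= \<epsilon> * b + \<epsilon> * c" if "a <= b + c" for a b c :: real
   using mult_left_mono[OF that, of \<epsilon>] \<epsilon> by (simp add: distrib_left)
  have d: "\<epsilon> * (C * (1 + N)) = C * \<epsilon> + \<epsilon> * (C * N)" "\<epsilon> * C = C * \<epsilon>" by (simp_all add: algebra_simps)
  have a1: "we (x, t) <= u (x, t) + C * \<epsilon>" and a2: "u (x, t) <= we (x, t) + (C * \<epsilon> + E)"
   using mul[OF w1(1)] mul[OF w1(2)] err unfolding vals d by linarith+
  have b: "we (x, t) <= ue (x, t) \<and> ue (x, t) <= we (x, t) + (C * \<epsilon> + E) \<and> ue (x, t) <= u (x, t) + C * \<epsilon> \<and> u (x, t) <= ue (x, t) + C * \<epsilon>"
   if "x \<in> closure (dilate \<epsilon> \<Omega>)"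
  proof -
   note z = z1[OF that]
   have "zs (X, T) <= us (X, T) + C" "us (X, T) <= zs (X, T) + C" using z(3) by (auto simp: abs_le_iff)
   note m = mul[OF this(1)] mul[OF this(2)] mul[OF z(2)]
   have "\<epsilon> * ws (X, T) <= \<epsilon> * zs (X, T)" using z(1) \<epsilon> by simp
   then show ?thesis using m err unfolding vals d by (intro conjI) linarith+
  qed
  show "let R = M0 * t + norm x; E = Cf * (R + 1) * \<omega> (\<epsilon> / R)
    in u (x, t) - E - (Cf + C) * \<epsilon> <= we (x, t) \<and> we (x, t) <= u (x, t) + Cf * \<epsilon> \<and>
     (x \<in> closure (dilate \<epsilon> \<Omega>) -->
       u (x, t) - E - (Cf + C) * \<epsilon> <= ue (x, t) - E - Cf * \<epsilon> \<and> ue (x, t) - E - Cf * \<epsilon> <= we (x, t) \<and>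
       we (x, t) <= ue (x, t) \<and> ue (x, t) <= u (x, t) + Cf * \<epsilon>) \<and>
     \<bar>we (x, t) - u (x, t)\<bar> <= E + Cf * \<epsilon>"
   unfolding Let_def R_def[symmetric] E_def[symmetric]
  proof (intro conjI impI)
   show "\<bar>we (x, t) - u (x, t)\<bar> <= E + Cf * \<epsilon>" using a1 a2 Ce E0 by linarith
  qed (use a1 a2 b Ce E0 in linarith)+
 qed
qed

end
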